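(* Let $d=2$ or $d=3$, let $B_2\subset\mathbb{R}^d$ be the open ball of radius $2$ centered at the origin, and let $$m(x)=\frac{(2+|x|)^{d-1}}{2^d|x|^{d-1}},\qquad x\in B_2\setminus\{0\}.$$ Consider the Born transmission eigenvalue problem $$\begin{cases}\Delta u+k^2u=-k^2mv & \text{in } B_2,\\ \Delta v+k^2v=0 & \text{in } B_2,\\ u=\partial_\nu u=0 & \text{on }\partial B_2,\end{cases}$$ and its Born transmission eigenvalues (BTEs) $k\in\mathbb{C}\setminus\{0\}$. Then: (i) There are no real, or purely imaginary, BTEs. (ii) There are infinitely many BTEs in $\mathbb{C}\setminus(\mathbb{R}\cup i\mathbb{R})$. (iii) The BTEs form a discrete set in $\mathbb{C}$, i.e. a countable set with no limit points in $\mathbb{C}$. (iv) There exists $c>0$ such that there are no BTEs in the strip $\{k\in\mathbb{C}:|\operatorname{Im}k|<c\}$.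
   Context: A number $k\in\mathbb{C}\setminus\{0\}$ is called a Born transmission eigenvalue (BTE) if there exists a nontrivial solution $(u,v)$ of the problem stated in the claim (complex-valued functions on $B_2$) such that $u\in H^2(B_2)$ and $mv\in L^2(B_2)$. Here $\nu$ is the outward unit normal on $\partial B_2$ and $\partial_\nu$ the normal derivative; the conditions $u=\partial_\nu u=0$ are understood in the sense of traces, and the equations in the distributional sense. Note that $m$ is unbounded near the origin. *)

theory Defs
  imports "HOL-Analysis.Analysis"
begin

section \<open>Smooth functions and test functions\<close>

text \<open>A list of basis vectors plays the role of a multi-index:
  the list \<open>[b1, ..., bn]\<close> stands for the differential operator
  \<open>\<partial>_b1 ... \<partial>_bn\<close>, of order \<open>n\<close>.\<close>

definition multi_indices :: "nat \<Rightarrow> 'a::euclidean_space list set" where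
  "multi_indices k = {bs. set bs \<subseteq> Basis \<and> length bs \<le> k}"

definition partials :: "'a::euclidean_space list \<Rightarrow> ('a \<Rightarrow> complex) \<Rightarrow> 'a \<Rightarrow> complex" where
  "partials bs f = foldr (\<lambda>b g x. frechet_derivative g (at x) b) bs f"

definition laplacian :: "('a::euclidean_space \<Rightarrow> complex) \<Rightarrow> 'a \<Rightarrow> complex" where
  "laplacian f x = (\<Sum>b\<in>Basis. partials [b, b] f x)"

text \<open>Smoothness on the whole space: all iterated partial derivatives are (Frechet)
  differentiable everywhere, and hence continuous.\<close>

definition smooth :: "('a::euclidean_space \<Rightarrow> complex) \<Rightarrow> bool" where
  "smooth f \<longleftrightarrow> (\<forall>bs. set bs \<subseteq> Basis \<longrightarrow> (\<forall>x. partials bs f differentiable (at x)))"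

definition test_functions :: "'a::euclidean_space set \<Rightarrow> ('a \<Rightarrow> complex) set" where
  "test_functions \<Omega> = {\<phi>. smooth \<phi> \<and> compact (closure {x. \<phi> x \<noteq> 0}) \<and> closure {x. \<phi> x \<noteq> 0} \<subseteq> \<Omega>}"

section \<open>Weak derivatives and Sobolev spaces\<close>

text \<open>Functions on \<open>\<Omega>\<close> are represented by total functions, of which only the values on
  \<open>\<Omega>\<close> (up to null sets) matter.\<close>

definition loc_integrable :: "'a::euclidean_space set \<Rightarrow> ('a \<Rightarrow> complex) \<Rightarrow> bool" where
  "loc_integrable \<Omega> f \<longleftrightarrow> (\<forall>K. compact K \<and> K \<subseteq> \<Omega> \<longrightarrow> integrable (lebesgue_on K) f)"

definition L2 :: "'a measure \<Rightarrow> ('a \<Rightarrow> complex) set" where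
  "L2 M = {f \<in> borel_measurable M. integrable M (\<lambda>x. (norm (f x))\<^sup>2)}"

definition L2_tendsto :: "'a measure \<Rightarrow> (nat \<Rightarrow> 'a \<Rightarrow> complex) \<Rightarrow> ('a \<Rightarrow> complex) \<Rightarrow> bool" where
  "L2_tendsto M F f \<longleftrightarrow>
     (\<forall>n. F n \<in> L2 M) \<and> f \<in> L2 M \<and> (\<lambda>n. \<integral>x. (norm (F n x - f x))\<^sup>2 \<partial>M) \<longlonglongrightarrow> 0"

definition weak_deriv ::
    "'a::euclidean_space set \<Rightarrow> 'a list \<Rightarrow> ('a \<Rightarrow> complex) \<Rightarrow> ('a \<Rightarrow> complex) \<Rightarrow> bool" where
  "weak_deriv \<Omega> bs f g \<longleftrightarrow>
     loc_integrable \<Omega> f \<and> loc_integrable \<Omega> g \<and>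
     (\<forall>\<phi>\<in>test_functions \<Omega>.
        (\<integral>x. f x * partials bs \<phi> x \<partial>lebesgue_on \<Omega>)
        = (-1) ^ length bs * (\<integral>x. g x * \<phi> x \<partial>lebesgue_on \<Omega>))"

text \<open>The Sobolev space \<open>H^k(\<Omega>)\<close>.\<close>

definition sobolev :: "nat \<Rightarrow> 'a::euclidean_space set \<Rightarrow> ('a \<Rightarrow> complex) set" where
  "sobolev k \<Omega> =
     {f \<in> L2 (lebesgue_on \<Omega>).
        \<forall>bs\<in>multi_indices k. \<exists>g\<in>L2 (lebesgue_on \<Omega>). weak_deriv \<Omega> bs f g}"

text \<open>Convergence in \<open>H^k(\<Omega>)\<close> of a sequence of smooth functions.\<close>

definition smooth_tendsto_sobolev ::
    "nat \<Rightarrow> 'a::euclidean_space set \<Rightarrow> (nat \<Rightarrow> 'a \<Rightarrow> complex) \<Rightarrow> ('a \<Rightarrow> complex) \<Rightarrow> bool" where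
  "smooth_tendsto_sobolev k \<Omega> F f \<longleftrightarrow>
     (\<forall>n. smooth (F n)) \<and>
     (\<forall>bs\<in>multi_indices k. \<exists>g. weak_deriv \<Omega> bs f g \<and>
        L2_tendsto (lebesgue_on \<Omega>) (\<lambda>n. partials bs (F n)) g)"

section \<open>Traces on spheres\<close>

text \<open>Surface measure on the sphere of radius \<open>r\<close>, obtained from the volume of cones:
  the cone \<open>{t x | 0 < t < 1, x \<in> A}\<close> over a Borel subset \<open>A\<close> of the sphere has volume
  \<open>r / d\<close> times the surface area of \<open>A\<close>, where \<open>d\<close> is the dimension.
  The origin is removed so that the radial projection maps into the sphere.\<close>

definition sphere_measure :: "real \<Rightarrow> 'a::euclidean_space measure" where
  "sphere_measure r =
     scale_measure (ennreal (DIM('a) / r))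
       (distr (restrict_space lborel (ball 0 r - {0})) (restrict_space borel (sphere 0 r))
          (\<lambda>x. (r / norm x) *\<^sub>R x))"

text \<open>The trace operator from \<open>H^1\<close> of the ball of radius \<open>r\<close> to \<open>L^2\<close> of its boundary, as a
  relation: the continuous extension of the restriction map on functions that are smooth
  up to the boundary.\<close>

definition has_trace ::
    "real \<Rightarrow> ('a::euclidean_space \<Rightarrow> complex) \<Rightarrow> ('a \<Rightarrow> complex) \<Rightarrow> bool" where
  "has_trace r w g \<longleftrightarrow>
     w \<in> sobolev 1 (ball 0 r) \<and>
     (\<exists>F. smooth_tendsto_sobolev 1 (ball 0 r) F w \<and> L2_tendsto (sphere_measure r) F g)"

text \<open>The trace of the outward normal derivative, i.e. the sum of the products of the
  components of the unit normal \<open>x / |x|\<close> with the traces of the weak partial derivatives.\<close>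

definition has_normal_trace ::
    "real \<Rightarrow> ('a::euclidean_space \<Rightarrow> complex) \<Rightarrow> ('a \<Rightarrow> complex) \<Rightarrow> bool" where
  "has_normal_trace r u h \<longleftrightarrow>
     (\<exists>D T. (\<forall>b\<in>Basis. weak_deriv (ball 0 r) [b] u (D b) \<and> has_trace r (D b) (T b)) \<and>
        (AE x in sphere_measure r. h x = (\<Sum>b\<in>Basis. of_real (sgn x \<bullet> b) * T b x)))"

section \<open>The Born transmission eigenvalue problem\<close>

text \<open>\<open>\<Delta> f + k\<^sup>2 f = g\<close> in the sense of distributions on \<open>\<Omega>\<close>.\<close>

definition helmholtz_distributional ::
    "'a::euclidean_space set \<Rightarrow> complex \<Rightarrow> ('a \<Rightarrow> complex) \<Rightarrow> ('a \<Rightarrow> complex) \<Rightarrow> bool" where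
  "helmholtz_distributional \<Omega> k f g \<longleftrightarrow>
     loc_integrable \<Omega> f \<and> loc_integrable \<Omega> g \<and>
     (\<forall>\<phi>\<in>test_functions \<Omega>.
        (\<integral>x. f x * (laplacian \<phi> x + k\<^sup>2 * \<phi> x) \<partial>lebesgue_on \<Omega>)
        = (\<integral>x. g x * \<phi> x \<partial>lebesgue_on \<Omega>))"

definition born_solution ::
    "real \<Rightarrow> ('a::euclidean_space \<Rightarrow> real) \<Rightarrow> complex \<Rightarrow>
     ('a \<Rightarrow> complex) \<Rightarrow> ('a \<Rightarrow> complex) \<Rightarrow> bool" where
  "born_solution r m k u v \<longleftrightarrow>
     u \<in> sobolev 2 (ball 0 r) \<and>
     (\<lambda>x. of_real (m x) * v x) \<in> L2 (lebesgue_on (ball 0 r)) \<and>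
     helmholtz_distributional (ball 0 r) k u (\<lambda>x. - k\<^sup>2 * of_real (m x) * v x) \<and>
     helmholtz_distributional (ball 0 r) k v (\<lambda>x. 0) \<and>
     has_trace r u (\<lambda>x. 0) \<and>
     has_normal_trace r u (\<lambda>x. 0)"

definition born_transmission_eigenvalues ::
    "real \<Rightarrow> ('a::euclidean_space \<Rightarrow> real) \<Rightarrow> complex set" where
  "born_transmission_eigenvalues r m =
     {k. k \<noteq> 0 \<and> (\<exists>u v. born_solution r m k u v \<and>
            \<not> (AE x in lebesgue_on (ball 0 r). u x = 0 \<and> v x = 0))}"

end

theory Submission
  imports Defs "HOL-Complex_Analysis.Complex_Analysis" "HOL-Real_Asymp.Real_Asymp"
begin

text \<open>With \<open>\<kappa> = k\<^sup>2\<close> and \<open>Y\<close> a harmonic homogeneous polynomial of degree \<open>l\<close>, the function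
  \<open>Y(x) B(\<kappa> |x|\<^sup>2)\<close>, where \<open>B\<close> is the entire function \<open>bes (2 l + d)\<close> (a normalised Bessel function),
  solves the Helmholtz equation.

  Let \<open>(u, v)\<close> solve the Born problem. Testing the equation of \<open>v\<close> with \<open>(4 - |x|\<^sup>2)\<^sup>2 Y(x) q(|x|\<^sup>2)\<close> shows
  that the functional \<open>q \<mapsto> \<integral> v Y q(|x|\<^sup>2)\<close> is proportional to \<open>q \<mapsto> \<integral> r\<^bsup>2l+d-1\<^esup> q(r\<^sup>2) B(\<kappa> r\<^sup>2) dr\<close>, while the
  equation of \<open>u\<close>, whose Cauchy data vanish, gives \<open>\<integral> m v Y B(\<kappa> |x|\<^sup>2) = 0\<close>. Hence, up to a constant factor,
  \<open>charfun d l \<kappa> = \<integral>\<^sub>0\<^sup>2 (2+r)\<^bsup>d-1\<^esup> r\<^bsup>2l\<^esup> B(\<kappa> r\<^sup>2)\<^sup>2 dr\<close> vanishes for some \<open>l\<close>, or else all moments of \<open>v\<close>, and then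
  \<open>u\<close> and \<open>v\<close>, are zero. Conversely, a zero of \<open>charfun d 4\<close> yields a solution \<open>u = Y U(|x|\<^sup>2)\<close>, \<open>v = Y B(\<kappa> |x|\<^sup>2)\<close>;
  the degree 4 is large enough for \<open>Y\<close> to compensate the singularity of \<open>m\<close> at the origin.

  It remains to locate the zeros of \<open>charfun\<close>. It is positive for real \<open>\<kappa>\<close>, which excludes real and imaginary \<open>k\<close>,
  and nonzero if \<open>l\<close> is large compared with \<open>|\<kappa>|\<close>, which gives discreteness. As an entire function of order at
  most 1/2 that is not a polynomial it has infinitely many zeros. The zero-free strip follows from a bound, uniform
  in \<open>l\<close>, of the \<open>k\<close>-derivative of the radial solution by the solution itself in \<open>L\<^sup>2(0,2)\<close>.\<close>

section \<open>Normalised Bessel functions\<close>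

text \<open>\<open>v\<close> solves its equation only in the sense of distributions and has no
  boundary values to work with. The factor \<open>(4 - |x|^2)^2\<close> is the way around this: it
  vanishes together with its gradient on the sphere, so the equation may be tested without any
  knowledge of \<open>v\<close> there. The price is that two numbers per degree, the response of the
  functional to the value and to the derivative of \<open>q\<close> at \<open>|x|^2 = 4\<close>,
  stay undetermined. Taylor polynomials of the Bessel solution, which the Helmholtz operator almost
  annihilates, give one relation between them; hence the functional is found only up to a factor.
  All tests are polynomials, so no expansion of \<open>v\<close> in spherical harmonics is made, and
  the pole of \<open>m\<close> is reached by truncation. The strip is the delicate claim, as one
  width must serve all \<open>l\<close> and all \<open>Re k\<close>. On the real axis
  \<open>charfun\<close> is the square of a weighted norm of the real radial solution; a bound on
  its rate of change in \<open>Im k\<close> relative to that norm, independent of \<open>l\<close>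
  and \<open>Re k\<close>, keeps it away from 0 within a fixed distance.\<close>

primrec bes_coeff :: "nat \<Rightarrow> nat \<Rightarrow> real" where
  "bes_coeff M 0 = 1"
| "bes_coeff M (Suc n) = - bes_coeff M n / ((real n + 1) * (4 * real n + 2 * real M))"

text \<open>This is the hypergeometric series \<open>0F1(M/2; -z/4)\<close>, that is, the Bessel
  function \<open>J_(M/2-1)(sqrt z)\<close> divided by its leading power and normalised to 1 at 0;
  \<open>M = 1\<close> gives \<open>cos (sqrt z)\<close>. As a power series in
  \<open>z = \<kappa> r^2\<close> it involves no branch of the square root.\<close>

definition bes :: "nat \<Rightarrow> complex \<Rightarrow> complex" where
  "bes M z = (\<Sum>n. of_real (bes_coeff M n) * z ^ n)"

lemma bes_coeff_le_exp: "M \<ge> 1 \<Longrightarrow> \<bar>bes_coeff M n\<bar> \<le> inverse (2 * real M) ^ n / fact n"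
proof (induction n)
  case (Suc n)
  have "\<bar>bes_coeff M (Suc n)\<bar> = \<bar>bes_coeff M n\<bar> / ((real n + 1) * (4 * real n + 2 * real M))"
    by (simp add: abs_mult)
  also have "\<dots> \<le> (inverse (2 * real M) ^ n / fact n) / ((real n + 1) * (2 * real M))"
    using Suc by (intro frac_le mult_left_mono mult_pos_pos) auto
  also have "\<dots> = inverse (2 * real M) ^ Suc n / fact (Suc n)"
    using Suc by (simp add: field_simps)
  finally show ?case .
qed auto

text \<open>The worst case is \<open>M = 1\<close>, the series of \<open>cos (sqrt z)\<close>,
  because \<open>(n+1)(4n+2) = (2n+1)(2n+2)\<close>. This bound yields growth of order 1/2, whereas
  \<open>bes_coeff_le_exp\<close> records the decay in \<open>M\<close>.\<close>

lemma bes_coeff_le_fact2: "M \<ge> 1 \<Longrightarrow> \<bar>bes_coeff M n\<bar> \<le> 1 / fact (2 * n)"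
proof (induction n)
  case (Suc n)
  have "\<bar>bes_coeff M (Suc n)\<bar> = \<bar>bes_coeff M n\<bar> / ((real n + 1) * (4 * real n + 2 * real M))"
    by (simp add: abs_mult)
  also have "\<dots> \<le> (1 / fact (2 * n)) / ((real n + 1) * (4 * real n + 2))"
    using Suc by (intro frac_le mult_left_mono mult_pos_pos) auto
  also have "\<dots> = 1 / fact (2 * Suc n)"
    by (simp add: field_simps)
  finally show ?case .
qed auto

lemma bes_norm_summable:
  assumes "M \<ge> 1" shows "summable (\<lambda>n. norm (of_real (bes_coeff M n) * (z::complex) ^ n))"
proof (rule summable_comparison_test')
  show "summable (\<lambda>n. (norm z * inverse (2 * real M)) ^ n / fact n)"
    using summable_exp_generic[of "norm z * inverse (2 * real M)"] by (simp add: field_simps)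
  show "norm (norm (of_real (bes_coeff M n) * z ^ n)) \<le> (norm z * inverse (2 * real M)) ^ n / fact n" for n
    using mult_right_mono[OF bes_coeff_le_exp[OF assms, of n], of "norm z ^ n"]
    by (simp add: norm_mult norm_power power_mult_distrib field_simps)
qed

lemma bes_summable: "M \<ge> 1 \<Longrightarrow> summable (\<lambda>n. of_real (bes_coeff M n) * (z::complex) ^ n)"
  by (rule summable_norm_cancel[OF bes_norm_summable])

lemma bes_0 [simp]: "bes M 0 = 1"
  by (simp add: bes_def)

text \<open>Coefficient form of the rule that differentiation raises \<open>M\<close> by 2 and
  multiplies by \<open>-1/(2M)\<close>, the analogue of raising the index of a Bessel function by
  one.\<close>

lemma bes_coeff_shift:
  assumes "M \<ge> 1"
  shows "(real n + 1) * bes_coeff M (Suc n) = - bes_coeff (M + 2) n / (2 * real M)"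
proof (induction n)
  case (Suc n)
  define x y where "x = bes_coeff M (Suc n)" and "y = bes_coeff (M + 2) n"
  have M: "real M > 0" using assms by simp
  have nz: "4 * real n + 4 + 2 * real M \<noteq> 0" "real n + 1 \<noteq> 0" "real n + 2 \<noteq> 0" using M by auto
  have 1: "(real (Suc n) + 1) * bes_coeff M (Suc (Suc n)) = - x / (4 * real n + 4 + 2 * real M)"
  proof -
    have "bes_coeff M (Suc (Suc n)) = - x / ((real n + 2) * (4 * real n + 4 + 2 * real M))"
      unfolding x_def by (subst bes_coeff.simps(2)) (simp del: bes_coeff.simps add: add.commute)
    then show ?thesis using nz(3) by (simp del: bes_coeff.simps add: add.commute)
  qed
  have 2: "bes_coeff (M + 2) (Suc n) = - y / ((real n + 1) * (4 * real n + 4 + 2 * real M))"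
    unfolding y_def bes_coeff.simps(2) by (simp add: algebra_simps)
  have 3: "y = - (real n + 1) * x * (2 * real M)"
    using Suc[folded x_def y_def] M by (simp add: field_simps)
  have "- x / Q = - (- (- p * x * m) / (p * Q)) / m" if "Q \<noteq> 0" "p \<noteq> 0" "m \<noteq> 0" for Q p m :: real
    using that by (simp add: divide_simps)
  from this[OF nz(1,2), of "2 * real M"] show ?case
    unfolding 1 2 unfolding 3 using M by simp
qed (use assms in \<open>simp add: field_simps\<close>)

lemma bes_has_field_derivative:
  assumes "M \<ge> 1"
  shows "(bes M has_field_derivative - bes (M + 2) z / (2 * of_nat M)) (at z)"
proof -
  have "(bes M has_field_derivative (\<Sum>n. diffs (\<lambda>n. of_real (bes_coeff M n)) n * z ^ n)) (at z)"
    unfolding bes_def [abs_def]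
    by (intro termdiffs_strong_converges_everywhere bes_summable assms)
  also have "(\<lambda>n. diffs (\<lambda>n. of_real (bes_coeff M n)) n * z ^ n)
      = (\<lambda>n. - 1 / (2 * of_nat M) * (of_real (bes_coeff (M+2) n) * z ^ n) :: complex)"
  proof
    fix n
    have "diffs (\<lambda>n. of_real (bes_coeff M n)) n = (of_real ((real n + 1) * bes_coeff M (Suc n)) :: complex)"
      by (simp add: diffs_def add.commute del: bes_coeff.simps)
    also have "\<dots> = of_real (- bes_coeff (M + 2) n / (2 * real M))"
      by (simp only: bes_coeff_shift[OF assms, of n])
    finally show "diffs (\<lambda>n. of_real (bes_coeff M n)) n * z ^ n =
      - 1 / (2 * of_nat M) * (of_real (bes_coeff (M+2) n) * z ^ n)" by simp
  qed
  also have "(\<Sum>n. - 1 / (2 * of_nat M) * (of_real (bes_coeff (M+2) n) * z ^ n))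
     = - bes (M + 2) z / (2 * of_nat M)"
    using bes_summable[of "M+2" z] assms by (subst suminf_mult) (auto simp: bes_def)
  finally show ?thesis .
qed

lemma bes_DERIV [derivative_intros]:
  assumes "M \<ge> 1" "(f has_field_derivative f') (at z within S)"
  shows "((\<lambda>x. bes M (f x)) has_field_derivative (- bes (M + 2) (f z) / (2 * of_nat M) * f')) (at z within S)"
  using DERIV_chain2[OF bes_has_field_derivative[OF assms(1)] assms(2)] .

lemma bes_holomorphic [holomorphic_intros]:
  assumes "f holomorphic_on S" "M \<ge> 1" shows "(\<lambda>z. bes M (f z)) holomorphic_on S"
proof -
  have "bes M holomorphic_on UNIV"
    using bes_has_field_derivative[OF assms(2)] field_differentiable_at_within
    by (auto simp: holomorphic_on_def field_differentiable_def)
  then show ?thesis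
    using holomorphic_on_compose[OF assms(1), of "bes M"] holomorphic_on_subset by (auto simp: o_def)
qed

lemma bes_continuous_on [continuous_intros]:
  assumes "continuous_on S f" "M \<ge> 1" shows "continuous_on S (\<lambda>z. bes M (f z))"
proof -
  have "continuous_on UNIV (bes M)"
    by (intro holomorphic_on_imp_continuous_on bes_holomorphic assms holomorphic_on_ident)
  then show ?thesis
    using continuous_on_compose[OF assms(1), of "bes M"] continuous_on_subset by (auto simp: o_def)
qed

text \<open>The three-term recurrence of Bessel functions in this normalisation. Since raising
  \<open>M\<close> by 2 amounts to differentiation, it is the radial Helmholtz equation in disguise;
  \<open>bes_radial_ode\<close> and \<open>bes_radial_flux_deriv\<close> are derived from
  it.\<close>

lemma bes_recurrence:
  assumes "M \<ge> 1"
  shows "bes M z - bes (M + 2) z + z * bes (M + 4) z / (of_nat M * (of_nat M + 2)) = 0"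
proof -
  have a: "bes_coeff M (Suc n) - bes_coeff (M+2) (Suc n) + bes_coeff (M+4) n / (real M * (real M + 2)) = 0" for n
  proof -
    have s1: "bes_coeff M (Suc n) = - bes_coeff (M + 2) n / (2 * real M) / (real n + 1)"
      using arg_cong[OF bes_coeff_shift[OF assms, of n], of "\<lambda>x. x / (real n + 1)"] by (simp del: bes_coeff.simps)
    have s2: "bes_coeff (M+2) (Suc n) = - bes_coeff (M + 4) n / (2 * (real M + 2)) / (real n + 1)"
      using arg_cong[OF bes_coeff_shift[of "M+2" n], of "\<lambda>x. x / (real n + 1)"]
      by (simp del: bes_coeff.simps add: add.commute eval_nat_numeral)
    have s3: "bes_coeff (M+2) (Suc n) = - bes_coeff (M + 2) n / ((real n + 1) * (4 * real n + 2 * (real M + 2)))"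
      by simp
    have "bes_coeff (M+2) n = - (real n + 1) * (4 * real n + 2 * (real M + 2)) * bes_coeff (M+2) (Suc n)"
    proof -
      have "c = - p * q * (- c / (p * q))" if "p \<noteq> 0" "q \<noteq> 0" for c p q :: real
        using that by simp
      moreover have "real n + 1 \<noteq> 0" "4 * real n + 2 * (real M + 2) \<noteq> 0" using assms by auto
      ultimately show ?thesis unfolding s3 by blast
    qed
    also have "\<dots> = (4 * real n + 2 * (real M + 2)) * bes_coeff (M + 4) n / (2 * (real M + 2))"
      unfolding s2 using assms by (simp add: divide_simps) (simp add: algebra_simps)
    finally have s4: "bes_coeff (M+2) n = (4 * real n + 2 * (real M + 2)) * bes_coeff (M + 4) n / (2 * (real M + 2))" .
    have p: "real n + 1 \<noteq> 0" "real M > 0" "real M + 2 \<noteq> 0" "2 * (real M + 2) \<noteq> 0" using assms by auto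
    show ?thesis
      unfolding s1 s2 unfolding s4 using p by (simp add: divide_simps) (simp add: algebra_simps)
  qed
  have s: "(\<lambda>n. of_real (bes_coeff K n) * z ^ n) sums bes K z" if "K \<ge> 1" for K
    unfolding bes_def using bes_summable[OF that] by (rule summable_sums)
  have sh: "(\<lambda>n. of_real (bes_coeff K (Suc n)) * z ^ Suc n) sums (bes K z - 1)" if "K \<ge> 1" for K
    by (rule iffD2[OF sums_Suc_iff]) (use s[OF that] in simp)
  have "(\<lambda>n. of_real (bes_coeff M (Suc n)) * z ^ Suc n - of_real (bes_coeff (M+2) (Suc n)) * z ^ Suc n
      + z / (of_nat M * (of_nat M + 2)) * (of_real (bes_coeff (M+4) n) * z ^ n))
    sums ((bes M z - 1) - (bes (M + 2) z - 1) + z / (of_nat M * (of_nat M + 2)) * bes (M + 4) z)"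
    using assms by (intro sums_add sums_diff sums_mult sh s) auto
  moreover have "(\<lambda>n. of_real (bes_coeff M (Suc n)) * z ^ Suc n - of_real (bes_coeff (M+2) (Suc n)) * z ^ Suc n
      + z / (of_nat M * (of_nat M + 2)) * (of_real (bes_coeff (M+4) n) * z ^ n))
    = (\<lambda>n. of_real (bes_coeff M (Suc n) - bes_coeff (M+2) (Suc n) + bes_coeff (M+4) n / (real M * (real M + 2))) * z ^ Suc n)"
    by (auto simp: algebra_simps)
  ultimately have "(\<lambda>n. 0) sums ((bes M z - 1) - (bes (M + 2) z - 1) + z / (of_nat M * (of_nat M + 2)) * bes (M + 4) z)"
    unfolding a by simp
  then show ?thesis
    using sums_unique2[OF sums_zero] by simp
qed

lemma bes_norm_le_cosh:
  assumes "M \<ge> 1" shows "norm (bes M z) \<le> exp (sqrt (norm z))"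
proof -
  define t where "t = sqrt (norm z)"
  have t: "t \<ge> 0" "norm z = t ^ 2" by (auto simp: t_def)
  have sub: "summable (\<lambda>n. t ^ (2 * n) / fact (2 * n))" and le: "(\<Sum>n. t ^ (2 * n) / fact (2 * n)) \<le> exp t"
  proof -
    have c: "(\<lambda>n. if even n then t ^ n / fact n else 0) sums cosh t"
      using cosh_converges[of t] by (simp only: scaleR_conv_of_real divide_inverse mult.commute id_apply real_scaleR_def of_real_eq_id)
    have sm: "strict_mono (\<lambda>n::nat. 2 * n)" by (simp add: strict_mono_def)
    have "(\<lambda>n. (if even (2*n) then t ^ (2*n) / fact (2*n) else 0)) sums cosh t"
      using c by (subst sums_mono_reindex[OF sm]) (auto elim: evenE)
    then have s: "(\<lambda>n. t ^ (2*n) / fact (2*n)) sums cosh t" by simp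
    then show "summable (\<lambda>n. t ^ (2 * n) / fact (2 * n))" by (simp add: sums_iff)
    have "exp (- t) \<le> exp t" using t by simp
    then have "cosh t \<le> exp t" by (simp add: cosh_def)
    then show "(\<Sum>n. t ^ (2 * n) / fact (2 * n)) \<le> exp t"
      using s by (simp add: sums_iff)
  qed
  have "norm (bes M z) \<le> (\<Sum>n. norm (of_real (bes_coeff M n) * z ^ n))"
    unfolding bes_def by (rule summable_norm[OF bes_norm_summable[OF assms]])
  also have "\<dots> \<le> (\<Sum>n. t ^ (2 * n) / fact (2 * n))"
  proof (rule suminf_le[OF _ bes_norm_summable[OF assms] sub])
    show "norm (of_real (bes_coeff M n) * z ^ n) \<le> t ^ (2 * n) / fact (2 * n)" for n
      using mult_right_mono[OF bes_coeff_le_fact2[OF assms, of n], of "norm z ^ n"] t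
      by (simp add: norm_mult norm_power power_mult)
  qed
  finally show ?thesis using le by (simp add: t_def)
qed

text \<open>The factor \<open>2 M\<close> in the exponent says that the function is close to 1 as
  long as the argument is small compared with \<open>M\<close>; this keeps \<open>charfun\<close>
  away from 0 for large \<open>l\<close>.\<close>

lemma bes_minus_one:
  assumes "M \<ge> 1" shows "norm (bes M z - 1) \<le> exp (norm z / (2 * real M)) - 1"
proof -
  let ?q = "norm z / (2 * real M)"
  have sh: "(\<lambda>n. of_real (bes_coeff M (Suc n)) * z ^ Suc n) sums (bes M z - 1)"
    by (rule iffD2[OF sums_Suc_iff])
       (use summable_sums[OF bes_summable[OF assms, of z]] in \<open>simp add: bes_def[symmetric]\<close>)
  have e: "(\<lambda>n. ?q ^ n / fact n) sums exp ?q"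
    using exp_converges[of ?q] by (simp add: field_simps)
  have e': "(\<lambda>n. ?q ^ Suc n / fact (Suc n)) sums (exp ?q - 1)"
    by (rule iffD2[OF sums_Suc_iff]) (use e in simp)
  have le: "norm (of_real (bes_coeff M (Suc n)) * z ^ Suc n) \<le> ?q ^ Suc n / fact (Suc n)" for n
    using mult_right_mono[OF bes_coeff_le_exp[OF assms, of "Suc n"], of "norm z ^ Suc n"]
    by (simp add: norm_mult norm_power power_mult_distrib field_simps del: bes_coeff.simps)
  have "norm (\<Sum>n. of_real (bes_coeff M (Suc n)) * z ^ Suc n) \<le> (\<Sum>n. ?q ^ Suc n / fact (Suc n))"
    by (rule norm_suminf_le[OF le sums_summable[OF e']])
  then show ?thesis using sh e' by (simp only: sums_iff)
qed

lemma bes_of_real: "M \<ge> 1 \<Longrightarrow> bes M (of_real t) \<in> \<real>"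
proof -
  assume M: "M \<ge> 1"
  have s: "summable (\<lambda>n. bes_coeff M n * t ^ n)"
    using bes_norm_summable[OF M, of "of_real t"]
    by (intro summable_norm_cancel[of "\<lambda>n. bes_coeff M n * t ^ n"]) (simp add: norm_mult norm_power abs_mult power_abs)
  have "bes M (of_real t) = of_real (\<Sum>n. bes_coeff M n * t ^ n)"
    unfolding bes_def using sums_of_real[OF summable_sums[OF s], where 'a = complex]
    by (simp add: sums_iff)
  then show ?thesis by simp
qed

section \<open>The characteristic function\<close>

lemma Re_of_real_mult: "Re (of_real a * z) = a * Re z"
  by simp

text \<open>\<open>r^(2l)\<close> is the polar weight \<open>r^(2l+d-1)\<close> times the factor
  \<open>r^(-(d-1))\<close> of \<open>m\<close>, so nothing singular is left at 0. The Bessel factor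
  is squared without a modulus: this keeps the integral holomorphic in \<kappa>, and for real
  \<kappa> the integrand is still nonnegative.\<close>

definition charfun :: "nat \<Rightarrow> nat \<Rightarrow> complex \<Rightarrow> complex" where
  "charfun d l \<kappa> = integral {0..2}
     (\<lambda>r::real. of_real ((2 + r) ^ (d - 1) * r ^ (2 * l)) * (bes (2 * l + d) (\<kappa> * of_real (r^2)))^2)"

lemma charfun_integrable [simp]:
  assumes "d \<ge> 1"
  shows "(\<lambda>r::real. of_real ((2 + r) ^ (d - 1) * r ^ (2 * l)) * (bes (2 * l + d) (\<kappa> * of_real (r^2)))^2)
    integrable_on {a..b}"
  by (intro integrable_continuous_real continuous_intros) (use assms in auto)

lemma charfun_holomorphic:
  assumes "d \<ge> 1" shows "charfun d l holomorphic_on UNIV"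
proof -
  define c :: complex where "c = 2 * of_nat (2 * l + d)"
  have "c = of_nat (2 * (2 * l + d))" by (simp add: c_def)
  then have c: "c \<noteq> 0" using assms by (simp only: of_nat_eq_0_iff) simp
  have "(\<lambda>\<kappa>. integral (cbox 0 2) (\<lambda>r::real. of_real ((2 + r) ^ (d - 1) * r ^ (2 * l)) *
     (bes (2 * l + d) (\<kappa> * of_real (r^2)))^2)) holomorphic_on UNIV"
  proof (rule leibniz_rule_holomorphic)
    fix \<kappa> :: complex and r :: real
    show "((\<lambda>\<kappa>. of_real ((2 + r) ^ (d - 1) * r ^ (2 * l)) * (bes (2 * l + d) (\<kappa> * of_real (r^2)))^2)
       has_field_derivative of_real ((2 + r) ^ (d - 1) * r ^ (2 * l)) *
         (2 * bes (2 * l + d) (\<kappa> * of_real (r^2)) *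
         (- bes (2 * l + d + 2) (\<kappa> * of_real (r^2)) / c * of_real (r^2)))) (at \<kappa> within UNIV)"
      using assms by (auto intro!: derivative_eq_intros simp: power2_eq_square c_def)
  next
    show "(\<lambda>r::real. of_real ((2 + r) ^ (d - 1) * r ^ (2 * l)) *
     (bes (2 * l + d) (\<kappa> * of_real (r^2)))^2) integrable_on cbox 0 2" for \<kappa>
      unfolding box_real by (rule charfun_integrable[OF assms])
  qed (use assms c in \<open>auto intro!: continuous_intros simp: case_prod_unfold\<close>)
  then show ?thesis
    by (simp add: charfun_def [abs_def])
qed

text \<open>For real \<kappa> the integrand is continuous and nonnegative, so a vanishing integral
  would make the Bessel factor vanish on \<open>(0,2]\<close> and, by continuity, at 0, where it
  equals 1.\<close>

lemma charfun_real_pos: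
  assumes "d \<ge> 1" "\<kappa> \<in> \<real>" shows "charfun d l \<kappa> \<noteq> 0"
proof
  assume 0: "charfun d l \<kappa> = 0"
  obtain t where t: "\<kappa> = of_real t" using assms(2) by (auto elim: Reals_cases)
  define g where "g r = (2 + r) ^ (d - 1) * r ^ (2 * l) * (Re (bes (2 * l + d) (\<kappa> * of_real (r^2))))^2" for r :: real
  have eq: "of_real ((2 + r) ^ (d - 1) * r ^ (2 * l)) * (bes (2 * l + d) (\<kappa> * of_real (r^2)))^2 = (of_real (g r) :: complex)" for r
  proof -
    have "bes (2 * l + d) (of_real (t * r^2)) \<in> \<real>" by (rule bes_of_real) (use assms in auto)
    then have "bes (2 * l + d) (\<kappa> * of_real (r^2)) = of_real (Re (bes (2 * l + d) (\<kappa> * of_real (r^2))))"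
      by (simp add: t)
    then show ?thesis unfolding g_def of_real_mult of_real_power by presburger
  qed
  have c: "continuous_on {0..2} g"
    unfolding g_def by (intro continuous_intros) (use assms in auto)
  have "of_real (integral {0..2} g) = (0::complex)"
    using 0 unfolding charfun_def eq
    using integral_linear[OF integrable_continuous_real[OF c] bounded_linear_of_real[where 'a = complex]]
    by (simp add: o_def)
  then have "integral {0..2} g = 0" by simp
  then have z: "g r = 0" if "r \<in> {0..2}" for r
    using integral_eq_0_iff[OF c] that by (auto simp: g_def)
  \<comment> \<open>At \<open>r = 0\<close> the weight \<open>r^(2l)\<close> may vanish and hide the
    Bessel factor, so the value there is reached by continuity from \<open>(0,2]\<close>.\<close>
  have cB: "continuous_on (closure {0<..2}) (\<lambda>r. Re (bes (2 * l + d) (\<kappa> * of_real (r^2))))"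
    by (intro continuous_intros) (use assms in auto)
  have "Re (bes (2 * l + d) (\<kappa> * of_real (0^2))) = 0"
  proof (rule continuous_constant_on_closure[OF cB])
    show "Re (bes (2 * l + d) (\<kappa> * of_real (r^2))) = 0" if "r \<in> {0<..2}" for r
      using z[of r] that by (simp add: g_def)
  qed simp
  then show False by simp
qed

text \<open>For \<open>r \<le> 2\<close> the argument has modulus at most
  \<open>4 R \<le> l\<close>, so the Bessel factor differs from 1 by at most
  \<open>exp(1/4) - 1 \<le> 5/16\<close>. Then its square has real part at least
  \<open>1 - 2 (5/16) - (5/16)^2 > 1/4\<close>.\<close>

lemma charfun_large_l:
  assumes "d \<ge> 1" "norm \<kappa> \<le> R" "R \<ge> 0" "real l \<ge> 4 * R"
  shows "charfun d l \<kappa> \<noteq> 0"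
proof
  assume 0: "charfun d l \<kappa> = 0"
  let ?B = "\<lambda>r::real. bes (2 * l + d) (\<kappa> * of_real (r^2))"
  have re: "Re ((?B r)^2) \<ge> 1/4" if r: "r \<in> {0..2}" for r
  proof -
    let ?w = "?B r - 1"
    have r4: "r^2 \<le> 4" using power_mono[of r 2 2] r by simp
    have "norm (\<kappa> * of_real (r^2)) \<le> R * 4"
      unfolding norm_mult norm_of_real using r4 assms by (intro mult_mono) auto
    also have "\<dots> \<le> real l" using assms by simp
    finally have n: "norm (\<kappa> * of_real (r^2)) \<le> real l" .
    have "norm (\<kappa> * of_real (r^2)) / (2 * real (2 * l + d)) \<le> 1/4"
      using n assms by (simp add: field_simps)
    then have "exp (norm (\<kappa> * of_real (r^2)) / (2 * real (2 * l + d))) \<le> exp (1/4)"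
      by simp
    also have "exp (1/4) \<le> (1 + 1/4 + (1/4)^2 :: real)"
      by (rule exp_bound) auto
    finally have w: "norm ?w \<le> 1/4 + 1/16"
      using bes_minus_one[of "2*l+d" "\<kappa> * of_real (r^2)"] assms by (simp add: power2_eq_square)
    have "(?B r)^2 = 1 + 2 * ?w + ?w^2" by (simp add: power2_eq_square algebra_simps)
    then have "Re ((?B r)^2) = 1 + 2 * Re ?w + Re (?w^2)" by simp
    moreover have "\<bar>Re ?w\<bar> \<le> 1/4 + 1/16" using abs_Re_le_cmod[of ?w] w by linarith
    moreover have "\<bar>Re (?w^2)\<bar> \<le> 25/256"
      using order_trans[OF abs_Re_le_cmod[of "?w^2", unfolded norm_power] power_mono[OF w, of 2]]
      by (simp add: power2_eq_square del: Re_power2)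
    ultimately show ?thesis by linarith
  qed
  have "integral {0..2} (\<lambda>r::real. r ^ (2*l) * (1/4)) \<le>
    integral {0..2} (\<lambda>r::real. Re (of_real ((2 + r) ^ (d - 1) * r ^ (2 * l)) * (?B r)^2))"
  proof (rule integral_le)
    fix r :: real assume r: "r \<in> {0..2}"
    have "1 ^ (d-1) * r ^ (2*l) \<le> (2 + r) ^ (d - 1) * r ^ (2 * l)"
      using r by (intro mult_right_mono power_mono) auto
    then have "r ^ (2*l) * (1/4) \<le> ((2 + r) ^ (d - 1) * r ^ (2 * l)) * Re ((?B r)^2)"
      using re[OF r] r by (intro mult_mono) auto
    then show "r ^ (2*l) * (1/4) \<le> Re (of_real ((2 + r) ^ (d - 1) * r ^ (2 * l)) * (?B r)^2)"
      unfolding Re_of_real_mult .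
  qed (use assms in \<open>auto intro!: integrable_continuous_real continuous_intros\<close>)
  also have "\<dots> = Re (charfun d l \<kappa>)"
    unfolding charfun_def by (rule integral_linear[OF charfun_integrable[OF assms(1)] bounded_linear_Re, unfolded o_def])
  finally have le: "integral {0..2} (\<lambda>r::real. r ^ (2*l) * (1/4)) \<le> 0" using 0 by simp
  have c: "continuous_on {0..2} (\<lambda>r::real. r ^ (2*l) * (1/4))" by (intro continuous_intros)
  have "integral {0..2} (\<lambda>r::real. r ^ (2*l) * (1/4)) \<ge> 0"
    by (intro integral_nonneg integrable_continuous_real c) auto
  with le have "integral {0..2} (\<lambda>r::real. r ^ (2*l) * (1/4)) = 0" by simp
  then show False
    using integral_eq_0_iff[OF c] by auto
qed

section \<open>Infinitely many zeros of \<open>charfun\<close>: growth against factorisation\<close>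

lemma bes_coeff_alternating: "bes_coeff M n * (- 1) ^ n = \<bar>bes_coeff M n\<bar>"
proof -
  have "bes_coeff M n * (- 1) ^ n \<ge> 0"
  proof (induction n)
    case (Suc n)
    have "bes_coeff M (Suc n) * (- 1) ^ Suc n
        = (bes_coeff M n * (- 1) ^ n) / ((real n + 1) * (4 * real n + 2 * real M))" by simp
    also have "\<dots> \<ge> 0" by (rule divide_nonneg_nonneg[OF Suc]) simp
    finally show ?case .
  qed simp
  then have "bes_coeff M n * (- 1) ^ n = \<bar>bes_coeff M n * (- 1) ^ n\<bar>" by simp
  then show ?thesis by (simp add: abs_mult)
qed

lemma bes_coeff_nonzero: "M \<ge> 1 \<Longrightarrow> bes_coeff M n \<noteq> 0"
  by (induction n) (auto simp: add_nonneg_eq_0_iff)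

text \<open>On the negative axis the alternating signs of the coefficients cancel, every term of the
  series is nonnegative, and any single term is a lower bound.\<close>

lemma bes_negative_real_ge:
  assumes "M \<ge> 1" "s \<ge> 0"
  shows "\<exists>x. bes M (of_real (- s)) = of_real x \<and> x \<ge> \<bar>bes_coeff M k\<bar> * s ^ k"
proof -
  have eq: "bes_coeff M n * (- s) ^ n = \<bar>bes_coeff M n\<bar> * s ^ n" for n
  proof -
    have "bes_coeff M n * (- s) ^ n = (bes_coeff M n * (- 1) ^ n) * s ^ n"
      by (subst power_minus) simp
    then show ?thesis unfolding bes_coeff_alternating .
  qed
  have s: "summable (\<lambda>n. bes_coeff M n * (- s) ^ n)"
    using bes_norm_summable[OF assms(1), of "of_real (- s)"]
    by (intro summable_norm_cancel[of "\<lambda>n. bes_coeff M n * (- s) ^ n"])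
       (simp add: norm_mult norm_power abs_mult power_abs)
  have "bes M (of_real (- s)) = of_real (\<Sum>n. bes_coeff M n * (- s) ^ n)"
    unfolding bes_def using sums_of_real[OF summable_sums[OF s], where 'a = complex]
    by (simp add: sums_iff)
  moreover have "(\<Sum>n\<in>{k}. bes_coeff M n * (- s) ^ n) \<le> (\<Sum>n. bes_coeff M n * (- s) ^ n)"
    by (rule sum_le_suminf[OF s]) (auto simp: eq assms)
  ultimately show ?thesis by (auto simp: eq)
qed

text \<open>Borel-Caratheodory estimate followed by Liouville's argument: over the disc of radius
  \<open>R\<close> the real part of \<open>g - g 0\<close> is bounded by a constant plus
  \<open>B sqrt R\<close>, the Schwarz lemma gains a factor \<open>1/R\<close>, and \<open>R\<close>
  tends to infinity.\<close>

lemma entire_real_part_sqrt_bound_imp_constant: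
  assumes hol: "g holomorphic_on UNIV" and B: "B \<ge> 0"
    and bd: "\<And>z. Re (g z) \<le> A + B * sqrt (norm z)"
  shows "g z = g 0"
proof -
  define h where "h w = g w - g 0" for w
  define C where "C = \<bar>A\<bar> + \<bar>Re (g 0)\<bar> + 1"
  have le: "norm (h z) \<le> (norm z / R) * (2 * (C + B * sqrt R) + norm (h z))" if R: "R > norm z" for R
  proof -
    define K where "K = C + B * sqrt R"
    have R0: "R > 0" using R norm_ge_zero[of z] by linarith
    have "K > 0" using B R0 by (simp add: K_def C_def add_pos_nonneg add_nonneg_pos)
    have re: "Re (h w) < K" if "norm w < R" for w
    proof -
      have "B * sqrt (norm w) \<le> B * sqrt R" using that B by (intro mult_left_mono) auto
      then show ?thesis using bd[of w] by (simp add: h_def K_def C_def)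
    qed
    have lt: "norm (h w) < norm (2 * of_real K - h w)" if "norm w < R" for w
    proof (rule power2_less_imp_less)
      have "K * Re (h w) < K * K" using re[OF that] \<open>K > 0\<close> by simp
      then show "(norm (h w))^2 < (norm (2 * of_real K - h w))^2"
        unfolding cmod_power2 by (simp add: power2_eq_square algebra_simps)
    qed simp
    \<comment> \<open>The map \<open>h / (2K - h)\<close> carries the half-plane
      \<open>Re h < K\<close> into the unit disc and fixes 0, which is the situation of the Schwarz
      lemma.\<close>
    define \<psi> where "\<psi> \<zeta> = h (of_real R * \<zeta>) / (2 * of_real K - h (of_real R * \<zeta>))" for \<zeta>
    have in_ball: "norm (of_real R * \<zeta>) < R" if "norm \<zeta> < 1" for \<zeta> :: complex
      using that R0 by (simp add: norm_mult)
    have nz: "2 * of_real K - h (of_real R * \<zeta>) \<noteq> 0" if "norm \<zeta> < 1" for \<zeta>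
      using lt[OF in_ball[OF that]] by (metis norm_not_less_zero norm_zero)
    have hh: "(\<lambda>\<zeta>. h (of_real R * \<zeta>)) holomorphic_on ball 0 1"
    proof -
      have "(\<lambda>\<zeta>. g (of_real R * \<zeta>)) holomorphic_on ball 0 1"
        using holomorphic_on_compose_gen[of "\<lambda>\<zeta>. of_real R * \<zeta>" "ball 0 1" g UNIV] hol
        by (auto simp: o_def intro!: holomorphic_intros)
      then show ?thesis unfolding h_def by (intro holomorphic_intros)
    qed
    have "norm (\<psi> (z / of_real R)) \<le> norm (z / of_real R)"
    proof (rule Schwarz_Lemma(1))
      show "\<psi> holomorphic_on ball 0 1"
        unfolding \<psi>_def by (intro holomorphic_intros hh) (use nz in auto)
      show "\<psi> 0 = 0" by (simp add: \<psi>_def h_def)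
      show "norm (\<psi> \<zeta>) < 1" if "norm \<zeta> < 1" for \<zeta>
        using lt[OF in_ball[OF that]] nz[OF that] by (simp add: \<psi>_def norm_divide divide_simps)
      show "norm (z / of_real R) < 1" using R R0 by (simp add: norm_divide)
    qed
    then have "norm (h z) / norm (2 * of_real K - h z) \<le> norm z / R"
      using R0 by (simp add: \<psi>_def norm_divide)
    moreover have "norm (2 * of_real K - h z) > 0" using lt[OF R] by (meson le_less_trans norm_ge_zero)
    ultimately have "norm (h z) \<le> norm z / R * norm (2 * of_real K - h z)"
      by (simp add: pos_divide_le_eq)
    also have "\<dots> \<le> norm z / R * (2 * K + norm (h z))"
      using norm_triangle_ineq4[of "2 * of_real K" "h z"] \<open>K > 0\<close> R0
      by (intro mult_left_mono) (auto simp: norm_mult)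
    finally show ?thesis by (simp add: K_def)
  qed
  have "((\<lambda>R. norm z * (2 * C + norm (h z)) * (1 / R) + 2 * norm z * B * (sqrt R / R)) \<longlongrightarrow>
      norm z * (2 * C + norm (h z)) * 0 + 2 * norm z * B * 0) at_top"
    by (intro tendsto_intros; real_asymp)
  then have "((\<lambda>R. norm z * (2 * C + norm (h z)) * (1 / R) + 2 * norm z * B * (sqrt R / R)) \<longlongrightarrow> 0) at_top"
    by simp
  moreover have "eventually (\<lambda>R. norm (h z) \<le> norm z * (2 * C + norm (h z)) * (1 / R) + 2 * norm z * B * (sqrt R / R)) at_top"
    using eventually_gt_at_top[of "norm z"]
  proof eventually_elim
    case (elim R)
    have "norm z / R * (2 * (C + B * sqrt R) + norm (h z))
       = norm z * (2 * C + norm (h z)) * (1 / R) + 2 * norm z * B * (sqrt R / R)"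
      by (simp add: divide_inverse algebra_simps)
    then show ?case using le[OF elim] by simp
  qed
  ultimately have "norm (h z) \<le> 0"
    by (rule tendsto_lowerbound) simp
  then show ?thesis by (simp add: h_def)
qed

text \<open>Dividing by the polynomial with the same zeros and orders leaves a zero-free entire
  function, which has a holomorphic logarithm on the simply connected plane.\<close>

lemma entire_finite_zeros_factorization:
  fixes f :: "complex \<Rightarrow> complex"
  assumes hol: "f holomorphic_on UNIV" and fin: "finite {z. f z = 0}"
  obtains Z n g where "finite Z" "g holomorphic_on UNIV"
    "\<And>z. f z = (\<Prod>a\<in>Z. (z - a) ^ n a) * exp (g z)"
proof -
  define Z where "Z = {z. f z = 0}"
  define n where "n a = nat (zorder f a)" for a
  define P where "P z = (\<Prod>a\<in>Z. (z - a) ^ n a)" for z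
  have Z: "finite Z" using fin by (simp add: Z_def)
  have an: "f analytic_on {a}" for a
    using hol analytic_on_holomorphic open_UNIV by blast
  \<comment> \<open>Finitely many zeros also exclude that \<open>f\<close> vanishes identically, so
    the order at every point is meaningful.\<close>
  have ev: "\<exists>\<^sub>F w in at a. f w \<noteq> 0" for a
  proof -
    have "eventually (\<lambda>w. w \<notin> Z) (at a)"
      using Z by (simp add: eventually_at_topological islimpt_finite flip: islimpt_def)
         (meson Z finite_imp_closed islimpt_def islimpt_finite)
    then have "eventually (\<lambda>w. f w \<noteq> 0) (at a)" by (simp add: Z_def)
    then show ?thesis by (rule eventually_frequently[rotated]) simp
  qed
  have holP: "P holomorphic_on UNIV"
    unfolding P_def by (intro holomorphic_intros)
  have nonneg: "zorder f a \<ge> 0" for a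
    by (rule zorder_ge_0[OF an ev])
  have pos: "zorder f a > 0 \<longleftrightarrow> f a = 0" for a
    using zorder_pos_iff'[OF an ev] by simp
  have P0: "P z = 0 \<longleftrightarrow> f z = 0" for z
    using Z pos[of z] by (auto simp: P_def n_def Z_def prod_zero_iff)
  have zP: "zorder P z = zorder f z" for z
  proof -
    have "zorder P z = int (n z)"
    proof (rule zorder_eqI[of UNIV z "\<lambda>w. \<Prod>a\<in>Z - {z}. (w - a) ^ n a"])
      show "(\<lambda>w. \<Prod>a\<in>Z - {z}. (w - a) ^ n a) holomorphic_on UNIV" by (intro holomorphic_intros)
      show "(\<Prod>a\<in>Z - {z}. (z - a) ^ n a) \<noteq> 0" using Z by (auto simp: prod_zero_iff)
      have n0: "n z = 0" if "z \<notin> Z" using that pos[of z] by (auto simp: n_def Z_def)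
      have Peq: "P w = (w - z) ^ n z * (\<Prod>a\<in>Z - {z}. (w - a) ^ n a)" for w
      proof (cases "z \<in> Z")
        case True
        then show ?thesis unfolding P_def using Z by (subst prod.remove[of Z z]) auto
      next
        case False
        then show ?thesis using n0[OF False] by (simp add: P_def)
      qed
      show "P w = (\<Prod>a\<in>Z - {z}. (w - a) ^ n a) * (w - z) powi int (n z)" for w
        unfolding Peq by (simp add: mult.commute)
    qed auto
    then show ?thesis using nonneg[of z] by (simp add: n_def)
  qed
  obtain h where h: "h holomorphic_on UNIV" "\<And>z. h z \<noteq> 0" "\<And>z. f z = h z * P z"
    using holomorphic_zorder_factorization[OF hol open_UNIV connected_UNIV holP] P0 zP by auto
  obtain g where g: "g holomorphic_on UNIV" "\<And>z. exp (g z) = h z"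
    using holomorphic_logarithm_exists[of UNIV h 0] h by auto
  show ?thesis
    by (rule that[OF Z g(1), of n]) (use h(3) g(2) in \<open>simp add: P_def mult.commute\<close>)
qed

lemma charfun_norm_le:
  assumes "d \<ge> 1"
  shows "norm (charfun d l \<kappa>) \<le> 2 * (4 ^ (d - 1) * 2 ^ (2 * l)) * exp (4 * sqrt (norm \<kappa>))"
proof -
  have "norm (charfun d l \<kappa>) \<le> (4 ^ (d - 1) * 2 ^ (2 * l) * exp (4 * sqrt (norm \<kappa>))) * (2 - 0)"
    unfolding charfun_def
  proof (rule integral_bound)
    fix r :: real assume r: "r \<in> {0..2}"
    have "sqrt (norm (\<kappa> * of_real (r^2))) = sqrt (norm \<kappa>) * r"
      using r by (simp add: norm_mult norm_power real_sqrt_mult)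
    also have "\<dots> \<le> sqrt (norm \<kappa>) * 2" using r by (intro mult_left_mono) auto
    finally have "exp (sqrt (norm (\<kappa> * of_real (r^2)))) \<le> exp (2 * sqrt (norm \<kappa>))" by simp
    then have "norm (bes (2 * l + d) (\<kappa> * of_real (r^2))) \<le> exp (2 * sqrt (norm \<kappa>))"
      using bes_norm_le_cosh[of "2*l+d" "\<kappa> * of_real (r^2)"] assms by linarith
    from power_mono[OF this, of 2] have "norm ((bes (2 * l + d) (\<kappa> * of_real (r^2)))^2) \<le> exp (4 * sqrt (norm \<kappa>))"
      by (simp add: norm_power exp_double[symmetric] flip: exp_of_nat_mult)
    moreover have "norm (of_real ((2 + r) ^ (d - 1) * r ^ (2 * l)) :: complex) \<le> 4 ^ (d - 1) * 2 ^ (2 * l)"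
      unfolding norm_of_real abs_mult power_abs using r by (intro mult_mono power_mono) auto
    ultimately show "norm (of_real ((2 + r) ^ (d - 1) * r ^ (2 * l)) * (bes (2 * l + d) (\<kappa> * of_real (r^2)))^2)
      \<le> 4 ^ (d - 1) * 2 ^ (2 * l) * exp (4 * sqrt (norm \<kappa>))"
      unfolding norm_mult[of "of_real _"] by (intro mult_mono) auto
  qed (use assms in \<open>auto intro!: continuous_intros\<close>)
  then show ?thesis by simp
qed

text \<open>Retaining the \<open>k\<close>-th term of the Bessel series in the squared factor gives
  growth of degree \<open>2 k\<close> along the negative axis. As \<open>k\<close> is arbitrary,
  \<open>charfun\<close> is not a polynomial.\<close>

lemma charfun_negative_real_ge:
  assumes "d \<ge> 1"
  shows "\<exists>e>0. \<forall>t\<ge>0. e * t ^ (2 * k) \<le> norm (charfun d l (of_real (- t)))"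
proof -
  define c where "c = \<bar>bes_coeff (2 * l + d) k\<bar>"
  have c: "c > 0" using bes_coeff_nonzero[of "2*l+d" k] assms by (simp add: c_def)
  define e where "e = integral {0..2} (\<lambda>r::real. r ^ (2*l) * (c * (r\<^sup>2) ^ k)^2)"
  have cont: "continuous_on {0..2} (\<lambda>r::real. r ^ (2*l) * (c * (r\<^sup>2) ^ k)^2)" by (intro continuous_intros)
  have "e \<ge> 0" unfolding e_def by (intro integral_nonneg integrable_continuous_real cont) auto
  moreover have "e \<noteq> 0"
    using integral_eq_0_iff[OF cont] c unfolding e_def by auto
  ultimately have e: "e > 0" by simp
  show ?thesis
  proof (intro exI[of _ e] conjI e allI impI)
    fix t :: real assume t: "t \<ge> 0"
    have "e * t ^ (2 * k) = integral {0..2} (\<lambda>r::real. (r ^ (2*l) * (c * (r\<^sup>2) ^ k)^2) * t ^ (2 * k))"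
      unfolding e_def by simp
    also have "\<dots> \<le> integral {0..2} (\<lambda>r::real. Re (of_real ((2 + r) ^ (d - 1) * r ^ (2 * l)) *
        (bes (2 * l + d) (of_real (- t) * of_real (r^2)))^2))"
    proof (rule integral_le)
      fix r :: real assume r: "r \<in> {0..2}"
      obtain x where x: "bes (2 * l + d) (of_real (- (t * r^2))) = of_real x" "x \<ge> c * (t * r\<^sup>2) ^ k"
        using bes_negative_real_ge[of "2*l+d" "t * r^2" k] assms t unfolding c_def by auto
      have "(r ^ (2*l) * (c * (r\<^sup>2) ^ k)^2) * t ^ (2 * k) = 1 ^ (d - 1) * r ^ (2*l) * (c * (t * r\<^sup>2) ^ k)^2"
        by (simp add: power_mult_distrib power_mult[symmetric] mult.commute mult.left_commute)
      also have "\<dots> \<le> (2 + r) ^ (d - 1) * r ^ (2 * l) * x^2"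
        using r x(2) c t by (intro mult_mono power_mono) auto
      also have "\<dots> = Re (of_real ((2 + r) ^ (d - 1) * r ^ (2 * l)) * (of_real x)^2)"
        unfolding Re_of_real_mult by (simp add: power2_eq_square)
      also have "(of_real x :: complex) = bes (2 * l + d) (of_real (- t) * of_real (r^2))"
        using x(1) by simp
      finally show "(r ^ (2*l) * (c * (r\<^sup>2) ^ k)^2) * t ^ (2 * k) \<le> Re (of_real ((2 + r) ^ (d - 1) * r ^ (2 * l)) *
        (bes (2 * l + d) (of_real (- t) * of_real (r^2)))^2)" .
    qed (use assms in \<open>auto intro!: integrable_continuous_real continuous_intros\<close>)
    also have "\<dots> = Re (charfun d l (of_real (- t)))"
      unfolding charfun_def by (rule integral_linear[OF charfun_integrable[OF assms(1)] bounded_linear_Re, unfolded o_def])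
    also have "\<dots> \<le> norm (charfun d l (of_real (- t)))" by (rule complex_Re_le_cmod)
    finally show "e * t ^ (2 * k) \<le> norm (charfun d l (of_real (- t)))" .
  qed
qed

text \<open>With finitely many zeros, \<open>charfun\<close> would be a polynomial times
  \<open>exp g\<close>. Growth of order 1/2 forces \<open>g\<close> to be constant, so
  \<open>charfun\<close> would have degree \<open>N\<close>, contradicting growth of degree
  \<open>2 (N + 1)\<close> on the negative axis.\<close>

lemma charfun_infinite_zeros:
  assumes "d \<ge> 1" shows "infinite {\<kappa>. charfun d l \<kappa> = 0}"
proof
  assume "finite {\<kappa>. charfun d l \<kappa> = 0}"
  then obtain Z n g where Z: "finite Z" and g: "g holomorphic_on UNIV"
    and eq: "\<And>z. charfun d l z = (\<Prod>a\<in>Z. (z - a) ^ n a) * exp (g z)"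
    using entire_finite_zeros_factorization[OF charfun_holomorphic[OF assms]] by metis
  \<comment> \<open>Every zero lies at distance at least 1 from the points with
    \<open>|z| \<ge> \<rho>\<close>, so the polynomial factor has modulus at least 1 there and the
    growth bound passes to \<open>exp (Re g)\<close>. Inside the disc the maximum principle takes
    over.\<close>
  define \<rho> where "\<rho> = 1 + (\<Sum>a\<in>Z. norm a)"
  have rho: "\<rho> \<ge> 1" "norm a \<le> \<rho> - 1" if "a \<in> Z" for a
    using that Z member_le_sum[of a Z norm] by (auto simp: \<rho>_def sum_nonneg)
  have rho1: "\<rho> \<ge> 1" by (simp add: \<rho>_def sum_nonneg)
  have P1: "norm (\<Prod>a\<in>Z. (z - a) ^ n a) \<ge> 1" if "norm z \<ge> \<rho>" for z
  proof -
    have "1 \<le> norm (z - a)" if "a \<in> Z" for a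
      using norm_triangle_ineq2[of z a] rho(2)[OF that] \<open>norm z \<ge> \<rho>\<close> by linarith
    then show ?thesis unfolding prod_norm[symmetric] norm_power
      by (intro prod_ge_1 one_le_power) auto
  qed
  define C where "C = 2 * (4 ^ (d - 1) * 2 ^ (2 * l) :: real)"
  have C: "C > 0" by (simp add: C_def)
  have bd1: "Re (g z) \<le> ln C + 4 * sqrt (norm z)" if "norm z \<ge> \<rho>" for z
  proof -
    have "exp (Re (g z)) \<le> norm (\<Prod>a\<in>Z. (z - a) ^ n a) * exp (Re (g z))"
      using P1[OF that] by simp
    also have "\<dots> = norm (charfun d l z)" by (simp add: eq norm_mult)
    also have "\<dots> \<le> C * exp (4 * sqrt (norm z))" using charfun_norm_le[OF assms] by (simp add: C_def)
    also have "\<dots> = exp (ln C + 4 * sqrt (norm z))" using C by (simp add: exp_add)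
    finally show ?thesis by simp
  qed
  have bd2: "Re (g z) \<le> ln C + 4 * sqrt \<rho>" if "norm z < \<rho>" for z
  proof (rule maximum_real_frontier[of g "ball 0 \<rho>"])
    show "g holomorphic_on interior (ball 0 \<rho>)" using g holomorphic_on_subset by blast
    show "continuous_on (closure (ball 0 \<rho>)) g"
      using g holomorphic_on_imp_continuous_on continuous_on_subset by blast
    show "Re (g w) \<le> ln C + 4 * sqrt \<rho>" if "w \<in> frontier (ball 0 \<rho>)" for w
      using that bd1[of w] rho1 by (simp add: frontier_ball)
  qed (use that in auto)
  have const: "g z = g 0" for z
  proof (rule entire_real_part_sqrt_bound_imp_constant[OF g, of 4 "ln C + 4 * sqrt \<rho>"])
    show "Re (g z) \<le> ln C + 4 * sqrt \<rho> + 4 * sqrt (norm z)" for z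
    proof (cases "norm z < \<rho>")
      case True
      moreover have "0 \<le> 4 * sqrt (norm z)" by simp
      ultimately show ?thesis using bd2 by smt
    next
      case False
      moreover have "0 \<le> 4 * sqrt \<rho>" using rho1 by simp
      ultimately show ?thesis using bd1[of z] by linarith
    qed
  qed simp
  define N where "N = (\<Sum>a\<in>Z. n a)"
  define E where "E = norm (exp (g 0))"
  obtain e where e: "e > 0" "\<And>t. t \<ge> 0 \<Longrightarrow> e * t ^ (2 * (N + 1)) \<le> norm (charfun d l (of_real (- t)))"
    using charfun_negative_real_ge[OF assms] by blast
  have "e * t \<le> 2 ^ N * E" if t: "t \<ge> \<rho>" for t
  proof -
    have t1: "t \<ge> 1" using t rho1 by simp
    have "norm (\<Prod>a\<in>Z. (of_real (- t) - a) ^ n a) \<le> (\<Prod>a\<in>Z. (2 * t) ^ n a)"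
      unfolding prod_norm[symmetric] norm_power
    proof (intro prod_mono conjI power_mono)
      fix a assume "a \<in> Z"
      show "norm (of_real (- t) - a) \<le> 2 * t"
        using norm_triangle_ineq4[of "of_real (- t)" a] rho(2)[OF \<open>a \<in> Z\<close>] t t1 by simp
    qed auto
    also have "\<dots> = (2 * t) ^ N" by (simp add: N_def power_sum)
    finally have "norm (\<Prod>a\<in>Z. (of_real (- t) - a) ^ n a) \<le> (2 * t) ^ N" .
    then have "norm (charfun d l (of_real (- t))) \<le> (2 * t) ^ N * E"
      unfolding eq const[of "of_real (- t)"] norm_mult E_def by (rule mult_right_mono) simp
    then have "e * t ^ (2 * (N + 1)) \<le> (2 * t) ^ N * E"
      using e(2)[of t] t1 by linarith
    moreover have "e * t ^ (2 * (N + 1)) = (e * t ^ (N + 2)) * t ^ N"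
      by (simp add: mult_2 power_add)
    moreover have "(2 * t) ^ N * E = (2 ^ N * E) * t ^ N"
      by (simp add: power_mult_distrib)
    ultimately have "(e * t ^ (N + 2)) * t ^ N \<le> (2 ^ N * E) * t ^ N"
      by (simp only:)
    then have "e * t ^ (N + 2) \<le> 2 ^ N * E" using t1 by (simp add: mult_le_cancel_right)
    moreover have "t ^ 1 \<le> t ^ (N + 2)" using t1 by (intro power_increasing) auto
    then have "e * t \<le> e * t ^ (N + 2)" using e(1) by (intro mult_left_mono) auto
    ultimately show ?thesis by linarith
  qed
  \<comment> \<open>This \<open>t\<close> is at least \<rho> and makes \<open>e t\<close> exceed the
    claimed bound.\<close>
  from this[of "\<rho> + 2 ^ N * E / e + 1"] have "e * (\<rho> + 2 ^ N * E / e + 1) \<le> 2 ^ N * E"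
    using e(1) by (simp add: E_def)
  moreover have "e * (\<rho> + 2 ^ N * E / e + 1) = e * \<rho> + 2 ^ N * E + e" using e(1) by (simp add: field_simps)
  moreover have "e * \<rho> > 0" using e(1) rho1 by simp
  ultimately show False using e(1) by linarith
qed

section \<open>The radial equation in divergence form and its integral identities\<close>

lemma bes_radial_deriv:
  assumes "M \<ge> 1"
  shows "((\<lambda>r::real. bes M (\<kappa> * of_real (r^2))) has_vector_derivative
     - (\<kappa> * of_real r * bes (M + 2) (\<kappa> * of_real (r^2)) / of_nat M)) (at r within S)"
proof -
  have "((\<lambda>z. bes M (\<kappa> * z^2)) has_field_derivative
     - bes (M + 2) (\<kappa> * (of_real r)^2) / (2 * of_nat M) * (\<kappa> * (2 * of_real r))) (at (of_real r))"
    using assms by (auto intro!: derivative_eq_intros)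
  from has_vector_derivative_real_field[OF this]
  have "((\<lambda>r::real. bes M (\<kappa> * (of_real r)^2)) has_vector_derivative
     - bes (M + 2) (\<kappa> * (of_real r)^2) / (2 * of_nat M) * (\<kappa> * (2 * of_real r))) (at r)"
    by simp
  then show ?thesis
    by (rule_tac has_vector_derivative_at_within) (simp add: field_simps)
qed

text \<open>Divergence form of the radial equation: with \<open>g\<close> the radial Bessel
  solution, \<open>r^(M-1) g'\<close> is \<open>-\<kappa>/M\<close> times the function
  differentiated here, so its derivative is \<open>-\<kappa> r^(M-1) g\<close>.\<close>

lemma bes_radial_flux_deriv:
  assumes "M \<ge> 1"
  shows "((\<lambda>r::real. of_real (r ^ M) * bes (M + 2) (\<kappa> * of_real (r^2))) has_vector_derivative
     of_nat M * of_real (r ^ (M - 1)) * bes M (\<kappa> * of_real (r^2))) (at r within S)"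
proof -
  let ?z = "\<kappa> * of_real (r^2)"
  have c0: "of_nat M * (of_nat M + 2) \<noteq> (0::complex)"
  proof -
    have "of_nat M * (of_nat M + 2) = (of_nat (M * (M + 2)) :: complex)" by (simp add: algebra_simps)
    then show ?thesis using assms by (simp only: of_nat_eq_0_iff) simp
  qed
  have M2: "of_nat M + 2 \<noteq> (0::complex)" "of_nat M \<noteq> (0::complex)" using c0 by auto
  have "?z * bes (M + 4) ?z = (bes (M + 2) ?z - bes M ?z) * (of_nat M * (of_nat M + 2))"
    using bes_recurrence[OF assms, of ?z] c0 by (simp add: divide_simps) (simp add: algebra_simps)
  then have rec: "\<kappa> * of_real (r^2) * bes (M + 4) ?z / (of_nat M + 2) = of_nat M * (bes (M + 2) ?z - bes M ?z)"
    using M2 by (simp add: field_simps)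
  have "((\<lambda>r::real. of_real (r ^ M) * bes (M + 2) (\<kappa> * of_real (r^2))) has_vector_derivative
     of_real (r ^ M) * - (\<kappa> * of_real r * bes (M + 2 + 2) ?z / of_nat (M + 2))
     + of_real (real M * r ^ (M - 1)) * bes (M + 2) ?z) (at r within S)"
    by (intro has_vector_derivative_mult bes_radial_deriv has_vector_derivative_of_real)
       (auto intro!: derivative_eq_intros)
  moreover have "of_real (r ^ M) * - (\<kappa> * of_real r * bes (M + 2 + 2) ?z / of_nat (M + 2))
     = - (of_real (r ^ (M - 1)) * (\<kappa> * of_real (r^2) * bes (M + 4) ?z / (of_nat M + 2)))"
  proof -
    have "r ^ M * r = r ^ (M - 1) * r^2"
      using assms by (cases M) (auto simp: power2_eq_square)
    then have "(of_real (r ^ M) * of_real r :: complex) = of_real (r ^ (M - 1)) * of_real (r^2)"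
      by (simp only: of_real_mult[symmetric])
    then show ?thesis by (simp add: eval_nat_numeral add.commute mult.left_commute mult.assoc[symmetric])
  qed
  ultimately show ?thesis unfolding rec by (simp add: algebra_simps)
qed

text \<open>Self-adjointness of the radial problem. A zero at the nonreal \<kappa> is a Dirichlet
  condition at \<open>r = 1\<close>; pairing the flux with \<open>cnj g\<close> and integrating from
  0 to 1 then yields \<open>Im \<kappa>\<close> times a weighted integral of \<open>|g|^2\<close>
  equal to 0.\<close>

lemma bes_nonreal_nonzero:
  assumes M: "M \<ge> 1" and "\<kappa> \<notin> \<real>" shows "bes M \<kappa> \<noteq> 0"
proof
  assume 0: "bes M \<kappa> = 0"
  define g where "g r = bes M (\<kappa> * of_real (r^2))" for r :: real
  define p where "p r = bes (M + 2) (\<kappa> * of_real (r^2))" for r :: real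
  have im: "Im \<kappa> \<noteq> 0" using assms by (simp add: complex_is_Real_iff)
  have dg: "(g has_vector_derivative - (\<kappa> * of_real r * p r / of_nat M)) (at r within S)" for r S
    unfolding g_def p_def by (rule bes_radial_deriv[OF M])
  have dq: "((\<lambda>r. of_real (r ^ M) * p r) has_vector_derivative of_nat M * of_real (r ^ (M - 1)) * g r) (at r within S)" for r S
    unfolding g_def p_def by (rule bes_radial_flux_deriv[OF M])
  have "((\<lambda>r. \<kappa> * ((of_real (r ^ M) * p r) * cnj (g r))) has_vector_derivative
     \<kappa> * ((of_real (r ^ M) * p r) * cnj (- (\<kappa> * of_real r * p r / of_nat M)) +
         (of_nat M * of_real (r ^ (M - 1)) * g r) * cnj (g r))) (at r within S)" for r S
    by (intro has_vector_derivative_mult_right has_vector_derivative_mult dq has_vector_derivative_cnj dg)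
  from bounded_linear.has_vector_derivative[OF bounded_linear_Im this]
  have d: "((\<lambda>r. Im (\<kappa> * ((of_real (r ^ M) * p r) * cnj (g r)))) has_vector_derivative
     Im (\<kappa> * ((of_real (r ^ M) * p r) * cnj (- (\<kappa> * of_real r * p r / of_nat M)) +
         (of_nat M * of_real (r ^ (M - 1)) * g r) * cnj (g r)))) (at r within S)" for r S .
  \<comment> \<open>The prefactor \<kappa> turns the gradient term into a multiple of
    \<open>\<kappa> cnj \<kappa>\<close>, which is real and drops out of the imaginary part.\<close>
  have eq: "Im (\<kappa> * ((of_real (r ^ M) * p r) * cnj (- (\<kappa> * of_real r * p r / of_nat M)) +
         (of_nat M * of_real (r ^ (M - 1)) * g r) * cnj (g r)))
     = Im \<kappa> * (real M * r ^ (M - 1) * (norm (g r))^2)" for r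
  proof -
    have "\<kappa> * ((of_real (r ^ M) * p r) * cnj (- (\<kappa> * of_real r * p r / of_nat M)) +
         (of_nat M * of_real (r ^ (M - 1)) * g r) * cnj (g r))
      = of_real (- (r ^ M * r / real M)) * ((\<kappa> * cnj \<kappa>) * (p r * cnj (p r)))
        + of_real (real M * r ^ (M - 1)) * (\<kappa> * (g r * cnj (g r)))"
      by (simp add: algebra_simps)
    also have "\<dots> = of_real (- (r ^ M * r / real M) * ((norm \<kappa>)^2 * (norm (p r))^2))
        + of_real (real M * r ^ (M - 1) * (norm (g r))^2) * \<kappa>"
      unfolding complex_norm_square[symmetric] by simp
    finally show ?thesis by (simp del: of_real_mult of_real_minus of_real_divide of_real_power)
  qed
  have "((\<lambda>r. Im \<kappa> * (real M * r ^ (M - 1) * (norm (g r))^2)) has_integral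
      Im (\<kappa> * ((of_real (1 ^ M) * p 1) * cnj (g 1))) - Im (\<kappa> * ((of_real (0 ^ M) * p 0) * cnj (g 0)))) {0..1}"
    by (rule fundamental_theorem_of_calculus) (use d eq in auto)
  then have "((\<lambda>r. Im \<kappa> * (real M * r ^ (M - 1) * (norm (g r))^2)) has_integral 0) {0..1}"
    using 0 M by (simp add: g_def zero_power)
  then have "((\<lambda>r. (1 / Im \<kappa>) * (Im \<kappa> * (real M * r ^ (M - 1) * (norm (g r))^2))) has_integral (1 / Im \<kappa>) * 0) {0..1}"
    by (rule has_integral_mult_right)
  then have hi: "((\<lambda>r. real M * r ^ (M - 1) * (norm (g r))^2) has_integral 0) {0..1}"
    using im by simp
  have cg: "continuous_on S g" for S
    unfolding g_def by (intro continuous_intros M)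
  have "continuous_on {0..1} (\<lambda>r. real M * r ^ (M - 1) * (norm (g r))^2)"
    by (intro continuous_intros cg)
  from integral_eq_0_iff[OF this] hi have z: "real M * r ^ (M - 1) * (norm (g r))^2 = 0" if "r \<in> {0..1}" for r
    using that by (auto simp: integral_unique)
  have "g 0 = 0"
  proof (rule continuous_constant_on_closure[OF cg])
    show "g r = 0" if "r \<in> {0<..1}" for r using z[of r] that M by auto
  qed simp
  then show False by (simp add: g_def)
qed

text \<open>Real form of the system \<open>r f' = l f + h\<close>,
  \<open>r h' = -(l+d-2) h - r^2 k^2 f\<close> with \<open>k^2 = \<alpha> + i \<beta>\<close>. The
  coefficient \<open>2l+d-1\<close> in the second quantity is the one for which all terms with
  \<open>l\<close> cancel in the derivative; the later estimates owe their uniformity in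
  \<open>l\<close> to this.\<close>

lemma lagrange_system_derivs:
  fixes f1 f2 h1 h2 :: "real \<Rightarrow> real" and r l \<alpha> \<beta> :: real
  assumes r: "r > 0" and d: "d = 2 \<or> d = (3::nat)"
    and f1: "(f1 has_real_derivative (l * f1 r + h1 r) / r) (at r)"
    and f2: "(f2 has_real_derivative (l * f2 r + h2 r) / r) (at r)"
    and h1: "(h1 has_real_derivative (- (l + real d - 2) * h1 r - r^2 * (\<alpha> * f1 r - \<beta> * f2 r)) / r) (at r)"
    and h2: "(h2 has_real_derivative (- (l + real d - 2) * h2 r - r^2 * (\<alpha> * f2 r + \<beta> * f1 r)) / r) (at r)"
  shows "((\<lambda>r. r * (f1 r * h1 r + f2 r * h2 r)) has_real_derivative
      (h1 r)^2 + (h2 r)^2 - \<alpha> * r^2 * ((f1 r)^2 + (f2 r)^2) + (3 - real d) * (f1 r * h1 r + f2 r * h2 r)) (at r)"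
    and "((\<lambda>r. r ^ (d - 2) * ((h1 r)^2 + (h2 r)^2 + \<alpha> * r^2 * ((f1 r)^2 + (f2 r)^2)
          + (2 * l + real d - 1) * (f1 r * h1 r + f2 r * h2 r))) has_real_derivative
      r ^ (d - 1) * (((h1 r)^2 + (h2 r)^2) / r^2 + \<alpha> * ((f1 r)^2 + (f2 r)^2)
          + 2 * \<beta> * (f2 r * h1 r - f1 r * h2 r))) (at r)"
proof -
  note DER = derivative_eq_intros f1 f2 h1 h2
  show "((\<lambda>r. r * (f1 r * h1 r + f2 r * h2 r)) has_real_derivative
      (h1 r)^2 + (h2 r)^2 - \<alpha> * r^2 * ((f1 r)^2 + (f2 r)^2) + (3 - real d) * (f1 r * h1 r + f2 r * h2 r)) (at r)"
    by (rule DER refl)+ (use r in \<open>simp add: field_simps power2_eq_square\<close>)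
  show "((\<lambda>r. r ^ (d - 2) * ((h1 r)^2 + (h2 r)^2 + \<alpha> * r^2 * ((f1 r)^2 + (f2 r)^2)
          + (2 * l + real d - 1) * (f1 r * h1 r + f2 r * h2 r))) has_real_derivative
      r ^ (d - 1) * (((h1 r)^2 + (h2 r)^2) / r^2 + \<alpha> * ((f1 r)^2 + (f2 r)^2)
          + 2 * \<beta> * (f2 r * h1 r - f1 r * h2 r))) (at r)"
    using d
  proof
    assume d: "d = 2"
    show ?thesis unfolding d
      apply (rule DER refl)+
      using r unfolding d by (simp add: field_simps power2_eq_square)
  next
    assume d: "d = 3"
    show ?thesis unfolding d
      apply (rule DER refl)+
      using r unfolding d by (simp add: field_simps power2_eq_square power3_eq_cube)
  qed
qed

text \<open>Cauchy-Schwarz against the constant 1, obtained from the nonnegative integral of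
  \<open>(norm f - m)^2\<close> where \<open>m\<close> is the mean of \<open>norm f\<close>.\<close>

lemma integral_norm_squared_le:
  fixes f :: "real \<Rightarrow> complex"
  assumes c: "continuous_on {0..r} f" and r: "r > 0"
  shows "(integral {0..r} (\<lambda>x. norm (f x)))^2 \<le> r * integral {0..r} (\<lambda>x. (norm (f x))^2)"
proof -
  define I where "I = integral {0..r} (\<lambda>x. norm (f x))"
  define m where "m = I / r"
  have cn: "continuous_on {0..r} (\<lambda>x. norm (f x))" by (intro continuous_intros c)
  have hI: "((\<lambda>x. norm (f x)) has_integral I) {0..r}"
    unfolding I_def by (intro integrable_integral integrable_continuous_real cn)
  have hP: "((\<lambda>x. (norm (f x))^2) has_integral integral {0..r} (\<lambda>x. (norm (f x))^2)) {0..r}"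
    by (intro integrable_integral integrable_continuous_real continuous_intros c)
  have "((\<lambda>x. (norm (f x))^2 - 2 * m * norm (f x) + m^2) has_integral
      integral {0..r} (\<lambda>x. (norm (f x))^2) - 2 * m * I + m^2 * r) {0..r}"
    using has_integral_add[OF has_integral_diff[OF hP has_integral_mult_right[OF hI, of "2 * m"]]
        has_integral_const_real[of "m^2" 0 r]] r by (simp add: mult.commute)
  then have "0 \<le> integral {0..r} (\<lambda>x. (norm (f x))^2) - 2 * m * I + m^2 * r"
  proof (rule has_integral_nonneg)
    fix x have "0 \<le> (norm (f x) - m)^2" by simp
    then show "0 \<le> (norm (f x))^2 - 2 * m * norm (f x) + m^2"
      by (simp add: power2_eq_square algebra_simps)
  qed
  moreover have "2 * m * I = 2 * I^2 / r" "m^2 * r = I^2 / r"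
    using r by (auto simp: m_def power2_eq_square field_simps)
  ultimately have "I^2 / r \<le> integral {0..r} (\<lambda>x. (norm (f x))^2)" by simp
  then show ?thesis using r by (simp add: I_def field_simps)
qed

section \<open>Functionals proportional to a Bessel moment\<close>

lemma square_image_subset: "(\<lambda>r::real. r^2) ` {0..2} \<subseteq> {0..4}"
proof (rule image_subsetI)
  fix r :: real assume "r \<in> {0..2}"
  then have "r^2 \<le> 2^2" by (intro power_mono) auto
  then show "r^2 \<in> {0..4}" by simp
qed

text \<open>The operator \<open>4 s q'' + 2 M q' + \<kappa> q\<close> in the variable
  \<open>s = |x|^2\<close>. For \<open>Y\<close> harmonic of degree \<open>l\<close> and
  \<open>M = 2l+d\<close>, the Helmholtz operator sends \<open>Y q(|x|^2)\<close> to
  \<open>Y\<close> times this polynomial, see \<open>laplacian_harmonic_mult_poly\<close>.\<close>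

definition helm_op :: "nat \<Rightarrow> complex \<Rightarrow> complex poly \<Rightarrow> complex poly" where
  "helm_op M \<kappa> q = [:0, 4:] * pderiv (pderiv q) + smult (2 * of_nat M) (pderiv q) + smult \<kappa> q"

lemma helm_op_add: "helm_op M \<kappa> (p + q) = helm_op M \<kappa> p + helm_op M \<kappa> q"
  by (simp add: helm_op_def pderiv_add algebra_simps smult_add_right)

lemma helm_op_smult: "helm_op M \<kappa> (smult c q) = smult c (helm_op M \<kappa> q)"
  by (simp add: helm_op_def pderiv_smult smult_add_right mult.commute)

text \<open>The operator is \<kappa> times the identity plus a part that lowers the degree, so
  \<open>p / \<kappa>\<close> is a preimage up to an error of smaller degree.\<close>

lemma helm_op_surj:
  assumes "\<kappa> \<noteq> 0" shows "\<exists>q. helm_op M \<kappa> q = p"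
proof (induction "degree p" arbitrary: p rule: less_induct)
  case less
  define R where "R = [:0, 4:] * pderiv (pderiv p) + smult (2 * of_nat M) (pderiv p)"
  have eq: "helm_op M \<kappa> (smult (1 / \<kappa>) p) = p + smult (1 / \<kappa>) R"
    unfolding helm_op_smult using assms by (simp add: helm_op_def R_def smult_add_right)
  show ?case
  proof (cases "degree p = 0")
    case True
    then have "pderiv p = 0" by (simp add: pderiv_eq_0_iff)
    then have "R = 0" by (simp add: R_def)
    then show ?thesis using eq by auto
  next
    case False
    have "degree ([:0, 4:] * pderiv (pderiv p)) < degree p"
    proof (cases "pderiv (pderiv p) = 0")
      case True then show ?thesis using False by simp
    next
      case nz: False
      have "degree p \<ge> 2"
      proof (rule ccontr)
        assume "\<not> 2 \<le> degree p"
        then have "degree (pderiv p) = 0" by (simp add: degree_pderiv)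
        then show False using nz by (simp add: pderiv_eq_0_iff)
      qed
      have "degree ([:0, 4:] * pderiv (pderiv p)) \<le> 1 + degree (pderiv (pderiv p))"
        using degree_mult_le[of "[:0, 4:]" "pderiv (pderiv p)"] by simp
      also have "\<dots> < degree p" using \<open>degree p \<ge> 2\<close> by (simp add: degree_pderiv)
      finally show ?thesis .
    qed
    moreover have "degree (smult (2 * of_nat M) (pderiv p)) < degree p"
      using False degree_smult_le[of "2 * of_nat M" "pderiv p"] by (simp add: degree_pderiv)
    ultimately have "degree R < degree p" unfolding R_def by (rule degree_add_less)
    then have "degree (smult (1 / \<kappa>) R) < degree p" using degree_smult_le le_less_trans by blast
    from less[OF this] obtain z where z: "helm_op M \<kappa> z = smult (1 / \<kappa>) R" by blast
    have "helm_op M \<kappa> (smult (1 / \<kappa>) p + smult (- 1) z) = p"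
      unfolding helm_op_add eq helm_op_smult[of _ _ "-1"] z by simp
    then show ?thesis by blast
  qed
qed

definition bes_poly :: "nat \<Rightarrow> complex \<Rightarrow> nat \<Rightarrow> complex poly" where
  "bes_poly M \<kappa> n = (\<Sum>j\<le>n. monom (of_real (bes_coeff M j) * \<kappa> ^ j) j)"

lemma helm_op_monom:
  "helm_op M \<kappa> (monom c (Suc n)) = monom (c * of_real ((real n + 1) * (4 * real n + 2 * real M))) n + monom (\<kappa> * c) (Suc n)"
proof -
  have 1: "pderiv (monom c (Suc n)) = monom (of_nat (Suc n) * c) n" by (simp add: pderiv_monom)
  have 2: "[:0, 4:] * pderiv (monom (of_nat (Suc n) * c) n) = monom (4 * of_nat n * of_nat (Suc n) * c) n"
  proof (cases n)
    case 0 then show ?thesis by (simp add: pderiv_monom)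
  next
    case (Suc m)
    have "[:0, 4:] = monom (4::complex) 1" by (simp add: monom_Suc monom_0)
    then show ?thesis using Suc by (simp add: pderiv_monom mult_monom algebra_simps)
  qed
  show ?thesis unfolding helm_op_def 1 2
    by (simp add: smult_monom add_monom algebra_simps)
qed

text \<open>The coefficient recursion makes the image telescope: only the top term survives, and it
  tends to 0 uniformly on bounded sets. The truncated series are thus polynomial test functions that
  are almost solutions.\<close>

lemma helm_op_bes_poly:
  assumes "M \<ge> 1"
  shows "helm_op M \<kappa> (bes_poly M \<kappa> n) = monom (\<kappa> * (of_real (bes_coeff M n) * \<kappa> ^ n)) n"
proof (induction n)
  case 0
  then show ?case by (simp add: bes_poly_def helm_op_def pderiv_monom smult_monom monom_0)
next
  case (Suc n)
  have nz: "(real n + 1) * (4 * real n + 2 * real M) \<noteq> 0" using assms by auto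
  have "of_real (bes_coeff M (Suc n)) * \<kappa> ^ Suc n * of_real ((real n + 1) * (4 * real n + 2 * real M))
      = of_real (bes_coeff M (Suc n) * ((real n + 1) * (4 * real n + 2 * real M))) * \<kappa> ^ Suc n" by (simp del: bes_coeff.simps)
  also have "bes_coeff M (Suc n) * ((real n + 1) * (4 * real n + 2 * real M)) = - bes_coeff M n"
  proof -
    have "x / y * y = x" if "y \<noteq> 0" for x y :: real using that by simp
    from this[OF nz] show ?thesis unfolding bes_coeff.simps .
  qed
  finally have e: "of_real (bes_coeff M (Suc n)) * \<kappa> ^ Suc n * of_real ((real n + 1) * (4 * real n + 2 * real M))
     = - (\<kappa> * (of_real (bes_coeff M n) * \<kappa> ^ n))" by simp
  have B: "bes_poly M \<kappa> (Suc n) = bes_poly M \<kappa> n + monom (of_real (bes_coeff M (Suc n)) * \<kappa> ^ Suc n) (Suc n)"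
    by (simp add: bes_poly_def del: bes_coeff.simps)
  show ?case unfolding B helm_op_add Suc helm_op_monom e
    by (simp only: add.assoc[symmetric] add_monom) simp
qed

lemma poly_bes_poly: "poly (bes_poly M \<kappa> n) z = (\<Sum>j\<le>n. of_real (bes_coeff M j) * (\<kappa> * z) ^ j)"
  by (simp add: bes_poly_def poly_sum poly_monom power_mult_distrib mult_ac)

lemma bes_poly_LIMSEQ: "M \<ge> 1 \<Longrightarrow> (\<lambda>n. poly (bes_poly M \<kappa> n) z) \<longlonglongrightarrow> bes M (\<kappa> * z)"
  using summable_LIMSEQ'[OF bes_summable[of M "\<kappa> * z"]] by (simp add: poly_bes_poly bes_def)

text \<open>The bound does not depend on the truncation \<open>n\<close>, as dominated convergence
  along the truncated series requires.\<close>

lemma bes_poly_norm_le: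
  assumes "M \<ge> 1" shows "\<exists>B\<ge>0. \<forall>n z. norm z \<le> R \<longrightarrow> norm (poly (bes_poly M \<kappa> n) z) \<le> B"
proof -
  let ?f = "\<lambda>j. norm (of_real (bes_coeff M j) * (of_real (norm \<kappa> * R) :: complex) ^ j)"
  have s: "summable ?f" by (rule bes_norm_summable[OF assms])
  have "norm (poly (bes_poly M \<kappa> n) z) \<le> (\<Sum>j. ?f j)" if z: "norm z \<le> R" for n z
  proof -
    have R: "R \<ge> 0" using order_trans[OF norm_ge_zero z] .
    have "norm (poly (bes_poly M \<kappa> n) z) \<le> (\<Sum>j\<le>n. ?f j)"
      unfolding poly_bes_poly
    proof (rule sum_norm_le)
      fix j
      have "norm (\<kappa> * z) \<le> norm \<kappa> * R" unfolding norm_mult using z by (intro mult_left_mono) auto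
      then have "norm (\<kappa> * z) ^ j \<le> (norm \<kappa> * R) ^ j" by (intro power_mono) auto
      then show "norm (of_real (bes_coeff M j) * (\<kappa> * z) ^ j) \<le> ?f j"
        unfolding norm_mult[of "of_real (bes_coeff M j)"] norm_power using R
        by (intro mult_left_mono) (auto simp: abs_mult norm_mult)
    qed
    also have "\<dots> \<le> (\<Sum>j. ?f j)" by (rule sum_le_suminf[OF s]) auto
    finally show ?thesis .
  qed
  moreover have "(\<Sum>j. ?f j) \<ge> 0" by (rule suminf_nonneg[OF s]) auto
  ultimately show ?thesis by blast
qed

lemma pderiv_setsum: "pderiv (\<Sum>i\<in>I. p i) = (\<Sum>i\<in>I. pderiv (p i))"
  by (induction I rule: infinite_finite_induct) (auto simp: pderiv_add)

lemma smult_setsum: "smult c (\<Sum>i\<in>I. p i) = (\<Sum>i\<in>I. smult c (p i))"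
  by (induction I rule: infinite_finite_induct) (auto simp: smult_add_right)

lemma pderiv_bes_poly:
  assumes "M \<ge> 1"
  shows "pderiv (bes_poly M \<kappa> (Suc n)) = smult (- \<kappa> / (2 * of_nat M)) (bes_poly (M + 2) \<kappa> n)"
proof -
  have t: "of_nat (Suc j) * (of_real (bes_coeff M (Suc j)) * \<kappa> ^ Suc j) = - \<kappa> / (2 * of_nat M) * (of_real (bes_coeff (M + 2) j) * \<kappa> ^ j)" for j
  proof -
    have "of_nat (Suc j) * (of_real (bes_coeff M (Suc j)) * \<kappa> ^ Suc j) = of_real ((real j + 1) * bes_coeff M (Suc j)) * (\<kappa> * \<kappa> ^ j)"
      by (simp del: bes_coeff.simps add: algebra_simps)
    also have "\<dots> = - \<kappa> / (2 * of_nat M) * (of_real (bes_coeff (M + 2) j) * \<kappa> ^ j)"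
      unfolding bes_coeff_shift[OF assms] by simp
    finally show ?thesis .
  qed
  have p: "pderiv (monom (of_real (bes_coeff M (Suc j)) * \<kappa> ^ Suc j) (Suc j)) = smult (- \<kappa> / (2 * of_nat M)) (monom (of_real (bes_coeff (M + 2) j) * \<kappa> ^ j) j)" for j
    unfolding pderiv_monom t smult_monom by simp
  have "bes_poly M \<kappa> (Suc n) = monom (of_real (bes_coeff M 0) * \<kappa> ^ 0) 0 + (\<Sum>j\<le>n. monom (of_real (bes_coeff M (Suc j)) * \<kappa> ^ Suc j) (Suc j))"
    unfolding bes_poly_def by (rule sum.atMost_Suc_shift)
  then have "pderiv (bes_poly M \<kappa> (Suc n)) = (\<Sum>j\<le>n. pderiv (monom (of_real (bes_coeff M (Suc j)) * \<kappa> ^ Suc j) (Suc j)))"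
    by (simp add: pderiv_add pderiv_setsum pderiv_monom del: bes_coeff.simps)
  then show ?thesis unfolding p by (simp add: bes_poly_def smult_setsum)
qed

definition bes_moment :: "nat \<Rightarrow> complex \<Rightarrow> (real \<Rightarrow> complex) \<Rightarrow> complex" where
  "bes_moment M \<kappa> g = integral {0..2} (\<lambda>r. of_real (r ^ (M - 1)) * g (r^2) * bes M (\<kappa> * of_real (r^2)))"

lemma poly_of_real_sq_deriv:
  fixes q :: "complex poly"
  shows "((\<lambda>r. poly q (of_real (r^2))) has_vector_derivative poly (pderiv q) (of_real (r^2)) * of_real (2 * r)) (at r within S)"
proof -
  have sq: "((\<lambda>z::complex. z^2) has_field_derivative 2 * of_real r) (at (of_real r))"
    by (rule derivative_eq_intros refl)+ simp
  have "((\<lambda>z. poly q (z^2)) has_field_derivative poly (pderiv q) ((of_real r)^2) * (2 * of_real r)) (at (of_real r :: complex))"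
    by (rule DERIV_chain2[OF poly_DERIV sq])
  from has_vector_derivative_real_field[OF this, of S]
  show ?thesis unfolding of_real_power of_real_mult of_real_numeral .
qed

text \<open>Lagrange's identity: the operator is moved onto the Bessel solution, which it
  annihilates, and only the boundary terms at \<open>r = 2\<close>, that is \<open>s = 4\<close>,
  remain. Those at 0 carry the factor \<open>r^M\<close>.\<close>

lemma bes_moment_helm_op:
  assumes M: "M \<ge> 1"
  shows "bes_moment M \<kappa> (\<lambda>s. poly (helm_op M \<kappa> q) (of_real s)) =
    2 ^ (M + 1) * bes M (\<kappa> * 4) * poly (pderiv q) 4 + \<kappa> / of_nat M * 2 ^ M * bes (M + 2) (\<kappa> * 4) * poly q 4"
proof -
  define \<Phi> where "\<Phi> r = bes M (\<kappa> * of_real (r^2))" for r :: real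
  define P where "P r = bes (M + 2) (\<kappa> * of_real (r^2))" for r :: real
  define Q where "Q p r = poly p (of_real (r^2) :: complex)" for p and r :: real
  have d\<Phi>: "(\<Phi> has_vector_derivative - (\<kappa> * of_real r * P r / of_nat M)) (at r within S)" for r S
    unfolding \<Phi>_def P_def by (rule bes_radial_deriv[OF M])
  have dP: "((\<lambda>r. of_real (r ^ M) * P r) has_vector_derivative of_nat M * of_real (r ^ (M - 1)) * \<Phi> r) (at r within S)" for r S
    unfolding \<Phi>_def P_def by (rule bes_radial_flux_deriv[OF M])
  have dQ: "(Q p has_vector_derivative Q (pderiv p) r * of_real (2 * r)) (at r within S)" for p r S
    unfolding Q_def by (rule poly_of_real_sq_deriv)
  have dr: "((\<lambda>r. complex_of_real (r ^ M)) has_vector_derivative of_real (real M * r ^ (M - 1))) (at r within S)" for r S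
    by (rule has_vector_derivative_of_real) (auto intro!: derivative_eq_intros)
  define W where "W r = 2 * (of_real (r ^ M) * (Q (pderiv q) r * \<Phi> r)) + (\<kappa> / of_nat M) * (Q q r * (of_real (r ^ M) * P r))" for r :: real
  have Wd: "(W has_vector_derivative of_real (r ^ (M - 1)) * Q (helm_op M \<kappa> q) r * \<Phi> r) (at r within S)" for r S
  proof -
    have "(W has_vector_derivative
        2 * (of_real (r ^ M) * (Q (pderiv q) r * - (\<kappa> * of_real r * P r / of_nat M) + Q (pderiv (pderiv q)) r * of_real (2 * r) * \<Phi> r)
          + of_real (real M * r ^ (M - 1)) * (Q (pderiv q) r * \<Phi> r))
      + (\<kappa> / of_nat M) * (Q q r * (of_nat M * of_real (r ^ (M - 1)) * \<Phi> r) + Q (pderiv q) r * of_real (2 * r) * (of_real (r ^ M) * P r))) (at r within S)"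
      unfolding W_def
      by (intro has_vector_derivative_add has_vector_derivative_mult_right has_vector_derivative_mult d\<Phi> dP dQ dr)
    moreover have "2 * (of_real (r ^ M) * (Q (pderiv q) r * - (\<kappa> * of_real r * P r / of_nat M) + Q (pderiv (pderiv q)) r * of_real (2 * r) * \<Phi> r)
          + of_real (real M * r ^ (M - 1)) * (Q (pderiv q) r * \<Phi> r))
      + (\<kappa> / of_nat M) * (Q q r * (of_nat M * of_real (r ^ (M - 1)) * \<Phi> r) + Q (pderiv q) r * of_real (2 * r) * (of_real (r ^ M) * P r))
      = of_real (r ^ (M - 1)) * Q (helm_op M \<kappa> q) r * \<Phi> r"
    proof -
      have rM: "complex_of_real (r ^ M) = of_real (r ^ (M - 1)) * of_real r"
        using M by (cases M) auto
      have h: "Q (helm_op M \<kappa> q) r = 4 * (of_real r * of_real r) * Q (pderiv (pderiv q)) r + 2 * of_nat M * Q (pderiv q) r + \<kappa> * Q q r"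
        by (simp add: Q_def helm_op_def power2_eq_square algebra_simps)
      have M0: "of_nat M \<noteq> (0::complex)" using M by simp
      have alg: "2 * (a * z * (q1 * - (c * m * z * p / m) + q2 * (2 * z) * f) + m * a * (q1 * f))
          + (c * m / m) * (q0 * (m * a * f) + q1 * (2 * z) * (a * z * p)) = a * (4 * (z * z) * q2 + 2 * m * q1 + c * m * q0) * f"
        if "m \<noteq> 0" for a z q0 q1 q2 c m p f :: complex
      proof -
        have e2: "c * m / m = c" for c by (rule nonzero_mult_div_cancel_right[OF that])
        have "c * m * z * p / m = (c * z * p) * m / m" by (simp only: mult_ac)
        then have e1: "c * m * z * p / m = c * z * p" unfolding e2 .
        show ?thesis unfolding e1 e2 by (simp add: algebra_simps)
      qed
      have k: "\<kappa> / of_nat M * of_nat M = \<kappa>" using M0 by simp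
      show ?thesis unfolding h rM of_real_mult of_real_numeral of_real_of_nat_eq
        by (rule alg[OF M0, of "of_real (r ^ (M - 1))" "of_real r" "Q (pderiv q) r" "\<kappa> / of_nat M" "P r" "Q (pderiv (pderiv q)) r" "\<Phi> r" "Q q r", unfolded k])
    qed
    ultimately show ?thesis by simp
  qed
  have I: "((\<lambda>r. of_real (r ^ (M - 1)) * Q (helm_op M \<kappa> q) r * \<Phi> r) has_integral W 2 - W 0) {0..2}"
    by (rule fundamental_theorem_of_calculus[OF _ Wd]) simp
  have W0: "W 0 = 0" unfolding W_def using M by (simp add: zero_power del: of_real_power)
  have W2: "W 2 = 2 ^ (M + 1) * bes M (\<kappa> * 4) * poly (pderiv q) 4 + \<kappa> / of_nat M * 2 ^ M * bes (M + 2) (\<kappa> * 4) * poly q 4"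
  proof -
    have f: "complex_of_real (2^2) = 4" "complex_of_real (2 ^ M) = 2 ^ M" by simp_all
    show ?thesis unfolding W_def Q_def \<Phi>_def P_def f by (simp only: power_add power_one_right mult_ac)
  qed
  have "bes_moment M \<kappa> (\<lambda>s. poly (helm_op M \<kappa> q) (of_real s)) = W 2 - W 0"
    unfolding bes_moment_def using integral_unique[OF I] unfolding Q_def \<Phi>_def .
  then show ?thesis unfolding W0 W2 diff_0_right .
qed

lemma bes_moment_linear:
  assumes "M \<ge> 1" "continuous_on {0..4} f" "continuous_on {0..4} g"
  shows "bes_moment M \<kappa> (\<lambda>s. f s + g s) = bes_moment M \<kappa> f + bes_moment M \<kappa> g"
    "bes_moment M \<kappa> (\<lambda>s. c * f s) = c * bes_moment M \<kappa> f"
proof -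
  have c: "continuous_on {0..2} (\<lambda>r::real. h (r^2))" if "continuous_on {0..4} h" for h :: "real \<Rightarrow> complex"
  proof (rule continuous_on_compose2[OF that])
    show "(\<lambda>r::real. r^2) ` {0..2} \<subseteq> {0..4}" by (rule square_image_subset)
  qed (intro continuous_intros)
  have i: "(\<lambda>r. of_real (r ^ (M - 1)) * h (r^2) * bes M (\<kappa> * of_real (r^2))) integrable_on {0..2}" if "continuous_on {0..4} h" for h
    by (intro integrable_continuous_real continuous_intros c that assms)
  show "bes_moment M \<kappa> (\<lambda>s. f s + g s) = bes_moment M \<kappa> f + bes_moment M \<kappa> g"
    unfolding bes_moment_def
    by (subst Henstock_Kurzweil_Integration.integral_add[OF i[OF assms(2)] i[OF assms(3)], symmetric]) (simp add: algebra_simps)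
  have "(\<lambda>r. of_real (r ^ (M - 1)) * (c * f (r^2)) * bes M (\<kappa> * of_real (r^2))) = (\<lambda>r. c * (of_real (r ^ (M - 1)) * f (r^2) * bes M (\<kappa> * of_real (r^2))))"
    by (auto simp: mult_ac)
  then show "bes_moment M \<kappa> (\<lambda>s. c * f s) = c * bes_moment M \<kappa> f"
    unfolding bes_moment_def by (simp only: integral_mult_right)
qed

lemma bes_moment_bound:
  assumes "M \<ge> 1"
  shows "\<exists>K\<ge>0. \<forall>g e. continuous_on {0..4} g \<longrightarrow> (\<forall>s\<in>{0..4}. norm (g s) \<le> e) \<longrightarrow> norm (bes_moment M \<kappa> g) \<le> K * e"
proof -
  have "bounded ((\<lambda>r. of_real (r ^ (M - 1)) * bes M (\<kappa> * of_real (r^2))) ` {0..2::real})"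
    by (intro compact_imp_bounded compact_continuous_image continuous_intros compact_Icc assms)
  then obtain B where B: "\<forall>y\<in>(\<lambda>r. of_real (r ^ (M - 1)) * bes M (\<kappa> * of_real (r^2))) ` {0..2::real}. norm y \<le> B"
    unfolding bounded_iff ..
  have B0: "B \<ge> 0" using B order_trans[OF norm_ge_zero] by fastforce
  have "norm (bes_moment M \<kappa> g) \<le> (2 * B) * e" if g: "continuous_on {0..4} g" "\<forall>s\<in>{0..4}. norm (g s) \<le> e" for g e
  proof -
    note sq = square_image_subset
    have "norm (bes_moment M \<kappa> g) \<le> (B * e) * (2 - 0)"
      unfolding bes_moment_def
    proof (rule integral_bound)
      show "continuous_on {0..2} (\<lambda>r. of_real (r ^ (M - 1)) * g (r^2) * bes M (\<kappa> * of_real (r^2)))"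
        by (intro continuous_intros continuous_on_compose2[OF g(1) _ sq] assms)
      fix r :: real assume r: "r \<in> {0..2}"
      have "of_real (r ^ (M - 1)) * g (r^2) * bes M (\<kappa> * of_real (r^2)) = (of_real (r ^ (M - 1)) * bes M (\<kappa> * of_real (r^2))) * g (r^2)"
        by simp
      also have "norm \<dots> \<le> B * e"
      proof -
        have "r^2 \<in> {0..4}" using r sq by blast
        then have "norm (g (r^2)) \<le> e" using g(2) by blast
        moreover have "norm (of_real (r ^ (M - 1)) * bes M (\<kappa> * of_real (r^2))) \<le> B" using B r by blast
        ultimately show ?thesis unfolding norm_mult[of "_ * bes M _"] using B0 by (intro mult_mono) auto
      qed
      finally show "norm (of_real (r ^ (M - 1)) * g (r^2) * bes M (\<kappa> * of_real (r^2))) \<le> B * e" .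
    qed simp
    then show ?thesis by (simp add: mult_ac)
  qed
  then show ?thesis using B0 by (intro exI[of _ "2 * B"]) auto
qed

text \<open>Composed with \<open>helm_op\<close>, both functionals depend on \<open>q\<close> only
  through \<open>q(4)\<close> and \<open>q'(4)\<close>: the moment by Lagrange's identity, \<Lambda>
  because it kills multiples of \<open>(s-4)^2\<close>. On the truncated Bessel series the composite
  with \<Lambda> tends to 0, which makes the two coefficient pairs parallel; surjectivity of
  \<open>helm_op\<close> then carries the relation to all polynomials.\<close>

lemma functional_proportional_to_moment:
  fixes \<Lambda> :: "complex poly \<Rightarrow> complex"
  assumes M: "M \<ge> 1" and \<kappa>: "\<kappa> \<noteq> 0"
    and add: "\<And>p q. \<Lambda> (p + q) = \<Lambda> p + \<Lambda> q" and sm: "\<And>c p. \<Lambda> (smult c p) = c * \<Lambda> p"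
    and bd: "\<And>p e. (\<And>s. s \<in> {0..4} \<Longrightarrow> norm (poly p (of_real s)) \<le> e) \<Longrightarrow> norm (\<Lambda> p) \<le> K * e"
    and zero: "\<And>p. \<Lambda> (helm_op M \<kappa> ([:-4, 1:]^2 * p)) = 0"
  shows "\<exists>s t. (s \<noteq> 0 \<or> t \<noteq> 0) \<and> (\<forall>q. s * \<Lambda> q + t * bes_moment M \<kappa> (\<lambda>x. poly q (of_real x)) = 0)"
proof -
  define a where "a = \<Lambda> (helm_op M \<kappa> 1)"
  define b where "b = \<Lambda> (helm_op M \<kappa> [:-4, 1:])"
  define A where "A = 2 ^ (M + 1) * bes M (\<kappa> * 4)"
  define A0 where "A0 = \<kappa> / of_nat M * 2 ^ M * bes (M + 2) (\<kappa> * 4)"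
  have I: "bes_moment M \<kappa> (\<lambda>s. poly (helm_op M \<kappa> q) (of_real s)) = A * poly (pderiv q) 4 + A0 * poly q 4" for q
    unfolding A_def A0_def by (rule bes_moment_helm_op[OF M])
  \<comment> \<open>Dividing twice by \<open>s - 4\<close> gives the Taylor form
    \<open>q = q(4) + q'(4) (s-4) + (s-4)^2 q4\<close>, whose last summand does not
    contribute.\<close>
  have L: "\<Lambda> (helm_op M \<kappa> q) = a * poly q 4 + b * poly (pderiv q) 4" for q
  proof -
    define q1 where "q1 = q - [:poly q 4:]"
    have "poly q1 4 = 0" by (simp add: q1_def)
    then have "[:-4, 1:] dvd q1" using poly_eq_0_iff_dvd[of q1 4] by simp
    then obtain q2 where q2: "q1 = [:-4, 1:] * q2" by (rule dvdE)
    define q3 where "q3 = q2 - [:poly q2 4:]"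
    have "poly q3 4 = 0" by (simp add: q3_def)
    then have "[:-4, 1:] dvd q3" using poly_eq_0_iff_dvd[of q3 4] by simp
    then obtain q4 where q4: "q3 = [:-4, 1:] * q4" by (rule dvdE)
    have qq: "q = smult (poly q 4) 1 + smult (poly q2 4) [:-4, 1:] + [:-4, 1:]^2 * q4"
    proof -
      have "q = [:poly q 4:] + [:-4, 1:] * q2" using q2 by (simp add: q1_def algebra_simps)
      moreover have "q2 = [:poly q2 4:] + [:-4, 1:] * q4" using q4 by (simp add: q3_def algebra_simps)
      ultimately have "q = [:poly q 4:] + [:-4, 1:] * ([:poly q2 4:] + [:-4, 1:] * q4)" by metis
      moreover have "[:poly q 4:] = smult (poly q 4) 1" "[:-4, 1:] * [:poly q2 4:] = smult (poly q2 4) [:-4, 1:]" by simp_all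
      ultimately show ?thesis by (simp only: distrib_left power2_eq_square mult.assoc add.assoc)
    qed
    have pq: "poly (pderiv q) 4 = poly q2 4"
      by (subst qq) (simp add: pderiv_add pderiv_diff pderiv_smult pderiv_mult pderiv_pCons power2_eq_square algebra_simps)
    from arg_cong[OF qq, of "\<lambda>q. \<Lambda> (helm_op M \<kappa> q)"]
    have "\<Lambda> (helm_op M \<kappa> q) = poly q 4 * a + poly q2 4 * b"
      by (simp only: helm_op_add helm_op_smult add sm zero a_def[symmetric] b_def[symmetric] add_0_right)
    then show ?thesis unfolding pq by (simp only: mult.commute)
  qed
  have lim1: "(\<lambda>n. \<Lambda> (helm_op M \<kappa> (bes_poly M \<kappa> (Suc n)))) \<longlonglongrightarrow> a * bes M (\<kappa> * 4) + b * (- \<kappa> / (2 * of_nat M) * bes (M + 2) (\<kappa> * 4))"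
    unfolding L pderiv_bes_poly[OF M] poly_smult
    by (intro tendsto_intros LIMSEQ_Suc[OF bes_poly_LIMSEQ] bes_poly_LIMSEQ M) simp
  have lim0: "(\<lambda>n. \<Lambda> (helm_op M \<kappa> (bes_poly M \<kappa> (Suc n)))) \<longlonglongrightarrow> 0"
  proof (rule Lim_null_comparison)
    let ?z = "\<lambda>n. norm \<kappa> * norm (of_real (bes_coeff M (Suc n)) * (\<kappa> * 4) ^ Suc n)"
    show "eventually (\<lambda>n. norm (\<Lambda> (helm_op M \<kappa> (bes_poly M \<kappa> (Suc n)))) \<le> K * ?z n) sequentially"
    proof (intro always_eventually allI bd)
      fix n and s :: real assume s: "s \<in> {0..4}"
      have "norm (poly (helm_op M \<kappa> (bes_poly M \<kappa> (Suc n))) (of_real s)) = norm \<kappa> * (\<bar>bes_coeff M (Suc n)\<bar> * norm \<kappa> ^ Suc n * s ^ Suc n)"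
        unfolding helm_op_bes_poly[OF M] poly_monom using s by (simp add: norm_mult norm_power del: bes_coeff.simps)
      also have "\<dots> \<le> norm \<kappa> * (\<bar>bes_coeff M (Suc n)\<bar> * norm \<kappa> ^ Suc n * 4 ^ Suc n)"
        using s by (intro mult_left_mono power_mono) (auto simp del: bes_coeff.simps)
      also have "\<dots> = ?z n" by (simp add: norm_mult norm_power power_mult_distrib del: bes_coeff.simps)
      finally show "norm (poly (helm_op M \<kappa> (bes_poly M \<kappa> (Suc n))) (of_real s)) \<le> ?z n" .
    qed
    have "(\<lambda>n. norm (of_real (bes_coeff M n) * (\<kappa> * 4) ^ n)) \<longlonglongrightarrow> 0"
      by (rule summable_LIMSEQ_zero[OF bes_norm_summable[OF M]])
    from tendsto_mult[OF tendsto_const[of K] tendsto_mult[OF tendsto_const[of "norm \<kappa>"] LIMSEQ_Suc[OF this]]]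
    show "(\<lambda>n. K * ?z n) \<longlonglongrightarrow> 0" by (simp del: bes_coeff.simps)
  qed
  have "a * bes M (\<kappa> * 4) + b * (- \<kappa> / (2 * of_nat M) * bes (M + 2) (\<kappa> * 4)) = 0"
    by (rule LIMSEQ_unique[OF lim1 lim0])
  then have "2 ^ (M + 1) * (a * bes M (\<kappa> * 4) + b * (- \<kappa> / (2 * of_nat M) * bes (M + 2) (\<kappa> * 4))) = 0" by simp
  then have det: "a * A = b * A0" by (simp add: A_def A0_def algebra_simps)
  \<comment> \<open>\<open>det\<close> says that \<open>(a,b)\<close> and \<open>(A0,A)\<close> are
    linearly dependent; the cases produce a common relation, including the degenerate one in which
    the moment of every \<open>helm_op\<close> image is 0.\<close>
  obtain s t where st: "s \<noteq> 0 \<or> t \<noteq> 0" "s * a + t * A0 = 0" "s * b + t * A = 0"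
  proof -
    consider "A \<noteq> 0" | "A = 0" "A0 \<noteq> 0" | "A = 0" "A0 = 0" by blast
    then show ?thesis
    proof cases
      case 1
      then show ?thesis using det by (intro that[of A "- b"]) (auto simp: algebra_simps)
    next
      case 2
      then have "b = 0" using det by simp
      then show ?thesis using 2 by (intro that[of A0 "- a"]) auto
    next
      case 3
      then show ?thesis by (intro that[of 0 1]) auto
    qed
  qed
  have "s * \<Lambda> q + t * bes_moment M \<kappa> (\<lambda>x. poly q (of_real x)) = 0" for q
  proof -
    obtain p where p: "helm_op M \<kappa> p = q" using helm_op_surj[OF \<kappa>] by blast
    have "s * \<Lambda> q + t * bes_moment M \<kappa> (\<lambda>x. poly q (of_real x)) = (s * a + t * A0) * poly p 4 + (s * b + t * A) * poly (pderiv p) 4"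
      unfolding p[symmetric] L I by (simp add: algebra_simps)
    then show ?thesis by (simp add: st)
  qed
  then show ?thesis using st(1) by blast
qed

lemma polynomial_function_imp_poly:
  fixes p :: "real \<Rightarrow> complex"
  assumes "polynomial_function p" shows "\<exists>q. \<forall>s. p s = poly q (of_real s)"
proof -
  have re: "real_polynomial_function (\<lambda>s. Re (p s))" "real_polynomial_function (\<lambda>s. Im (p s))"
    using assms bounded_linear_Re bounded_linear_Im unfolding polynomial_function_def o_def by auto
  have *: "\<exists>q::complex poly. \<forall>s. of_real (f s) = poly q (of_real s)" if f: "real_polynomial_function f" for f :: "real \<Rightarrow> real"
  proof -
    obtain a n where f: "f = (\<lambda>x. \<Sum>i\<le>n. a i * x ^ i)"
      using f unfolding real_polynomial_function_iff_sum by blast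
    show ?thesis
      by (intro exI[of _ "\<Sum>i\<le>n. monom (of_real (a i)) i"]) (simp add: f poly_sum poly_monom)
  qed
  obtain q1 q2 where q: "\<And>s. complex_of_real (Re (p s)) = poly q1 (of_real s)" "\<And>s. complex_of_real (Im (p s)) = poly q2 (of_real s)"
    using *[OF re(1)] *[OF re(2)] by metis
  have "p s = poly (q1 + smult \<i> q2) (of_real s)" for s
    by (simp add: q[symmetric] complex_eq_iff)
  then show ?thesis by blast
qed

text \<open>Both functionals are bounded for the supremum norm on \<open>[0,4]\<close>, so the
  Weierstrass theorem extends the relation from polynomials to continuous profiles. This is needed
  because truncations of \<open>m\<close> are not polynomial.\<close>

lemma functional_moment_extend:
  fixes \<Lambda> :: "(real \<Rightarrow> complex) \<Rightarrow> complex"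
  assumes M: "M \<ge> 1"
    and add: "\<And>f g. continuous_on UNIV f \<Longrightarrow> continuous_on UNIV g \<Longrightarrow> \<Lambda> (\<lambda>s. f s + g s) = \<Lambda> f + \<Lambda> g"
    and bd: "\<And>f e. continuous_on UNIV f \<Longrightarrow> (\<And>s. s \<in> {0..4} \<Longrightarrow> norm (f s) \<le> e) \<Longrightarrow> norm (\<Lambda> f) \<le> K * e"
    and K: "K \<ge> 0"
    and z: "\<And>q. s * \<Lambda> (\<lambda>x. poly q (of_real x)) + t * bes_moment M \<kappa> (\<lambda>x. poly q (of_real x)) = 0"
    and g: "continuous_on UNIV g"
  shows "s * \<Lambda> g + t * bes_moment M \<kappa> g = 0"
proof -
  obtain K' where K': "K' \<ge> 0" "\<And>g e. continuous_on {0..4} g \<Longrightarrow> (\<forall>s\<in>{0..4}. norm (g s) \<le> e) \<Longrightarrow> norm (bes_moment M \<kappa> g) \<le> K' * e"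
    using bes_moment_bound[OF M] by blast
  have bnd: "norm (s * \<Lambda> g + t * bes_moment M \<kappa> g) \<le> e * (norm s * K + norm t * K')" if e: "e > 0" for e
  proof -
    obtain p where p: "polynomial_function p" "\<forall>x\<in>{0..4}. norm (g x - p x) < e"
      using Stone_Weierstrass_polynomial_function[OF compact_Icc continuous_on_subset[OF g subset_UNIV] e] by blast
    obtain q where q: "\<And>s. p s = poly q (of_real s)" using polynomial_function_imp_poly[OF p(1)] by blast
    define h where "h x = g x - p x" for x
    have cp: "continuous_on UNIV (\<lambda>x. poly q (complex_of_real x))" by (intro continuous_intros)
    have ch: "continuous_on UNIV h" unfolding h_def q by (intro continuous_intros g)
    have he: "norm (h x) \<le> e" if "x \<in> {0..4}" for x using p(2) that by (auto simp: h_def intro!: less_imp_le)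
    have gs: "g = (\<lambda>x. poly q (of_real x) + h x)" by (auto simp: h_def q)
    have e1: "\<Lambda> g = \<Lambda> (\<lambda>x. poly q (of_real x)) + \<Lambda> h"
      by (subst gs) (rule add[OF cp ch])
    have e2: "bes_moment M \<kappa> g = bes_moment M \<kappa> (\<lambda>x. poly q (of_real x)) + bes_moment M \<kappa> h"
      by (subst gs) (rule bes_moment_linear(1)[OF M continuous_on_subset[OF cp subset_UNIV] continuous_on_subset[OF ch subset_UNIV]])
    have "s * \<Lambda> g + t * bes_moment M \<kappa> g =
      (s * \<Lambda> (\<lambda>x. poly q (of_real x)) + t * bes_moment M \<kappa> (\<lambda>x. poly q (of_real x))) + (s * \<Lambda> h + t * bes_moment M \<kappa> h)"
      unfolding e1 e2 by (simp add: algebra_simps)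
    also have "\<dots> = s * \<Lambda> h + t * bes_moment M \<kappa> h" unfolding z by simp
    also have "norm \<dots> \<le> norm s * (K * e) + norm t * (K' * e)"
      using bd[OF ch he] K'(2)[OF continuous_on_subset[OF ch subset_UNIV]] he
      by (intro order_trans[OF norm_triangle_ineq] add_mono) (auto simp: norm_mult intro!: mult_left_mono)
    finally show ?thesis by (simp add: algebra_simps)
  qed
  have ev: "eventually (\<lambda>e. norm (s * \<Lambda> g + t * bes_moment M \<kappa> g) \<le> e * (norm s * K + norm t * K')) (at_right 0)"
  proof (rule eventually_mono[OF eventually_at_right_less[of "0::real"]])
    fix e :: real assume "0 < e"
    then show "norm (s * \<Lambda> g + t * bes_moment M \<kappa> g) \<le> e * (norm s * K + norm t * K')" by (rule bnd)
  qed
  have "((\<lambda>e. e * (norm s * K + norm t * K')) \<longlongrightarrow> 0 * (norm s * K + norm t * K')) (at_right 0)"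
    by (intro tendsto_intros)
  from tendsto_lowerbound[OF this ev trivial_limit_at_right_real]
  have "norm (s * \<Lambda> g + t * bes_moment M \<kappa> g) \<le> 0" unfolding mult_zero_left .
  then show ?thesis unfolding norm_le_zero_iff .
qed

section \<open>A zero-free strip\<close>

text \<open>\<open>F\<close> is the radial solution and \<open>h = r F' - l F\<close>, which equals \<open>k\<close> times the \<open>k\<close>-derivative of \<open>F\<close>.
  A Rellich-type multiplier argument bounds the \<open>L\<^sup>2\<close> norm of \<open>h\<close> by \<open>|k|\<close> times that of \<open>F\<close>, uniformly in \<open>l\<close>
  for \<open>|Im k| \<le> 1\<close>.\<close>

locale radial_system =
  fixes d l :: nat and k :: complex
  assumes d: "d = 2 \<or> d = 3"
begin

definition M where "M = 2 * l + d"
definition F :: "real \<Rightarrow> complex" where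
  "F r = of_real (r ^ l) * bes M (k^2 * of_real (r^2))"
text \<open>For \<open>r > 0\<close> this is \<open>F' - l F / r\<close>, written without the
  division so that it is continuous at 0; the quantity called \<open>h\<close> is
  \<open>r J\<close>.\<close>

definition J :: "real \<Rightarrow> complex" where
  "J r = - (k^2 / of_nat M) * of_real (r ^ (l + 1)) * bes (M + 2) (k^2 * of_real (r^2))"

lemma M_ge: "M \<ge> 1" and M_pos: "M > 0" using d by (auto simp: M_def)

lemma F_deriv:
  "(F has_vector_derivative of_nat l * of_real (r ^ (l - 1)) * bes M (k^2 * of_real (r^2)) + J r) (at r within S)"
proof -
  have "(F has_vector_derivative
     of_real (r ^ l) * - (k^2 * of_real r * bes (M + 2) (k^2 * of_real (r^2)) / of_nat M)
     + of_real (real l * r ^ (l - 1)) * bes M (k^2 * of_real (r^2))) (at r within S)"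
    unfolding F_def
    by (intro has_vector_derivative_mult bes_radial_deriv M_ge has_vector_derivative_of_real)
       (auto intro!: derivative_eq_intros)
  then show ?thesis by (simp add: J_def algebra_simps)
qed

lemma cont_F: "continuous_on S F" and cont_J: "continuous_on S J"
  unfolding F_def J_def by (intro continuous_intros; use M_ge in simp)+

lemma F_deriv_pos:
  assumes "r > 0"
  shows "(F has_vector_derivative (of_nat l * F r + of_real r * J r) / of_real r) (at r)"
proof -
  have "of_nat l * of_real (r ^ (l - 1)) * bes M (k^2 * of_real (r^2)) + J r = (of_nat l * F r + of_real r * J r) / of_real r"
  proof -
    have "of_nat l * of_real (r ^ (l - 1)) * of_real r = (of_nat l * of_real (r ^ l) :: complex)"
      by (cases l) auto
    then have "(of_nat l * of_real (r ^ (l - 1)) * bes M (k^2 * of_real (r^2)) + J r) * of_real r = of_nat l * F r + of_real r * J r"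
      by (auto simp: F_def algebra_simps)
    then show ?thesis using assms by (simp add: eq_divide_eq)
  qed
  then show ?thesis using F_deriv[of r UNIV] by simp
qed

lemma flux:
  "r \<ge> 0 \<Longrightarrow> J r * of_real (r ^ (l + d - 1)) = - (k^2 / of_nat M) * (of_real (r ^ M) * bes (M + 2) (k^2 * of_real (r^2)))"
proof -
  have "r ^ (l + 1) * r ^ (l + d - 1) = r ^ M"
    using d unfolding power_add[symmetric] M_def by (intro arg_cong[where f = "\<lambda>n. r ^ n"]) auto
  then have "(of_real (r ^ (l + 1)) * of_real (r ^ (l + d - 1)) :: complex) = of_real (r ^ M)"
    by (simp only: of_real_mult[symmetric])
  then show ?thesis by (simp add: J_def mult_ac del: of_real_power power_Suc)
qed

lemma flux_deriv:
  "((\<lambda>r. - (k^2 / of_nat M) * (of_real (r ^ M) * bes (M + 2) (k^2 * of_real (r^2)))) has_vector_derivative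
     - k\<^sup>2 * of_real (r ^ (l + d - 1)) * F r) (at r within S)"
proof -
  have "r ^ (M - 1) = r ^ (l + d - 1) * r ^ l"
    using d unfolding power_add[symmetric] M_def by (intro arg_cong[where f = "\<lambda>n. r ^ n"]) auto
  then have "(of_real (r ^ (M - 1)) :: complex) = of_real (r ^ (l + d - 1)) * of_real (r ^ l)"
    by (simp only: of_real_mult[symmetric])
  then have "- (k^2 / of_nat M) * (of_nat M * of_real (r ^ (M - 1)) * bes M (k^2 * of_real (r^2)))
     = - k\<^sup>2 * of_real (r ^ (l + d - 1)) * F r"
    using M_pos by (simp add: F_def)
  then show ?thesis
    using has_vector_derivative_mult_right[OF bes_radial_flux_deriv[OF M_ge, of "k^2" r S], of "- (k^2 / of_nat M)"]
    by simp
qed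

text \<open>\<open>r^(l+d-1) J\<close> is the integral of \<open>-k^2 s^(l+d-1) F\<close> from 0.
  Bounding the increasing weight by its value at \<open>r\<close> and cancelling it leaves an
  estimate in which \<open>l\<close> no longer occurs.\<close>

lemma norm_J_le:
  assumes r: "r > 0"
  shows "norm (J r) \<le> (norm k)^2 * integral {0..r} (\<lambda>s. norm (F s))"
proof -
  have hi: "((\<lambda>s. - k\<^sup>2 * of_real (s ^ (l + d - 1)) * F s) has_integral J r * of_real (r ^ (l + d - 1))) {0..r}"
  proof -
    have "((\<lambda>s. - k\<^sup>2 * of_real (s ^ (l + d - 1)) * F s) has_integral
       - (k^2 / of_nat M) * (of_real (r ^ M) * bes (M + 2) (k^2 * of_real (r^2)))
       - - (k^2 / of_nat M) * (of_real (0 ^ M) * bes (M + 2) (k^2 * of_real (0^2)))) {0..r}"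
      by (rule fundamental_theorem_of_calculus) (use r flux_deriv in auto)
    moreover have "(0::real) ^ M = 0" using M_pos by (simp add: zero_power)
    ultimately show ?thesis using flux[of r] r by simp
  qed
  have "norm (J r * of_real (r ^ (l + d - 1))) \<le> integral {0..r} (\<lambda>s. ((norm k)^2 * r ^ (l + d - 1)) * norm (F s))"
    unfolding integral_unique[OF hi, symmetric]
  proof (rule integral_norm_bound_integral)
    show "(\<lambda>s. - k\<^sup>2 * of_real (s ^ (l + d - 1)) * F s) integrable_on {0..r}" using hi by blast
    show "(\<lambda>s. ((norm k)^2 * r ^ (l + d - 1)) * norm (F s)) integrable_on {0..r}"
      by (intro integrable_continuous_real continuous_intros cont_F)
    fix s assume s: "s \<in> {0..r}"
    show "norm (- k\<^sup>2 * of_real (s ^ (l + d - 1)) * F s) \<le> ((norm k)^2 * r ^ (l + d - 1)) * norm (F s)"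
      unfolding norm_mult norm_minus_cancel norm_power norm_of_real using s
      by (intro mult_right_mono mult_left_mono) (auto intro!: power_mono)
  qed
  also have "\<dots> = ((norm k)^2 * integral {0..r} (\<lambda>s. norm (F s))) * r ^ (l + d - 1)"
    by (simp add: mult_ac)
  finally have "norm (J r) * r ^ (l + d - 1) \<le> ((norm k)^2 * integral {0..r} (\<lambda>s. norm (F s))) * r ^ (l + d - 1)"
    using r by (simp add: norm_mult norm_power)
  then show ?thesis using r by (simp add: mult_le_cancel_right)
qed

definition P where "P = integral {0..2} (\<lambda>r. (norm (F r))^2)"
definition R where "R = integral {0..2} (\<lambda>r. (r * norm (J r))^2)"

lemma int_P: "(\<lambda>r. (norm (F r))^2) integrable_on {0..b}"
  and int_R: "(\<lambda>r. (r * norm (J r))^2) integrable_on {0..b}"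
  by (intro integrable_continuous_real continuous_intros cont_F cont_J)+

lemma P_nonneg: "P \<ge> 0" and R_nonneg: "R \<ge> 0"
  unfolding P_def R_def by (intro integral_nonneg int_P int_R; simp)+

lemma norm_J_sq_le:
  assumes "r \<in> {0..2}"
  shows "(norm (J r))^2 \<le> (norm k) ^ 4 * r * P"
proof (cases "r = 0")
  case True
  then show ?thesis using P_nonneg by (simp add: J_def)
next
  case False
  with assms have r: "r > 0" by simp
  have "(norm (J r))^2 \<le> ((norm k)^2 * integral {0..r} (\<lambda>s. norm (F s)))^2"
    by (intro power_mono norm_J_le r) auto
  also have "\<dots> = (norm k) ^ 4 * (integral {0..r} (\<lambda>s. norm (F s)))^2"
    by (simp add: power_mult_distrib power_mult[symmetric])
  also have "\<dots> \<le> (norm k) ^ 4 * (r * integral {0..r} (\<lambda>x. (norm (F x))^2))"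
    by (intro mult_left_mono integral_norm_squared_le cont_F r) auto
  also have "\<dots> \<le> (norm k) ^ 4 * (r * P)"
    unfolding P_def using assms r
    by (intro mult_left_mono integral_subset_le int_P) auto
  finally show ?thesis by (simp add: mult_ac)
qed

lemma R_le_small: "R \<le> 16 * (norm k) ^ 4 * P"
proof -
  have "R \<le> integral {0..2} (\<lambda>r::real. 8 * ((norm k) ^ 4 * P))"
    unfolding R_def
  proof (intro integral_le int_R)
    fix r :: real assume r: "r \<in> {0..2}"
    have "(r * norm (J r))^2 = r^2 * (norm (J r))^2" by (simp add: power_mult_distrib)
    also have "\<dots> \<le> 2^2 * ((norm k) ^ 4 * 2 * P)"
    proof (intro mult_mono power_mono)
      have "(norm k) ^ 4 * r * P \<le> (norm k) ^ 4 * 2 * P"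
        using r P_nonneg by (intro mult_right_mono mult_left_mono) auto
      then show "(norm (J r))^2 \<le> (norm k) ^ 4 * 2 * P" using norm_J_sq_le[OF r] by linarith
    qed (use r in auto)
    finally show "(r * norm (J r))^2 \<le> 8 * ((norm k) ^ 4 * P)" by simp
  qed auto
  then show ?thesis by simp
qed

text \<open>Split at \<open>r = e\<close>: beyond \<open>e\<close> one factor \<open>r\<close> is
  traded for \<open>r^2 / e\<close>, below \<open>e\<close> the pointwise bound on \<open>J\<close>
  is used.\<close>

lemma weighted_J_le:
  assumes r: "r \<in> {0..2}" and e: "e > 0"
  shows "r * (norm (J r))^2 \<le> (r * norm (J r))^2 / e + (norm k) ^ 4 * e^2 * P"
proof (cases "r \<ge> e")
  case True
  have "r * (norm (J r))^2 = (e * r) * (norm (J r))^2 / e" using e by simp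
  also have "\<dots> \<le> (r * r) * (norm (J r))^2 / e"
    using e True r by (intro divide_right_mono mult_right_mono) auto
  also have "\<dots> = (r * norm (J r))^2 / e" by (simp add: power2_eq_square mult_ac)
  moreover have "(norm k) ^ 4 * e^2 * P \<ge> 0" using P_nonneg by simp
  ultimately show ?thesis by linarith
next
  case False
  have "r * (norm (J r))^2 \<le> r * ((norm k) ^ 4 * r * P)"
    using r by (intro mult_left_mono norm_J_sq_le) auto
  also have "\<dots> = (norm k) ^ 4 * r^2 * P" by (simp add: power2_eq_square mult_ac)
  also have "\<dots> \<le> (norm k) ^ 4 * e^2 * P"
    using False r P_nonneg by (intro mult_right_mono mult_left_mono power_mono) auto
  moreover have "(r * norm (J r))^2 / e \<ge> 0" using e by simp
  ultimately show ?thesis by linarith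
qed

definition h where "h r = of_real r * J r"

lemma cont_h: "continuous_on S h"
  unfolding h_def by (intro continuous_intros cont_J)

lemma norm_h: "r \<ge> 0 \<Longrightarrow> norm (h r) = r * norm (J r)"
  by (simp add: h_def norm_mult)

lemma h_deriv_pos:
  assumes r: "r > 0"
  shows "(h has_vector_derivative (- of_real (real l + real d - 2) * h r - k^2 * of_real (r^2) * F r) / of_real r) (at r)"
proof -
  define n where "n = l + d - 2"
  have n: "l + d - 1 = Suc n" "real n = real l + real d - 2" using d by (auto simp: n_def)
  define \<Phi> where "\<Phi> r = - (k^2 / of_nat M) * (of_real (r ^ M) * bes (M + 2) (k^2 * of_real (r^2)))" for r :: real
  have hPhi: "h s = inverse (s ^ n) *\<^sub>R \<Phi> s" if "s > 0" for s
  proof -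
    have "\<Phi> s = s ^ n *\<^sub>R h s"
      using flux[of s, unfolded n(1)] that by (simp add: \<Phi>_def h_def n(1) scaleR_conv_of_real mult_ac)
    then show ?thesis using that by simp
  qed
  have D: "((\<lambda>s. inverse (s ^ n) *\<^sub>R \<Phi> s) has_vector_derivative
      inverse (r ^ n) *\<^sub>R (- k\<^sup>2 * of_real (r ^ (l + d - 1)) * F r) + (- real n / (r ^ n * r)) *\<^sub>R \<Phi> r) (at r)"
  proof (rule has_vector_derivative_scaleR)
    show "((\<lambda>s. inverse (s ^ n)) has_real_derivative - real n / (r ^ n * r)) (at r)"
    proof -
      have "((\<lambda>s. s ^ n) has_real_derivative real n * r ^ (n - 1)) (at r)"
        by (auto intro!: derivative_eq_intros)
      from DERIV_inverse'[OF this] r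
      have D: "((\<lambda>s. inverse (s ^ n)) has_real_derivative - (inverse (r ^ n) * (real n * r ^ (n - 1)) * inverse (r ^ n))) (at r)"
        by simp
      have "real n * r ^ (n - 1) * r = real n * r ^ n" by (cases n) auto
      then have "real n * r ^ (n - 1) = real n * r ^ n / r" using r by (simp add: eq_divide_eq)
      then have e: "- (inverse (r ^ n) * (real n * r ^ (n - 1)) * inverse (r ^ n)) = - real n / (r ^ n * r)"
        using r by (simp add: field_simps)
      show ?thesis using D unfolding e .
    qed
    show "(\<Phi> has_vector_derivative - k\<^sup>2 * of_real (r ^ (l + d - 1)) * F r) (at r)"
      using flux_deriv[of r UNIV] unfolding \<Phi>_def [abs_def] .
  qed
  have e1: "inverse (r ^ n) *\<^sub>R (- k\<^sup>2 * of_real (r ^ (l + d - 1)) * F r) = - (k^2 * of_real (r^2) * F r) / of_real r"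
    unfolding n(1) using r by (simp add: scaleR_conv_of_real field_simps power2_eq_square)
  have "(- real n / (r ^ n * r)) *\<^sub>R \<Phi> r = - of_real (real n) * (inverse (r ^ n) *\<^sub>R \<Phi> r) / of_real r"
    using r by (simp add: scaleR_conv_of_real field_simps)
  then have e2: "(- real n / (r ^ n * r)) *\<^sub>R \<Phi> r = - of_real (real n) * h r / of_real r"
    using hPhi[OF r] by simp
  have "(h has_vector_derivative - (k^2 * of_real (r^2) * F r) / of_real r + - of_real (real n) * h r / of_real r) (at r)"
    by (rule has_vector_derivative_transform_within_open[OF D[unfolded e1 e2], of "{0<..}"]) (use r hPhi in auto)
  moreover have "- (k^2 * of_real (r^2) * F r) / of_real r + - of_real (real n) * h r / of_real r
     = (- of_real (real l + real d - 2) * h r - k^2 * of_real (r^2) * F r) / of_real r"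
    unfolding n(2) by (simp add: diff_divide_distrib add_divide_distrib)
  ultimately show ?thesis by simp
qed

definition X where "X r = Re (F r) * Re (h r) + Im (F r) * Im (h r)"
definition \<alpha> where "\<alpha> = Re (k^2)"
definition \<beta> where "\<beta> = Im (k^2)"
definition E where "E r = (Re (h r))^2 + (Im (h r))^2 + \<alpha> * r^2 * ((Re (F r))^2 + (Im (F r))^2)
  + (2 * real l + real d - 1) * X r"

lemma real_derivs:
  assumes r: "r > 0"
  shows "((\<lambda>r. Re (F r)) has_real_derivative (real l * Re (F r) + Re (h r)) / r) (at r)"
    and "((\<lambda>r. Im (F r)) has_real_derivative (real l * Im (F r) + Im (h r)) / r) (at r)"
    and "((\<lambda>r. Re (h r)) has_real_derivative
        (- (real l + real d - 2) * Re (h r) - r^2 * (\<alpha> * Re (F r) - \<beta> * Im (F r))) / r) (at r)"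
    and "((\<lambda>r. Im (h r)) has_real_derivative
        (- (real l + real d - 2) * Im (h r) - r^2 * (\<alpha> * Im (F r) + \<beta> * Re (F r))) / r) (at r)"
proof -
  note dF = F_deriv_pos[OF r, folded h_def]
  note dh = h_deriv_pos[OF r]
  have e: "Re ((of_nat l * F r + h r) / of_real r) = (real l * Re (F r) + Re (h r)) / r"
    "Im ((of_nat l * F r + h r) / of_real r) = (real l * Im (F r) + Im (h r)) / r"
    by simp_all
  have "k^2 * of_real (r^2) * F r = of_real (r^2) * (k^2 * F r)" by simp
  then have e': "Re (k^2 * of_real (r^2) * F r) = r^2 * (\<alpha> * Re (F r) - \<beta> * Im (F r))"
    "Im (k^2 * of_real (r^2) * F r) = r^2 * (\<alpha> * Im (F r) + \<beta> * Re (F r))"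
    by (simp_all add: \<alpha>_def \<beta>_def algebra_simps del: Re_power2 Im_power2 of_real_power)
  have e2: "Re ((- of_real (real l + real d - 2) * h r - k^2 * of_real (r^2) * F r) / of_real r)
     = (- (real l + real d - 2) * Re (h r) - r^2 * (\<alpha> * Re (F r) - \<beta> * Im (F r))) / r"
    "Im ((- of_real (real l + real d - 2) * h r - k^2 * of_real (r^2) * F r) / of_real r)
     = (- (real l + real d - 2) * Im (h r) - r^2 * (\<alpha> * Im (F r) + \<beta> * Re (F r))) / r"
    unfolding Re_divide_of_real Im_divide_of_real minus_complex.simps e' by simp_all
  note R = bounded_linear.has_vector_derivative[OF bounded_linear_Re] bounded_linear.has_vector_derivative[OF bounded_linear_Im]
  show "((\<lambda>r. Re (F r)) has_real_derivative (real l * Re (F r) + Re (h r)) / r) (at r)"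
    "((\<lambda>r. Im (F r)) has_real_derivative (real l * Im (F r) + Im (h r)) / r) (at r)"
    using R[OF dF] unfolding e has_real_derivative_iff_has_vector_derivative by auto
  show "((\<lambda>r. Re (h r)) has_real_derivative
        (- (real l + real d - 2) * Re (h r) - r^2 * (\<alpha> * Re (F r) - \<beta> * Im (F r))) / r) (at r)"
    "((\<lambda>r. Im (h r)) has_real_derivative
        (- (real l + real d - 2) * Im (h r) - r^2 * (\<alpha> * Im (F r) + \<beta> * Re (F r))) / r) (at r)"
    using R[OF dh] unfolding e2 has_real_derivative_iff_has_vector_derivative by auto
qed

lemma X_identity:
  "((\<lambda>r. (norm (h r))^2 - \<alpha> * (r^2 * (norm (F r))^2) + (3 - real d) * X r) has_integral 2 * X 2) {0..2}"
proof -
  have "((\<lambda>r. (Re (h r))^2 + (Im (h r))^2 - \<alpha> * r^2 * ((Re (F r))^2 + (Im (F r))^2)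
      + (3 - real d) * (Re (F r) * Re (h r) + Im (F r) * Im (h r))) has_integral
     (2 * (Re (F 2) * Re (h 2) + Im (F 2) * Im (h 2)) - 0 * (Re (F 0) * Re (h 0) + Im (F 0) * Im (h 0)))) {0..2}"
  proof (rule fundamental_theorem_of_calculus_interior)
    show "continuous_on {0..2} (\<lambda>r. r * (Re (F r) * Re (h r) + Im (F r) * Im (h r)))"
      by (intro continuous_intros cont_F cont_h)
    fix r :: real assume "r \<in> {0<..<2}"
    then have r: "r > 0" by simp
    show "((\<lambda>r. r * (Re (F r) * Re (h r) + Im (F r) * Im (h r))) has_vector_derivative
       ((Re (h r))^2 + (Im (h r))^2 - \<alpha> * r^2 * ((Re (F r))^2 + (Im (F r))^2)
      + (3 - real d) * (Re (F r) * Re (h r) + Im (F r) * Im (h r)))) (at r)"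
      unfolding has_real_derivative_iff_has_vector_derivative[symmetric]
      by (rule lagrange_system_derivs(1)[OF r d real_derivs(1-4)[OF r]])
  qed simp
  then show ?thesis by (simp add: X_def cmod_power2 mult.assoc)
qed

lemma E_identity:
  "((\<lambda>r. r ^ (d - 1) * ((norm (J r))^2 + \<alpha> * (norm (F r))^2
      + 2 * \<beta> * (Im (F r) * Re (h r) - Re (F r) * Im (h r)))) has_integral 2 ^ (d - 2) * E 2) {0..2}"
proof -
  have "((\<lambda>r. r ^ (d - 1) * ((norm (J r))^2 + \<alpha> * (norm (F r))^2
      + 2 * \<beta> * (Im (F r) * Re (h r) - Re (F r) * Im (h r)))) has_integral 2 ^ (d - 2) * E 2 - 0 ^ (d - 2) * E 0) {0..2}"
  proof (rule fundamental_theorem_of_calculus_interior)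
    show "continuous_on {0..2} (\<lambda>r. r ^ (d - 2) * E r)"
      unfolding E_def X_def by (intro continuous_intros cont_F cont_h)
    fix r :: real assume "r \<in> {0<..<2}"
    then have r: "r > 0" by simp
    have hJ: "((Re (h r))^2 + (Im (h r))^2) / r^2 = (norm (J r))^2"
      unfolding cmod_power2[symmetric] using r norm_h[of r] by (simp add: power_mult_distrib)
    show "((\<lambda>r. r ^ (d - 2) * E r) has_vector_derivative r ^ (d - 1) * ((norm (J r))^2 + \<alpha> * (norm (F r))^2
      + 2 * \<beta> * (Im (F r) * Re (h r) - Re (F r) * Im (h r)))) (at r)"
      unfolding has_real_derivative_iff_has_vector_derivative[symmetric] E_def X_def hJ[symmetric] cmod_power2[of "F r"]
      by (rule lagrange_system_derivs(2)[OF r d real_derivs(1-4)[OF r]])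
  qed simp
  moreover have "E 0 = 0" by (simp add: E_def X_def h_def)
  ultimately show ?thesis by simp
qed

lemma abs_X_le: "\<bar>X r\<bar> \<le> norm (F r) * norm (h r)"
  and abs_Y_le: "\<bar>Im (F r) * Re (h r) - Re (F r) * Im (h r)\<bar> \<le> norm (F r) * norm (h r)"
proof -
  have "X r = Re (cnj (F r) * h r)" "Im (F r) * Re (h r) - Re (F r) * Im (h r) = Im (F r * cnj (h r))"
    by (auto simp: X_def)
  then show "\<bar>X r\<bar> \<le> norm (F r) * norm (h r)"
    "\<bar>Im (F r) * Re (h r) - Re (F r) * Im (h r)\<bar> \<le> norm (F r) * norm (h r)"
    using abs_Re_le_cmod[of "cnj (F r) * h r"] abs_Im_le_cmod[of "F r * cnj (h r)"]
    by (auto simp: norm_mult)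
qed

lemma hi_P: "((\<lambda>r. (norm (F r))^2) has_integral P) {0..2}"
  unfolding P_def by (rule integrable_integral[OF int_P])

lemma hi_R: "((\<lambda>r. (norm (h r))^2) has_integral R) {0..2}"
proof -
  have "((\<lambda>r. (r * norm (J r))^2) has_integral R) {0..2}"
    unfolding R_def by (rule integrable_integral[OF int_R])
  then show ?thesis
    by (rule has_integral_eq[rotated]) (simp add: norm_h)
qed

text \<open>\<open>R_le_small\<close> has \<open>|k|^4\<close>, which is too weak for large
  \<open>k\<close>. Here \<open>E_identity\<close> bounds the energy at the boundary, the energy
  controls \<open>X 2\<close> with a gain of order \<open>1/a\<close> through the
  arithmetic-geometric inequality, and \<open>X_identity\<close> turns the bound on
  \<open>X 2\<close> into one on \<open>R\<close>.\<close>

lemma R_le_large: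
  assumes a: "a = \<bar>Re k\<bar>" "a \<ge> 32" and b: "\<bar>Im k\<bar> \<le> 1"
  shows "R \<le> 12 * a^2 * P"
proof -
  have b2: "(Im k)^2 \<le> 1" using b by (simp add: abs_square_le_1)
  have a2: "a^2 = (Re k)^2" using a by simp
  have a1024: "a^2 \<ge> 1024" using power_mono[of 32 a 2] a(2) by simp
  have alpha: "\<alpha> \<le> a^2" "\<alpha> \<ge> a^2 - 1" using b2 by (auto simp: \<alpha>_def a2 Re_power2)
  have beta: "\<bar>\<beta>\<bar> \<le> 2 * a"
  proof -
    have "\<bar>\<beta>\<bar> = 2 * a * \<bar>Im k\<bar>" by (simp add: \<beta>_def a abs_mult Im_power2)
    also have "\<dots> \<le> 2 * a * 1" using b a by (intro mult_left_mono) auto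
    finally show ?thesis by simp
  qed
  have k4: "(norm k) ^ 4 \<le> 2 * a ^ 4"
  proof -
    have "(norm k)^2 \<le> a^2 + 1" using b2 by (simp add: cmod_power2 a2)
    also have "\<dots> \<le> (5/4) * a^2" using a1024 by simp
    finally have "((norm k)^2)^2 \<le> ((5/4) * a^2)^2" by (intro power_mono) auto
    also have "\<dots> = (25/16) * a ^ 4" by (simp add: power_mult_distrib power2_eq_square power4_eq_xxxx)
    also have "\<dots> \<le> 2 * a ^ 4" by simp
    finally show ?thesis by (simp add: power_mult[symmetric])
  qed
  have sq: "sqrt \<alpha> \<ge> 15/16 * a"
  proof (rule real_le_rsqrt)
    have "(15/16 * a)^2 = (225/256) * a^2" by (simp add: power2_eq_square)
    also have "\<dots> \<le> a^2 - 1" using a1024 by simp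
    finally show "(15/16 * a)^2 \<le> \<alpha>" using alpha by linarith
  qed
  have a0: "a > 0" using a by simp
  have fh: "2 * (s * norm (F r) * norm (h r)) \<le> (norm (h r))^2 + s^2 * (norm (F r))^2" for r s
  proof -
    have "0 \<le> (norm (h r) - s * norm (F r))^2" by simp
    then show ?thesis by (simp add: power2_eq_square algebra_simps)
  qed
  have E2: "E 2 \<le> (a/8 + 4) * R + 262 * a^2 * P"
  proof -
    have "2 ^ (d - 2) * E 2 \<le> 2 ^ (d - 2) * ((a/8 + 4) * R + 6 * a^2 * P + 2 * (128 * a^2 * P))"
    proof (rule has_integral_le[OF E_identity])
      show "((\<lambda>r. 2 ^ (d - 2) * ((a/8 + 4) * (norm (h r))^2 + 6 * a^2 * (norm (F r))^2 + 128 * a^2 * P)) has_integral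
        2 ^ (d - 2) * ((a/8 + 4) * R + 6 * a^2 * P + 2 * (128 * a^2 * P))) {0..2}"
        using has_integral_const_real[of "128 * a^2 * P" 0 2]
        by (intro has_integral_mult_right has_integral_add hi_R hi_P) simp
      fix r :: real assume r: "r \<in> {0..2}"
      let ?G = "(norm (J r))^2 + a^2 * (norm (F r))^2 + 2 * (2 * a * (norm (F r) * norm (h r)))"
      have "\<beta> * (Im (F r) * Re (h r) - Re (F r) * Im (h r)) \<le> \<bar>\<beta>\<bar> * \<bar>Im (F r) * Re (h r) - Re (F r) * Im (h r)\<bar>"
        by (metis abs_mult abs_ge_self)
      also have "\<dots> \<le> 2 * a * (norm (F r) * norm (h r))"
        using beta abs_Y_le a0 by (intro mult_mono) auto
      moreover have "\<alpha> * (norm (F r))^2 \<le> a^2 * (norm (F r))^2" using alpha by (intro mult_right_mono) auto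
      ultimately have "(norm (J r))^2 + \<alpha> * (norm (F r))^2 + 2 * \<beta> * (Im (F r) * Re (h r) - Re (F r) * Im (h r)) \<le> ?G"
        by linarith
      then have "r ^ (d - 1) * ((norm (J r))^2 + \<alpha> * (norm (F r))^2 + 2 * \<beta> * (Im (F r) * Re (h r) - Re (F r) * Im (h r)))
          \<le> r ^ (d - 1) * ?G"
        using r by (intro mult_left_mono) auto
      also have "\<dots> \<le> (2 ^ (d - 2) * r) * ?G"
      proof (rule mult_right_mono)
        show "r ^ (d - 1) \<le> 2 ^ (d - 2) * r" using d r by (auto simp: power2_eq_square mult_right_mono)
      qed (use a0 in auto)
      also have "\<dots> = 2 ^ (d - 2) * (r * ?G)" by simp
      also have "\<dots> \<le> 2 ^ (d - 2) * ((a/8 + 4) * (norm (h r))^2 + 6 * a^2 * (norm (F r))^2 + 128 * a^2 * P)"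
      proof (rule mult_left_mono)
        \<comment> \<open>The choice \<open>e = 8/a\<close> leaves the coefficient
          \<open>a/8\<close> in front of \<open>R\<close>, small enough to be absorbed after the
          division by \<open>a\<close> below, and reduces \<open>a^4\<close> to \<open>a^2\<close>
          in the other term.\<close>
        have "r * (norm (J r))^2 \<le> (r * norm (J r))^2 / (8/a) + (norm k) ^ 4 * (8/a)^2 * P"
          using a0 by (intro weighted_J_le r) auto
        also have "(norm k) ^ 4 * (8/a)^2 * P \<le> (2 * a ^ 4) * (8/a)^2 * P"
          using k4 P_nonneg by (intro mult_right_mono) auto
        also have "(2 * a ^ 4) * (8/a)^2 * P = 128 * a^2 * P"
          using a0 by (simp add: field_simps power2_eq_square power4_eq_xxxx)
        also have "(r * norm (J r))^2 / (8/a) = a/8 * (norm (h r))^2"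
          using r by (simp add: norm_h)
        finally have 1: "r * (norm (J r))^2 \<le> a/8 * (norm (h r))^2 + 128 * a^2 * P" by simp
        have 2: "r * (a^2 * (norm (F r))^2) \<le> 2 * (a^2 * (norm (F r))^2)"
          using r by (intro mult_right_mono) auto
        have "r * (2 * (2 * a * (norm (F r) * norm (h r)))) \<le> 2 * (2 * (2 * a * (norm (F r) * norm (h r))))"
          using r a0 by (intro mult_right_mono) auto
        also have "\<dots> \<le> 4 * ((norm (h r))^2 + a^2 * (norm (F r))^2)"
          using fh[of a r] by (simp add: mult_ac)
        finally have 3: "r * (2 * (2 * a * (norm (F r) * norm (h r)))) \<le> 4 * ((norm (h r))^2 + a^2 * (norm (F r))^2)" .
        show "r * ?G \<le> (a/8 + 4) * (norm (h r))^2 + 6 * a^2 * (norm (F r))^2 + 128 * a^2 * P"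
          using 1 2 3 by (simp add: algebra_simps)
      qed simp
      finally show "r ^ (d - 1) * ((norm (J r))^2 + \<alpha> * (norm (F r))^2 + 2 * \<beta> * (Im (F r) * Re (h r) - Re (F r) * Im (h r)))
        \<le> 2 ^ (d - 2) * ((a/8 + 4) * (norm (h r))^2 + 6 * a^2 * (norm (F r))^2 + 128 * a^2 * P)" .
    qed
    then have "E 2 \<le> (a/8 + 4) * R + 6 * a^2 * P + 2 * (128 * a^2 * P)"
      by (subst (asm) mult_le_cancel_left_pos) auto
    then show ?thesis by (simp add: algebra_simps)
  qed
  have X2: "2 * X 2 \<le> 2/15 * R + 140 * (a * P)"
  proof (cases "X 2 > 0")
    case False
    moreover have "2/15 * R + 140 * (a * P) \<ge> 0" using R_nonneg P_nonneg a0 by simp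
    ultimately show ?thesis by linarith
  next
    case True
    have "15/4 * a * X 2 \<le> 4 * sqrt \<alpha> * X 2" using sq True by (intro mult_right_mono) auto
    also have "\<dots> \<le> 4 * sqrt \<alpha> * (norm (F 2) * norm (h 2))"
      using abs_X_le[of 2] alpha a1024 by (intro mult_left_mono) auto
    also have "\<dots> \<le> (norm (h 2))^2 + 4 * \<alpha> * (norm (F 2))^2"
      using fh[of "2 * sqrt \<alpha>" 2] alpha a1024 by (simp add: power_mult_distrib mult_ac)
    also have "\<dots> \<le> E 2"
      using True d by (auto simp: E_def cmod_power2)
    also note E2
    also have "(a/8 + 4) * R + 262 * a^2 * P \<le> (a/4) * R + 262 * a^2 * P"
      using a R_nonneg by (intro add_right_mono mult_right_mono) auto
    finally have "a * (15/4 * X 2) \<le> a * (R/4 + 262 * (a * P))"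
      by (simp add: algebra_simps power2_eq_square)
    then have "15/4 * X 2 \<le> R/4 + 262 * (a * P)" using a0 by simp
    moreover have "a * P \<ge> 0" using a0 P_nonneg by simp
    ultimately show ?thesis by simp
  qed
  have aP: "32 * (a * P) \<le> a^2 * P" "1024 * P \<le> a^2 * P"
    using mult_right_mono[OF a(2), of "a * P"] mult_right_mono[OF a1024 P_nonneg] a0 P_nonneg
    by (auto simp: power2_eq_square mult.assoc)
  \<comment> \<open>By \<open>X2\<close>, the right side contains at most
    \<open>(2/15 + 1/8) R\<close>, which the left side absorbs; the remaining terms are multiples of
    \<open>a^2 P\<close> because \<open>a \<ge> 32\<close>.\<close>
  have "R \<le> 2 * X 2 + 4 * a^2 * P + (R/8 + 2 * P)"
  proof (rule has_integral_le[OF hi_R])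
    show "((\<lambda>r. ((norm (h r))^2 - \<alpha> * (r^2 * (norm (F r))^2) + (3 - real d) * X r) + 4 * a^2 * (norm (F r))^2
       + ((norm (h r))^2 / 8 + 2 * (norm (F r))^2)) has_integral 2 * X 2 + 4 * a^2 * P + (R/8 + 2 * P)) {0..2}"
      using has_integral_mult_right[OF hi_R, of "1/8"]
      by (intro has_integral_add X_identity has_integral_mult_right hi_P) simp
    fix r :: real assume r: "r \<in> {0..2}"
    have "\<alpha> * (r^2 * (norm (F r))^2) \<le> a^2 * (2^2 * (norm (F r))^2)"
      using alpha r a1024 by (intro mult_mono power_mono) auto
    moreover have "- ((3 - real d) * X r) \<le> (norm (h r))^2 / 8 + 2 * (norm (F r))^2"
    proof -
      have "- ((3 - real d) * X r) \<le> norm (F r) * norm (h r)"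
        using d abs_X_le[of r] by auto
      then show ?thesis using fh[of 4 r] by simp
    qed
    ultimately show "(norm (h r))^2 \<le> ((norm (h r))^2 - \<alpha> * (r^2 * (norm (F r))^2) + (3 - real d) * X r) + 4 * a^2 * (norm (F r))^2
       + ((norm (h r))^2 / 8 + 2 * (norm (F r))^2)" by simp
  qed
  moreover have "a^2 * P \<ge> 0" using P_nonneg by simp
  ultimately have "R \<le> 12 * (a^2 * P)" using X2 aP by linarith
  then show ?thesis by simp
qed

text \<open>For \<open>|Re k| < 32\<close> one has \<open>|k|^2 \<le> 1024 + 1\<close>, and
  \<open>16 * 1025 = 16400\<close>. Beyond that \<open>R_le_large\<close> has the smaller constant
  12.\<close>

lemma R_le: "\<bar>Im k\<bar> \<le> 1 \<Longrightarrow> R \<le> 16400 * (norm k)^2 * P"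
proof -
  assume b: "\<bar>Im k\<bar> \<le> 1"
  have b2: "(Im k)^2 \<le> 1" using b by (simp add: abs_square_le_1)
  show ?thesis
  proof (cases "\<bar>Re k\<bar> \<ge> 32")
    case True
    have "R \<le> 12 * (Re k)^2 * P" using R_le_large[OF refl True b] by simp
    also have "\<dots> \<le> 16400 * (norm k)^2 * P"
      using P_nonneg by (intro mult_right_mono) (auto simp: cmod_power2)
    finally show ?thesis .
  next
    case False
    then have "(Re k)^2 \<le> 32^2" by (intro abs_le_square_iff[THEN iffD1]) auto
    then have "(norm k)^2 \<le> 1025" using b2 by (simp add: cmod_power2)
    then have "(norm k)^2 * ((norm k)^2 * P) \<le> 1025 * ((norm k)^2 * P)"
      using P_nonneg by (intro mult_right_mono) auto
    moreover have "R \<le> 16 * ((norm k)^2 * ((norm k)^2 * P))"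
      using R_le_small by (simp add: power2_eq_square power4_eq_xxxx mult_ac)
    ultimately show ?thesis by simp
  qed
qed

end

text \<open>Along \<open>k = a + i b\<close> with \<open>a\<close> fixed, compare
  \<open>A(b)\<close>, the weighted integral of \<open>|f|^2\<close>, with
  \<open>B(b) = Re charfun\<close>, the real part of the weighted integral of \<open>f^2\<close>.
  They agree at \<open>b = 0\<close>, where \<open>f\<close> is real, and both have derivatives
  bounded by \<open>514 A\<close>. Gronwall's argument for \<open>A\<close> then gives
  \<open>B(b) \<ge> A(0) (2 - exp(514 b))\<close>.\<close>

lemma charfun_strip:
  assumes d: "d = 2 \<or> d = (3::nat)"
  shows "\<exists>c>0. \<forall>l k. \<bar>Im k\<bar> < c \<longrightarrow> charfun d l (k^2) \<noteq> 0"
proof -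
  have main: "charfun d l (k^2) \<noteq> 0" if k: "0 \<le> Im k" "Im k < 1/1028" for l k
  proof -
    define N where "N = 2 * l + d"
    have N: "N \<ge> 1" using d by (auto simp: N_def)
    define f where "f k r = of_real (r ^ l) * bes N (k^2 * of_real (r^2))" for k and r :: real
    \<comment> \<open>The derivative of \<open>f\<close> in \<open>k\<close>. For
      \<open>k \<noteq> 0\<close>, \<open>k g\<close> is the function \<open>h\<close> of the radial
      system, so \<open>R_le\<close> bounds \<open>g\<close> by \<open>f\<close> after the factor
      \<open>|k|^2\<close> cancels.\<close>
    define g where "g k r = - (k * inverse (of_nat N)) * of_real (r ^ (l + 2)) * bes (N + 2) (k^2 * of_real (r^2))" for k and r :: real
    have dk: "((\<lambda>k. f k r) has_field_derivative g k r) (at k)" for k r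
    proof -
      have "((\<lambda>k. f k r) has_field_derivative of_real (r ^ l) * (- bes (N + 2) (k^2 * of_real (r^2)) / (2 * of_nat N) * (2 * k * of_real (r^2)))) (at k)"
        unfolding f_def using N by (auto intro!: derivative_eq_intros)
      also have "of_real (r ^ l) * (- bes (N + 2) (k^2 * of_real (r^2)) / (2 * of_nat N) * (2 * k * of_real (r^2))) = g k r"
        using N by (simp add: g_def field_simps power_add power2_eq_square)
      finally show ?thesis .
    qed
    have cf: "continuous_on S (\<lambda>x. f (p x) (q x))" if "continuous_on S p" "continuous_on S q" for S :: "'z::topological_space set" and p q
      unfolding f_def by (intro continuous_intros that N)
    have cg: "continuous_on S (\<lambda>x. g (p x) (q x))" if "continuous_on S p" "continuous_on S q" for S :: "'z::topological_space set" and p q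
      unfolding g_def by (intro continuous_intros that) (use N in simp)
    have key: "integral {0..2} (\<lambda>r. (norm (g k r))^2) \<le> 16400 * integral {0..2} (\<lambda>r. (norm (f k r))^2)" if "\<bar>Im k\<bar> \<le> 1" for k
    proof (cases "k = 0")
      case True
      have "integral {0..2} (\<lambda>r. (norm (f k r))^2) \<ge> 0"
        by (intro integral_nonneg integrable_continuous_real continuous_intros cf) auto
      then show ?thesis using True by (simp add: g_def)
    next
      case False
      interpret radial_system d l k by unfold_locales (rule d)
      have F: "F r = f k r" for r by (simp add: F_def f_def M_def N_def)
      have J: "of_real r * J r = k * g k r" for r
        by (simp add: J_def g_def M_def N_def divide_inverse power2_eq_square mult_ac)
      have "(r * norm (J r))^2 = (norm k)^2 * (norm (g k r))^2" if "r \<in> {0..2}" for r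
        using arg_cong[OF J[of r], of norm] that by (simp add: norm_mult power_mult_distrib)
      then have "R = integral {0..2} (\<lambda>r. (norm k)^2 * (norm (g k r))^2)"
        unfolding R_def by (intro integral_cong) auto
      then have R: "R = (norm k)^2 * integral {0..2} (\<lambda>r. (norm (g k r))^2)" by simp
      have "(norm k)^2 * integral {0..2} (\<lambda>r. (norm (g k r))^2) \<le> (norm k)^2 * (16400 * P)"
        using R_le[OF that] unfolding R by (simp add: mult_ac)
      then show ?thesis using False by (simp add: P_def F)
    qed
    define w where "w r = (2 + r) ^ (d - 1)" for r :: real
    have w: "w r \<ge> 2 ^ (d - 1)" "w r \<le> 4 ^ (d - 1)" if "r \<in> {0..2}" for r
      using that by (auto simp: w_def intro!: power_mono)
    have cw: "continuous_on S (\<lambda>x. w (q x))" if "continuous_on S q" for S :: "'z::topological_space set" and q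
      unfolding w_def by (intro continuous_intros that)
    define a where "a = Re k"
    define z where "z b = of_real a + \<i> * of_real b" for b :: real
    have cz: "continuous_on S (\<lambda>x. z (p x))" if "continuous_on S p" for S :: "'z::topological_space set" and p
      unfolding z_def by (intro continuous_intros that)
    have zk: "z (Im k) = k" by (simp add: z_def a_def complex_eq_iff)
    have dz: "((\<lambda>b. f (z b) r) has_vector_derivative \<i> * g (z b) r) (at b)" for b r
    proof -
      have "(z has_vector_derivative \<i>) (at b)"
        unfolding z_def by (auto intro!: derivative_eq_intros)
      from field_vector_diff_chain_at[OF this dk] show ?thesis by (simp add: o_def)
    qed
    define A where "A b = integral (cbox 0 2) (\<lambda>r. w r * (norm (f (z b) r))^2)" for b
    define A' where "A' b = integral (cbox 0 2) (\<lambda>r. w r * (2 * Re (cnj (f (z b) r) * (\<i> * g (z b) r))))" for b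
    define B where "B b = integral (cbox 0 2) (\<lambda>r. w r * Re ((f (z b) r)^2))" for b
    define B' where "B' b = integral (cbox 0 2) (\<lambda>r. w r * (2 * Re (f (z b) r * (\<i> * g (z b) r))))" for b
    have dRe: "((\<lambda>b. Re (f (z b) r)) has_real_derivative Re (\<i> * g (z b) r)) (at b)"
      and dIm: "((\<lambda>b. Im (f (z b) r)) has_real_derivative Im (\<i> * g (z b) r)) (at b)" for b r
      using bounded_linear.has_vector_derivative[OF bounded_linear_Re dz]
        bounded_linear.has_vector_derivative[OF bounded_linear_Im dz]
      by (auto simp: has_real_derivative_iff_has_vector_derivative)
    have dA: "(A has_real_derivative A' b) (at b)" for b
      unfolding A_def A'_def
    proof (rule leibniz_rule_field_derivative)
      show "((\<lambda>b. w r * (norm (f (z b) r))^2) has_real_derivative w r * (2 * Re (cnj (f (z b) r) * (\<i> * g (z b) r)))) (at b within UNIV)" for b r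
        unfolding cmod_power2
        by (rule derivative_eq_intros dRe dIm refl)+ (simp add: algebra_simps)
    qed (auto simp: case_prod_unfold intro!: integrable_continuous_real continuous_intros cf cg cw cz)
    have dB: "(B has_real_derivative B' b) (at b)" for b
      unfolding B_def B'_def
    proof (rule leibniz_rule_field_derivative)
      show "((\<lambda>b. w r * Re ((f (z b) r)^2)) has_real_derivative w r * (2 * Re (f (z b) r * (\<i> * g (z b) r)))) (at b within UNIV)" for b r
        unfolding Re_power2
        by (rule derivative_eq_intros dRe dIm refl)+ (simp add: algebra_simps)
    qed (auto simp: case_prod_unfold intro!: integrable_continuous_real continuous_intros cf cg cw cz)
    have hA: "((\<lambda>r. w r * (norm (f (z b) r))^2) has_integral A b) {0..2}" for b
      unfolding A_def box_real
      by (intro integrable_integral integrable_continuous_real continuous_intros cw cf cz)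
    have A0: "A b \<ge> 0" for b
      using w by (intro has_integral_nonneg[OF hA]) (auto simp: w_def)
    \<comment> \<open>The weight \<open>w\<close> lies between \<open>2^(d-1)\<close> and
      \<open>4^(d-1)\<close>, which costs a factor \<open>2^(d-1) \<le> 4\<close>; then
      \<open>4 * 16400 \<le> 257^2\<close>. A perfect square is convenient for the balanced product
      estimate that follows.\<close>
    have gle: "integral {0..2} (\<lambda>r. w r * (norm (g (z b) r))^2) \<le> 257^2 * A b" if b: "\<bar>b\<bar> \<le> 1" for b
    proof -
      have "integral {0..2} (\<lambda>r. w r * (norm (g (z b) r))^2) \<le> integral {0..2} (\<lambda>r. 4 ^ (d - 1) * (norm (g (z b) r))^2)"
        by (intro integral_le integrable_continuous_real continuous_intros cw cg cz mult_right_mono w) auto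
      also have "\<dots> = 4 ^ (d - 1) * integral {0..2} (\<lambda>r. (norm (g (z b) r))^2)" by simp
      also have "\<dots> \<le> 4 ^ (d - 1) * (16400 * integral {0..2} (\<lambda>r. (norm (f (z b) r))^2))"
        using b by (intro mult_left_mono key) (auto simp: z_def)
      also have "\<dots> = 16400 * 2 ^ (d - 1) * integral {0..2} (\<lambda>r. 2 ^ (d - 1) * (norm (f (z b) r))^2)"
        by (simp add: power_mult_distrib[symmetric])
      also have "\<dots> \<le> 16400 * 2 ^ (d - 1) * A b"
        unfolding integral_unique[OF hA, symmetric]
        by (intro mult_left_mono integral_le integrable_continuous_real continuous_intros cw cf cz mult_right_mono w) auto
      also have "\<dots> \<le> 257^2 * A b"
        using d A0 by (intro mult_right_mono) auto
      finally show ?thesis .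
    qed
    have bound: "\<bar>integral (cbox 0 2) (\<lambda>r. w r * (2 * Re (u r * (\<i> * g (z b) r))))\<bar> \<le> 514 * A b"
      if b: "\<bar>b\<bar> \<le> 1" and u: "\<And>r. norm (u r) = norm (f (z b) r)" "continuous_on {0..2} u" for b u
    proof -
      have "norm (integral {0..2} (\<lambda>r. w r * (2 * Re (u r * (\<i> * g (z b) r))))) \<le>
         integral {0..2} (\<lambda>r. 257 * (w r * (norm (f (z b) r))^2) + (1/257) * (w r * (norm (g (z b) r))^2))"
      proof (rule integral_norm_bound_integral)
        fix r :: real assume r: "r \<in> {0..2}"
        have "\<bar>Re (u r * (\<i> * g (z b) r))\<bar> \<le> norm (f (z b) r) * norm (g (z b) r)"
          using abs_Re_le_cmod[of "u r * (\<i> * g (z b) r)"] u by (simp add: norm_mult)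
        moreover have "0 \<le> (257 * norm (f (z b) r) - norm (g (z b) r))^2" by simp
        then have "2 * (norm (f (z b) r) * norm (g (z b) r)) \<le> 257 * (norm (f (z b) r))^2 + (1/257) * (norm (g (z b) r))^2"
          by (simp add: power2_eq_square algebra_simps)
        ultimately have "2 * \<bar>Re (u r * (\<i> * g (z b) r))\<bar> \<le> 257 * (norm (f (z b) r))^2 + (1/257) * (norm (g (z b) r))^2"
          by linarith
        moreover have w0: "w r \<ge> 0" using r by (simp add: w_def)
        ultimately have "w r * (2 * \<bar>Re (u r * (\<i> * g (z b) r))\<bar>) \<le> w r * (257 * (norm (f (z b) r))^2 + (1/257) * (norm (g (z b) r))^2)"
          by (intro mult_left_mono) auto
        have "norm (w r * (2 * Re (u r * (\<i> * g (z b) r)))) = w r * (2 * \<bar>Re (u r * (\<i> * g (z b) r))\<bar>)"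
        proof -
          have "norm (w r * (2 * x)) = w r * (2 * \<bar>x\<bar>)" for x using w0 by (simp add: abs_mult)
          then show ?thesis .
        qed
        show "norm (w r * (2 * Re (u r * (\<i> * g (z b) r)))) \<le> 257 * (w r * (norm (f (z b) r))^2) + (1/257) * (w r * (norm (g (z b) r))^2)"
        proof -
          have "w r * (257 * x + (1/257) * y) = 257 * (w r * x) + (1/257) * (w r * y)" for x y
            by (simp add: algebra_simps)
          then show ?thesis
            using \<open>w r * (2 * \<bar>Re (u r * (\<i> * g (z b) r))\<bar>) \<le> _\<close> \<open>norm (w r * _) = _\<close> by (simp only:)
        qed
      qed (intro integrable_continuous_real continuous_intros cw cf cg cz u(2))+
      also have "\<dots> = 257 * A b + (1/257) * integral {0..2} (\<lambda>r. w r * (norm (g (z b) r))^2)"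
        by (intro integral_unique has_integral_add has_integral_mult_right hA integrable_integral)
           (intro integrable_continuous_real continuous_intros cw cg cz)
      also have "\<dots> \<le> 514 * A b" using gle[OF b] by simp
      finally show ?thesis by simp
    qed
    have A'_le: "\<bar>A' b\<bar> \<le> 514 * A b" and B'_le: "\<bar>B' b\<bar> \<le> 514 * A b" if "\<bar>b\<bar> \<le> 1" for b
      unfolding A'_def B'_def using that by (intro bound; auto intro!: continuous_intros cf cz)+
    have A_le: "A b \<le> exp (514 * b) * A 0" if b: "0 \<le> b" "b \<le> 1" for b
    proof -
      have "exp (- (514 * b)) * A b \<le> exp (- (514 * 0)) * A 0"
      proof (rule DERIV_nonpos_imp_nonincreasing[OF b(1)])
        fix x assume x: "0 \<le> x" "x \<le> b"
        have "((\<lambda>b. exp (- (514 * b)) * A b) has_real_derivative exp (- (514 * x)) * (A' x - 514 * A x)) (at x)"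
          by (rule derivative_eq_intros dA refl)+ (simp add: algebra_simps)
        moreover have "exp (- (514 * x)) * (A' x - 514 * A x) \<le> 0"
          using A'_le[of x] x b by (intro mult_nonneg_nonpos) auto
        ultimately show "\<exists>y. ((\<lambda>b. exp (- (514 * b)) * A b) has_real_derivative y) (at x) \<and> y \<le> 0" by blast
      qed
      then have "exp (514 * b) * (exp (- (514 * b)) * A b) \<le> exp (514 * b) * A 0" by simp
      then show ?thesis by (simp add: exp_minus field_simps)
    qed
    \<comment> \<open>The derivative of \<open>B + A(0) exp(514 b)\<close> is nonnegative because
      \<open>|B'| \<le> 514 A \<le> 514 A(0) exp(514 b)\<close>.\<close>
    have "B 0 + A 0 * exp (514 * 0) \<le> B (Im k) + A 0 * exp (514 * Im k)"
    proof (rule DERIV_nonneg_imp_nondecreasing[OF k(1)])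
      fix x assume x: "0 \<le> x" "x \<le> Im k"
      have "((\<lambda>b. B b + A 0 * exp (514 * b)) has_real_derivative B' x + 514 * (A 0 * exp (514 * x))) (at x)"
        by (rule derivative_eq_intros dB refl)+ (simp add: algebra_simps)
      moreover have "B' x + 514 * (A 0 * exp (514 * x)) \<ge> 0"
        using B'_le[of x] A_le[of x] x k by (simp add: mult.commute)
      ultimately show "\<exists>y. ((\<lambda>b. B b + A 0 * exp (514 * b)) has_real_derivative y) (at x) \<and> 0 \<le> y" by blast
    qed
    then have BA: "B (Im k) \<ge> B 0 + A 0 - A 0 * exp (514 * Im k)" by simp
    have Bchar: "B b = Re (charfun d l ((z b)^2))" for b
    proof -
      have d1: "d \<ge> 1" using d by auto
      have "Re (charfun d l ((z b)^2)) = integral {0..2} (\<lambda>r. Re (of_real ((2 + r) ^ (d - 1) * r ^ (2 * l)) * (bes (2 * l + d) ((z b)^2 * of_real (r^2)))^2))"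
        unfolding charfun_def by (rule integral_linear[OF charfun_integrable[OF d1] bounded_linear_Re, unfolded o_def, symmetric])
      also have "(\<lambda>r. Re (of_real ((2 + r) ^ (d - 1) * r ^ (2 * l)) * (bes (2 * l + d) ((z b)^2 * of_real (r^2)))^2)) = (\<lambda>r. w r * Re ((f (z b) r)^2))"
      proof
        fix r
        have "of_real ((2 + r) ^ (d - 1) * r ^ (2 * l)) * (bes (2 * l + d) ((z b)^2 * of_real (r^2)))^2 = of_real (w r) * (f (z b) r)^2"
          by (simp add: w_def f_def N_def power_mult_distrib power_mult[symmetric] mult.commute)
        then show "Re (of_real ((2 + r) ^ (d - 1) * r ^ (2 * l)) * (bes (2 * l + d) ((z b)^2 * of_real (r^2)))^2) = w r * Re ((f (z b) r)^2)"
          by (simp only: Re_of_real_mult)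
      qed
      finally show ?thesis by (simp add: B_def)
    qed
    have real_f: "Re ((f (z 0) r)^2) = (norm (f (z 0) r))^2" for r
    proof -
      have "f (z 0) r \<in> \<real>"
      proof -
        have "bes N (of_real (a^2 * r^2)) \<in> \<real>" by (rule bes_of_real[OF N])
        then show ?thesis by (simp add: f_def z_def)
      qed
      then show ?thesis by (auto elim!: Reals_cases simp: norm_power[symmetric] simp flip: of_real_power)
    qed
    have BA0: "B 0 = A 0" by (simp add: B_def A_def real_f)
    have "A 0 > 0"
    proof -
      have "charfun d l ((z 0)^2) \<noteq> 0" by (rule charfun_real_pos) (use d in \<open>auto simp: z_def\<close>)
      moreover have "charfun d l ((z 0)^2) = of_real (A 0)"
      proof -
        have e: "of_real ((2 + r) ^ (d - 1) * r ^ (2 * l)) * (bes (2 * l + d) ((z 0)^2 * of_real (r^2)))^2 = (of_real (w r * (norm (f (z 0) r))^2) :: complex)" for r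
        proof -
          have "bes N (of_real (a^2 * r^2)) \<in> \<real>" by (rule bes_of_real[OF N])
          then have "f (z 0) r \<in> \<real>" by (simp add: f_def z_def)
          then have "(f (z 0) r)^2 = of_real ((norm (f (z 0) r))^2)"
            by (auto elim!: Reals_cases simp: norm_power[symmetric] simp flip: of_real_power)
          moreover have "of_real ((2 + r) ^ (d - 1) * r ^ (2 * l)) * (bes (2 * l + d) ((z 0)^2 * of_real (r^2)))^2 = of_real (w r) * (f (z 0) r)^2"
            by (simp add: w_def f_def N_def power_mult_distrib power_mult[symmetric] mult.commute)
          ultimately show ?thesis by simp
        qed
        show ?thesis unfolding charfun_def e
          by (rule integral_unique) (rule has_integral_of_real[OF hA])
      qed
      ultimately have "A 0 \<noteq> 0" by auto
      then show ?thesis using A0[of 0] by linarith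
    qed
    \<comment> \<open>The width \<open>1/1028\<close> is half of \<open>1/514\<close>, so the
      exponent is at most \<open>1/2\<close> and the exponential at most \<open>7/4\<close>.\<close>
    moreover have "exp (514 * Im k) < 2"
    proof -
      have "exp (514 * Im k) \<le> exp (1/2)" using k by simp
      also have "exp (1/2) \<le> (1 + 1/2 + (1/2)^2 :: real)" by (rule exp_bound) auto
      also have "\<dots> < 2" by (simp add: power2_eq_square)
      finally show ?thesis .
    qed
    ultimately have "A 0 * exp (514 * Im k) < A 0 * 2" by (intro mult_strict_left_mono)
    then have "B (Im k) > 0" using BA BA0 by linarith
    then show ?thesis using Bchar[of "Im k"] unfolding zk by auto
  qed
  show ?thesis
  proof (intro exI[of _ "1/1028"] conjI allI impI)
    fix l and k :: complex assume k: "\<bar>Im k\<bar> < 1/1028"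
    show "charfun d l (k^2) \<noteq> 0"
    proof (cases "Im k \<ge> 0")
      case True then show ?thesis using main[of k l] k by simp
    next
      case False then show ?thesis using main[of "- k" l] k by simp
    qed
  qed simp
qed

section \<open>Smooth and radial functions\<close>

lemma partials_Nil [simp]: "partials [] f = f"
  by (simp add: partials_def)

lemma partials_Cons: "partials (b # bs) f = partials [b] (partials bs f)"
  by (simp add: partials_def)

lemma partials_append: "partials (as @ bs) f = partials as (partials bs f)"
  by (simp add: partials_def)

lemma partials_single:
  assumes "\<And>x. (f has_derivative f' x) (at x)"
  shows "partials [b] f = (\<lambda>x. f' x b)"
  using frechet_derivative_at[OF assms] by (simp add: partials_def)

lemma partials_single_at:
  assumes "(f has_derivative f') (at x)"
  shows "partials [b] f x = f' b"
  using frechet_derivative_at[OF assms] by (simp add: partials_def)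

lemma partials_has_derivative:
  assumes "f differentiable at x"
  shows "(f has_derivative (\<lambda>h. \<Sum>b\<in>Basis. (h \<bullet> b) *\<^sub>R partials [b] f x)) (at x)"
proof -
  obtain f' where f': "(f has_derivative f') (at x)" using assms by (auto simp: differentiable_def)
  have "f' = (\<lambda>h. \<Sum>b\<in>Basis. (h \<bullet> b) *\<^sub>R partials [b] f x)"
  proof
    fix h
    interpret linear f' using f' has_derivative_linear by blast
    have "f' h = f' (\<Sum>b\<in>Basis. (h \<bullet> b) *\<^sub>R b)" by (simp add: euclidean_representation)
    then show "f' h = (\<Sum>b\<in>Basis. (h \<bullet> b) *\<^sub>R partials [b] f x)"
      by (simp add: sum scale partials_single_at[OF f'])
  qed
  then show ?thesis using f' by simp
qed

text \<open>A version of \<open>smooth\<close> graded by order: closure under products and under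
  radial composition is proved by induction on the order.\<close>

definition Ck :: "nat \<Rightarrow> ('a::euclidean_space \<Rightarrow> complex) \<Rightarrow> bool" where
  "Ck n f \<longleftrightarrow> (\<forall>bs x. set bs \<subseteq> Basis \<longrightarrow> length bs \<le> n \<longrightarrow> partials bs f differentiable (at x))"

lemma smooth_iff_Ck: "smooth f \<longleftrightarrow> (\<forall>n. Ck n f)"
  unfolding smooth_def Ck_def by (meson order_refl)

lemma Ck_mono: "Ck m f \<Longrightarrow> n \<le> m \<Longrightarrow> Ck n f"
  by (auto simp: Ck_def)

lemma Ck_differentiable: "Ck n f \<Longrightarrow> f differentiable (at x)"
  unfolding Ck_def by (metis empty_subsetI le0 list.set(1) list.size(3) partials_Nil)

lemma Ck_0: "Ck 0 f \<longleftrightarrow> (\<forall>x. f differentiable (at x))"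
  by (auto simp: Ck_def)

text \<open>It is the innermost derivative that is split off. \<open>partials\<close> folds from the
  right, so this is the last element of the list.\<close>

lemma Ck_Suc: "Ck (Suc n) f \<longleftrightarrow> (\<forall>x. f differentiable (at x)) \<and> (\<forall>b\<in>Basis. Ck n (partials [b] f))"
proof (intro iffI conjI allI ballI)
  assume *: "Ck (Suc n) f"
  show "f differentiable (at x)" for x by (rule Ck_differentiable[OF *])
  fix b :: 'a assume b: "b \<in> Basis"
  show "Ck n (partials [b] f)"
    unfolding Ck_def
  proof (intro allI impI)
    fix bs x assume "set bs \<subseteq> (Basis :: 'a set)" "length bs \<le> n"
    then show "partials bs (partials [b] f) differentiable (at x)"
      using *[unfolded Ck_def, rule_format, of "bs @ [b]" x] b by (simp add: partials_append)
  qed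
next
  assume *: "(\<forall>x. f differentiable (at x)) \<and> (\<forall>b\<in>Basis. Ck n (partials [b] f))"
  show "Ck (Suc n) f" unfolding Ck_def
  proof (intro allI impI)
    fix bs x assume bs: "set bs \<subseteq> (Basis :: 'a set)" "length bs \<le> Suc n"
    show "partials bs f differentiable (at x)"
    proof (cases bs rule: rev_cases)
      case Nil then show ?thesis using * by simp
    next
      case (snoc as b)
      then have "Ck n (partials [b] f)" using * bs by simp
      then show ?thesis using bs snoc unfolding Ck_def by (simp add: partials_append)
    qed
  qed
qed

lemma Ck_continuous_on: "Ck n f \<Longrightarrow> continuous_on S f"
  by (meson Ck_differentiable continuous_at_imp_continuous_on differentiable_imp_continuous_within)

lemma Ck_partials: "Ck (n + length bs) f \<Longrightarrow> set bs \<subseteq> Basis \<Longrightarrow> Ck n (partials bs f)"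
proof (induction bs arbitrary: n)
  case (Cons b bs)
  then have "Ck (Suc n) (partials bs f)" by simp
  then show ?case using Cons.prems by (subst partials_Cons) (simp add: Ck_Suc)
qed simp

lemma smooth_differentiable: "smooth f \<Longrightarrow> f differentiable (at x)"
  using Ck_differentiable smooth_iff_Ck by blast

lemma smooth_partials: "smooth f \<Longrightarrow> set bs \<subseteq> Basis \<Longrightarrow> smooth (partials bs f)"
  using Ck_partials smooth_iff_Ck by blast

lemma smooth_continuous_on: "smooth f \<Longrightarrow> continuous_on S f"
  using Ck_continuous_on smooth_iff_Ck by blast

lemma smooth_partials_continuous_on: "smooth f \<Longrightarrow> set bs \<subseteq> Basis \<Longrightarrow> continuous_on S (partials bs f)"
  by (intro smooth_continuous_on smooth_partials)

lemma partials_const [simp]: "partials [b] (\<lambda>x. c) = (\<lambda>x. 0)"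
  by (subst partials_single[of _ "\<lambda>x h. 0"]) auto

lemma Ck_const [simp]: "Ck n (\<lambda>x. c)"
  by (induction n arbitrary: c) (auto simp: Ck_0 Ck_Suc)

lemma partials_add:
  assumes "\<And>x. f differentiable (at x)" "\<And>x. g differentiable (at x)"
  shows "partials [b] (\<lambda>x. f x + g x) = (\<lambda>x. partials [b] f x + partials [b] g x)"
  by (subst partials_single[OF has_derivative_add[OF frechet_derivative_works[THEN iffD1, OF assms(1)] frechet_derivative_works[THEN iffD1, OF assms(2)]]])
     (simp add: partials_def)

lemma Ck_add: "Ck n f \<Longrightarrow> Ck n g \<Longrightarrow> Ck n (\<lambda>x. f x + g x)"
proof (induction n arbitrary: f g)
  case 0 then show ?case by (auto simp: Ck_0 intro: differentiable_add)
next
  case (Suc n)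
  then show ?case
    by (auto simp: Ck_Suc partials_add intro: differentiable_add)
qed

lemma partials_mult:
  assumes "\<And>x. f differentiable (at x)" "\<And>x. g differentiable (at x)"
  shows "partials [b] (\<lambda>x. f x * g x) = (\<lambda>x. partials [b] f x * g x + f x * partials [b] g x)"
  by (subst partials_single[OF has_derivative_mult[OF frechet_derivative_works[THEN iffD1, OF assms(1)] frechet_derivative_works[THEN iffD1, OF assms(2)]]])
     (simp add: partials_def add.commute)

lemma Ck_mult: "Ck n f \<Longrightarrow> Ck n g \<Longrightarrow> Ck n (\<lambda>x. f x * g x)"
proof (induction n arbitrary: f g)
  case 0 then show ?case by (auto simp: Ck_0 intro: differentiable_mult)
next
  case (Suc n)
  have "Ck n f" "Ck n g" using Suc.prems Ck_mono[of "Suc n" _ n] by auto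
  then show ?case using Suc
    by (auto simp: Ck_Suc partials_mult intro!: differentiable_mult Ck_add Suc.IH)
qed

lemma Ck_sum: "(\<And>i. i \<in> I \<Longrightarrow> Ck n (f i)) \<Longrightarrow> Ck n (\<lambda>x. \<Sum>i\<in>I. f i x)"
  by (induction I rule: infinite_finite_induct) (auto intro: Ck_add)

lemma Ck_uminus: "Ck n f \<Longrightarrow> Ck n (\<lambda>x. - f x)"
  using Ck_mult[OF Ck_const[of n "-1"], of f] by simp

lemma Ck_diff: "Ck n f \<Longrightarrow> Ck n g \<Longrightarrow> Ck n (\<lambda>x. f x - g x)"
  using Ck_add[of n f "\<lambda>x. - g x"] Ck_uminus[of n g] by simp

lemma partials_coord: "partials [b] (\<lambda>x. of_real (x \<bullet> c)) = (\<lambda>x. of_real (b \<bullet> c))"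
proof -
  have "((\<lambda>x. complex_of_real (x \<bullet> c)) has_derivative (\<lambda>h. of_real (h \<bullet> c))) (at x)" for x
    by (auto intro!: derivative_eq_intros)
  from partials_single[OF this] show ?thesis .
qed

lemma Ck_coord [simp]: "Ck n (\<lambda>x. of_real (x \<bullet> c))"
proof -
  have "(\<lambda>x. complex_of_real (x \<bullet> c)) differentiable (at x)" for x
    unfolding differentiable_def by (rule exI) (auto intro!: derivative_eq_intros)
  then show ?thesis by (cases n) (auto simp: Ck_0 Ck_Suc partials_coord)
qed

lemma smooth_const [simp]: "smooth (\<lambda>x. c)"
  and smooth_coord [simp]: "smooth (\<lambda>x. of_real (x \<bullet> b))"
  and smooth_add: "smooth f \<Longrightarrow> smooth g \<Longrightarrow> smooth (\<lambda>x. f x + g x)"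
  and smooth_mult: "smooth f \<Longrightarrow> smooth g \<Longrightarrow> smooth (\<lambda>x. f x * g x)"
  and smooth_diff: "smooth f \<Longrightarrow> smooth g \<Longrightarrow> smooth (\<lambda>x. f x - g x)"
  by (auto simp: smooth_iff_Ck Ck_add Ck_mult Ck_diff)

lemma smooth_sum: "(\<And>i. i \<in> I \<Longrightarrow> smooth (f i)) \<Longrightarrow> smooth (\<lambda>x. \<Sum>i\<in>I. f i x)"
  by (auto simp: smooth_iff_Ck intro: Ck_sum)

lemma laplacian_eq: "laplacian f x = (\<Sum>b\<in>Basis. partials [b] (partials [b] f) x)"
  by (simp add: laplacian_def partials_Cons[of _ "[_]"])

lemma laplacian_add:
  assumes "Ck 1 f" "Ck 1 g"
  shows "laplacian (\<lambda>x. f x + g x) x = laplacian f x + laplacian g x"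
  using assms by (simp add: laplacian_eq partials_add Ck_Suc Ck_0 sum.distrib)

lemma laplacian_mult:
  assumes "Ck 1 f" "Ck 1 g"
  shows "laplacian (\<lambda>x. f x * g x) x =
    laplacian f x * g x + 2 * (\<Sum>b\<in>Basis. partials [b] f x * partials [b] g x) + f x * laplacian g x"
proof -
  have d: "f differentiable (at x)" "g differentiable (at x)" for x
    using assms Ck_differentiable by auto
  have "partials [b] (partials [b] (\<lambda>x. f x * g x)) x = partials [b] (partials [b] f) x * g x
      + 2 * (partials [b] f x * partials [b] g x) + f x * partials [b] (partials [b] g) x" if b: "b \<in> Basis" for b
  proof -
    have d': "partials [b] f differentiable (at x)" "partials [b] g differentiable (at x)" for x
      using assms b by (auto simp: Ck_Suc Ck_0)
    then show ?thesis
      by (simp add: partials_mult[OF d] partials_add partials_mult[OF d'(1) d(2)] partials_mult[OF d(1) d'(2)]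
          differentiable_mult d)
  qed
  then show ?thesis
    by (simp add: laplacian_eq sum.distrib sum_distrib_left sum_distrib_right)
qed

lemma laplacian_const [simp]: "laplacian (\<lambda>x. c) = (\<lambda>x. 0)"
  by (auto simp: laplacian_eq)

lemma laplacian_cmult: "Ck 1 f \<Longrightarrow> laplacian (\<lambda>x. c * f x) x = c * laplacian f x"
  using laplacian_mult[of "\<lambda>x. c" f x] by simp

section \<open>Radial functions\<close>

lemma radial_has_derivative:
  assumes "(g has_vector_derivative g') (at (c + e * (x \<bullet> x)))"
  shows "((\<lambda>x::'a::euclidean_space. g (c + e * (x \<bullet> x)) :: complex) has_derivative
     (\<lambda>h. of_real (2 * e * (x \<bullet> h)) * g')) (at x)"
proof -
  have "((\<lambda>x::'a. c + e * (x \<bullet> x)) has_derivative (\<lambda>h. e * (x \<bullet> h + h \<bullet> x))) (at x)"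
    by (auto intro!: derivative_eq_intros)
  from diff_chain_at[OF this assms[unfolded has_vector_derivative_def]]
  show ?thesis
    by (simp add: o_def inner_commute scaleR_conv_of_real mult_ac algebra_simps)
qed

lemma partials_radial:
  assumes "(g has_vector_derivative g') (at (c + e * (x \<bullet> x)))"
  shows "partials [b] (\<lambda>x. g (c + e * (x \<bullet> x))) x = of_real (x \<bullet> b) * (of_real (2 * e) * g')"
  using partials_single_at[OF radial_has_derivative[OF assms], of b] by simp

lemma partials_radial_fun:
  assumes "\<And>x::'a::euclidean_space. (g has_vector_derivative g' (c + e * (x \<bullet> x))) (at (c + e * (x \<bullet> x)))"
  shows "partials [b] (\<lambda>x::'a. g (c + e * (x \<bullet> x))) =
    (\<lambda>x. of_real (x \<bullet> b) * (of_real (2 * e) * g' (c + e * (x \<bullet> x))))"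
  using partials_radial[OF assms] by auto

text \<open>A partial derivative turns \<open>g(c + e |x|^2)\<close> into a coordinate times the
  same expression for \<open>g'\<close>. A set of profiles closed under differentiation therefore
  replaces explicit formulas for higher derivatives. \<open>T\<close> only has to contain the values
  of \<open>c + e |x|^2\<close>, which admits profiles that are singular at
  \<open>s = 0\<close>.\<close>

lemma Ck_radial_family:
  fixes G :: "(real \<Rightarrow> complex) set"
  assumes cl: "\<And>g. g \<in> G \<Longrightarrow> \<exists>g'\<in>G. \<forall>s\<in>T. (g has_vector_derivative g' s) (at s)"
    and T: "\<And>x::'a::euclidean_space. c + e * (x \<bullet> x) \<in> T" and "g \<in> G"
  shows "Ck n (\<lambda>x::'a. g (c + e * (x \<bullet> x)))"
  using \<open>g \<in> G\<close>
proof (induction n arbitrary: g)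
  case 0
  then obtain g' where g': "\<forall>s\<in>T. (g has_vector_derivative g' s) (at s)" using cl by blast
  then have "(\<lambda>x::'a. g (c + e * (x \<bullet> x))) differentiable (at x)" for x
    unfolding differentiable_def using radial_has_derivative[of g "g' (c + e * (x \<bullet> x))" c e x] T by blast
  then show ?case by (simp add: Ck_0)
next
  case (Suc n)
  then obtain g' where g': "g' \<in> G" "\<forall>s\<in>T. (g has_vector_derivative g' s) (at s)" using cl by blast
  then have d: "(\<lambda>x::'a. g (c + e * (x \<bullet> x))) differentiable (at x)" for x
    unfolding differentiable_def using radial_has_derivative[of g "g' (c + e * (x \<bullet> x))" c e x] T by blast
  have "partials [b] (\<lambda>x::'a. g (c + e * (x \<bullet> x))) =
    (\<lambda>x. of_real (x \<bullet> b) * (of_real (2 * e) * g' (c + e * (x \<bullet> x))))" for b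
    by (rule partials_radial_fun) (use g' T in blast)
  then show ?case unfolding Ck_Suc using d Suc.IH[OF g'(1)]
    by (auto intro!: Ck_mult)
qed

lemma smooth_radial_family:
  fixes G :: "(real \<Rightarrow> complex) set"
  assumes "\<And>g. g \<in> G \<Longrightarrow> \<exists>g'\<in>G. \<forall>s\<in>T. (g has_vector_derivative g' s) (at s)"
    and "\<And>x::'a::euclidean_space. c + e * (x \<bullet> x) \<in> T" and "g \<in> G"
  shows "smooth (\<lambda>x::'a. g (c + e * (x \<bullet> x)))"
  using Ck_radial_family[OF assms] by (simp add: smooth_iff_Ck)

lemma inner_self_eq_sum: "(\<Sum>b\<in>Basis. (x \<bullet> b) * (x \<bullet> b)) = x \<bullet> (x::'a::euclidean_space)"
  by (subst (3) euclidean_inner) simp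

lemma laplacian_radial:
  assumes g: "\<And>s. s \<in> T \<Longrightarrow> (g has_vector_derivative g' s) (at s)" "\<And>s. s \<in> T \<Longrightarrow> (g' has_vector_derivative g'' s) (at s)"
    and T: "\<And>x::'a::euclidean_space. c + e * (x \<bullet> x) \<in> T"
  shows "laplacian (\<lambda>x::'a. g (c + e * (x \<bullet> x))) x =
    of_real (4 * e\<^sup>2 * (x \<bullet> x)) * g'' (c + e * (x \<bullet> x)) + of_real (2 * e * DIM('a)) * g' (c + e * (x \<bullet> x))"
proof -
  let ?s = "\<lambda>x::'a. c + e * (x \<bullet> x)"
  have 1: "partials [b] (\<lambda>x::'a. g (?s x)) = (\<lambda>x. of_real (x \<bullet> b) * (of_real (2 * e) * g' (?s x)))" for b
    by (rule partials_radial_fun) (use g(1) T in blast)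
  have d2: "(\<lambda>x::'a. of_real (2 * e) * g' (?s x)) differentiable (at x)" for x
    using radial_has_derivative[OF g(2)[OF T]] by (intro differentiable_mult) (auto simp: differentiable_def)
  have d3: "(\<lambda>x::'a. complex_of_real (x \<bullet> b)) differentiable (at x)" for b x
    using Ck_differentiable[OF Ck_coord] .
  have d4: "(\<lambda>x::'a. g' (?s x)) differentiable (at x)" for x
    using radial_has_derivative[OF g(2)[OF T]] by (auto simp: differentiable_def)
  have 2: "partials [b] (\<lambda>x::'a. of_real (2 * e) * g' (?s x)) = (\<lambda>x. of_real (2 * e) * (of_real (x \<bullet> b) * (of_real (2 * e) * g'' (?s x))))" for b
  proof -
    have "partials [b] (\<lambda>x::'a. g' (?s x)) = (\<lambda>x. of_real (x \<bullet> b) * (of_real (2 * e) * g'' (?s x)))"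
      by (rule partials_radial_fun) (use g(2) T in blast)
    then show ?thesis using d4 by (subst partials_mult) auto
  qed
  have "laplacian (\<lambda>x::'a. g (?s x)) x = (\<Sum>b\<in>Basis. of_real (2 * e) * g' (?s x)
       + of_real (4 * e\<^sup>2 * ((x \<bullet> b) * (x \<bullet> b))) * g'' (?s x))"
    unfolding laplacian_eq 1
    by (intro sum.cong refl, subst partials_mult[OF d3 d2], simp only: partials_coord 2)
       (simp add: inner_Basis power2_eq_square algebra_simps)
  also have "\<dots> = of_real (2 * e) * g' (?s x) * of_nat DIM('a) + of_real (4 * e\<^sup>2 * (\<Sum>b\<in>Basis. (x \<bullet> b) * (x \<bullet> b))) * g'' (?s x)"
    by (simp add: sum.distrib sum_distrib_left sum_distrib_right)
  finally show ?thesis by (simp add: inner_self_eq_sum)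
qed

text \<open>Homogeneous polynomials, generated so that degree, smoothness, Euler's identity and size
  bounds can be read off by induction. The zero function has every degree, which avoids case
  distinctions after differentiation.\<close>

inductive hpoly :: "nat \<Rightarrow> ('a::euclidean_space \<Rightarrow> complex) \<Rightarrow> bool" where
  hpoly_const: "hpoly 0 (\<lambda>x. c)"
| hpoly_coord_mult: "hpoly n p \<Longrightarrow> b \<in> Basis \<Longrightarrow> hpoly (Suc n) (\<lambda>x. of_real (x \<bullet> b) * p x)"
| hpoly_add: "hpoly n p \<Longrightarrow> hpoly n q \<Longrightarrow> hpoly n (\<lambda>x. p x + q x)"

lemma hpoly_zero: "hpoly n (\<lambda>x. 0)"
proof (induction n)
  case (Suc n)
  obtain b :: 'a where "b \<in> Basis" using nonempty_Basis by blast
  from hpoly_coord_mult[OF Suc this] show ?case by simp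
qed (rule hpoly_const)

lemma hpoly_cmult: "hpoly n p \<Longrightarrow> hpoly n (\<lambda>x. c * p x)"
proof (induction rule: hpoly.induct)
  case (hpoly_coord_mult n p b)
  from hpoly.hpoly_coord_mult[OF hpoly_coord_mult(3,2)] show ?case by (simp add: mult.left_commute)
next
  case (hpoly_add n p q)
  from hpoly.hpoly_add[OF hpoly_add(3,4)] show ?case by (simp add: distrib_left)
qed (rule hpoly_const)

lemma hpoly_mult: "hpoly n p \<Longrightarrow> hpoly m q \<Longrightarrow> hpoly (n + m) (\<lambda>x. p x * q x)"
proof (induction rule: hpoly.induct)
  case (hpoly_const c)
  then show ?case by (simp add: hpoly_cmult)
next
  case (hpoly_coord_mult n p b)
  from hpoly.hpoly_coord_mult[OF hpoly_coord_mult(3)[OF hpoly_coord_mult(4)] hpoly_coord_mult(2)]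
  show ?case by (simp add: mult.assoc)
next
  case (hpoly_add n p q)
  from hpoly.hpoly_add[OF hpoly_add(3,4)] hpoly_add(5) show ?case by (simp add: distrib_right)
qed

lemma hpoly_sum: "(\<And>i. i \<in> I \<Longrightarrow> hpoly n (p i)) \<Longrightarrow> hpoly n (\<lambda>x. \<Sum>i\<in>I. p i x)"
  by (induction I rule: infinite_finite_induct) (auto intro: hpoly_zero hpoly_add)

lemma hpoly_smooth: "hpoly n p \<Longrightarrow> smooth p"
  by (induction rule: hpoly.induct) (auto intro: smooth_add smooth_mult)

lemma hpoly_Ck: "hpoly n p \<Longrightarrow> Ck k p"
  using hpoly_smooth smooth_iff_Ck by blast

text \<open>The second conjunct serves degree 0, where \<open>n - 1\<close> is 0 again and the
  degree alone does not show that the derivative vanishes; the product rule in the induction needs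
  it.\<close>

lemma hpoly_partial_aux:
  "hpoly n p \<Longrightarrow> hpoly (n - 1) (partials [b] p) \<and> (n = 0 \<longrightarrow> partials [b] p = (\<lambda>x. 0))"
proof (induction rule: hpoly.induct)
  case (hpoly_const c)
  then show ?case by (simp add: hpoly_zero)
next
  case (hpoly_coord_mult n p c)
  have d: "p differentiable at x" for x using hpoly_coord_mult(1) hpoly_Ck Ck_differentiable by blast
  have e: "partials [b] (\<lambda>x. of_real (x \<bullet> c) * p x) = (\<lambda>x. of_real (b \<bullet> c) * p x + of_real (x \<bullet> c) * partials [b] p x)"
    using Ck_differentiable[OF Ck_coord] d by (subst partials_mult) (auto simp: partials_coord)
  have "hpoly n (\<lambda>x. of_real (x \<bullet> c) * partials [b] p x)"
  proof (cases n)
    case 0 then show ?thesis using hpoly_coord_mult by (simp add: hpoly_zero)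
  next
    case (Suc m)
    then have "hpoly m (partials [b] p)" using hpoly_coord_mult(3) by simp
    from hpoly.hpoly_coord_mult[OF this hpoly_coord_mult(2)] show ?thesis using Suc by simp
  qed
  then show ?case unfolding e using hpoly_cmult[OF hpoly_coord_mult(1)] by (simp add: hpoly_add)
next
  case (hpoly_add n p q)
  have "p differentiable at x" "q differentiable at x" for x using hpoly_add(1,2) hpoly_Ck Ck_differentiable by blast+
  then show ?case using hpoly_add by (auto simp: partials_add hpoly.hpoly_add)
qed

lemma hpoly_partial: "hpoly n p \<Longrightarrow> hpoly (n - 1) (partials [b] p)"
  using hpoly_partial_aux by blast

lemma hpoly_euler: "hpoly n p \<Longrightarrow> (\<Sum>b\<in>Basis. of_real (x \<bullet> b) * partials [b] p x) = of_nat n * p x"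
proof (induction rule: hpoly.induct)
  case (hpoly_coord_mult n p c)
  have d: "p differentiable at x" for x using hpoly_coord_mult(1) hpoly_Ck Ck_differentiable by blast
  have "partials [b] (\<lambda>x. of_real (x \<bullet> c) * p x) x = of_real (b \<bullet> c) * p x + of_real (x \<bullet> c) * partials [b] p x" for b
    using Ck_differentiable[OF Ck_coord] d by (subst partials_mult) (auto simp: partials_coord)
  then have "(\<Sum>b\<in>Basis. of_real (x \<bullet> b) * partials [b] (\<lambda>x. of_real (x \<bullet> c) * p x) x)
     = of_real (\<Sum>b\<in>Basis. (x \<bullet> b) * (b \<bullet> c)) * p x + of_real (x \<bullet> c) * (\<Sum>b\<in>Basis. of_real (x \<bullet> b) * partials [b] p x)"
    by (simp add: distrib_left sum.distrib sum_distrib_left sum_distrib_right mult_ac)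
  also have "(\<Sum>b\<in>Basis. (x \<bullet> b) * (b \<bullet> c)) = x \<bullet> c"
    by (subst (2) euclidean_inner) (simp add: inner_commute)
  finally show ?case using hpoly_coord_mult(3) by (simp add: algebra_simps)
next
  case (hpoly_add n p q)
  have "p differentiable at x" "q differentiable at x" for x using hpoly_add(1,2) hpoly_Ck Ck_differentiable by blast+
  then show ?case using hpoly_add by (simp add: partials_add distrib_left sum.distrib)
qed simp

lemma hpoly_laplacian: "hpoly n p \<Longrightarrow> hpoly (n - 2) (laplacian p)"
proof -
  assume "hpoly n p"
  then have "hpoly (n - 1 - 1) (partials [b] (partials [b] p))" for b
    by (intro hpoly_partial)
  then have "hpoly (n - 2) (\<lambda>x. \<Sum>b\<in>Basis. partials [b] (partials [b] p) x)"
    by (intro hpoly_sum) (simp add: numeral_2_eq_2)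
  then show ?thesis unfolding laplacian_eq[abs_def] .
qed

lemma hpoly_laplacian_zero: "hpoly n p \<Longrightarrow> n < 2 \<Longrightarrow> laplacian p = (\<lambda>x. 0)"
proof
  fix x assume p: "hpoly n p" "n < 2"
  have "partials [b] (partials [b] p) = (\<lambda>x. 0)" for b
  proof -
    have n: "n - 1 = 0" using p(2) by simp
    have "hpoly 0 (partials [b] p)" using hpoly_partial[OF p(1), of b] unfolding n .
    then show ?thesis using hpoly_partial_aux by blast
  qed
  then show "laplacian p x = 0" by (simp add: laplacian_eq)
qed

lemma hpoly_norm_le: "hpoly n p \<Longrightarrow> \<exists>C\<ge>0. \<forall>x. norm (p x) \<le> C * norm x ^ n"
proof (induction rule: hpoly.induct)
  case (hpoly_const c)
  then show ?case by (intro exI[of _ "norm c"]) auto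
next
  case (hpoly_coord_mult n p b)
  then obtain C where C: "C \<ge> 0" "\<And>x. norm (p x) \<le> C * norm x ^ n" by blast
  have "norm (of_real (x \<bullet> b) * p x) \<le> C * norm x ^ Suc n" for x
  proof -
    have "\<bar>x \<bullet> b\<bar> * norm (p x) \<le> norm x * (C * norm x ^ n)"
      using Basis_le_norm[OF hpoly_coord_mult(2)] C by (intro mult_mono) auto
    then show ?thesis by (simp add: norm_mult mult_ac)
  qed
  then show ?case using C(1) by blast
next
  case (hpoly_add n p q)
  then obtain C D where C: "C \<ge> 0" "\<And>x. norm (p x) \<le> C * norm x ^ n" "D \<ge> 0" "\<And>x. norm (q x) \<le> D * norm x ^ n" by metis
  have "norm (p x + q x) \<le> (C + D) * norm x ^ n" for x
    using norm_triangle_ineq[of "p x" "q x"] C(2)[of x] C(4)[of x] by (simp add: distrib_right)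
  then show ?case using C by (intro exI[of _ "C + D"]) auto
qed

lemma hpoly_inner_self: "hpoly 2 (\<lambda>x. of_real (x \<bullet> x))"
proof -
  have "hpoly (Suc (Suc 0)) (\<lambda>x::'a. of_real (x \<bullet> b) * (of_real (x \<bullet> b) * 1))" if "b \<in> Basis" for b
    by (intro hpoly_coord_mult that hpoly_const)
  from hpoly_sum[of Basis, OF this] have "hpoly 2 (\<lambda>x::'a. \<Sum>b\<in>Basis. of_real ((x \<bullet> b) * (x \<bullet> b)))"
    by (simp add: numeral_2_eq_2)
  then show ?thesis unfolding of_real_sum[symmetric] inner_self_eq_sum .
qed

section \<open>The divergence theorem on balls\<close>

lemma has_derivative_imp_LIMSEQ:
  fixes f :: "'a::euclidean_space \<Rightarrow> complex"
  assumes "(f has_derivative f') (at x)" and b: "b \<noteq> 0"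
  shows "(\<lambda>n. real (Suc n) *\<^sub>R (f (x + b /\<^sub>R real (Suc n)) - f x)) \<longlonglongrightarrow> f' b"
proof -
  interpret bounded_linear f' using assms(1) by (rule has_derivative_bounded_linear)
  have lim: "((\<lambda>h. norm (f (x + h) - f x - f' h) / norm h) \<longlongrightarrow> 0) (at 0)"
    using assms(1) by (simp add: has_derivative_at)
  have "(\<lambda>n. inverse (real (Suc n)) *\<^sub>R b) \<longlonglongrightarrow> 0 *\<^sub>R b"
    by (intro tendsto_scaleR tendsto_const LIMSEQ_inverse_real_of_nat)
  then have "filterlim (\<lambda>n. b /\<^sub>R real (Suc n)) (at 0) sequentially"
    using b by (simp add: filterlim_at)
  from filterlim_compose[OF lim this]
  have "(\<lambda>n. norm b * (norm (f (x + b /\<^sub>R real (Suc n)) - f x - f' (b /\<^sub>R real (Suc n))) / norm (b /\<^sub>R real (Suc n)))) \<longlonglongrightarrow> norm b * 0"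
    by (intro tendsto_mult tendsto_const)
  moreover have "norm b * (norm (f (x + b /\<^sub>R real (Suc n)) - f x - f' (b /\<^sub>R real (Suc n))) / norm (b /\<^sub>R real (Suc n)))
     = norm (real (Suc n) *\<^sub>R (f (x + b /\<^sub>R real (Suc n)) - f x) - f' b)" for n
  proof -
    define m where "m = real (Suc n)"
    have m: "m > 0" by (simp add: m_def)
    have "m *\<^sub>R (f (x + b /\<^sub>R m) - f x) - f' b = m *\<^sub>R (f (x + b /\<^sub>R m) - f x - f' (b /\<^sub>R m))"
      using m by (simp add: scale scaleR_diff_right)
    then have "norm (m *\<^sub>R (f (x + b /\<^sub>R m) - f x) - f' b) = m * norm (f (x + b /\<^sub>R m) - f x - f' (b /\<^sub>R m))"
      using m by simp
    then show ?thesis using b m unfolding m_def[symmetric] by (simp add: field_simps)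
  qed
  ultimately have "(\<lambda>n. norm (real (Suc n) *\<^sub>R (f (x + b /\<^sub>R real (Suc n)) - f x) - f' b)) \<longlonglongrightarrow> 0" by simp
  then show ?thesis by (simp add: tendsto_norm_zero_iff LIM_zero_iff)
qed

lemma integral_lborel_translate:
  fixes f :: "'a::euclidean_space \<Rightarrow> complex"
  assumes "f \<in> borel_measurable borel"
  shows "(\<integral>x. f (x + c) \<partial>lborel) = (\<integral>x. f x \<partial>lborel)"
proof -
  have "(\<integral>x. f x \<partial>lborel) = (\<integral>x. f x \<partial>distr lborel borel ((+) c))"
    by (simp add: lborel_distr_plus)
  also have "\<dots> = (\<integral>x. f (c + x) \<partial>lborel)"
    using assms by (subst integral_distr) auto
  finally show ?thesis by (simp add: add.commute)
qed

lemma integrable_continuous_ball_supp: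
  fixes f :: "'a::euclidean_space \<Rightarrow> complex"
  assumes "continuous_on UNIV f" "\<And>x. norm x > \<rho> \<Longrightarrow> f x = 0"
  shows "integrable lborel f"
proof -
  have "integrable lborel (\<lambda>x. indicator (cball 0 \<rho>) x *\<^sub>R f x)"
    by (intro borel_integrable_compact continuous_on_subset[OF assms(1)]) auto
  also have "(\<lambda>x. indicator (cball 0 \<rho>) x *\<^sub>R f x) = f"
    using assms(2) by (fastforce simp: indicator_def)
  finally show ?thesis .
qed

text \<open>Difference quotients have integral 0 by translation invariance and are dominated by the
  Lipschitz constant on a bounded set, so their almost everywhere limit has integral 0 as
  well.\<close>

lemma integral_derivative_lipschitz_zero:
  fixes G D :: "'a::euclidean_space \<Rightarrow> complex"
  assumes L: "\<And>x y. norm (G x - G y) \<le> L * norm (x - y)"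
    and supp: "\<And>x. norm x > \<rho> \<Longrightarrow> G x = 0"
    and lim: "AE x in lborel. (\<lambda>n. real (Suc n) *\<^sub>R (G (x + b /\<^sub>R real (Suc n)) - G x)) \<longlonglongrightarrow> D x"
    and D: "D \<in> borel_measurable borel"
  shows "integrable lborel D" "(\<integral>x. D x \<partial>lborel) = 0"
proof -
  have "continuous_on UNIV G"
  proof (rule uniformly_continuous_imp_continuous)
    have "L \<ge> 0"
    proof -
      obtain c :: 'a where "c \<in> Basis" using nonempty_Basis by blast
      then show ?thesis using order_trans[OF norm_ge_zero L[of c 0]] by simp
    qed
    then have "L-lipschitz_on UNIV G" using L by (auto simp: lipschitz_on_def dist_norm)
    then show "uniformly_continuous_on UNIV G" by (rule lipschitz_on_uniformly_continuous)
  qed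
  note contG = this
  then have mG [measurable]: "G \<in> borel_measurable borel" by (rule borel_measurable_continuous_onI)
  note D [measurable]
  have iG: "integrable lborel G" by (rule integrable_continuous_ball_supp[OF contG supp])
  have iG': "integrable lborel (\<lambda>x. G (x + c))" for c
  proof (rule integrable_continuous_ball_supp[of _ "\<rho> + norm c"])
    show "continuous_on UNIV (\<lambda>x. G (x + c))"
      by (rule continuous_on_compose2[OF contG]) (auto intro!: continuous_intros)
    show "G (x + c) = 0" if "\<rho> + norm c < norm x" for x
      using supp[of "x + c"] that norm_triangle_ineq4[of "x + c" c] by simp
  qed
  let ?s = "\<lambda>n x. real (Suc n) *\<^sub>R (G (x + b /\<^sub>R real (Suc n)) - G x)"
  let ?w = "\<lambda>x::'a. indicator (cball 0 (\<rho> + norm b)) x *\<^sub>R (L * norm b)"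
  have w: "integrable lborel ?w"
    by (intro borel_integrable_compact) auto
  have bd: "norm (?s n x) \<le> ?w x" for n x
  proof (cases "norm x \<le> \<rho> + norm b")
    case True
    have "norm (?s n x) \<le> real (Suc n) * (L * norm ((x + b /\<^sub>R real (Suc n)) - x))"
      using L[of "x + b /\<^sub>R real (Suc n)" x] by (simp add: mult_left_mono del: of_nat_Suc)
    also have "\<dots> = L * norm b" by simp
    finally show ?thesis using True by simp
  next
    case False
    have "norm (b /\<^sub>R real (Suc n)) \<le> norm b"
      using mult_left_mono[of 1 "real (Suc n)" "norm b"] by (simp add: divide_simps)
    then have "norm (x + b /\<^sub>R real (Suc n)) > \<rho>"
      using False norm_triangle_ineq4[of "x + b /\<^sub>R real (Suc n)" "b /\<^sub>R real (Suc n)"] by simp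
    moreover have "norm x > \<rho>" using False norm_ge_zero[of b] by linarith
    ultimately have "?s n x = 0" using supp by simp
    then show ?thesis using False by simp
  qed
  have ms: "?s n \<in> borel_measurable lborel" for n by measurable
  show "integrable lborel D"
    by (rule integrable_dominated_convergence[OF _ ms w lim]) (use D bd in auto)
  have "(\<lambda>n. \<integral>x. ?s n x \<partial>lborel) \<longlonglongrightarrow> (\<integral>x. D x \<partial>lborel)"
    by (rule integral_dominated_convergence[OF _ ms w lim]) (use D bd in auto)
  moreover have "(\<integral>x. ?s n x \<partial>lborel) = 0" for n
    using iG iG' integral_lborel_translate[OF mG, of "b /\<^sub>R real (Suc n)"] by simp
  ultimately have "(\<lambda>n::nat. 0) \<longlonglongrightarrow> (\<integral>x. D x \<partial>lborel)" by (simp only:)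
  from LIMSEQ_unique[OF this tendsto_const] show "(\<integral>x. D x \<partial>lborel) = 0" .
qed

lemma Ck_lipschitz_on_compact_convex:
  fixes F :: "'a::euclidean_space \<Rightarrow> complex"
  assumes F: "Ck 1 F" and S: "compact S" "convex S"
  shows "\<exists>L\<ge>0. \<forall>x\<in>S. \<forall>y\<in>S. norm (F x - F y) \<le> L * norm (x - y)"
proof -
  have "\<exists>B. \<forall>x\<in>S. norm (partials [b] F x) \<le> B" if "b \<in> Basis" for b
  proof -
    have "compact (partials [b] F ` S)"
      using F that S by (intro compact_continuous_image Ck_continuous_on[of 0]) (auto simp: Ck_Suc)
    then have "bounded (partials [b] F ` S)" by (rule compact_imp_bounded)
    then show ?thesis unfolding bounded_iff by auto
  qed
  then obtain B where B: "\<And>b x. b \<in> Basis \<Longrightarrow> x \<in> S \<Longrightarrow> norm (partials [b] F x) \<le> B b" by metis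
  define L where "L = (\<Sum>b\<in>Basis. \<bar>B b\<bar>)"
  have der: "(F has_derivative (\<lambda>h. \<Sum>b\<in>Basis. (h \<bullet> b) *\<^sub>R partials [b] F x)) (at x within S)" for x
    by (rule has_derivative_at_withinI[OF partials_has_derivative[OF Ck_differentiable[OF F]]])
  have "onorm (\<lambda>h. \<Sum>b\<in>Basis. (h \<bullet> b) *\<^sub>R partials [b] F x) \<le> L" if x: "x \<in> S" for x
  proof (rule onorm_bound)
    show "0 \<le> L" by (simp add: L_def sum_nonneg)
    fix h :: 'a
    have "norm (\<Sum>b\<in>Basis. (h \<bullet> b) *\<^sub>R partials [b] F x) \<le> (\<Sum>b\<in>Basis. norm h * \<bar>B b\<bar>)"
    proof (rule sum_norm_le)
      fix b :: 'a assume b: "b \<in> Basis"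
      have "norm ((h \<bullet> b) *\<^sub>R partials [b] F x) = \<bar>h \<bullet> b\<bar> * norm (partials [b] F x)" by simp
      also have "\<dots> \<le> norm h * \<bar>B b\<bar>"
        using Basis_le_norm[OF b, of h] B[OF b x] by (intro mult_mono) auto
      finally show "norm ((h \<bullet> b) *\<^sub>R partials [b] F x) \<le> norm h * \<bar>B b\<bar>" .
    qed
    also have "\<dots> = L * norm h" by (simp add: L_def sum_distrib_left[symmetric] mult.commute)
    finally show "norm (\<Sum>b\<in>Basis. (h \<bullet> b) *\<^sub>R partials [b] F x) \<le> L * norm h" .
  qed
  from differentiable_bound[OF S(2) der this]
  show ?thesis by (intro exI[of _ L]) (auto simp: L_def sum_nonneg)
qed

lemma integral_ball_scale:
  fixes q :: "'a::euclidean_space \<Rightarrow> complex"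
  assumes q: "q \<in> borel_measurable borel" and hom: "\<And>x. q (c *\<^sub>R x) = q x" and c: "c > 0"
  shows "(\<integral>x. indicator (ball 0 (c * r)) x *\<^sub>R q x \<partial>lborel) = of_real (c ^ DIM('a)) * (\<integral>x. indicator (ball 0 r) x *\<^sub>R q x \<partial>lborel)"
proof -
  let ?f = "\<lambda>x. indicator (ball 0 (c * r)) x *\<^sub>R q x"
  have m: "?f \<in> borel_measurable borel"
    by (intro borel_measurable_scaleR borel_measurable_indicator q) simp
  have "(\<integral>x. ?f x \<partial>lborel) = (\<integral>x. ?f x \<partial>density (distr lborel borel (\<lambda>x. 0 + c *\<^sub>R x)) (\<lambda>_. \<bar>c\<bar> ^ DIM('a)))"
    using lborel_affine[of c "0::'a"] c by simp
  also have "\<dots> = (\<integral>x. (\<bar>c\<bar> ^ DIM('a)) *\<^sub>R ?f x \<partial>distr lborel borel (\<lambda>x. 0 + c *\<^sub>R x))"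
    using m by (subst integral_density) auto
  also have "\<dots> = (\<integral>x. (\<bar>c\<bar> ^ DIM('a)) *\<^sub>R ?f (0 + c *\<^sub>R x) \<partial>lborel)"
    by (subst integral_distr[OF _ borel_measurable_scaleR[OF borel_measurable_const m]]) auto
  also have "(\<lambda>x. ?f (0 + c *\<^sub>R x)) = (\<lambda>x. indicator (ball 0 r) x *\<^sub>R q x)"
    using c hom by (auto simp: indicator_def fun_eq_iff)
  finally show ?thesis using c by (simp add: scaleR_conv_of_real)
qed

lemma scale_measure_eq_density: "scale_measure c M = density M (\<lambda>_. c)"
  by (rule measure_eqI) (auto simp: emeasure_density_const)

lemma integral_sphere_measure:
  fixes f :: "'a::euclidean_space \<Rightarrow> complex"
  assumes f: "f \<in> borel_measurable borel" and r: "r > 0"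
  shows "(\<integral>x. f x \<partial>sphere_measure r) =
    of_real (DIM('a) / r) * (\<integral>x. indicator (ball 0 r - {0}) x *\<^sub>R f ((r / norm x) *\<^sub>R x) \<partial>lborel)"
proof -
  define h where "h = (\<lambda>x::'a. (r / norm x) *\<^sub>R x)"
  have hm: "h \<in> measurable (restrict_space lborel (ball 0 r - {0})) (restrict_space borel (sphere 0 r))"
  proof (rule measurable_restrict_space2)
    show "h \<in> space (restrict_space lborel (ball 0 r - {0})) \<rightarrow> sphere 0 r"
      using r by (auto simp: h_def space_restrict_space)
    have "h \<in> borel_measurable borel" unfolding h_def by measurable
    then show "h \<in> borel_measurable (restrict_space lborel (ball 0 r - {0}))"
      by (intro measurable_restrict_space1) simp
  qed
  let ?D = "distr (restrict_space lborel (ball 0 r - {0})) (restrict_space borel (sphere 0 r)) h"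
  have fm: "f \<in> borel_measurable (restrict_space borel (sphere 0 r))"
    by (intro measurable_restrict_space1 f)
  have "(\<integral>x. f x \<partial>sphere_measure r) = (\<integral>x. f x \<partial>density ?D (\<lambda>_. ennreal (DIM('a) / r)))"
    unfolding sphere_measure_def scale_measure_eq_density h_def ..
  also have "\<dots> = (\<integral>x. (DIM('a) / r) *\<^sub>R f x \<partial>?D)"
    using r fm by (subst integral_density) auto
  also have "\<dots> = of_real (DIM('a) / r) * (\<integral>x. f x \<partial>?D)"
    by (subst integral_scaleR_right) (simp add: scaleR_conv_of_real)
  also have "(\<integral>x. f x \<partial>?D) = (\<integral>x. f (h x) \<partial>restrict_space lborel (ball 0 r - {0}))"
    by (rule integral_distr[OF hm fm])
  also have "\<dots> = (\<integral>x. indicator (ball 0 r - {0}) x *\<^sub>R f (h x) \<partial>lborel)"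
    by (subst integral_restrict_space) auto
  finally show ?thesis by (simp add: h_def)
qed

lemma sphere_null_lborel: "AE x in lborel. norm (x::'a::euclidean_space) \<noteq> r"
proof -
  have "sphere 0 r \<in> null_sets (lebesgue :: 'a measure)"
    using negligible_sphere negligible_iff_null_sets by blast
  then have "sphere (0::'a) r \<in> null_sets lborel"
    using null_sets_completion_iff[of "sphere (0::'a) r" lborel] by simp
  from AE_not_in[OF this] show ?thesis by simp
qed

lemma integral_lborel_ball_minus:
  fixes f :: "'a::euclidean_space \<Rightarrow> complex"
  assumes f: "f \<in> borel_measurable borel" and B: "\<And>x. x \<in> ball 0 r \<Longrightarrow> norm (f x) \<le> B" and "s \<le> r"
  shows "integrable lborel (\<lambda>x. indicator (ball 0 s) x *\<^sub>R f x)"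
    "(\<integral>x. (indicator (ball 0 r) x - indicator (ball 0 s) x) *\<^sub>R f x \<partial>lborel) =
      (\<integral>x. indicator (ball 0 r) x *\<^sub>R f x \<partial>lborel) - (\<integral>x. indicator (ball 0 s) x *\<^sub>R f x \<partial>lborel)"
proof -
  have i: "integrable lborel (\<lambda>x. indicator (ball 0 s) x *\<^sub>R f x)" if "s \<le> r" for s
  proof (rule Bochner_Integration.integrable_bound)
    show "integrable lborel (\<lambda>x::'a. indicator (cball 0 r) x *\<^sub>R B)"
      by (intro borel_integrable_compact) auto
    show "(\<lambda>x. indicator (ball 0 s) x *\<^sub>R f x) \<in> borel_measurable lborel"
      using f by (intro borel_measurable_scaleR borel_measurable_indicator) auto
    show "AE x in lborel. norm (indicator (ball 0 s) x *\<^sub>R f x) \<le> norm (indicator (cball 0 r) x *\<^sub>R B)"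
    proof (rule AE_I2)
      fix x :: 'a
      show "norm (indicator (ball 0 s) x *\<^sub>R f x) \<le> norm (indicator (cball 0 r) x *\<^sub>R B)"
        using B[of x] that by (auto simp: indicator_def)
    qed
  qed
  show "integrable lborel (\<lambda>x. indicator (ball 0 s) x *\<^sub>R f x)" by (rule i[OF assms(3)])
  show "(\<integral>x. (indicator (ball 0 r) x - indicator (ball 0 s) x) *\<^sub>R f x \<partial>lborel) =
      (\<integral>x. indicator (ball 0 r) x *\<^sub>R f x \<partial>lborel) - (\<integral>x. indicator (ball 0 s) x *\<^sub>R f x \<partial>lborel)"
    unfolding scaleR_diff_left by (rule Bochner_Integration.integral_diff[OF i[OF order_refl] i[OF assms(3)]])
qed

text \<open>For \<open>q\<close> homogeneous of degree 0, scaling shows that the integral over the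
  shell is \<open>1 - y^d\<close> times the integral over the ball. Divided by the thickness
  \<open>r (1 - y)\<close> the factor tends to \<open>d / r\<close>, the constant in
  \<open>sphere_measure\<close>.\<close>

lemma shell_average_limit:
  fixes q :: "'a::euclidean_space \<Rightarrow> complex"
  assumes q: "q \<in> borel_measurable borel" "\<And>x. norm (q x) \<le> B" and hom: "\<And>c x. c > 0 \<Longrightarrow> q (c *\<^sub>R x) = q x"
    and r: "r > 0"
  defines "y \<equiv> (\<lambda>n. 1 - 1 / (real n + 2))"
  shows "(\<lambda>n. (1 / (r * (1 - y n))) *\<^sub>R (\<integral>x. (indicator (ball 0 r) x - indicator (ball 0 (y n * r)) x) *\<^sub>R q x \<partial>lborel))
     \<longlonglongrightarrow> of_real (DIM('a) / r) * (\<integral>x. indicator (ball 0 r) x *\<^sub>R q x \<partial>lborel)"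
proof -
  let ?I = "\<integral>x. indicator (ball 0 r) x *\<^sub>R q x \<partial>lborel"
  have y: "y n > 0" "y n < 1" for n by (auto simp: y_def field_simps)
  have "(1 / (r * (1 - y n))) *\<^sub>R (\<integral>x. (indicator (ball 0 r) x - indicator (ball 0 (y n * r)) x) *\<^sub>R q x \<partial>lborel)
      = of_real ((\<Sum>i<DIM('a). y n ^ i) / r) * ?I" for n
  proof -
    have "y n * r \<le> r" using y[of n] r by simp
    have "(\<integral>x. (indicator (ball 0 r) x - indicator (ball 0 (y n * r)) x) *\<^sub>R q x \<partial>lborel) = ?I - of_real (y n ^ DIM('a)) * ?I"
      using integral_lborel_ball_minus(2)[OF q(1) q(2) \<open>y n * r \<le> r\<close>] integral_ball_scale[OF q(1) hom[OF y(1)] y(1), of n r]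
      by simp
    also have "\<dots> = of_real (1 - y n ^ DIM('a)) * ?I" by (simp add: algebra_simps)
    also have "1 - y n ^ DIM('a) = (1 - y n) * (\<Sum>i<DIM('a). y n ^ i)" by (rule one_diff_power_eq)
    finally show ?thesis using y[of n] r by (simp add: scaleR_conv_of_real)
  qed
  moreover have "(\<lambda>n. of_real ((\<Sum>i<DIM('a). y n ^ i) / r) * ?I) \<longlonglongrightarrow> of_real ((\<Sum>i<DIM('a). 1 ^ i) / r) * ?I"
  proof -
    have "y \<longlonglongrightarrow> 1" unfolding y_def by real_asymp
    then show ?thesis using r by (intro tendsto_intros) auto
  qed
  ultimately show ?thesis by simp
qed

text \<open>\<open>F\<close> is multiplied by a piecewise linear radial cutoff, so that the integral
  of the derivative of the product is 0. The cutoff contributes \<open>-\<nu> / e\<close> on a shell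
  of thickness \<open>e\<close>, and this shell average tends to the surface integral, since the
  surface measure is itself defined by cones.\<close>

lemma divergence_ball:
  fixes F :: "'a::euclidean_space \<Rightarrow> complex"
  assumes F: "Ck 1 F" and r: "r > 0" and b: "b \<in> Basis"
  shows "(\<integral>x. indicator (ball 0 r) x *\<^sub>R partials [b] F x \<partial>lborel) = (\<integral>x. F x * of_real (sgn x \<bullet> b) \<partial>sphere_measure r)"
proof -
  define y where "y n = 1 - 1 / (real n + 2)" for n
  have y: "y n > 0" "y n < 1" for n by (auto simp: y_def field_simps)
  define e where "e n = r * (1 - y n)" for n
  have e: "e n > 0" "e n < r" "y n * r = r - e n" for n using y[of n] r by (auto simp: e_def algebra_simps)
  have y1: "y \<longlonglongrightarrow> 1" unfolding y_def by real_asymp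
  have e0: "e \<longlonglongrightarrow> 0"
    unfolding e_def using tendsto_mult[OF tendsto_const tendsto_diff[OF tendsto_const y1], of r 1] by simp
  have "b \<noteq> 0" using b nonzero_Basis by blast
  have cF: "continuous_on S F" for S by (rule Ck_continuous_on[OF F])
  have cD: "continuous_on S (partials [b] F)" for S
    using F b by (intro Ck_continuous_on[of 0]) (auto simp: Ck_Suc)
  have mF [measurable]: "F \<in> borel_measurable borel" and mD [measurable]: "partials [b] F \<in> borel_measurable borel"
    by (intro borel_measurable_continuous_onI cF cD)+
  obtain L where L: "L \<ge> 0" "\<And>x y. norm x \<le> r \<Longrightarrow> norm y \<le> r \<Longrightarrow> norm (F x - F y) \<le> L * norm (x - y)"
    using Ck_lipschitz_on_compact_convex[OF F compact_cball[of 0 r] convex_cball] by auto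
  have bdd: "\<exists>K. \<forall>x. norm x \<le> r \<longrightarrow> norm (g x) \<le> K" if "\<And>S. continuous_on S g" for g :: "'a \<Rightarrow> complex"
  proof -
    have "bounded (g ` cball 0 r)"
      by (intro compact_imp_bounded compact_continuous_image that compact_cball)
    then obtain a where "\<forall>y\<in>g ` cball 0 r. norm y \<le> a" unfolding bounded_iff ..
    then show ?thesis by (intro exI[of _ a]) auto
  qed
  obtain K where K: "\<And>x. norm x \<le> r \<Longrightarrow> norm (F x) \<le> K" using bdd[OF cF] by auto
  have K0: "K \<ge> 0" using order_trans[OF norm_ge_zero K[of 0]] r by simp
  obtain K' where K': "\<And>x. norm x \<le> r \<Longrightarrow> norm (partials [b] F x) \<le> K'" using bdd[OF cD] by auto
  define \<eta> where "\<eta> n x = max 0 (min 1 ((r - norm x) / e n))" for n and x :: 'a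
  have \<eta>: "0 \<le> \<eta> n x" "\<eta> n x \<le> 1" for n x by (auto simp: \<eta>_def)
  have \<eta>0: "\<eta> n x = 0" if "norm x \<ge> r" for n x
    using that e(1)[of n] divide_nonpos_pos[of "r - norm x" "e n"] by (simp add: \<eta>_def max_def min_def)
  have \<eta>lip: "\<bar>\<eta> n x - \<eta> n z\<bar> \<le> norm (x - z) / e n" for n x z
  proof -
    have "\<bar>max 0 (min 1 s) - max 0 (min 1 t)\<bar> \<le> \<bar>s - t\<bar>" for s t :: real by (auto simp: max_def min_def)
    then have "\<bar>\<eta> n x - \<eta> n z\<bar> \<le> \<bar>(r - norm x) / e n - (r - norm z) / e n\<bar>" unfolding \<eta>_def .
    also have "\<dots> = \<bar>norm x - norm z\<bar> / e n"
      using e(1)[of n] by (simp add: diff_divide_distrib[symmetric] abs_minus_commute)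
    also have "\<dots> \<le> norm (x - z) / e n"
      using e(1)[of n] norm_triangle_ineq3[of x z] by (intro divide_right_mono) auto
    finally show ?thesis .
  qed
  define G where "G n x = F x * of_real (\<eta> n x)" for n x
  define sh :: "nat \<Rightarrow> 'a \<Rightarrow> real" where "sh n x = indicator (ball 0 r) x - indicator (ball 0 (y n * r)) x" for n x
  define \<nu> where "\<nu> x = (x \<bullet> b) / norm x" for x :: 'a
  have \<nu>: "\<bar>\<nu> x\<bar> \<le> 1" for x
    using Basis_le_norm[OF b, of x] by (cases "x = 0") (auto simp: \<nu>_def)
  have m\<nu> [measurable]: "\<nu> \<in> borel_measurable borel" unfolding \<nu>_def by measurable
  have msh [measurable]: "sh n \<in> borel_measurable borel" for n unfolding sh_def by (intro borel_measurable_diff borel_measurable_indicator) auto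
  have m\<eta> [measurable]: "\<eta> n \<in> borel_measurable borel" for n unfolding \<eta>_def by measurable
  \<comment> \<open>The partial derivative of \<open>G n\<close> off the spheres
    \<open>|x| = r\<close> and \<open>|x| = r - e n\<close>, which are null sets.\<close>
  define D where "D n x = indicator (ball 0 r) x *\<^sub>R (partials [b] F x * of_real (\<eta> n x)) - (1 / e n) *\<^sub>R (sh n x *\<^sub>R (F x * of_real (\<nu> x)))" for n x
  have lip1: "norm (G n x - G n z) \<le> (L + K / e n) * norm (x - z)" if "norm x \<le> r" for n x z
  proof (cases "norm z \<le> r")
    case True
    have "G n x - G n z = (F x - F z) * of_real (\<eta> n x) + F z * of_real (\<eta> n x - \<eta> n z)"
      by (simp add: G_def algebra_simps)
    also have "norm \<dots> \<le> norm (F x - F z) * 1 + norm (F z) * \<bar>\<eta> n x - \<eta> n z\<bar>"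
      using \<eta>[of n x] by (intro order_trans[OF norm_triangle_ineq] add_mono) (auto simp: norm_mult mult_left_le simp del: of_real_diff)
    also have "\<dots> \<le> L * norm (x - z) * 1 + K * (norm (x - z) / e n)"
      using L(1) L(2)[OF that True] K[OF True] \<eta>lip[of n x z] K0 by (intro add_mono mult_mono) auto
    finally show ?thesis by (simp add: algebra_simps)
  next
    case False
    then have z: "\<eta> n z = 0" by (intro \<eta>0) auto
    have "norm (G n x - G n z) = norm (F x) * \<bar>\<eta> n x - \<eta> n z\<bar>"
      using z \<eta>[of n x] by (simp add: G_def norm_mult)
    also have "\<dots> \<le> K * (norm (x - z) / e n)"
      using K[OF that] \<eta>lip K0 by (intro mult_mono) auto
    also have "\<dots> \<le> (L + K / e n) * norm (x - z)" using L(1) by (simp add: algebra_simps)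
    finally show ?thesis .
  qed
  have lip: "norm (G n x - G n z) \<le> (L + K / e n) * norm (x - z)" for n x z
  proof (cases "norm x \<le> r \<or> norm z \<le> r")
    case True
    then show ?thesis using lip1[of x n z] lip1[of z n x] by (auto simp: norm_minus_commute)
  next
    case False
    then have "G n x = 0" "G n z = 0" using \<eta>0[of x n] \<eta>0[of z n] by (auto simp: G_def)
    then show ?thesis using L(1) K0 e(1)[of n] by simp
  qed
  have supp: "G n x = 0" if "norm x > r" for n x using \<eta>0[of x n] that by (simp add: G_def)
  have derivG: "\<exists>g'. (G n has_derivative g') (at x) \<and> g' b = D n x" if x: "norm x \<noteq> r" "norm x \<noteq> r - e n" for n x
  proof -
    have dF: "(F has_derivative frechet_derivative F (at x)) (at x)"
      using Ck_differentiable[OF F] frechet_derivative_works by blast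
    have pF: "frechet_derivative F (at x) b = partials [b] F x" by (simp add: partials_def)
    consider "norm x < r - e n" | "r - e n < norm x" "norm x < r" | "r < norm x" using x by linarith
    then show ?thesis
    proof cases
      case 1
      have "(G n has_derivative frechet_derivative F (at x)) (at x)"
      proof (rule has_derivative_transform_within_open[OF dF, of "ball 0 (r - e n)"])
        fix z :: 'a assume "z \<in> ball 0 (r - e n)"
        then have "(r - norm z) / e n \<ge> 1" using e(1)[of n] by (simp add: pos_le_divide_eq)
        then show "F z = G n z" by (simp add: G_def \<eta>_def)
      qed (use 1 in auto)
      moreover have "D n x = partials [b] F x"
      proof -
        have "(r - norm x) / e n \<ge> 1" using 1 e(1)[of n] by (simp add: pos_le_divide_eq)
        then have "\<eta> n x = 1" by (simp add: \<eta>_def)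
        moreover have "norm x < r" using 1 e(1)[of n] by linarith
        ultimately show ?thesis using 1 by (simp add: D_def sh_def e(3))
      qed
      ultimately show ?thesis using pF by auto
    next
      case 2
      have x0: "x \<noteq> 0" using 2 e(2)[of n] by auto
      have dn: "(norm has_derivative (\<lambda>h. h \<bullet> sgn x)) (at x)" by (rule has_derivative_norm[OF x0])
      have d2: "((\<lambda>z. complex_of_real ((r - norm z) / e n)) has_derivative (\<lambda>h. of_real ((0 - h \<bullet> sgn x) / e n))) (at x)"
        by (intro has_derivative_of_real bounded_linear.has_derivative[OF bounded_linear_divide has_derivative_diff[OF has_derivative_const dn]])
      have d3: "((\<lambda>z. F z * of_real ((r - norm z) / e n)) has_derivative
          (\<lambda>h. F x * of_real ((0 - h \<bullet> sgn x) / e n) + frechet_derivative F (at x) h * of_real ((r - norm x) / e n))) (at x)"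
        by (rule has_derivative_mult[OF dF d2])
      have "(G n has_derivative
          (\<lambda>h. F x * of_real ((0 - h \<bullet> sgn x) / e n) + frechet_derivative F (at x) h * of_real ((r - norm x) / e n))) (at x)"
      proof (rule has_derivative_transform_within_open[OF d3, of "ball 0 r - cball 0 (r - e n)"])
        fix z :: 'a assume "z \<in> ball 0 r - cball 0 (r - e n)"
        then have "(r - norm z) / e n \<le> 1" "(r - norm z) / e n \<ge> 0" using e(1)[of n] by (auto simp: pos_divide_le_eq)
        then show "F z * of_real ((r - norm z) / e n) = G n z" by (simp add: G_def \<eta>_def)
      qed (use 2 in auto)
      moreover have "F x * of_real ((0 - b \<bullet> sgn x) / e n) + frechet_derivative F (at x) b * of_real ((r - norm x) / e n) = D n x"
      proof -
        have "(r - norm x) / e n \<le> 1" "(r - norm x) / e n \<ge> 0" using 2 e(1)[of n] by (auto simp: pos_divide_le_eq)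
        then have "\<eta> n x = (r - norm x) / e n" by (simp add: \<eta>_def)
        moreover have "sh n x = 1" using 2 by (simp add: sh_def e(3))
        moreover have "b \<bullet> sgn x = \<nu> x" by (simp add: sgn_div_norm \<nu>_def divide_inverse mult.commute inner_commute)
        ultimately show ?thesis using 2 by (simp add: D_def pF scaleR_conv_of_real)
      qed
      ultimately show ?thesis by blast
    next
      case 3
      have "(G n has_derivative (\<lambda>h. 0)) (at x)"
        by (rule has_derivative_transform_within_open[OF has_derivative_const[of 0], of "- cball 0 r"]) (use 3 supp in auto)
      moreover have "D n x = 0" using 3 e[of n] by (simp add: D_def sh_def indicator_def)
      ultimately show ?thesis by auto
    qed
  qed
  have limG: "AE x in lborel. (\<lambda>m. real (Suc m) *\<^sub>R (G n (x + b /\<^sub>R real (Suc m)) - G n x)) \<longlonglongrightarrow> D n x" for n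
    using sphere_null_lborel[of r] sphere_null_lborel[of "r - e n"]
  proof eventually_elim
    case (elim x)
    from derivG[OF elim] obtain g' where g': "(G n has_derivative g') (at x)" "g' b = D n x" by blast
    show ?case using has_derivative_imp_LIMSEQ[OF g'(1) \<open>b \<noteq> 0\<close>] g'(2) by simp
  qed
  have mball [measurable]: "Measurable.pred borel (\<lambda>x::'a. x \<in> ball 0 s)" for s
    by (simp add: pred_def)
  have mDn: "D n \<in> borel_measurable borel" for n unfolding D_def by measurable
  have int0: "(\<integral>x. D n x \<partial>lborel) = 0" for n
    by (rule integral_derivative_lipschitz_zero(2)[OF lip supp limG mDn])
  define A where "A n = (\<integral>x. indicator (ball 0 r) x *\<^sub>R (partials [b] F x * of_real (\<eta> n x)) \<partial>lborel)" for n
  define S where "S n = (\<integral>x. sh n x *\<^sub>R (F x * of_real (\<nu> x)) \<partial>lborel)" for n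
  have le_ball: "y n * r \<le> r" for n using e(1)[of n] by (simp add: e(3))
  have iball: "integrable lborel (\<lambda>x. indicator (ball 0 s) x *\<^sub>R g x)"
    if "g \<in> borel_measurable borel" "\<And>x. norm x \<le> r \<Longrightarrow> norm (g x) \<le> B" "s \<le> r" for g :: "'a \<Rightarrow> complex" and B s
    by (rule integral_lborel_ball_minus(1)[where r = r and B = B]) (use that in auto)
  have ish: "integrable lborel (\<lambda>x. sh n x *\<^sub>R g x)"
    if "g \<in> borel_measurable borel" "\<And>x. norm x \<le> r \<Longrightarrow> norm (g x) \<le> B" for g :: "'a \<Rightarrow> complex" and B n
    unfolding sh_def scaleR_diff_left
    by (intro Bochner_Integration.integrable_diff iball[OF that]) (use le_ball in auto)
  have K\<nu>: "norm (F x * of_real (\<nu> x)) \<le> K" if "norm x \<le> r" for x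
    using K[OF that] \<nu>[of x] K0 mult_mono[of "norm (F x)" K "\<bar>\<nu> x\<bar>" 1] by (simp add: norm_mult)
  have K'\<eta>: "norm (partials [b] F x * of_real (\<eta> n x)) \<le> K'" if "norm x \<le> r" for x n
    using K'[OF that] \<eta>[of n x] mult_mono[of "norm (partials [b] F x)" K' "\<bar>\<eta> n x\<bar>" 1] order_trans[OF norm_ge_zero K'[OF that]]
    by (simp add: norm_mult)
  have AS: "A n = (1 / e n) *\<^sub>R S n" for n
  proof -
    have "integrable lborel (\<lambda>x. indicator (ball 0 r) x *\<^sub>R (partials [b] F x * of_real (\<eta> n x)))"
      by (rule iball[OF _ K'\<eta>]) auto
    moreover have "integrable lborel (\<lambda>x. (1 / e n) *\<^sub>R (sh n x *\<^sub>R (F x * of_real (\<nu> x))))"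
      by (intro integrable_scaleR_right ish[OF _ K\<nu>]) auto
    ultimately have "(\<integral>x. D n x \<partial>lborel) = A n - (\<integral>x. (1 / e n) *\<^sub>R (sh n x *\<^sub>R (F x * of_real (\<nu> x))) \<partial>lborel)"
      unfolding D_def A_def by (rule Bochner_Integration.integral_diff)
    then have "(\<integral>x. D n x \<partial>lborel) = A n - (1 / e n) *\<^sub>R S n"
      unfolding S_def by (simp only: integral_scaleR_right)
    then show ?thesis using int0 by simp
  qed
  have A_lim: "A \<longlonglongrightarrow> (\<integral>x. indicator (ball 0 r) x *\<^sub>R partials [b] F x \<partial>lborel)"
    unfolding A_def
  proof (rule integral_dominated_convergence[where w = "\<lambda>x. indicator (cball 0 r) x *\<^sub>R K'"])
    show "integrable lborel (\<lambda>x::'a. indicator (cball 0 r) x *\<^sub>R K')" by (intro borel_integrable_compact) auto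
    show "AE x in lborel. norm (indicator (ball 0 r) x *\<^sub>R (partials [b] F x * of_real (\<eta> n x))) \<le> indicator (cball 0 r) x *\<^sub>R K'" for n
      using K'\<eta> order_trans[OF norm_ge_zero K'[of 0]] r by (intro AE_I2) (auto simp: indicator_def)
    show "AE x in lborel. (\<lambda>n. indicator (ball 0 r) x *\<^sub>R (partials [b] F x * of_real (\<eta> n x))) \<longlonglongrightarrow> indicator (ball 0 r) x *\<^sub>R partials [b] F x"
    proof (rule AE_I2)
      fix x :: 'a
      show "(\<lambda>n. indicator (ball 0 r) x *\<^sub>R (partials [b] F x * of_real (\<eta> n x))) \<longlonglongrightarrow> indicator (ball 0 r) x *\<^sub>R partials [b] F x"
      proof (cases "norm x < r")
        case True
        then have "eventually (\<lambda>n. e n < r - norm x) sequentially" by (intro order_tendstoD(2)[OF e0]) auto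
        then have "eventually (\<lambda>n. \<eta> n x = 1) sequentially"
        proof eventually_elim
          case (elim n)
          then have "(r - norm x) / e n \<ge> 1" using e(1)[of n] by (simp add: pos_le_divide_eq)
          then show ?case by (simp add: \<eta>_def)
        qed
        then have "(\<lambda>n. \<eta> n x) \<longlonglongrightarrow> 1" by (rule tendsto_eventually)
        then have "(\<lambda>n. indicator (ball 0 r) x *\<^sub>R (partials [b] F x * of_real (\<eta> n x))) \<longlonglongrightarrow> indicator (ball 0 r) x *\<^sub>R (partials [b] F x * of_real 1)"
          by (intro tendsto_intros)
        then show ?thesis by simp
      qed auto
    qed
  qed measurable
  \<comment> \<open>\<open>F\<close> frozen at the radial projection onto the sphere. This is
    homogeneous of degree 0, as \<open>shell_average_limit\<close> requires, and differs from
    \<open>F\<close> by at most \<open>L e\<close> on the shell.\<close>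
  define q where "q x = F ((r / norm x) *\<^sub>R x) * of_real (\<nu> x)" for x
  have mq: "q \<in> borel_measurable borel" unfolding q_def by measurable
  have nq: "norm ((r / norm x) *\<^sub>R x) \<le> r" for x :: 'a using r by (cases "x = 0") auto
  have Kq: "norm (q x) \<le> K" for x
    using K[OF nq[of x]] \<nu>[of x] K0 mult_mono[of "norm (F ((r / norm x) *\<^sub>R x))" K "\<bar>\<nu> x\<bar>" 1] by (simp add: norm_mult q_def)
  have hq: "q (c *\<^sub>R x) = q x" if "c > 0" for c x using that by (simp add: q_def \<nu>_def)
  define Q where "Q n = (\<integral>x. sh n x *\<^sub>R q x \<partial>lborel)" for n
  have Q_lim: "(\<lambda>n. (1 / e n) *\<^sub>R Q n) \<longlonglongrightarrow> of_real (DIM('a) / r) * (\<integral>x. indicator (ball 0 r) x *\<^sub>R q x \<partial>lborel)"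
    using shell_average_limit[OF mq Kq hq r] unfolding Q_def sh_def e_def y_def .
  have vol: "(\<lambda>n. (1 / e n) *\<^sub>R (\<integral>x. sh n x *\<^sub>R (1::complex) \<partial>lborel)) \<longlonglongrightarrow> of_real (DIM('a) / r) * (\<integral>x. indicator (ball (0::'a) r) x *\<^sub>R 1 \<partial>lborel)"
    using shell_average_limit[of "\<lambda>x::'a. 1" 1, OF _ _ _ r] unfolding sh_def e_def y_def by simp
  have sh01: "0 \<le> sh n x" "sh n x \<le> 1" "sh n x \<noteq> 0 \<Longrightarrow> norm x < r \<and> r - e n \<le> norm x" for n x
    using le_ball[of n] by (auto simp: sh_def indicator_def e(3) of_bool_def split: if_splits)
  have diff: "norm (S n - Q n) \<le> L * e n * norm (\<integral>x. sh n x *\<^sub>R (1::complex) \<partial>lborel)" for n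
  proof -
    have i1: "integrable lborel (\<lambda>x. sh n x *\<^sub>R (1::complex))"
      by (rule ish[where B = 1]) auto
    have "integrable lborel (\<lambda>x. Re (sh n x *\<^sub>R (1::complex)))" by (rule integrable_Re[OF i1])
    then have i2: "integrable lborel (sh n)" by simp
    have "S n - Q n = (\<integral>x. sh n x *\<^sub>R (F x * of_real (\<nu> x)) - sh n x *\<^sub>R q x \<partial>lborel)"
      unfolding S_def Q_def
      by (rule Bochner_Integration.integral_diff[symmetric]) (auto intro!: ish[OF _ K\<nu>] ish[OF mq Kq])
    also have "norm \<dots> \<le> (\<integral>x. norm (sh n x *\<^sub>R (F x * of_real (\<nu> x)) - sh n x *\<^sub>R q x) \<partial>lborel)"
      by (rule integral_norm_bound)
    also have "\<dots> \<le> (\<integral>x. (L * e n) * sh n x \<partial>lborel)"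
    proof (rule integral_mono)
      show "integrable lborel (\<lambda>x. norm (sh n x *\<^sub>R (F x * of_real (\<nu> x)) - sh n x *\<^sub>R q x))"
        by (intro integrable_norm Bochner_Integration.integrable_diff) (auto intro!: ish[OF _ K\<nu>] ish[OF mq Kq])
      show "integrable lborel (\<lambda>x. (L * e n) * sh n x)" using i2 by simp
      fix x :: 'a
      show "norm (sh n x *\<^sub>R (F x * of_real (\<nu> x)) - sh n x *\<^sub>R q x) \<le> (L * e n) * sh n x"
      proof (cases "sh n x = 0")
        case False
        then have x: "norm x < r" "r - e n \<le> norm x" using sh01(3) by auto
        have x0: "x \<noteq> 0" using x e(2)[of n] by auto
        have "x - (r / norm x) *\<^sub>R x = (1 - r / norm x) *\<^sub>R x" by (simp add: algebra_simps)
        then have "norm (x - (r / norm x) *\<^sub>R x) = \<bar>1 - r / norm x\<bar> * norm x" by simp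
        also have "\<dots> = \<bar>norm x - r\<bar>" using x0 by (simp add: abs_mult[symmetric] field_simps del: abs_mult_pos)
        also have "\<dots> \<le> e n" using x by simp
        finally have "norm (F x - F ((r / norm x) *\<^sub>R x)) \<le> L * e n"
          using L(2)[of x "(r / norm x) *\<^sub>R x"] nq[of x] x L(1) mult_left_mono[of _ "e n" L] by fastforce
        then have "norm (F x - F ((r / norm x) *\<^sub>R x)) * \<bar>\<nu> x\<bar> \<le> (L * e n) * 1"
          using \<nu>[of x] L(1) e(1)[of n] by (intro mult_mono) auto
        then have "sh n x * (norm (F x - F ((r / norm x) *\<^sub>R x)) * \<bar>\<nu> x\<bar>) \<le> sh n x * (L * e n)"
          using sh01(1) by (intro mult_left_mono) auto
        moreover have "sh n x *\<^sub>R (F x * of_real (\<nu> x)) - sh n x *\<^sub>R q x = sh n x *\<^sub>R ((F x - F ((r / norm x) *\<^sub>R x)) * of_real (\<nu> x))"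
          by (simp add: q_def algebra_simps)
        ultimately show ?thesis using sh01(1)[of n x] by (simp add: norm_mult mult.commute)
      qed simp
    qed
    also have "\<dots> = (L * e n) * (\<integral>x. sh n x \<partial>lborel)" by simp
    also have "(\<integral>x. sh n x \<partial>lborel) = norm (\<integral>x. sh n x *\<^sub>R (1::complex) \<partial>lborel)"
    proof -
      have "(\<integral>x. sh n x *\<^sub>R (1::complex) \<partial>lborel) = of_real (\<integral>x. sh n x \<partial>lborel)"
        using i2 by (simp add: scaleR_conv_of_real)
      moreover have "(\<integral>x. sh n x \<partial>lborel) \<ge> 0" using sh01 by simp
      ultimately show ?thesis by simp
    qed
    finally show ?thesis by simp
  qed
  have "(\<lambda>n. (1 / e n) *\<^sub>R S n - (1 / e n) *\<^sub>R Q n) \<longlonglongrightarrow> 0"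
  proof (rule Lim_null_comparison)
    show "eventually (\<lambda>n. norm ((1 / e n) *\<^sub>R S n - (1 / e n) *\<^sub>R Q n) \<le> L * e n * norm ((1 / e n) *\<^sub>R (\<integral>x. sh n x *\<^sub>R (1::complex) \<partial>lborel))) sequentially"
    proof (rule always_eventually, rule allI)
      fix n
      have "norm ((1 / e n) *\<^sub>R S n - (1 / e n) *\<^sub>R Q n) = (1 / e n) * norm (S n - Q n)"
        unfolding scaleR_diff_right[symmetric] using e(1)[of n] by simp
      also have "\<dots> \<le> (1 / e n) * (L * e n * norm (\<integral>x. sh n x *\<^sub>R (1::complex) \<partial>lborel))"
        using e(1)[of n] by (intro mult_left_mono diff) auto
      also have "\<dots> = L * e n * norm ((1 / e n) *\<^sub>R (\<integral>x. sh n x *\<^sub>R (1::complex) \<partial>lborel))"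
        using e(1)[of n] by simp
      finally show "norm ((1 / e n) *\<^sub>R S n - (1 / e n) *\<^sub>R Q n) \<le> L * e n * norm ((1 / e n) *\<^sub>R (\<integral>x. sh n x *\<^sub>R (1::complex) \<partial>lborel))" .
    qed
    have "(\<lambda>n. L * e n * norm ((1 / e n) *\<^sub>R (\<integral>x. sh n x *\<^sub>R (1::complex) \<partial>lborel)))
       \<longlonglongrightarrow> L * 0 * norm (of_real (DIM('a) / r) * (\<integral>x. indicator (ball (0::'a) r) x *\<^sub>R (1::complex) \<partial>lborel))"
      by (rule tendsto_mult[OF tendsto_mult[OF tendsto_const e0] tendsto_norm[OF vol]])
    then show "(\<lambda>n. L * e n * norm ((1 / e n) *\<^sub>R (\<integral>x. sh n x *\<^sub>R (1::complex) \<partial>lborel))) \<longlonglongrightarrow> 0" by simp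
  qed
  from tendsto_add[OF this Q_lim]
  have "A \<longlonglongrightarrow> of_real (DIM('a) / r) * (\<integral>x. indicator (ball 0 r) x *\<^sub>R q x \<partial>lborel)"
    by (simp add: AS[abs_def])
  from LIMSEQ_unique[OF A_lim this]
  have "(\<integral>x. indicator (ball 0 r) x *\<^sub>R partials [b] F x \<partial>lborel) = of_real (DIM('a) / r) * (\<integral>x. indicator (ball 0 r) x *\<^sub>R q x \<partial>lborel)" .
  also have "(\<lambda>x. indicator (ball 0 r) x *\<^sub>R q x) = (\<lambda>x. indicator (ball 0 r - {0}) x *\<^sub>R (F ((r / norm x) *\<^sub>R x) * of_real (sgn ((r / norm x) *\<^sub>R x) \<bullet> b)))"
  proof
    fix x :: 'a
    show "indicator (ball 0 r) x *\<^sub>R q x = indicator (ball 0 r - {0}) x *\<^sub>R (F ((r / norm x) *\<^sub>R x) * of_real (sgn ((r / norm x) *\<^sub>R x) \<bullet> b))"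
    proof (cases "x = 0")
      case True
      then show ?thesis by (simp add: q_def \<nu>_def)
    next
      case False
      have "sgn (r / norm x) = 1" using r False by simp
      then have "sgn ((r / norm x) *\<^sub>R x) = sgn x" unfolding sgn_scaleR by simp
      then have s: "sgn ((r / norm x) *\<^sub>R x) \<bullet> b = \<nu> x"
        by (simp only: sgn_div_norm \<nu>_def divide_inverse inner_scaleR_left mult.commute)
      show ?thesis unfolding s q_def using False by (simp add: indicator_def)
    qed
  qed
  also have "of_real (DIM('a) / r) * (\<integral>x. indicator (ball 0 r - {0}) x *\<^sub>R (F ((r / norm x) *\<^sub>R x) * of_real (sgn ((r / norm x) *\<^sub>R x) \<bullet> b)) \<partial>lborel)
     = (\<integral>x. F x * of_real (sgn x \<bullet> b) \<partial>sphere_measure r)"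
    by (rule integral_sphere_measure[OF _ r, symmetric]) (simp add: sgn_div_norm)
  finally show ?thesis .
qed

section \<open>Square integrable functions\<close>

lemma L2_diff:
  assumes "f \<in> L2 M" "g \<in> L2 M" shows "(\<lambda>x. f x - g x) \<in> L2 M"
proof -
  have m [measurable]: "f \<in> borel_measurable M" "g \<in> borel_measurable M" using assms by (auto simp: L2_def)
  have i: "integrable M (\<lambda>x. 2 * (norm (f x))^2 + 2 * (norm (g x))^2)" using assms by (auto simp: L2_def)
  have "integrable M (\<lambda>x. (norm (f x - g x))^2)"
  proof (rule Bochner_Integration.integrable_bound[OF i])
    show "AE x in M. norm ((norm (f x - g x))^2) \<le> norm (2 * (norm (f x))^2 + 2 * (norm (g x))^2)"
    proof (rule AE_I2)
      fix x
      have "(norm (f x - g x))^2 \<le> (norm (f x) + norm (g x))^2" by (intro power_mono norm_triangle_ineq4) auto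
      also have "\<dots> \<le> 2 * (norm (f x))^2 + 2 * (norm (g x))^2"
        using zero_le_power2[of "norm (f x) - norm (g x)"] by (simp add: power2_eq_square algebra_simps)
      finally show "norm ((norm (f x - g x))^2) \<le> norm (2 * (norm (f x))^2 + 2 * (norm (g x))^2)" by simp
    qed
  qed measurable
  then show ?thesis by (simp add: L2_def)
qed

text \<open>Young's inequality with a free parameter; in limit arguments, choosing \<open>t\<close>
  suitably does the work of the Cauchy-Schwarz inequality.\<close>

lemma L2_mult_weighted:
  assumes f: "f \<in> L2 M" and g: "g \<in> L2 M" and t: "t > 0"
  shows "integrable M (\<lambda>x. f x * g x)"
    "norm (\<integral>x. f x * g x \<partial>M) \<le> (1 / t) * (\<integral>x. (norm (f x))^2 \<partial>M) + t * (\<integral>x. (norm (g x))^2 \<partial>M)"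
proof -
  have m [measurable]: "f \<in> borel_measurable M" "g \<in> borel_measurable M" using assms by (auto simp: L2_def)
  have i: "integrable M (\<lambda>x. (norm (f x))^2)" "integrable M (\<lambda>x. (norm (g x))^2)" using assms by (auto simp: L2_def)
  have le: "norm (f x * g x) \<le> (1 / t) * (norm (f x))^2 + t * (norm (g x))^2" for x
  proof -
    define a b where "a = norm (f x)" and "b = norm (g x)"
    have "0 \<le> (a - t * b)^2" by simp
    then have "2 * (t * (a * b)) \<le> a^2 + t^2 * b^2" by (simp add: power2_eq_square algebra_simps)
    moreover have "0 \<le> t * (a * b)" using t by (simp add: a_def b_def)
    ultimately have "t * (a * b) \<le> a^2 + t^2 * b^2" by linarith
    then have "t * (a * b) \<le> t * ((1 / t) * a^2 + t * b^2)" using t by (simp add: power2_eq_square algebra_simps)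
    then show ?thesis using t by (simp add: norm_mult a_def b_def)
  qed
  have i2: "integrable M (\<lambda>x. (1 / t) * (norm (f x))^2 + t * (norm (g x))^2)" using i by auto
  show i3: "integrable M (\<lambda>x. f x * g x)"
    by (rule Bochner_Integration.integrable_bound[OF i2]) (use le in \<open>auto intro!: AE_I2 order_trans[OF le]\<close>)
  have "norm (\<integral>x. f x * g x \<partial>M) \<le> (\<integral>x. norm (f x * g x) \<partial>M)" by (rule integral_norm_bound)
  also have "\<dots> \<le> (\<integral>x. (1 / t) * (norm (f x))^2 + t * (norm (g x))^2 \<partial>M)"
    by (rule integral_mono[OF integrable_norm[OF i3] i2 le])
  also have "\<dots> = (1 / t) * (\<integral>x. (norm (f x))^2 \<partial>M) + t * (\<integral>x. (norm (g x))^2 \<partial>M)" using i by simp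
  finally show "norm (\<integral>x. f x * g x \<partial>M) \<le> (1 / t) * (\<integral>x. (norm (f x))^2 \<partial>M) + t * (\<integral>x. (norm (g x))^2 \<partial>M)" .
qed

lemma L2_mult_integrable: "f \<in> L2 M \<Longrightarrow> g \<in> L2 M \<Longrightarrow> integrable M (\<lambda>x. f x * g x)"
  using L2_mult_weighted(1)[of f M g 1] by simp

lemma L2_tendsto_integral_mult:
  assumes F: "L2_tendsto M F f" and \<psi>: "\<psi> \<in> L2 M"
  shows "(\<lambda>n. \<integral>x. F n x * \<psi> x \<partial>M) \<longlonglongrightarrow> (\<integral>x. f x * \<psi> x \<partial>M)"
proof (rule LIM_zero_cancel, rule tendsto_norm_zero_cancel, rule order_tendstoI)
  define G where "G = (\<integral>x. (norm (\<psi> x))^2 \<partial>M)"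
  have Fn: "F n \<in> L2 M" and f: "f \<in> L2 M" for n using F by (auto simp: L2_tendsto_def)
  have lim: "(\<lambda>n. \<integral>x. (norm (F n x - f x))^2 \<partial>M) \<longlonglongrightarrow> 0" using F by (auto simp: L2_tendsto_def)
  fix e :: real
  show "e < 0 \<Longrightarrow> eventually (\<lambda>n. e < norm ((\<integral>x. F n x * \<psi> x \<partial>M) - (\<integral>x. f x * \<psi> x \<partial>M))) sequentially"
    by (rule always_eventually) (metis norm_ge_zero order_less_le_trans)
  assume e: "0 < e"
  have G: "G \<ge> 0" by (simp add: G_def)
  \<comment> \<open>Makes the term with the fixed function at most \<open>e/2\<close>; the added 1
    covers the case \<open>G = 0\<close>.\<close>
  define t where "t = e / (2 * (G + 1))"
  have G1: "2 * (G + 1) > 0" by (intro mult_pos_pos add_nonneg_pos G) auto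
  have t: "t > 0" unfolding t_def by (rule divide_pos_pos[OF e G1])
  have "t * G = (e / 2) * (G / (G + 1))" by (simp add: t_def)
  also have "\<dots> \<le> (e / 2) * 1" using e G by (intro mult_left_mono) auto
  finally have tG: "t * G \<le> e / 2" by simp
  have "eventually (\<lambda>n. (\<integral>x. (norm (F n x - f x))^2 \<partial>M) < t * (e / 2)) sequentially"
    using order_tendstoD(2)[OF lim, of "t * (e / 2)"] t e by simp
  then show "eventually (\<lambda>n. norm ((\<integral>x. F n x * \<psi> x \<partial>M) - (\<integral>x. f x * \<psi> x \<partial>M)) < e) sequentially"
  proof eventually_elim
    case (elim n)
    have "(\<integral>x. F n x * \<psi> x \<partial>M) - (\<integral>x. f x * \<psi> x \<partial>M) = (\<integral>x. (F n x - f x) * \<psi> x \<partial>M)"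
      using L2_mult_integrable[OF Fn \<psi>] L2_mult_integrable[OF f \<psi>] by (simp add: left_diff_distrib)
    also have "norm \<dots> \<le> (1 / t) * (\<integral>x. (norm (F n x - f x))^2 \<partial>M) + t * G"
      unfolding G_def by (rule L2_mult_weighted(2)[OF L2_diff[OF Fn f] \<psi> t])
    also have "\<dots> < e / 2 + e / 2"
      using elim t tG by (intro add_less_le_mono) (auto simp: pos_divide_less_eq mult.commute)
    finally show ?case by simp
  qed
qed

lemma L2_bounded:
  assumes "finite_measure M" "f \<in> borel_measurable M" "\<And>x. x \<in> space M \<Longrightarrow> norm (f x) \<le> B"
  shows "f \<in> L2 M"
proof -
  interpret finite_measure M by fact
  have "integrable M (\<lambda>x. (norm (f x))^2)"
  proof (rule integrable_const_bound[where B = "B^2"])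
    show "AE x in M. norm ((norm (f x))^2) \<le> B^2"
      using assms(3) by (intro AE_I2) (auto intro!: power_mono)
  qed (use assms(2) in measurable)
  then show ?thesis using assms(2) by (simp add: L2_def)
qed

lemma L2_integrable:
  assumes "finite_measure M" "f \<in> L2 M" shows "integrable M f"
proof -
  have "(\<lambda>x. 1) \<in> L2 M" by (rule L2_bounded[OF assms(1), where B = 1]) auto
  from L2_mult_integrable[OF assms(2) this] show ?thesis by simp
qed

lemma finite_measure_lebesgue_on_ball: "finite_measure (lebesgue_on (ball (c::'a::euclidean_space) r))"
proof
  have "ball c r \<in> lmeasurable" by (rule lmeasurable_ball)
  then have "emeasure lebesgue (ball c r) < \<infinity>" by (auto simp: fmeasurable_def)
  then show "emeasure (lebesgue_on (ball c r)) (space (lebesgue_on (ball c r))) \<noteq> \<infinity>"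
    by (simp add: space_restrict_space emeasure_restrict_space)
qed

lemma space_sphere_measure: "space (sphere_measure r :: 'a::euclidean_space measure) = sphere 0 r"
proof -
  have "sets (sphere_measure r :: 'a measure) = sets (restrict_space borel (sphere (0::'a) r))"
    by (simp add: sphere_measure_def)
  from sets_eq_imp_space_eq[OF this] show ?thesis by (simp add: space_restrict_space)
qed

lemma finite_measure_sphere_measure:
  assumes r: "r > 0" shows "finite_measure (sphere_measure r :: 'a::euclidean_space measure)"
proof
  let ?R = "restrict_space lborel (ball 0 r - {0::'a})" and ?S = "restrict_space borel (sphere (0::'a) r)"
  let ?h = "\<lambda>x::'a. (r / norm x) *\<^sub>R x"
  have hm: "?h \<in> measurable ?R ?S"
  proof (rule measurable_restrict_space2)
    show "?h \<in> space ?R \<rightarrow> sphere 0 r"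
      using r by (auto simp: space_restrict_space)
    have "?h \<in> borel_measurable borel" by measurable
    then show "?h \<in> borel_measurable ?R"
      by (intro measurable_restrict_space1) simp
  qed
  have "emeasure (distr ?R ?S ?h) (sphere 0 r) \<le> emeasure ?R (space ?R)"
    using hm by (subst emeasure_distr) (auto simp: sets_restrict_space intro!: emeasure_mono image_eqI[of _ _ UNIV])
  also have "\<dots> = emeasure lborel (ball 0 r - {0::'a})"
    by (subst emeasure_restrict_space) (auto simp: space_restrict_space)
  also have "\<dots> \<le> emeasure lborel (ball (0::'a) r)" by (intro emeasure_mono) auto
  also have "\<dots> < \<infinity>" by (rule emeasure_lborel_ball_finite)
  finally have "emeasure (distr ?R ?S ?h) (sphere 0 r) < \<infinity>" .
  then show "emeasure (sphere_measure r) (space (sphere_measure r :: 'a measure)) \<noteq> \<infinity>"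
    unfolding space_sphere_measure unfolding sphere_measure_def emeasure_scale_measure
    by (auto simp: ennreal_mult_eq_top_iff)
qed

lemma borel_measurable_sphere_measure:
  "f \<in> borel_measurable borel \<Longrightarrow> f \<in> borel_measurable (sphere_measure r :: 'a::euclidean_space measure)"
proof -
  assume "f \<in> borel_measurable borel"
  then have "f \<in> borel_measurable (restrict_space borel (sphere (0::'a) r))" by (rule measurable_restrict_space1)
  moreover have "sets (sphere_measure r :: 'a measure) = sets (restrict_space borel (sphere (0::'a) r))"
    by (simp add: sphere_measure_def)
  ultimately show ?thesis by (subst measurable_cong_sets) auto
qed

lemma borel_measurable_lebesgue_on:
  "f \<in> borel_measurable borel \<Longrightarrow> f \<in> borel_measurable (lebesgue_on S)"
  by (intro measurable_restrict_space1 measurable_completion) simp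

lemma integral_lebesgue_on_ball_eq_lborel:
  fixes f :: "'a::euclidean_space \<Rightarrow> complex"
  assumes "f \<in> borel_measurable borel"
  shows "(\<integral>x. f x \<partial>lebesgue_on (ball c r)) = (\<integral>x. indicator (ball c r) x *\<^sub>R f x \<partial>lborel)"
proof -
  have "(\<integral>x. f x \<partial>lebesgue_on (ball c r)) = (\<integral>x. indicator (ball c r) x *\<^sub>R f x \<partial>lebesgue)"
    by (rule integral_restrict_space) simp
  also have "\<dots> = (\<integral>x. indicator (ball c r) x *\<^sub>R f x \<partial>lborel)"
    using assms by (intro integral_completion borel_measurable_scaleR borel_measurable_indicator) auto
  finally show ?thesis .
qed

lemma bounded_continuous_on_ball:
  fixes f :: "'a::euclidean_space \<Rightarrow> complex"
  assumes "continuous_on UNIV f" shows "\<exists>B\<ge>0. \<forall>x\<in>cball 0 r. norm (f x) \<le> B"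
proof -
  have "bounded (f ` cball 0 r)"
    by (intro compact_imp_bounded compact_continuous_image continuous_on_subset[OF assms] compact_cball) auto
  then obtain a where "\<forall>y\<in>f ` cball 0 r. norm y \<le> a" unfolding bounded_iff ..
  then show ?thesis by (intro exI[of _ "max 0 a"]) (auto simp: max.coboundedI2)
qed

lemma L2_continuous_ball:
  assumes "continuous_on UNIV f" shows "f \<in> L2 (lebesgue_on (ball 0 r))"
proof -
  obtain B where "\<forall>x\<in>cball 0 r. norm (f x) \<le> B" using bounded_continuous_on_ball[OF assms] by blast
  then show ?thesis
    by (intro L2_bounded[OF finite_measure_lebesgue_on_ball, where B = B] borel_measurable_lebesgue_on
        borel_measurable_continuous_onI assms) (auto simp: space_restrict_space)
qed

lemma integrable_mult_continuous_ball:
  assumes g: "integrable (lebesgue_on (ball 0 r)) g" and f: "continuous_on UNIV f"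
  shows "integrable (lebesgue_on (ball 0 r)) (\<lambda>x. g x * f x :: complex)"
proof -
  obtain B where B: "B \<ge> 0" "\<forall>x\<in>cball 0 r. norm (f x) \<le> B" using bounded_continuous_on_ball[OF f] by blast
  have [measurable]: "f \<in> borel_measurable (lebesgue_on (ball 0 r))"
    by (intro borel_measurable_lebesgue_on borel_measurable_continuous_onI f)
  have [measurable]: "g \<in> borel_measurable (lebesgue_on (ball 0 r))" using g by auto
  have i: "integrable (lebesgue_on (ball 0 r)) (\<lambda>x. g x * of_real B)" using g by simp
  show ?thesis
  proof (rule Bochner_Integration.integrable_bound[OF i])
    show "AE x in lebesgue_on (ball 0 r). norm (g x * f x) \<le> norm (g x * of_real B)"
      using B by (intro AE_I2) (auto simp: norm_mult space_restrict_space intro!: mult_left_mono)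
  qed measurable
qed

section \<open>Testing the Helmholtz equation\<close>

lemma Ck_1_radial:
  assumes g: "\<And>s. s \<in> T \<Longrightarrow> (g has_vector_derivative g' s) (at s)" "\<And>s. s \<in> T \<Longrightarrow> (g' has_vector_derivative g'' s) (at s)"
    and T: "\<And>x::'a::euclidean_space. c + e * (x \<bullet> x) \<in> T"
  shows "Ck 1 (\<lambda>x::'a. g (c + e * (x \<bullet> x)))"
proof -
  have d: "(\<lambda>x::'a. g (c + e * (x \<bullet> x))) differentiable (at x)" "(\<lambda>x::'a. g' (c + e * (x \<bullet> x))) differentiable (at x)" for x
    using radial_has_derivative[OF g(1)[OF T]] radial_has_derivative[OF g(2)[OF T]] by (auto simp: differentiable_def)
  have "partials [b] (\<lambda>x::'a. g (c + e * (x \<bullet> x))) = (\<lambda>x. of_real (x \<bullet> b) * (of_real (2 * e) * g' (c + e * (x \<bullet> x))))" for b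
    by (rule partials_radial_fun) (use g(1) T in blast)
  then show ?thesis
    unfolding One_nat_def Ck_Suc using d Ck_coord[of 0] Ck_const[of 0]
    by (auto simp: Ck_0 intro!: differentiable_mult Ck_differentiable[OF Ck_coord[of 0]])
qed

lemma laplacian_mult_radial:
  fixes p :: "'a::euclidean_space \<Rightarrow> complex"
  assumes p: "Ck 1 p"
    and g: "\<And>s. s \<in> T \<Longrightarrow> (g has_vector_derivative g' s) (at s)" "\<And>s. s \<in> T \<Longrightarrow> (g' has_vector_derivative g'' s) (at s)"
    and T: "\<And>x::'a. c + e * (x \<bullet> x) \<in> T"
  shows "laplacian (\<lambda>x. p x * g (c + e * (x \<bullet> x))) x =
    laplacian p x * g (c + e * (x \<bullet> x))
    + of_real (4 * e) * (\<Sum>b\<in>Basis. of_real (x \<bullet> b) * partials [b] p x) * g' (c + e * (x \<bullet> x))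
    + p x * (of_real (4 * e^2 * (x \<bullet> x)) * g'' (c + e * (x \<bullet> x)) + of_real (2 * e * DIM('a)) * g' (c + e * (x \<bullet> x)))"
proof -
  have r: "partials [b] (\<lambda>x::'a. g (c + e * (x \<bullet> x))) x = of_real (x \<bullet> b) * (of_real (2 * e) * g' (c + e * (x \<bullet> x)))" for b
    by (rule partials_radial[OF g(1)[OF T]])
  have "(\<Sum>b\<in>Basis. partials [b] p x * partials [b] (\<lambda>x. g (c + e * (x \<bullet> x))) x)
     = of_real (2 * e) * (\<Sum>b\<in>Basis. of_real (x \<bullet> b) * partials [b] p x) * g' (c + e * (x \<bullet> x))"
    unfolding r by (simp add: sum_distrib_left sum_distrib_right mult_ac)
  then show ?thesis
    by (subst laplacian_mult[OF p Ck_1_radial[OF g T]], simp_all only: laplacian_radial[OF g T]) simp_all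
qed

lemma laplacian_harmonic_mult_radial:
  fixes Y :: "'a::euclidean_space \<Rightarrow> complex"
  assumes Y: "hpoly l Y" "\<And>x. laplacian Y x = 0"
    and g: "\<And>s. s \<in> T \<Longrightarrow> (g has_vector_derivative g' s) (at s)" "\<And>s. s \<in> T \<Longrightarrow> (g' has_vector_derivative g'' s) (at s)"
    and T: "\<And>x::'a. c + (x \<bullet> x) \<in> T"
  shows "laplacian (\<lambda>x. Y x * g (c + (x \<bullet> x))) x =
    Y x * (4 * of_real (x \<bullet> x) * g'' (c + (x \<bullet> x)) + 2 * of_nat (2 * l + DIM('a)) * g' (c + (x \<bullet> x)))"
  using laplacian_mult_radial[OF hpoly_Ck[OF Y(1)] g, where T = T and c = c and e = 1 and x = x] T
  by (simp add: Y(2) hpoly_euler[OF Y(1)] algebra_simps)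

text \<open>The factor \<open>q(1/\<tau>)\<close> makes the class closed under differentiation, with
  \<open>cutoff'\<close> acting on \<open>q\<close>, while the exponential makes every member flat
  at 0. As \<delta> tends to 0, \<open>q = 1\<close> approximates \<open>\<tau>^2\<close> and
  \<open>q = [:0, 0, 1:]\<close> approximates 1 on \<open>\<tau> > 0\<close>.\<close>

definition cutoff :: "real \<Rightarrow> real poly \<Rightarrow> real \<Rightarrow> real" where
  "cutoff \<delta> q \<tau> = (if \<tau> > 0 then \<tau>\<^sup>2 * poly q (1 / \<tau>) * exp (- (\<delta> / \<tau>)) else 0)"

definition cutoff' :: "real \<Rightarrow> real poly \<Rightarrow> real poly" where
  "cutoff' \<delta> q = [:0, 2:] * q - [:0, 0, 1:] * pderiv q + [:0, 0, \<delta>:] * q"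

lemma poly_exp_tendsto_0:
  fixes q :: "real poly"
  assumes \<delta>: "\<delta> > 0" shows "((\<lambda>\<sigma>. poly q \<sigma> * exp (- (\<delta> * \<sigma>))) \<longlongrightarrow> 0) at_top"
proof -
  have m: "((\<lambda>\<sigma>. \<sigma> ^ n * exp (- (\<delta> * \<sigma>))) \<longlongrightarrow> 0) at_top" for n
    using \<delta> by real_asymp
  have "((\<lambda>\<sigma>. \<Sum>i\<le>degree q. coeff q i * (\<sigma> ^ i * exp (- (\<delta> * \<sigma>)))) \<longlongrightarrow> (\<Sum>i\<le>degree q. coeff q i * 0)) at_top"
    by (intro tendsto_sum tendsto_mult tendsto_const m)
  then show ?thesis
    by (simp add: poly_altdef sum_distrib_right mult.assoc)
qed

lemma cutoff_has_derivative:
  assumes \<delta>: "\<delta> > 0"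
  shows "(cutoff \<delta> q has_real_derivative cutoff \<delta> (cutoff' \<delta> q) \<tau>) (at \<tau>)"
proof -
  consider "\<tau> > 0" | "\<tau> < 0" | "\<tau> = 0" by linarith
  then show ?thesis
  proof cases
    case 1
    have "((\<lambda>\<tau>. \<tau>\<^sup>2 * poly q (1 / \<tau>) * exp (- (\<delta> / \<tau>))) has_real_derivative
      (2 * \<tau> * poly q (1 / \<tau>) + \<tau>\<^sup>2 * (poly (pderiv q) (1 / \<tau>) * (- 1 / \<tau>\<^sup>2))) * exp (- (\<delta> / \<tau>))
       + \<tau>\<^sup>2 * poly q (1 / \<tau>) * (exp (- (\<delta> / \<tau>)) * (\<delta> / \<tau>\<^sup>2))) (at \<tau>)"
      using 1 by (auto intro!: derivative_eq_intros DERIV_chain2[OF poly_DERIV] simp: power2_eq_square field_simps)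
    moreover have "(2 * \<tau> * poly q (1 / \<tau>) + \<tau>\<^sup>2 * (poly (pderiv q) (1 / \<tau>) * (- 1 / \<tau>\<^sup>2))) * exp (- (\<delta> / \<tau>))
       + \<tau>\<^sup>2 * poly q (1 / \<tau>) * (exp (- (\<delta> / \<tau>)) * (\<delta> / \<tau>\<^sup>2)) = cutoff \<delta> (cutoff' \<delta> q) \<tau>"
      using 1 by (simp add: cutoff_def cutoff'_def power2_eq_square field_simps)
    ultimately have "((\<lambda>\<tau>. \<tau>\<^sup>2 * poly q (1 / \<tau>) * exp (- (\<delta> / \<tau>))) has_real_derivative cutoff \<delta> (cutoff' \<delta> q) \<tau>) (at \<tau>)" by simp
    then show ?thesis
      by (rule has_field_derivative_transform_within_open[where S = "{0<..}"]) (use 1 in \<open>auto simp: cutoff_def\<close>)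
  next
    case 2
    have "((\<lambda>\<tau>. 0) has_real_derivative 0) (at \<tau>)" by simp
    then have "(cutoff \<delta> q has_real_derivative 0) (at \<tau>)"
      by (rule has_field_derivative_transform_within_open[where S = "{..<0}"]) (use 2 in \<open>auto simp: cutoff_def\<close>)
    then show ?thesis using 2 by (simp add: cutoff_def)
  next
    case 3
    have "((\<lambda>h. cutoff \<delta> q h / h) \<longlongrightarrow> 0) (at 0)"
    proof (rule filterlim_split_at)
      have "eventually (\<lambda>h. cutoff \<delta> q h / h = 0) (at_left 0)"
        by (intro eventually_mono[OF eventually_at_left_real[of "-1" 0]]) (auto simp: cutoff_def)
      then show "((\<lambda>h. cutoff \<delta> q h / h) \<longlongrightarrow> 0) (at_left 0)" by (rule tendsto_eventually)
      have "((\<lambda>h::real. h * (poly q (inverse h) * exp (- (\<delta> * inverse h)))) \<longlongrightarrow> 0 * 0) (at_right 0)"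
        by (intro tendsto_mult filterlim_compose[OF poly_exp_tendsto_0[OF \<delta>] filterlim_inverse_at_top_right])
           (auto intro!: tendsto_eq_intros)
      moreover have "eventually (\<lambda>h. h * (poly q (inverse h) * exp (- (\<delta> * inverse h))) = cutoff \<delta> q h / h) (at_right 0)"
        by (intro eventually_mono[OF eventually_at_right_real[of 0 1]]) (auto simp: cutoff_def power2_eq_square field_simps)
      ultimately show "((\<lambda>h. cutoff \<delta> q h / h) \<longlongrightarrow> 0) (at_right 0)"
        using tendsto_cong by fastforce
    qed
    then have "(cutoff \<delta> q has_real_derivative 0) (at 0)"
      by (simp add: DERIV_def cutoff_def)
    then show ?thesis using 3 by (simp add: cutoff_def)
  qed
qed

lemma cutoff_has_vector_derivative:
  "\<delta> > 0 \<Longrightarrow> ((\<lambda>\<tau>. complex_of_real (cutoff \<delta> q \<tau>)) has_vector_derivative complex_of_real (cutoff \<delta> (cutoff' \<delta> q) \<tau>)) (at \<tau>)"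
  by (rule has_vector_derivative_of_real[OF cutoff_has_derivative])

lemma smooth_cutoff:
  assumes "\<delta> > 0"
  shows "smooth (\<lambda>x::'a::euclidean_space. complex_of_real (cutoff \<delta> q (c + e * (x \<bullet> x))))"
proof (rule smooth_radial_family[where G = "range (\<lambda>q \<tau>. complex_of_real (cutoff \<delta> q \<tau>))" and T = UNIV])
  show "\<exists>g'\<in>range (\<lambda>q \<tau>. complex_of_real (cutoff \<delta> q \<tau>)). \<forall>s\<in>UNIV. (g has_vector_derivative g' s) (at s)"
    if g: "g \<in> range (\<lambda>q \<tau>. complex_of_real (cutoff \<delta> q \<tau>))" for g
  proof -
    obtain q where "g = (\<lambda>\<tau>. complex_of_real (cutoff \<delta> q \<tau>))" using g by auto
    then show ?thesis using cutoff_has_vector_derivative[OF assms, of q]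
      by (intro bexI[of _ "\<lambda>\<tau>. complex_of_real (cutoff \<delta> (cutoff' \<delta> q) \<tau>)"]) auto
  qed
qed auto

text \<open>Subtracting \<delta> in the argument confines the support to
  \<open>|x|^2 \<le> r^2 - \<delta>\<close>, a compact subset of the open ball.\<close>

lemma cutoff_mult_test_function:
  fixes \<phi> :: "'a::euclidean_space \<Rightarrow> complex"
  assumes "\<delta> > 0" "r > 0" "smooth \<phi>"
  shows "(\<lambda>x. \<phi> x * of_real (cutoff \<delta> q (r^2 - \<delta> + (-1) * (x \<bullet> x)))) \<in> test_functions (ball 0 r)"
proof -
  let ?\<psi> = "\<lambda>x. \<phi> x * of_real (cutoff \<delta> q (r^2 - \<delta> + (-1) * (x \<bullet> x)))"
  let ?K = "{x::'a. x \<bullet> x \<le> r^2 - \<delta>}"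
  have sub: "?K \<subseteq> ball 0 r"
  proof
    fix x assume "x \<in> ?K"
    then have "(norm x)^2 < r^2" using assms(1) by (simp add: power2_norm_eq_inner)
    then show "x \<in> ball 0 r" using assms(2) by (simp add: power2_less_imp_less)
  qed
  have cl: "closed ?K" by (intro closed_Collect_le continuous_intros)
  have "compact ?K" using sub cl bounded_subset[OF bounded_ball] compact_eq_bounded_closed by blast
  have "{x. ?\<psi> x \<noteq> 0} \<subseteq> ?K" by (auto simp: cutoff_def split: if_splits)
  then have "closure {x. ?\<psi> x \<noteq> 0} \<subseteq> ?K" using cl by (rule closure_minimal)
  moreover have "compact (closure {x. ?\<psi> x \<noteq> 0})"
    using \<open>compact ?K\<close> calculation compact_Int_closed[OF \<open>compact ?K\<close> closed_closure[of "{x. ?\<psi> x \<noteq> 0}"]]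
    by (simp add: Int_absorb1)
  moreover have "smooth ?\<psi>" by (rule smooth_mult[OF assms(3) smooth_cutoff[OF assms(1)]])
  ultimately show ?thesis using sub unfolding test_functions_def by blast
qed

text \<open>The cutoffs \<open>X n\<close> are bounded by 1 and tend to 1 inside the ball, so
  dominated convergence removes the compact support of the test function. Since only
  \<open>g\<close> carries the information, no boundary term can appear.\<close>

lemma test_zero_imp_smooth_zero:
  fixes g \<phi> :: "'a::euclidean_space \<Rightarrow> complex"
  assumes r: "r > 0" and g: "integrable (lebesgue_on (ball 0 r)) g"
    and test: "\<And>\<psi>. \<psi> \<in> test_functions (ball 0 r) \<Longrightarrow> (\<integral>x. g x * \<psi> x \<partial>lebesgue_on (ball 0 r)) = 0"
    and \<phi>: "smooth \<phi>"
  shows "(\<integral>x. g x * \<phi> x \<partial>lebesgue_on (ball 0 r)) = 0"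
proof -
  define X where "X n x = cutoff (1 / real (Suc n)) [:0, 0, 1:] (r^2 - 1 / real (Suc n) + (-1) * (x \<bullet> x))" for n and x :: 'a
  have c: "cutoff \<delta> [:0, 0, 1:] \<tau> = (if \<tau> > 0 then exp (- (\<delta> / \<tau>)) else 0)" for \<delta> \<tau>
    by (auto simp: cutoff_def power2_eq_square)
  have X01: "\<bar>X n x\<bar> \<le> 1" for n x
    by (auto simp: X_def c)
  have g\<phi>: "integrable (lebesgue_on (ball 0 r)) (\<lambda>x. g x * \<phi> x)"
    by (rule integrable_mult_continuous_ball[OF g smooth_continuous_on[OF \<phi>]])
  have mX: "X n \<in> borel_measurable (lebesgue_on (ball 0 r))" for n
  proof -
    have "continuous_on UNIV (\<lambda>x. Re (complex_of_real (X n x)))"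
      unfolding X_def by (intro continuous_intros smooth_continuous_on smooth_cutoff) auto
    then have "continuous_on UNIV (X n)" by simp
    then show ?thesis by (intro borel_measurable_lebesgue_on borel_measurable_continuous_onI)
  qed
  have "(\<lambda>n. \<integral>x. g x * (\<phi> x * of_real (X n x)) \<partial>lebesgue_on (ball 0 r)) \<longlonglongrightarrow> (\<integral>x. g x * \<phi> x \<partial>lebesgue_on (ball 0 r))"
  proof (rule integral_dominated_convergence[where w = "\<lambda>x. norm (g x * \<phi> x)"])
    show "integrable (lebesgue_on (ball 0 r)) (\<lambda>x. norm (g x * \<phi> x))" using g\<phi> by simp
    show "(\<lambda>x. g x * \<phi> x) \<in> borel_measurable (lebesgue_on (ball 0 r))" using g\<phi> by auto
    have "(\<lambda>x. (g x * \<phi> x) * of_real (X n x)) \<in> borel_measurable (lebesgue_on (ball 0 r))" for n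
      by (rule borel_measurable_times[OF borel_measurable_integrable[OF g\<phi>] measurable_compose[OF mX borel_measurable_of_real]])
    then show "(\<lambda>x. g x * (\<phi> x * of_real (X n x))) \<in> borel_measurable (lebesgue_on (ball 0 r))" for n
      by (simp add: mult.assoc)
    show "AE x in lebesgue_on (ball 0 r). norm (g x * (\<phi> x * of_real (X n x))) \<le> norm (g x * \<phi> x)" for n
      using X01 by (intro AE_I2) (auto simp: norm_mult mult_left_le mult.assoc intro!: mult_left_mono)
    show "AE x in lebesgue_on (ball 0 r). (\<lambda>n. g x * (\<phi> x * of_real (X n x))) \<longlonglongrightarrow> g x * \<phi> x"
    proof (rule AE_I2)
      fix x assume "x \<in> space (lebesgue_on (ball (0::'a) r))"
      then have "norm x < r" by (simp add: space_restrict_space)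
      then have x: "x \<bullet> x < r^2" by (simp add: power2_norm_eq_inner[symmetric] power_strict_mono)
      have d0: "(\<lambda>n. 1 / real (Suc n)) \<longlonglongrightarrow> 0" using LIMSEQ_inverse_real_of_nat by (simp add: inverse_eq_divide)
      have t: "(\<lambda>n. r^2 - 1 / real (Suc n) + (-1) * (x \<bullet> x)) \<longlonglongrightarrow> r^2 - 0 + (-1) * (x \<bullet> x)"
        by (intro tendsto_intros d0)
      have pos: "r^2 - 0 + (-1) * (x \<bullet> x) > 0" using x by simp
      have ev: "eventually (\<lambda>n. r^2 - 1 / real (Suc n) + (-1) * (x \<bullet> x) > 0) sequentially"
        by (rule order_tendstoD(1)[OF t pos])
      have "(\<lambda>n. exp (- ((1 / real (Suc n)) / (r^2 - 1 / real (Suc n) + (-1) * (x \<bullet> x))))) \<longlonglongrightarrow> exp (- (0 / (r^2 - 0 + (-1) * (x \<bullet> x))))"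
        by (intro tendsto_exp tendsto_minus tendsto_divide d0 t) (use pos in simp)
      then have "(\<lambda>n. X n x) \<longlonglongrightarrow> exp (- (0 / (r^2 - 0 + (-1) * (x \<bullet> x))))"
        by (rule Lim_transform_eventually) (use ev in \<open>eventually_elim, simp add: X_def c\<close>)
      then have "(\<lambda>n. X n x) \<longlonglongrightarrow> 1" by simp
      then have "(\<lambda>n. g x * (\<phi> x * of_real (X n x))) \<longlonglongrightarrow> g x * (\<phi> x * of_real 1)"
        by (intro tendsto_intros)
      then show "(\<lambda>n. g x * (\<phi> x * of_real (X n x))) \<longlonglongrightarrow> g x * \<phi> x" by simp
    qed
  qed
  moreover have "(\<integral>x. g x * (\<phi> x * of_real (X n x)) \<partial>lebesgue_on (ball 0 r)) = 0" for n
    unfolding X_def by (intro test cutoff_mult_test_function r \<phi>) simp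
  ultimately have "(\<lambda>n::nat. 0) \<longlonglongrightarrow> (\<integral>x. g x * \<phi> x \<partial>lebesgue_on (ball 0 r))" by (simp only:)
  from LIMSEQ_unique[OF this tendsto_const] show ?thesis by simp
qed

text \<open>\<open>(r^2 - |x|^2)^2\<close> vanishes to second order on the sphere. Its
  approximations \<open>cutoff \<delta> 1\<close> have first and second derivatives bounded
  uniformly in \<delta>, so dominated convergence against the merely integrable \<open>v\<close>
  extends the distributional equation to this factor.\<close>

lemma helmholtz_test_quadratic:
  fixes v p :: "'a::euclidean_space \<Rightarrow> complex"
  assumes r: "r > 0" and v: "integrable (lebesgue_on (ball 0 r)) v"
    and helm: "helmholtz_distributional (ball 0 r) k v (\<lambda>x. 0)" and p: "smooth p"
  shows "(\<integral>x. v x * (laplacian (\<lambda>x. p x * of_real ((r^2 + (-1) * (x \<bullet> x))^2)) x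
     + k^2 * (p x * of_real ((r^2 + (-1) * (x \<bullet> x))^2))) \<partial>lebesgue_on (ball 0 r)) = 0"
proof -
  let ?M = "lebesgue_on (ball (0::'a) r)"
  define \<delta> where "\<delta> n = 1 / real (Suc n)" for n
  have \<delta>: "\<delta> n > 0" "\<delta> n \<le> 1" for n by (auto simp: \<delta>_def)
  have d0: "\<delta> \<longlonglongrightarrow> 0" unfolding \<delta>_def using LIMSEQ_inverse_real_of_nat by (simp add: inverse_eq_divide)
  define t where "t n x = r^2 - \<delta> n + (-1) * (x \<bullet> x)" for n and x :: 'a
  define g0 g1 g2 where "g0 n = cutoff (\<delta> n) 1" and "g1 n = cutoff (\<delta> n) (cutoff' (\<delta> n) 1)" and
    "g2 n = cutoff (\<delta> n) (cutoff' (\<delta> n) (cutoff' (\<delta> n) 1))" for n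
  define E where "E x = (\<Sum>b\<in>Basis. of_real (x \<bullet> b) * partials [b] p x)" for x
  have f0: "g0 n \<tau> = (if \<tau> > 0 then \<tau>\<^sup>2 * exp (- (\<delta> n / \<tau>)) else 0)" for n \<tau>
    by (simp add: g0_def cutoff_def)
  have f1: "g1 n \<tau> = (if \<tau> > 0 then (2 * \<tau> + \<delta> n) * exp (- (\<delta> n / \<tau>)) else 0)" for n \<tau>
    by (simp add: g1_def cutoff_def cutoff'_def power2_eq_square field_simps)
  have f2: "g2 n \<tau> = (if \<tau> > 0 then (2 + 2 * (\<delta> n / \<tau>) + (\<delta> n / \<tau>)^2) * exp (- (\<delta> n / \<tau>)) else 0)" for n \<tau>
    by (simp add: g2_def cutoff_def cutoff'_def pderiv_mult pderiv_pCons power2_eq_square field_simps)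
  \<comment> \<open>The Helmholtz expression as a function of the values of the radial profile and
    of its two derivatives, so that the approximations and the limit have the same shape.\<close>
  define I where "I a0 a1 a2 x = laplacian p x * of_real a0 + of_real (4 * (-1)) * E x * of_real a1
    + p x * (of_real (4 * (-1)^2 * (x \<bullet> x)) * of_real a2 + of_real (2 * (-1) * DIM('a)) * of_real a1) + k^2 * (p x * of_real a0)"
    for a0 a1 a2 :: real and x
  have Ip: "Ck 1 p" using p by (simp add: smooth_iff_Ck)
  have lap_n: "laplacian (\<lambda>x. p x * of_real (g0 n (t n x))) x + k^2 * (p x * of_real (g0 n (t n x)))
     = I (g0 n (t n x)) (g1 n (t n x)) (g2 n (t n x)) x" for n x
    unfolding I_def E_def t_def g0_def g1_def g2_def
    by (subst laplacian_mult_radial[OF Ip cutoff_has_vector_derivative[OF \<delta>(1)] cutoff_has_vector_derivative[OF \<delta>(1)] UNIV_I]) simp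
  have lap: "laplacian (\<lambda>x. p x * of_real ((r^2 + (-1) * (x \<bullet> x))^2)) x + k^2 * (p x * of_real ((r^2 + (-1) * (x \<bullet> x))^2))
     = I ((r^2 + (-1) * (x \<bullet> x))^2) (2 * (r^2 + (-1) * (x \<bullet> x))) 2 x" for x
  proof -
    have g1: "((\<lambda>\<tau>. complex_of_real (\<tau>\<^sup>2)) has_vector_derivative complex_of_real (2 * \<tau>)) (at \<tau>)" for \<tau>
      by (rule has_vector_derivative_of_real) (auto intro!: derivative_eq_intros)
    have g2: "((\<lambda>\<tau>. complex_of_real (2 * \<tau>)) has_vector_derivative complex_of_real 2) (at \<tau>)" for \<tau>
      by (rule has_vector_derivative_of_real) (auto intro!: derivative_eq_intros)
    show ?thesis unfolding I_def E_def
      by (subst laplacian_mult_radial[OF Ip g1 g2 UNIV_I]) simp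
  qed
  have cont: "continuous_on UNIV (laplacian p)" "continuous_on UNIV E" "continuous_on UNIV p"
    unfolding laplacian_def[abs_def] E_def
    by (intro continuous_intros smooth_partials_continuous_on smooth_continuous_on p; simp)+
  obtain B0 B1 B2 where B: "B0 \<ge> 0" "\<And>x. x \<in> cball 0 r \<Longrightarrow> norm (laplacian p x) \<le> B0"
      "B1 \<ge> 0" "\<And>x. x \<in> cball 0 r \<Longrightarrow> norm (E x) \<le> B1" "B2 \<ge> 0" "\<And>x. x \<in> cball 0 r \<Longrightarrow> norm (p x) \<le> B2"
    using bounded_continuous_on_ball[OF cont(1), of r] bounded_continuous_on_ball[OF cont(2), of r] bounded_continuous_on_ball[OF cont(3), of r]
    by metis
  \<comment> \<open>A crude common bound for the profile and its two derivatives, uniform in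
    \<open>n\<close> for arguments up to \<open>r^2\<close>.\<close>
  define a where "a = (r^2)^2 + 2 * r^2 + 6"
  have a: "a \<ge> 0" by (simp add: a_def)
  have "(r^2)^2 \<ge> 0" "r^2 \<ge> 0" by (rule zero_le_power2)+
  then have a_ge: "2 \<le> a" "2 * r^2 + 1 \<le> a" "(r^2)^2 \<le> a" unfolding a_def by linarith+
  define C where "C = B0 * a + 4 * B1 * a + B2 * (4 * r^2 * a + 2 * DIM('a) * a) + norm (k^2) * (B2 * a)"
  have I_le: "norm (I a0 a1 a2 x) \<le> C" if x: "norm x < r" and "\<bar>a0\<bar> \<le> a" "\<bar>a1\<bar> \<le> a" "\<bar>a2\<bar> \<le> a" for a0 a1 a2 x
  proof -
    have x': "x \<in> cball 0 r" using x by simp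
    have xx: "\<bar>x \<bullet> x\<bar> \<le> r^2" using x by (simp add: power2_norm_eq_inner[symmetric] power_mono)
    have "norm (laplacian p x * of_real a0) \<le> B0 * a"
      unfolding norm_mult norm_of_real using B that x' by (intro mult_mono) auto
    moreover have "norm (of_real (4 * (-1)) * E x * of_real a1) \<le> 4 * B1 * a"
      unfolding norm_mult norm_of_real using B that x' by (intro mult_mono) auto
    moreover have "norm (p x * (of_real (4 * (-1)^2 * (x \<bullet> x)) * of_real a2 + of_real (2 * (-1) * DIM('a)) * of_real a1)) \<le> B2 * (4 * r^2 * a + 2 * DIM('a) * a)"
      unfolding norm_mult[of "p x"]
    proof (intro mult_mono order_trans[OF norm_triangle_ineq] add_mono)
      show "norm (of_real (4 * (-1)^2 * (x \<bullet> x)) * of_real a2 :: complex) \<le> 4 * r^2 * a"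
        unfolding norm_mult norm_of_real using xx that a by (intro mult_mono) auto
      show "norm (of_real (2 * (-1) * DIM('a)) * of_real a1 :: complex) \<le> 2 * DIM('a) * a"
        unfolding norm_mult norm_of_real using that a by (intro mult_mono) auto
    qed (use B x' in auto)
    moreover have "norm (k^2 * (p x * of_real a0)) \<le> norm (k^2) * (B2 * a)"
      unfolding norm_mult[of "k^2"] norm_mult[of "p x"] norm_of_real using B that x' by (intro mult_left_mono mult_mono) auto
    ultimately show ?thesis unfolding I_def C_def
      by (intro order_trans[OF norm_triangle_ineq] add_mono) auto
  qed
  have g_le: "\<bar>g0 n \<tau>\<bar> \<le> a" "\<bar>g1 n \<tau>\<bar> \<le> a" "\<bar>g2 n \<tau>\<bar> \<le> a" if "\<tau> \<le> r^2" for n \<tau>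
  proof -
    have "\<bar>g0 n \<tau>\<bar> \<le> a \<and> \<bar>g1 n \<tau>\<bar> \<le> a \<and> \<bar>g2 n \<tau>\<bar> \<le> a"
    proof (cases "\<tau> > 0")
      case True
      define y where "y = \<delta> n / \<tau>"
      have y: "y > 0" using True \<delta>(1)[of n] by (simp add: y_def)
      define ey where "ey = exp (- y)"
      have ey: "0 < ey" "ey \<le> 1" using y by (auto simp: ey_def)
      \<comment> \<open>With \<open>y = \<delta>/\<tau>\<close> the second derivative is
        \<open>(2 + 2y + y^2) exp(-y)\<close>, which this inequality bounds by 2 however close
        \<tau> is to 0.\<close>
      have "1 + y + y^2 / 2 \<le> exp y" using exp_lower_Taylor_quadratic[of y] y by simp
      then have "(1 + y + y^2 / 2) * ey \<le> exp y * ey" using ey by (intro mult_right_mono) auto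
      also have "exp y * ey = 1" by (simp add: ey_def exp_minus)
      finally have e2: "(2 + 2 * y + y^2) * ey \<le> 2" by (simp add: algebra_simps)
      have "\<bar>g2 n \<tau>\<bar> = (2 + 2 * y + y^2) * ey" using True y ey by (simp add: f2 y_def[symmetric] ey_def[symmetric])
      then have 2: "\<bar>g2 n \<tau>\<bar> \<le> a" using e2 a_ge by linarith
      have "\<bar>g1 n \<tau>\<bar> = (2 * \<tau> + \<delta> n) * ey"
        using True \<delta>(1)[of n] ey by (simp add: f1 y_def[symmetric] ey_def[symmetric])
      also have "\<dots> \<le> (2 * \<tau> + \<delta> n) * 1" using ey True \<delta>(1)[of n] by (intro mult_left_mono) auto
      also have "\<dots> \<le> a" using that \<delta>(2)[of n] a_ge by simp
      finally have 1: "\<bar>g1 n \<tau>\<bar> \<le> a" .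
      have "\<bar>g0 n \<tau>\<bar> = \<tau>\<^sup>2 * ey" using True ey by (simp add: f0 y_def[symmetric] ey_def[symmetric])
      also have "\<dots> \<le> (r^2)^2 * 1" using ey True that by (intro mult_mono power_mono) auto
      also have "\<dots> \<le> a" using a_ge by simp
      finally show ?thesis using 1 2 by simp
    qed (use a in \<open>simp add: f0 f1 f2\<close>)
    then show "\<bar>g0 n \<tau>\<bar> \<le> a" "\<bar>g1 n \<tau>\<bar> \<le> a" "\<bar>g2 n \<tau>\<bar> \<le> a" by auto
  qed
  have t_le: "t n x \<le> r^2" for n x using \<delta>(1)[of n] inner_ge_zero[of x] unfolding t_def by linarith
  have lim: "(\<lambda>n. I (g0 n (t n x)) (g1 n (t n x)) (g2 n (t n x)) x) \<longlonglongrightarrow> I ((r^2 + (-1) * (x \<bullet> x))^2) (2 * (r^2 + (-1) * (x \<bullet> x))) 2 x"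
    if x: "norm x < r" for x
  proof -
    define \<tau> where "\<tau> = r^2 - 0 + (-1) * (x \<bullet> x)"
    have "(norm x)^2 < r^2" using x by (intro power_strict_mono) auto
    then have \<tau>: "\<tau> > 0" by (simp add: \<tau>_def power2_norm_eq_inner)
    have tl: "(\<lambda>n. t n x) \<longlonglongrightarrow> \<tau>" unfolding t_def \<tau>_def by (intro tendsto_intros d0)
    have ev: "eventually (\<lambda>n. t n x > 0) sequentially" by (rule order_tendstoD(1)[OF tl \<tau>])
    have yl: "(\<lambda>n. \<delta> n / t n x) \<longlonglongrightarrow> 0" using tendsto_divide[OF d0 tl] \<tau> by simp
    have el: "(\<lambda>n. exp (- (\<delta> n / t n x))) \<longlonglongrightarrow> 1" using tendsto_exp[OF tendsto_minus[OF yl]] by simp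
    have "(\<lambda>n. (t n x)^2 * exp (- (\<delta> n / t n x))) \<longlonglongrightarrow> \<tau>\<^sup>2 * 1" by (intro tendsto_intros tl el)
    then have l0: "(\<lambda>n. g0 n (t n x)) \<longlonglongrightarrow> \<tau>\<^sup>2 * 1"
      by (rule Lim_transform_eventually) (use ev in \<open>eventually_elim, simp add: f0\<close>)
    have "(\<lambda>n. (2 * t n x + \<delta> n) * exp (- (\<delta> n / t n x))) \<longlonglongrightarrow> (2 * \<tau> + 0) * 1" by (intro tendsto_intros tl el d0)
    then have l1: "(\<lambda>n. g1 n (t n x)) \<longlonglongrightarrow> (2 * \<tau> + 0) * 1"
      by (rule Lim_transform_eventually) (use ev in \<open>eventually_elim, simp add: f1\<close>)
    have "(\<lambda>n. (2 + 2 * (\<delta> n / t n x) + (\<delta> n / t n x)^2) * exp (- (\<delta> n / t n x))) \<longlonglongrightarrow> (2 + 2 * 0 + 0^2) * 1"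
      by (intro tendsto_intros yl el)
    then have l2: "(\<lambda>n. g2 n (t n x)) \<longlonglongrightarrow> (2 + 2 * 0 + 0^2) * 1"
      by (rule Lim_transform_eventually) (use ev in \<open>eventually_elim, simp add: f2\<close>)
    have "(\<lambda>n. I (g0 n (t n x)) (g1 n (t n x)) (g2 n (t n x)) x) \<longlonglongrightarrow> I (\<tau>\<^sup>2 * 1) ((2 * \<tau> + 0) * 1) ((2 + 2 * 0 + 0^2) * 1) x"
      unfolding I_def by (intro tendsto_intros l0 l1 l2)
    then show ?thesis by (simp add: \<tau>_def)
  qed
  have mI: "(\<lambda>x. I (a0 x) (a1 x) (a2 x) x) \<in> borel_measurable ?M"
    if "continuous_on UNIV a0" "continuous_on UNIV a1" "continuous_on UNIV a2" for a0 a1 a2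
    unfolding I_def by (intro borel_measurable_lebesgue_on borel_measurable_continuous_onI continuous_intros cont that)
  have cc: "continuous_on UNIV (\<lambda>x. cutoff (\<delta> n) q (t n x))" for n q
  proof -
    have "continuous_on UNIV (\<lambda>x. Re (complex_of_real (cutoff (\<delta> n) q (t n x))))"
      unfolding t_def by (intro continuous_intros smooth_continuous_on smooth_cutoff \<delta>)
    then show ?thesis by simp
  qed
  have mv: "v \<in> borel_measurable ?M" using v by auto
  have "(\<lambda>n. \<integral>x. v x * I (g0 n (t n x)) (g1 n (t n x)) (g2 n (t n x)) x \<partial>?M)
     \<longlonglongrightarrow> (\<integral>x. v x * I ((r^2 + (-1) * (x \<bullet> x))^2) (2 * (r^2 + (-1) * (x \<bullet> x))) 2 x \<partial>?M)"
  proof (rule integral_dominated_convergence[where w = "\<lambda>x. norm (v x) * C"])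
    show "integrable ?M (\<lambda>x. norm (v x) * C)" using v by simp
    show "AE x in ?M. norm (v x * I (g0 n (t n x)) (g1 n (t n x)) (g2 n (t n x)) x) \<le> norm (v x) * C" for n
      using I_le g_le[OF t_le] by (intro AE_I2) (auto simp: norm_mult space_restrict_space intro!: mult_left_mono)
    show "AE x in ?M. (\<lambda>n. v x * I (g0 n (t n x)) (g1 n (t n x)) (g2 n (t n x)) x) \<longlonglongrightarrow> v x * I ((r^2 + (-1) * (x \<bullet> x))^2) (2 * (r^2 + (-1) * (x \<bullet> x))) 2 x"
      using lim by (intro AE_I2 tendsto_mult tendsto_const) (auto simp: space_restrict_space)
    show "(\<lambda>x. v x * I (g0 n (t n x)) (g1 n (t n x)) (g2 n (t n x)) x) \<in> borel_measurable ?M" for n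
      unfolding g0_def g1_def g2_def by (intro borel_measurable_times mv mI cc)
    show "(\<lambda>x. v x * I ((r^2 + (-1) * (x \<bullet> x))^2) (2 * (r^2 + (-1) * (x \<bullet> x))) 2 x) \<in> borel_measurable ?M"
      by (intro borel_measurable_times mv mI continuous_intros)
  qed
  moreover have "(\<integral>x. v x * I (g0 n (t n x)) (g1 n (t n x)) (g2 n (t n x)) x \<partial>?M) = 0" for n
  proof -
    have "(\<lambda>x. p x * of_real (g0 n (t n x))) \<in> test_functions (ball 0 r)"
      unfolding g0_def t_def by (rule cutoff_mult_test_function[OF \<delta>(1) r p])
    then show ?thesis
      using helm unfolding helmholtz_distributional_def lap_n[symmetric] by simp
  qed
  ultimately have "(\<lambda>n::nat. 0) \<longlonglongrightarrow> (\<integral>x. v x * I ((r^2 + (-1) * (x \<bullet> x))^2) (2 * (r^2 + (-1) * (x \<bullet> x))) 2 x \<partial>?M)" by (simp only:)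
  from LIMSEQ_unique[OF this tendsto_const] show ?thesis unfolding lap by simp
qed

section \<open>Moments and traces\<close>

lemma sigma_finite_lebesgue: "sigma_finite_measure (lebesgue :: 'a::euclidean_space measure)"
proof
  obtain A :: "'a set set" where A: "countable A" "A \<subseteq> sets lborel" "\<Union>A = space lborel" "\<forall>a\<in>A. emeasure lborel a \<noteq> \<infinity>"
    using lborel.sigma_finite_countable by blast
  then show "\<exists>A::'a set set. countable A \<and> A \<subseteq> sets lebesgue \<and> \<Union>A = space lebesgue \<and> (\<forall>a\<in>A. emeasure lebesgue a \<noteq> \<infinity>)"
    by (intro exI[of _ A]) (auto simp: subset_iff)
qed

text \<open>Closed sets are an intersection-stable generator of the Borel sets, so Dynkin's argument
  extends the vanishing to Borel sets; Lebesgue sets differ from these only by null sets.\<close>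

lemma set_lebesgue_integral_closed_zero_imp_AE_zero:
  fixes g :: "'a::euclidean_space \<Rightarrow> complex"
  assumes g: "integrable lebesgue g"
    and cl: "\<And>C. closed C \<Longrightarrow> (LINT x:C|lebesgue. g x) = 0"
  shows "AE x in lebesgue. g x = 0"
proof (rule sigma_finite_measure.density_zero[OF sigma_finite_lebesgue g])
  have si: "set_integrable lebesgue A g" if "A \<in> sets lebesgue" for A
    unfolding set_integrable_def using g that by (rule integrable_mult_indicator[rotated])
  have U: "(LINT x:UNIV|lebesgue. g x) = 0" by (rule cl) simp
  have borel: "(LINT x:A|lebesgue. g x) = 0" if "A \<in> sets borel" for A
  proof -
    have sb: "sigma_sets UNIV {C::'a set. closed C} = sets borel" by (simp add: borel_eq_closed)
    have IS: "Int_stable {C::'a set. closed C}" by (auto simp: Int_stable_def)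
    have sub: "{C::'a set. closed C} \<subseteq> Pow UNIV" by simp
    have "A \<in> sigma_sets UNIV {C. closed C}" using that sb by simp
    with IS sub show ?thesis
    proof (induction rule: sigma_sets_induct_disjoint)
      case (basic A)
      then show ?case using cl by simp
    next
      case empty
      show ?case by (simp add: set_lebesgue_integral_def)
    next
      case (compl A)
      then have A: "A \<in> sets lebesgue" using sb by auto
      have "(LINT x:A \<union> (UNIV - A)|lebesgue. g x) = (LINT x:A|lebesgue. g x) + (LINT x:UNIV - A|lebesgue. g x)"
        using A by (intro set_integral_Un si) auto
      moreover have "A \<union> (UNIV - A) = UNIV" by blast
      ultimately show ?case using U compl by simp
    next
      case (union A)
      then have A: "A i \<in> sets lebesgue" for i using sb by auto
      have "(LINT x:(\<Union>i. A i)|lebesgue. g x) = (\<Sum>i. LINT x:A i|lebesgue. g x)"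
        using union(1) by (intro lebesgue_integral_countable_add si A) (auto simp: disjoint_family_on_def intro: A)
      then show ?case using union by simp
    qed
  qed
  fix A :: "'a set" assume "A \<in> sets lebesgue"
  then obtain S N N' where *: "N' \<in> null_sets lborel" "S \<in> sets lborel" "N \<subseteq> N'" "A = S \<union> N"
    by (auto elim: sets_completionE)
  have "N' \<in> null_sets lebesgue" using *(1) by (auto simp: null_sets_completion_iff2)
  have "AE x in lebesgue. x \<notin> N'" by (rule AE_not_in) fact
  then have "AE x in lebesgue. indicator A x *\<^sub>R g x = indicator S x *\<^sub>R g x"
    by eventually_elim (use * in \<open>auto simp: indicator_def\<close>)
  then have "(LINT x:A|lebesgue. g x) = (LINT x:S|lebesgue. g x)"
    unfolding set_lebesgue_integral_def
    by (intro integral_cong_AE borel_measurable_scaleR borel_measurable_indicator)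
       (use \<open>A \<in> sets lebesgue\<close> * g in \<open>auto simp: sets_completionI_sets\<close>)
  also have "\<dots> = 0" using * by (intro borel) simp
  finally show "(LINT x:A|lebesgue. g x) = 0" .
qed

text \<open>Polynomials given by their homogeneous components: Stone-Weierstrass delivers
  polynomials, and the harmonic decomposition acts on the components.\<close>

definition poly_fun :: "('a::euclidean_space \<Rightarrow> complex) \<Rightarrow> bool" where
  "poly_fun p \<longleftrightarrow> (\<exists>n q. (\<forall>i. hpoly i (q i)) \<and> p = (\<lambda>x. \<Sum>i\<le>n. q i x))"

lemma hpoly_imp_poly_fun:
  assumes "hpoly n p" shows "poly_fun p"
proof -
  have "p = (\<lambda>x. \<Sum>i\<le>n. (if i = n then p else (\<lambda>x. 0)) x)"
    by (simp add: if_distribR)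
  moreover have "\<forall>i. hpoly i (if i = n then p else (\<lambda>x. 0))" using assms hpoly_zero by auto
  ultimately show ?thesis unfolding poly_fun_def
    by (intro exI[of _ n] exI[of _ "\<lambda>i. if i = n then p else (\<lambda>x. 0)"] conjI)
qed

lemma poly_fun_add:
  assumes "poly_fun p" "poly_fun q" shows "poly_fun (\<lambda>x. p x + q x)"
proof -
  obtain n p' m q' where p: "\<And>i. hpoly i (p' i)" "p = (\<lambda>x. \<Sum>i\<le>n. p' i x)" and q: "\<And>i. hpoly i (q' i)" "q = (\<lambda>x. \<Sum>i\<le>m. q' i x)"
    using assms unfolding poly_fun_def by metis
  define P where "P i = (if i \<le> n then p' i else (\<lambda>x. 0))" for i
  define Q where "Q i = (if i \<le> m then q' i else (\<lambda>x. 0))" for i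
  have "(\<Sum>i\<le>max n m. P i x) = (\<Sum>i\<le>n. p' i x)" "(\<Sum>i\<le>max n m. Q i x) = (\<Sum>i\<le>m. q' i x)" for x
    by (rule sum.mono_neutral_cong_right; auto simp: P_def Q_def)+
  then have "(\<lambda>x. p x + q x) = (\<lambda>x. \<Sum>i\<le>max n m. (\<lambda>x. P i x + Q i x) x)"
    by (simp add: p q sum.distrib)
  moreover have "\<forall>i. hpoly i (\<lambda>x. P i x + Q i x)" using p q hpoly_zero by (auto simp: P_def Q_def intro!: hpoly_add)
  ultimately show ?thesis unfolding poly_fun_def
    by (intro exI[of _ "max n m"] exI[of _ "\<lambda>i x. P i x + Q i x"] conjI)
qed

lemma poly_fun_sum: "(\<And>i. i \<in> I \<Longrightarrow> poly_fun (p i)) \<Longrightarrow> poly_fun (\<lambda>x. \<Sum>i\<in>I. p i x)"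
  by (induction I rule: infinite_finite_induct)
     (auto intro: poly_fun_add hpoly_imp_poly_fun hpoly_const)

lemma poly_fun_mult:
  assumes "poly_fun p" "poly_fun q" shows "poly_fun (\<lambda>x. p x * q x)"
proof -
  obtain n p' m q' where p: "\<And>i. hpoly i (p' i)" "p = (\<lambda>x. \<Sum>i\<le>n. p' i x)" and q: "\<And>i. hpoly i (q' i)" "q = (\<lambda>x. \<Sum>i\<le>m. q' i x)"
    using assms unfolding poly_fun_def by metis
  have "(\<lambda>x. p x * q x) = (\<lambda>x. \<Sum>i\<le>n. \<Sum>j\<le>m. p' i x * q' j x)" by (simp add: p q sum_product)
  then show ?thesis by (simp only:) (intro poly_fun_sum hpoly_imp_poly_fun[OF hpoly_mult[OF p(1) q(1)]])
qed

lemma real_polynomial_function_imp_poly_fun: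
  "real_polynomial_function f \<Longrightarrow> poly_fun (\<lambda>x. complex_of_real (f x))"
proof (induction rule: real_polynomial_function.induct)
  case (linear f)
  then interpret bounded_linear f .
  have fx: "f x = (\<Sum>b\<in>Basis. (x \<bullet> b) * f b)" for x
  proof -
    have "f x = f (\<Sum>b\<in>Basis. (x \<bullet> b) *\<^sub>R b)" by (simp add: euclidean_representation)
    then show ?thesis by (simp add: sum scaleR)
  qed
  have "complex_of_real (f x) = (\<Sum>b\<in>Basis. of_real (x \<bullet> b) * of_real (f b))" for x
    by (subst fx) simp
  then have "(\<lambda>x. complex_of_real (f x)) = (\<lambda>x. \<Sum>b\<in>Basis. of_real (x \<bullet> b) * of_real (f b))" ..
  moreover have "poly_fun (\<lambda>x. \<Sum>b\<in>Basis. complex_of_real (x \<bullet> b) * of_real (f b))"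
    by (intro poly_fun_sum hpoly_imp_poly_fun[OF hpoly_coord_mult[OF hpoly_const]])
  ultimately show ?case by simp
next
  case (const c)
  then show ?case by (intro hpoly_imp_poly_fun[OF hpoly_const])
qed (auto intro: poly_fun_add poly_fun_mult)

text \<open>Vanishing passes from polynomials to continuous functions by uniform approximation, and
  from these to indicators of closed sets through the decreasing functions
  \<open>max 0 (1 - n dist)\<close>.\<close>

lemma integral_poly_zero_imp_AE_zero:
  fixes v :: "'a::euclidean_space \<Rightarrow> complex"
  assumes v: "integrable (lebesgue_on (ball 0 r)) v"
    and z: "\<And>p. poly_fun p \<Longrightarrow> (\<integral>x. v x * p x \<partial>lebesgue_on (ball 0 r)) = 0"
  shows "AE x in lebesgue_on (ball 0 r). v x = 0"
proof -
  let ?M = "lebesgue_on (ball (0::'a) r)"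
  have mv: "v \<in> borel_measurable ?M" using v by auto
  have cont0: "(\<integral>x. v x * of_real (f x) \<partial>?M) = 0" if f: "continuous_on UNIV f" for f :: "'a \<Rightarrow> real"
  proof -
    have "norm (\<integral>x. v x * of_real (f x) \<partial>?M) \<le> e * (\<integral>x. norm (v x) \<partial>?M)" if e: "e > 0" for e
    proof -
      obtain q where q: "real_polynomial_function q" "\<And>x. x \<in> cball 0 r \<Longrightarrow> \<bar>f x - q x\<bar> < e"
        using Stone_Weierstrass_real_polynomial_function[OF compact_cball continuous_on_subset[OF f subset_UNIV] e] by metis
      have cq: "continuous_on UNIV q"
        using q(1) by (auto intro: continuous_on_polymonial_function simp: real_polynomial_function_eq)
      have i: "integrable ?M (\<lambda>x. v x * of_real (f x))" "integrable ?M (\<lambda>x. v x * of_real (q x))"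
        by (intro integrable_mult_continuous_ball[OF v] continuous_intros f cq)+
      have "(\<integral>x. v x * of_real (f x) \<partial>?M) = (\<integral>x. v x * of_real (f x) \<partial>?M) - (\<integral>x. v x * of_real (q x) \<partial>?M)"
        using z[OF real_polynomial_function_imp_poly_fun[OF q(1)]] by simp
      also have "\<dots> = (\<integral>x. v x * of_real (f x) - v x * of_real (q x) \<partial>?M)"
        by (rule Bochner_Integration.integral_diff[symmetric, OF i])
      also have "norm \<dots> \<le> (\<integral>x. norm (v x * of_real (f x) - v x * of_real (q x)) \<partial>?M)" by (rule integral_norm_bound)
      also have "\<dots> \<le> (\<integral>x. e * norm (v x) \<partial>?M)"
      proof (rule integral_mono)
        show "integrable ?M (\<lambda>x. norm (v x * of_real (f x) - v x * of_real (q x)))" using i by simp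
        show "integrable ?M (\<lambda>x. e * norm (v x))" using v by simp
        fix x assume "x \<in> space ?M"
        then have "\<bar>f x - q x\<bar> \<le> e" using q(2)[of x] by (simp add: space_restrict_space)
        then have "\<bar>f x - q x\<bar> * norm (v x) \<le> e * norm (v x)" by (rule mult_right_mono) simp
        then show "norm (v x * of_real (f x) - v x * of_real (q x)) \<le> e * norm (v x)"
          by (simp add: right_diff_distrib[symmetric] norm_mult mult.commute flip: of_real_diff)
      qed
      finally show ?thesis by simp
    qed
    moreover have "((\<lambda>e. e * (\<integral>x. norm (v x) \<partial>?M)) \<longlongrightarrow> 0 * (\<integral>x. norm (v x) \<partial>?M)) (at_right 0)"
      by (intro tendsto_intros)
    ultimately have "norm (\<integral>x. v x * of_real (f x) \<partial>?M) \<le> 0 * (\<integral>x. norm (v x) \<partial>?M)"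
      by (intro tendsto_lowerbound[where F = "at_right (0::real)"]) (auto simp: eventually_at_right_less eventually_at_filter)
    then show ?thesis by simp
  qed
  define g where "g x = indicator (ball 0 r) x *\<^sub>R v x" for x
  have g: "integrable lebesgue g"
    using v unfolding g_def by (subst (asm) integrable_restrict_space) auto
  have "AE x in lebesgue. g x = 0"
  proof (rule set_lebesgue_integral_closed_zero_imp_AE_zero[OF g])
    fix C :: "'a set" assume C: "closed C"
    have "(LINT x:C|lebesgue. g x) = (\<integral>x. v x * of_real (indicator C x) \<partial>?M)"
      unfolding set_lebesgue_integral_def g_def
      by (subst integral_restrict_space) (auto simp: scaleR_conv_of_real mult_ac intro!: Bochner_Integration.integral_cong)
    also have "\<dots> = 0"
    proof (cases "C = {}")
      case False
      define f where "f n x = max 0 (1 - real n * infdist x C)" for n and x :: 'a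
      have "(\<lambda>n. \<integral>x. v x * of_real (f n x) \<partial>?M) \<longlonglongrightarrow> (\<integral>x. v x * of_real (indicator C x) \<partial>?M)"
      proof (rule integral_dominated_convergence[where w = "\<lambda>x. norm (v x)"])
        show "AE x in ?M. (\<lambda>n. v x * of_real (f n x)) \<longlonglongrightarrow> v x * of_real (indicator C x)"
        proof (intro AE_I2 tendsto_mult tendsto_of_real tendsto_const)
          fix x
          show "(\<lambda>n. f n x) \<longlonglongrightarrow> indicator C x"
          proof (cases "x \<in> C")
            case True then show ?thesis by (simp add: f_def)
          next
            case x: False
            then have d: "infdist x C > 0" using C False by (simp add: infdist_pos_not_in_closed)
            obtain N :: nat where N: "1 / infdist x C < real N" using reals_Archimedean2 by blast
            have "eventually (\<lambda>n. f n x = 0) sequentially"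
              using eventually_ge_at_top[of N]
            proof eventually_elim
              case (elim n)
              then have "1 / infdist x C < real n" using N by linarith
              then have "1 < real n * infdist x C" using d by (simp add: pos_divide_less_eq)
              then show ?case by (simp add: f_def)
            qed
            then show ?thesis using x by (simp add: tendsto_eventually)
          qed
        qed
        have cf: "continuous_on UNIV (f n)" for n unfolding f_def by (intro continuous_intros)
        show "(\<lambda>x. v x * of_real (f n x)) \<in> borel_measurable ?M" for n
          by (intro borel_measurable_times mv measurable_compose[OF _ borel_measurable_of_real] borel_measurable_lebesgue_on borel_measurable_continuous_onI cf)
        show "(\<lambda>x. v x * of_real (indicator C x)) \<in> borel_measurable ?M"
          using C by (intro borel_measurable_times mv measurable_compose[OF _ borel_measurable_of_real] borel_measurable_lebesgue_on borel_measurable_indicator) auto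
        show "AE x in ?M. norm (v x * of_real (f n x)) \<le> norm (v x)" for n
          by (intro AE_I2) (auto simp: norm_mult f_def infdist_nonneg mult_left_le)
      qed (use v in simp)
      moreover have "(\<integral>x. v x * of_real (f n x) \<partial>?M) = 0" for n
        by (rule cont0) (auto simp: f_def[abs_def] intro!: continuous_intros)
      ultimately have "(\<lambda>n::nat. 0) \<longlonglongrightarrow> (\<integral>x. v x * of_real (indicator C x) \<partial>?M)" by (simp only:)
      from LIMSEQ_unique[OF this tendsto_const] show ?thesis .
    qed simp
    finally show "(LINT x:C|lebesgue. g x) = 0" .
  qed
  then show ?thesis
    by (subst AE_restrict_space_iff) (auto simp: g_def indicator_def elim!: eventually_mono)
qed

section \<open>Green's formula from traces\<close>

lemma L2_sphere_normal_component:
  fixes \<phi> :: "'a::euclidean_space \<Rightarrow> complex"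
  assumes r: "r > 0" and \<phi>: "smooth \<phi>" and b: "b \<in> Basis"
  shows "(\<lambda>x. \<phi> x * of_real (sgn x \<bullet> b)) \<in> L2 (sphere_measure r)"
proof -
  obtain B where B: "B \<ge> 0" "\<forall>x\<in>cball 0 r. norm (\<phi> x) \<le> B"
    using bounded_continuous_on_ball[OF smooth_continuous_on[OF \<phi>]] by blast
  show ?thesis
  proof (rule L2_bounded[OF finite_measure_sphere_measure[OF r], where B = B])
    have [measurable]: "\<phi> \<in> borel_measurable borel" by (intro borel_measurable_continuous_onI smooth_continuous_on \<phi>)
    have "(\<lambda>x. \<phi> x * of_real (sgn x \<bullet> b)) = (\<lambda>x. \<phi> x * of_real ((x \<bullet> b) / norm x))"
      by (auto simp: sgn_div_norm divide_inverse mult.commute)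
    moreover have "(\<lambda>x. \<phi> x * of_real ((x \<bullet> b) / norm x)) \<in> borel_measurable borel" by measurable
    ultimately show "(\<lambda>x. \<phi> x * of_real (sgn x \<bullet> b)) \<in> borel_measurable (sphere_measure r)"
      by (intro borel_measurable_sphere_measure) simp
    fix x :: 'a assume "x \<in> space (sphere_measure r)"
    then have "norm (\<phi> x) \<le> B" using B by (simp add: space_sphere_measure)
    moreover have "\<bar>sgn x \<bullet> b\<bar> \<le> 1"
      using Basis_le_norm[OF b, of "sgn x"] norm_sgn[of x] by (auto split: if_splits)
    ultimately show "norm (\<phi> x * of_real (sgn x \<bullet> b)) \<le> B"
      using B(1) mult_mono[of "norm (\<phi> x)" B "\<bar>sgn x \<bullet> b\<bar>" 1] by (simp add: norm_mult)
  qed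
qed

text \<open>The divergence theorem holds for the smooth functions that define the trace, and all its
  terms are continuous under the two \<open>L2\<close> convergences.\<close>

lemma has_trace_green:
  fixes w :: "'a::euclidean_space \<Rightarrow> complex"
  assumes r: "r > 0" and tr: "has_trace r w T" and b: "b \<in> Basis"
  shows "\<exists>g. g \<in> L2 (lebesgue_on (ball 0 r)) \<and> weak_deriv (ball 0 r) [b] w g \<and> T \<in> L2 (sphere_measure r) \<and>
    (\<forall>\<phi>. smooth \<phi> \<longrightarrow> (\<integral>x. g x * \<phi> x \<partial>lebesgue_on (ball 0 r)) =
       (\<integral>x. T x * (\<phi> x * of_real (sgn x \<bullet> b)) \<partial>sphere_measure r) - (\<integral>x. w x * partials [b] \<phi> x \<partial>lebesgue_on (ball 0 r)))"
proof -
  let ?M = "lebesgue_on (ball (0::'a) r)" and ?S = "sphere_measure r :: 'a measure"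
  obtain F where F: "smooth_tendsto_sobolev 1 (ball 0 r) F w" and T: "L2_tendsto ?S F T"
    using tr by (auto simp: has_trace_def)
  have sF: "smooth (F n)" for n using F by (auto simp: smooth_tendsto_sobolev_def)
  have "[b] \<in> multi_indices 1" "[] \<in> multi_indices 1" using b by (auto simp: multi_indices_def)
  then obtain g g0 where g: "weak_deriv (ball 0 r) [b] w g" "L2_tendsto ?M (\<lambda>n. partials [b] (F n)) g"
    and g0: "weak_deriv (ball 0 r) [] w g0" "L2_tendsto ?M F g0"
  proof -
    note * = F[unfolded smooth_tendsto_sobolev_def, THEN conjunct2]
    from bspec[OF * \<open>[b] \<in> multi_indices 1\<close>] bspec[OF * \<open>[] \<in> multi_indices 1\<close>] show ?thesis
      using that by auto
  qed
  have gL: "g \<in> L2 ?M" "g0 \<in> L2 ?M" "T \<in> L2 ?S" using g(2) g0(2) T by (auto simp: L2_tendsto_def)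
  have wL: "w \<in> L2 ?M" using tr by (auto simp: has_trace_def sobolev_def)
  have wi: "integrable ?M w" "integrable ?M g0" using L2_integrable[OF finite_measure_lebesgue_on_ball] wL gL by auto
  \<comment> \<open>The limit \<open>g0\<close> attached to the empty multi-index is linked to
    \<open>w\<close> only by test functions, so integrals are compared rather than the
    functions.\<close>
  have w0: "(\<integral>x. g0 x * \<phi> x \<partial>?M) = (\<integral>x. w x * \<phi> x \<partial>?M)" if \<phi>: "smooth \<phi>" for \<phi>
  proof -
    have "(\<integral>x. (g0 x - w x) * \<phi> x \<partial>?M) = 0"
    proof (rule test_zero_imp_smooth_zero[OF r _ _ \<phi>])
      show "integrable ?M (\<lambda>x. g0 x - w x)" using wi by simp
      fix \<psi> assume \<psi>: "\<psi> \<in> test_functions (ball (0::'a) r)"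
      then have "continuous_on UNIV \<psi>" by (auto simp: test_functions_def smooth_continuous_on)
      then have "integrable ?M (\<lambda>x. w x * \<psi> x)" "integrable ?M (\<lambda>x. g0 x * \<psi> x)"
        by (rule integrable_mult_continuous_ball[OF wi(1)], rule integrable_mult_continuous_ball[OF wi(2)])
      moreover have "(\<integral>x. w x * \<psi> x \<partial>?M) = (\<integral>x. g0 x * \<psi> x \<partial>?M)"
        using g0(1) \<psi> by (auto simp: weak_deriv_def)
      ultimately show "(\<integral>x. (g0 x - w x) * \<psi> x \<partial>?M) = 0" by (simp add: left_diff_distrib)
    qed
    moreover have "integrable ?M (\<lambda>x. w x * \<phi> x)" "integrable ?M (\<lambda>x. g0 x * \<phi> x)"
      by (intro integrable_mult_continuous_ball[OF wi(1)] integrable_mult_continuous_ball[OF wi(2)] smooth_continuous_on \<phi>)+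
    ultimately show ?thesis by (simp add: left_diff_distrib)
  qed
  have "(\<integral>x. g x * \<phi> x \<partial>?M) = (\<integral>x. T x * (\<phi> x * of_real (sgn x \<bullet> b)) \<partial>?S) - (\<integral>x. w x * partials [b] \<phi> x \<partial>?M)"
    if \<phi>: "smooth \<phi>" for \<phi>
  proof -
    have p\<phi>: "smooth (partials [b] \<phi>)" using \<phi> b by (intro smooth_partials) auto
    have eq: "(\<integral>x. partials [b] (F n) x * \<phi> x \<partial>?M) + (\<integral>x. F n x * partials [b] \<phi> x \<partial>?M)
        = (\<integral>x. F n x * (\<phi> x * of_real (sgn x \<bullet> b)) \<partial>?S)" for n
    proof -
      have pF: "smooth (partials [b] (F n))" using sF b by (intro smooth_partials) auto
      have iF: "integrable ?M (F n)" "integrable ?M (partials [b] (F n))"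
        by (intro L2_integrable[OF finite_measure_lebesgue_on_ball] L2_continuous_ball smooth_continuous_on sF pF)+
      have "integrable ?M (\<lambda>x. partials [b] (F n) x * \<phi> x)" "integrable ?M (\<lambda>x. F n x * partials [b] \<phi> x)"
        by (intro integrable_mult_continuous_ball iF smooth_continuous_on \<phi> p\<phi>)+
      then have "(\<integral>x. partials [b] (F n) x * \<phi> x \<partial>?M) + (\<integral>x. F n x * partials [b] \<phi> x \<partial>?M)
         = (\<integral>x. partials [b] (F n) x * \<phi> x + F n x * partials [b] \<phi> x \<partial>?M)" by simp
      also have "\<dots> = (\<integral>x. partials [b] (\<lambda>x. F n x * \<phi> x) x \<partial>?M)"
        by (simp add: partials_mult smooth_differentiable sF \<phi>)
      also have "\<dots> = (\<integral>x. indicator (ball 0 r) x *\<^sub>R partials [b] (\<lambda>x. F n x * \<phi> x) x \<partial>lborel)"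
        using b by (intro integral_lebesgue_on_ball_eq_lborel borel_measurable_continuous_onI smooth_partials_continuous_on smooth_mult sF \<phi>) auto
      also have "\<dots> = (\<integral>x. (F n x * \<phi> x) * of_real (sgn x \<bullet> b) \<partial>?S)"
        using smooth_mult[OF sF \<phi>] by (intro divergence_ball r b) (simp add: smooth_iff_Ck)
      finally show ?thesis by (simp add: mult.assoc)
    qed
    have \<phi>L: "\<phi> \<in> L2 ?M" "partials [b] \<phi> \<in> L2 ?M"
      by (intro L2_continuous_ball smooth_continuous_on \<phi> p\<phi>)+
    have \<nu>L: "(\<lambda>x. \<phi> x * of_real (sgn x \<bullet> b)) \<in> L2 ?S"
      by (rule L2_sphere_normal_component[OF r \<phi> b])
    have "(\<lambda>n. (\<integral>x. partials [b] (F n) x * \<phi> x \<partial>?M) + (\<integral>x. F n x * partials [b] \<phi> x \<partial>?M))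
       \<longlonglongrightarrow> (\<integral>x. g x * \<phi> x \<partial>?M) + (\<integral>x. g0 x * partials [b] \<phi> x \<partial>?M)"
      by (intro tendsto_add L2_tendsto_integral_mult g g0 \<phi>L)
    moreover have "(\<lambda>n. \<integral>x. F n x * (\<phi> x * of_real (sgn x \<bullet> b)) \<partial>?S) \<longlonglongrightarrow> (\<integral>x. T x * (\<phi> x * of_real (sgn x \<bullet> b)) \<partial>?S)"
      by (rule L2_tendsto_integral_mult[OF T \<nu>L])
    ultimately have "(\<integral>x. g x * \<phi> x \<partial>?M) + (\<integral>x. g0 x * partials [b] \<phi> x \<partial>?M) = (\<integral>x. T x * (\<phi> x * of_real (sgn x \<bullet> b)) \<partial>?S)"
      unfolding eq by (rule LIMSEQ_unique)
    then show ?thesis using w0[OF p\<phi>] by (simp add: algebra_simps)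
  qed
  then show ?thesis using gL g(1) by blast
qed

text \<open>Integration by parts twice. The first boundary term vanishes because \<open>u\<close>
  has trace 0. In the second the traces \<open>T b\<close> need not vanish one by one; only their
  sum against the normal does, so the terms must be summed over the basis before the boundary
  integral is evaluated.\<close>

lemma green_zero_traces:
  fixes u f :: "'a::euclidean_space \<Rightarrow> complex"
  assumes r: "r > 0" and u: "u \<in> sobolev 2 (ball 0 r)" and tr0: "has_trace r u (\<lambda>x. 0)" and tr1: "has_normal_trace r u (\<lambda>x. 0)"
    and f: "f \<in> L2 (lebesgue_on (ball 0 r))"
    and helm: "helmholtz_distributional (ball 0 r) k u f" and \<phi>: "smooth \<phi>"
  shows "(\<integral>x. u x * (laplacian \<phi> x + k\<^sup>2 * \<phi> x) \<partial>lebesgue_on (ball 0 r)) = (\<integral>x. f x * \<phi> x \<partial>lebesgue_on (ball 0 r))"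
proof -
  let ?M = "lebesgue_on (ball (0::'a) r)" and ?S = "sphere_measure r :: 'a measure"
  note L2i = L2_integrable[OF finite_measure_lebesgue_on_ball]
  obtain D T where D: "\<And>b. b \<in> Basis \<Longrightarrow> weak_deriv (ball 0 r) [b] u (D b)" "\<And>b. b \<in> Basis \<Longrightarrow> has_trace r (D b) (T b)"
    and T: "AE x in ?S. 0 = (\<Sum>b\<in>Basis. of_real (sgn x \<bullet> b) * T b x)"
    using tr1 unfolding has_normal_trace_def by blast
  have DL: "D b \<in> L2 ?M" if "b \<in> Basis" for b using D(2)[OF that] by (auto simp: has_trace_def sobolev_def)
  have uL: "u \<in> L2 ?M" using u by (auto simp: sobolev_def)
  \<comment> \<open>The derivative \<open>D b\<close> of the normal trace and the one supplied by
    the trace of \<open>u\<close> are both weak derivatives; they agree on test functions and hence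
    on smooth functions.\<close>
  have D1: "(\<integral>x. D b x * \<psi> x \<partial>?M) = - (\<integral>x. u x * partials [b] \<psi> x \<partial>?M)" if b: "b \<in> Basis" and \<psi>: "smooth \<psi>" for b \<psi>
  proof -
    obtain g where g: "g \<in> L2 ?M" "weak_deriv (ball 0 r) [b] u g"
      "(\<integral>x. g x * \<psi> x \<partial>?M) = (\<integral>x. 0 * (\<psi> x * of_real (sgn x \<bullet> b)) \<partial>?S) - (\<integral>x. u x * partials [b] \<psi> x \<partial>?M)"
      using has_trace_green[OF r tr0 b] \<psi> by blast
    have "(\<integral>x. (D b x - g x) * \<psi> x \<partial>?M) = 0"
    proof (rule test_zero_imp_smooth_zero[OF r _ _ \<psi>])
      show "integrable ?M (\<lambda>x. D b x - g x)" using L2i[OF DL[OF b]] L2i[OF g(1)] by simp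
      fix \<xi> assume \<xi>: "\<xi> \<in> test_functions (ball (0::'a) r)"
      then have "continuous_on UNIV \<xi>" by (auto simp: test_functions_def smooth_continuous_on)
      then have "integrable ?M (\<lambda>x. D b x * \<xi> x)" "integrable ?M (\<lambda>x. g x * \<xi> x)"
        by (rule integrable_mult_continuous_ball[OF L2i[OF DL[OF b]]], rule integrable_mult_continuous_ball[OF L2i[OF g(1)]])
      moreover have "(\<integral>x. D b x * \<xi> x \<partial>?M) = (\<integral>x. g x * \<xi> x \<partial>?M)"
        using D(1)[OF b] g(2) \<xi> by (auto simp: weak_deriv_def)
      ultimately show "(\<integral>x. (D b x - g x) * \<xi> x \<partial>?M) = 0" by (simp add: left_diff_distrib)
    qed
    moreover have "integrable ?M (\<lambda>x. D b x * \<psi> x)" "integrable ?M (\<lambda>x. g x * \<psi> x)"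
      by (intro integrable_mult_continuous_ball[OF L2i[OF DL[OF b]]] integrable_mult_continuous_ball[OF L2i[OF g(1)]] smooth_continuous_on \<psi>)+
    ultimately show ?thesis using g(3) by (simp add: left_diff_distrib eq_neg_iff_add_eq_0)
  qed
  have "\<forall>b\<in>Basis. \<exists>h. h \<in> L2 ?M \<and> T b \<in> L2 ?S \<and> (\<forall>\<psi>. smooth \<psi> \<longrightarrow> (\<integral>x. h x * \<psi> x \<partial>?M) =
       (\<integral>x. T b x * (\<psi> x * of_real (sgn x \<bullet> b)) \<partial>?S) - (\<integral>x. D b x * partials [b] \<psi> x \<partial>?M))"
    using has_trace_green[OF r D(2)] by (intro ballI) blast
  from bchoice[OF this] obtain h where hh: "\<forall>b\<in>Basis. h b \<in> L2 ?M \<and> T b \<in> L2 ?S \<and> (\<forall>\<psi>. smooth \<psi> \<longrightarrow> (\<integral>x. h b x * \<psi> x \<partial>?M) =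
       (\<integral>x. T b x * (\<psi> x * of_real (sgn x \<bullet> b)) \<partial>?S) - (\<integral>x. D b x * partials [b] \<psi> x \<partial>?M))" ..
  have h: "h b \<in> L2 ?M" "T b \<in> L2 ?S" if "b \<in> Basis" for b using bspec[OF hh that] by simp_all
  have h3: "(\<integral>x. h b x * \<psi> x \<partial>?M) =
       (\<integral>x. T b x * (\<psi> x * of_real (sgn x \<bullet> b)) \<partial>?S) - (\<integral>x. D b x * partials [b] \<psi> x \<partial>?M)"
    if "b \<in> Basis" "smooth \<psi>" for b \<psi> using bspec[OF hh that(1)] that(2) by simp
  define H where "H x = (\<Sum>b\<in>Basis. h b x)" for x
  have Hi: "integrable ?M H" unfolding H_def using L2i[OF h(1)] by simp
  have H: "(\<integral>x. H x * \<psi> x \<partial>?M) = (\<integral>x. u x * laplacian \<psi> x \<partial>?M)" if \<psi>: "smooth \<psi>" for \<psi>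
  proof -
    have i1: "integrable ?M (\<lambda>x. h b x * \<psi> x)" if "b \<in> Basis" for b
      by (rule integrable_mult_continuous_ball[OF L2i[OF h(1)[OF that]] smooth_continuous_on[OF \<psi>]])
    have i2: "integrable ?M (\<lambda>x. u x * partials [b] (partials [b] \<psi>) x)" if "b \<in> Basis" for b
      by (rule integrable_mult_continuous_ball[OF L2i[OF uL]])
         (intro smooth_continuous_on smooth_partials \<psi>, use that in auto)
    have i3: "integrable ?S (\<lambda>x. T b x * (\<psi> x * of_real (sgn x \<bullet> b)))" if b: "b \<in> Basis" for b
      by (rule L2_mult_integrable[OF h(2)[OF b] L2_sphere_normal_component[OF r \<psi> b]])
    have "(\<Sum>b\<in>Basis. \<integral>x. T b x * (\<psi> x * of_real (sgn x \<bullet> b)) \<partial>?S) = (\<integral>x. (\<Sum>b\<in>Basis. T b x * (\<psi> x * of_real (sgn x \<bullet> b))) \<partial>?S)"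
      by (rule Bochner_Integration.integral_sum[symmetric]) (rule i3)
    also have "\<dots> = 0"
    proof (rule integral_eq_zero_AE)
      show "AE x in ?S. (\<Sum>b\<in>Basis. T b x * (\<psi> x * of_real (sgn x \<bullet> b))) = 0"
        using T
      proof eventually_elim
        case (elim x)
        have "(\<Sum>b\<in>Basis. T b x * (\<psi> x * of_real (sgn x \<bullet> b))) = \<psi> x * (\<Sum>b\<in>Basis. of_real (sgn x \<bullet> b) * T b x)"
          by (simp add: sum_distrib_left mult_ac)
        then show ?case using elim by simp
      qed
    qed
    finally have T0: "(\<Sum>b\<in>Basis. \<integral>x. T b x * (\<psi> x * of_real (sgn x \<bullet> b)) \<partial>?S) = 0" .
    have "(\<integral>x. H x * \<psi> x \<partial>?M) = (\<Sum>b\<in>Basis. \<integral>x. h b x * \<psi> x \<partial>?M)"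
      unfolding H_def sum_distrib_right by (rule Bochner_Integration.integral_sum) (rule i1)
    also have "\<dots> = (\<Sum>b\<in>Basis. (\<integral>x. T b x * (\<psi> x * of_real (sgn x \<bullet> b)) \<partial>?S) + (\<integral>x. u x * partials [b] (partials [b] \<psi>) x \<partial>?M))"
      by (intro sum.cong refl) (simp add: h3 \<psi> D1 smooth_partials)
    also have "\<dots> = (\<Sum>b\<in>Basis. \<integral>x. u x * partials [b] (partials [b] \<psi>) x \<partial>?M)"
      by (simp add: sum.distrib T0)
    also have "\<dots> = (\<integral>x. (\<Sum>b\<in>Basis. u x * partials [b] (partials [b] \<psi>) x) \<partial>?M)"
      by (rule Bochner_Integration.integral_sum[symmetric]) (rule i2)
    finally show ?thesis by (simp add: laplacian_eq sum_distrib_left)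
  qed
  have cl: "continuous_on UNIV (laplacian \<psi>)" if "smooth \<psi>" for \<psi> :: "'a \<Rightarrow> complex"
    unfolding laplacian_def[abs_def] by (intro continuous_intros smooth_partials_continuous_on that) simp
  have ui: "integrable ?M u" "integrable ?M f" using L2i uL f by auto
  have split: "(\<integral>x. u x * (laplacian \<psi> x + k\<^sup>2 * \<psi> x) \<partial>?M) = (\<integral>x. H x * \<psi> x \<partial>?M) + k\<^sup>2 * (\<integral>x. u x * \<psi> x \<partial>?M)" if \<psi>: "smooth \<psi>" for \<psi>
  proof -
    have "integrable ?M (\<lambda>x. u x * laplacian \<psi> x)" "integrable ?M (\<lambda>x. u x * \<psi> x)"
      by (rule integrable_mult_continuous_ball[OF ui(1) cl[OF \<psi>]], rule integrable_mult_continuous_ball[OF ui(1) smooth_continuous_on[OF \<psi>]])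
    then have "(\<integral>x. u x * laplacian \<psi> x + k\<^sup>2 * (u x * \<psi> x) \<partial>?M) = (\<integral>x. H x * \<psi> x \<partial>?M) + k\<^sup>2 * (\<integral>x. u x * \<psi> x \<partial>?M)"
      using H[OF \<psi>] by simp
    moreover have "(\<lambda>x. u x * (laplacian \<psi> x + k\<^sup>2 * \<psi> x)) = (\<lambda>x. u x * laplacian \<psi> x + k\<^sup>2 * (u x * \<psi> x))"
      by (auto simp: algebra_simps)
    ultimately show ?thesis by simp
  qed
  \<comment> \<open>The residual of the equation, an integrable function that annihilates test
    functions and therefore all smooth functions.\<close>
  define W where "W x = H x + k\<^sup>2 * u x - f x" for x
  have Wi: "integrable ?M W" unfolding W_def using Hi ui by simp
  have W: "(\<integral>x. W x * \<psi> x \<partial>?M) = (\<integral>x. u x * (laplacian \<psi> x + k\<^sup>2 * \<psi> x) \<partial>?M) - (\<integral>x. f x * \<psi> x \<partial>?M)" if \<psi>: "smooth \<psi>" for \<psi>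
  proof -
    have "integrable ?M (\<lambda>x. H x * \<psi> x)" "integrable ?M (\<lambda>x. u x * \<psi> x)" "integrable ?M (\<lambda>x. f x * \<psi> x)"
      by (rule integrable_mult_continuous_ball[OF Hi smooth_continuous_on[OF \<psi>]],
          rule integrable_mult_continuous_ball[OF ui(1) smooth_continuous_on[OF \<psi>]],
          rule integrable_mult_continuous_ball[OF ui(2) smooth_continuous_on[OF \<psi>]])
    then show ?thesis unfolding split[OF \<psi>] W_def by (simp add: distrib_right left_diff_distrib mult.assoc)
  qed
  have "(\<integral>x. W x * \<phi> x \<partial>?M) = 0"
  proof (rule test_zero_imp_smooth_zero[OF r Wi _ \<phi>])
    fix \<psi> assume \<psi>: "\<psi> \<in> test_functions (ball (0::'a) r)"
    then have "smooth \<psi>" by (auto simp: test_functions_def)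
    then show "(\<integral>x. W x * \<psi> x \<partial>?M) = 0"
      using helm \<psi> by (simp add: W helmholtz_distributional_def)
  qed
  then show ?thesis using W[OF \<phi>] by simp
qed

section \<open>Eigenvalues are zeros of the characteristic function\<close>

lemma poly_of_real_deriv:
  "((\<lambda>s. poly q (complex_of_real s)) has_vector_derivative poly (pderiv q) (of_real s)) (at s)"
  using has_vector_derivative_real_field[OF poly_DERIV[of q "of_real s"]] by simp

lemma smooth_poly_inner_self: "smooth (\<lambda>x::'a::euclidean_space. poly q (complex_of_real (x \<bullet> x)))"
proof (induction q)
  case (pCons a q)
  have "smooth (\<lambda>x::'a. complex_of_real (x \<bullet> x))" by (rule hpoly_smooth[OF hpoly_inner_self])
  then show ?case using pCons by (auto intro!: smooth_add smooth_mult)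
qed simp

lemma laplacian_harmonic_mult_poly:
  fixes Y :: "'a::euclidean_space \<Rightarrow> complex"
  assumes Y: "hpoly l Y" "\<And>x. laplacian Y x = 0"
  shows "laplacian (\<lambda>x. Y x * poly q (of_real (x \<bullet> x))) x + \<kappa> * (Y x * poly q (of_real (x \<bullet> x)))
    = Y x * poly (helm_op (2 * l + DIM('a)) \<kappa> q) (of_real (x \<bullet> x))"
proof -
  have "laplacian (\<lambda>x. Y x * poly q (of_real (0 + (x \<bullet> x)))) x =
    Y x * (4 * of_real (x \<bullet> x) * poly (pderiv (pderiv q)) (of_real (0 + (x \<bullet> x))) + 2 * of_nat (2 * l + DIM('a)) * poly (pderiv q) (of_real (0 + (x \<bullet> x))))"
    by (rule laplacian_harmonic_mult_radial[where T = UNIV, OF Y poly_of_real_deriv poly_of_real_deriv UNIV_I])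
  then show ?thesis by (simp add: helm_op_def algebra_simps)
qed

section \<open>Harmonic decomposition and polynomial solutions\<close>

lemma laplacian_inner_self_mult:
  fixes z :: "'a::euclidean_space \<Rightarrow> complex"
  assumes "hpoly m z"
  shows "laplacian (\<lambda>x. of_real (x \<bullet> x) * z x) x = of_real (x \<bullet> x) * laplacian z x + of_nat (2 * DIM('a) + 4 * m) * z x"
proof -
  have d: "((\<lambda>s. complex_of_real s) has_vector_derivative 1) (at s)" "((\<lambda>s. 1::complex) has_vector_derivative 0) (at s)" for s :: real
    using has_vector_derivative_of_real[of "\<lambda>s. s" 1 "at s"] by auto
  have "laplacian (\<lambda>x. z x * of_real (0 + 1 * (x \<bullet> x))) x = laplacian z x * of_real (0 + 1 * (x \<bullet> x))
    + of_real (4 * 1) * (\<Sum>b\<in>Basis. of_real (x \<bullet> b) * partials [b] z x) * 1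
    + z x * (of_real (4 * 1^2 * (x \<bullet> x)) * 0 + of_real (2 * 1 * real DIM('a)) * 1)"
    by (rule laplacian_mult_radial[where T = UNIV and g' = "\<lambda>_. 1" and g'' = "\<lambda>_. 0", OF hpoly_Ck[OF assms] d UNIV_I])
  then show ?thesis by (simp add: hpoly_euler[OF assms] algebra_simps)
qed

text \<open>\<open>w / a\<close> leaves the error \<open>|x|^2\<close> times its Laplacian.
  Correcting by \<open>|x|^2 z\<close> leads to the same equation for \<open>z\<close> in degree
  \<open>m - 2\<close>, with \<open>a\<close> replaced by the larger \<open>a + 2d + 4(m-2)\<close>;
  positivity of the constant thus persists.\<close>

lemma hpoly_solve_shifted_laplacian:
  fixes w :: "'a::euclidean_space \<Rightarrow> complex"
  assumes "a > 0" "hpoly m w"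
  shows "\<exists>p. hpoly m p \<and> (\<forall>x. of_real (x \<bullet> x) * laplacian p x + of_real a * p x = w x)"
  using assms
proof (induction m arbitrary: a w rule: less_induct)
  case (less m)
  define w1 where "w1 = (\<lambda>x. of_real (1 / a) * w x)"
  have w1: "hpoly m w1" unfolding w1_def by (rule hpoly_cmult[OF less.prems(2)])
  have aw1: "of_real a * w1 x = w x" for x using less.prems(1) by (simp add: w1_def)
  show ?case
  proof (cases "m < 2")
    case True
    then show ?thesis using w1 aw1 hpoly_laplacian_zero[OF w1 True] by (intro exI[of _ w1]) simp
  next
    case False
    define a' where "a' = a + (2 * DIM('a) + 4 * real (m - 2))"
    have a': "a' > 0" using less.prems(1) by (simp add: a'_def add_pos_nonneg)
    have "hpoly (m - 2) (\<lambda>x. (-1) * laplacian w1 x)"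
      by (intro hpoly_cmult hpoly_laplacian w1)
    from less.IH[OF _ a' this] False obtain z where z: "hpoly (m - 2) z"
      "\<And>x. of_real (x \<bullet> x) * laplacian z x + of_real a' * z x = (-1) * laplacian w1 x" by auto
    have zz: "hpoly m (\<lambda>x. of_real (x \<bullet> x) * z x)"
      using hpoly_mult[OF hpoly_inner_self z(1)] unfolding le_add_diff_inverse[OF False[unfolded not_less]] .
    define p where "p = (\<lambda>x. w1 x + of_real (x \<bullet> x) * z x)"
    have p: "hpoly m p" unfolding p_def by (rule hpoly_add[OF w1 zz])
    have "of_real (x \<bullet> x) * laplacian p x + of_real a * p x = w x" for x
    proof -
      have lp: "laplacian p x = laplacian w1 x + (of_real (x \<bullet> x) * laplacian z x + of_nat (2 * DIM('a) + 4 * (m - 2)) * z x)"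
        unfolding p_def by (simp add: laplacian_add hpoly_Ck[OF w1] hpoly_Ck[OF zz] laplacian_inner_self_mult[OF z(1)])
      have n: "of_nat (2 * DIM('a) + 4 * (m - 2)) = (of_real (a' - a) :: complex)"
        by (simp add: a'_def)
      have "laplacian w1 x = - (of_real (x \<bullet> x) * laplacian z x + of_real a' * z x)" using z(2)[of x] by simp
      then have "laplacian p x = of_real (a' - a) * z x - of_real a' * z x" unfolding lp n by simp
      also have "\<dots> = - of_real a * z x" by (simp add: algebra_simps)
      finally have "laplacian p x = - of_real a * z x" .
      then have "of_real (x \<bullet> x) * laplacian p x + of_real a * p x = of_real a * w1 x" by (simp add: p_def algebra_simps)
      then show ?thesis using aw1 by simp
    qed
    then show ?thesis using p by blast
  qed
qed

text \<open>\<open>q\<close> is chosen so that \<open>|x|^2 q\<close> has the same Laplacian as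
  \<open>p\<close>; this is the shifted equation with \<open>a = 2d + 4(n-2)\<close>.\<close>

lemma hpoly_decompose:
  fixes p :: "'a::euclidean_space \<Rightarrow> complex"
  assumes p: "hpoly n p" and n: "n \<ge> 2"
  shows "\<exists>h q. hpoly n h \<and> (\<forall>x. laplacian h x = 0) \<and> hpoly (n - 2) q \<and> (\<forall>x. p x = h x + of_real (x \<bullet> x) * q x)"
proof -
  define a where "a = 2 * DIM('a) + 4 * real (n - 2)"
  have "a > 0" by (simp add: a_def add_pos_nonneg)
  from hpoly_solve_shifted_laplacian[OF this hpoly_laplacian[OF p]]
  obtain q where q: "hpoly (n - 2) q" "\<And>x. of_real (x \<bullet> x) * laplacian q x + of_real a * q x = laplacian p x" by blast
  have qq: "hpoly n (\<lambda>x. of_real (x \<bullet> x) * q x)"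
    using hpoly_mult[OF hpoly_inner_self q(1)] unfolding le_add_diff_inverse[OF n] .
  define h where "h = (\<lambda>x. p x + (-1) * (of_real (x \<bullet> x) * q x))"
  have h: "hpoly n h" unfolding h_def by (rule hpoly_add[OF p hpoly_cmult[OF qq]])
  have "laplacian h x = 0" for x
  proof -
    have "laplacian h x = laplacian p x + (-1) * laplacian (\<lambda>x. of_real (x \<bullet> x) * q x) x"
      unfolding h_def using hpoly_Ck[OF p] hpoly_Ck[OF qq] hpoly_Ck[OF hpoly_cmult[OF qq]]
      by (simp only: laplacian_add laplacian_cmult)
    also have "\<dots> = laplacian p x - (of_real (x \<bullet> x) * laplacian q x + of_real a * q x)"
      unfolding laplacian_inner_self_mult[OF q(1)] by (simp add: a_def)
    finally show ?thesis unfolding q(2) by simp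
  qed
  then show ?thesis using h q(1) by (intro exI[of _ h] exI[of _ q]) (simp add: h_def)
qed

text \<open>The Neumann series \<open>q/\<kappa> - \<Delta>q/\<kappa>^2 + ...\<close> is finite
  because each Laplacian lowers the degree by two. It provides the functions against which Green's
  formula tests \<open>u\<close>.\<close>

lemma hpoly_helmholtz_surj:
  fixes q :: "'a::euclidean_space \<Rightarrow> complex"
  assumes "\<kappa> \<noteq> 0" "hpoly n q"
  shows "\<exists>\<phi>. smooth \<phi> \<and> (\<forall>x. laplacian \<phi> x + \<kappa> * \<phi> x = q x)"
  using assms(2)
proof (induction n arbitrary: q rule: less_induct)
  case (less n)
  define q1 where "q1 = (\<lambda>x. (1 / \<kappa>) * q x)"
  have q1: "hpoly n q1" unfolding q1_def by (rule hpoly_cmult[OF less.prems])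
  have kq1: "\<kappa> * q1 x = q x" for x using assms(1) by (simp add: q1_def)
  show ?case
  proof (cases "n < 2")
    case True
    then show ?thesis using hpoly_smooth[OF q1] kq1 hpoly_laplacian_zero[OF q1 True] by (intro exI[of _ q1]) simp
  next
    case False
    then have "n - 2 < n" by simp
    from less.IH[OF this hpoly_laplacian[OF q1]] obtain \<psi> where \<psi>: "smooth \<psi>" "\<And>x. laplacian \<psi> x + \<kappa> * \<psi> x = laplacian q1 x" by blast
    have s: "smooth (\<lambda>x. q1 x + (-1) * \<psi> x)" by (intro smooth_add smooth_mult hpoly_smooth[OF q1] \<psi> smooth_const)
    have "laplacian (\<lambda>x. q1 x + (-1) * \<psi> x) x + \<kappa> * (q1 x + (-1) * \<psi> x) = q x" for x
    proof -
      have c: "Ck 1 \<psi>" "Ck 1 (\<lambda>x. (-1) * \<psi> x)" "Ck 1 q1"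
        using \<psi>(1) hpoly_Ck[OF q1] Ck_mult[OF Ck_const[of 1 "-1"], of \<psi>] by (auto simp: smooth_iff_Ck)
      have "laplacian (\<lambda>x. q1 x + (-1) * \<psi> x) x = laplacian q1 x + (-1) * laplacian \<psi> x"
        unfolding laplacian_add[OF c(3,2)] laplacian_cmult[OF c(1)] ..
      then show ?thesis unfolding \<psi>(2)[symmetric] using kq1 by (simp add: algebra_simps)
    qed
    then show ?thesis using s by blast
  qed
qed

lemma AE_lebesgue_on_ball_nonzero: "AE x in lebesgue_on (ball (0::'a::euclidean_space) r). x \<noteq> 0"
proof -
  have "{0::'a} \<in> null_sets lebesgue" by (simp add: negligible_iff_null_sets[symmetric])
  from AE_not_in[OF this] show ?thesis
    by (subst AE_restrict_space_iff) (auto elim!: eventually_mono)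
qed

lemma born_solution_trivial:
  fixes m :: "'a::euclidean_space \<Rightarrow> real" and u v :: "'a \<Rightarrow> complex"
  assumes d: "DIM('a) = 2 \<or> DIM('a) = 3"
    and m: "\<And>x. x \<in> ball 0 2 - {0} \<Longrightarrow> m x = (2 + norm x) ^ (DIM('a) - 1) / (2 ^ DIM('a) * norm x ^ (DIM('a) - 1))"
    and sol: "born_solution 2 m k u v" and k: "k \<noteq> 0" and nz: "\<And>l. charfun DIM('a) l (k^2) \<noteq> 0"
  shows "AE x in lebesgue_on (ball 0 2). u x = 0 \<and> v x = 0"
proof -
  let ?M = "lebesgue_on (ball (0::'a) 2)" and ?d = "DIM('a)"
  define \<kappa> where "\<kappa> = k^2"
  have \<kappa>: "\<kappa> \<noteq> 0" using k by (simp add: \<kappa>_def)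
  note L2i = L2_integrable[OF finite_measure_lebesgue_on_ball]
  have d1: "?d - 1 \<ge> 1" "?d \<ge> 1" using d by auto
  define mv where "mv x = of_real (m x) * v x" for x
  have mvL: "mv \<in> L2 ?M" using sol by (simp add: born_solution_def mv_def[abs_def])
  have mvm: "mv \<in> borel_measurable ?M" using mvL by (auto simp: L2_def)
  define \<mu> where "\<mu> x = (2 + norm x) ^ (?d - 1) / (2 ^ ?d * norm x ^ (?d - 1))" for x :: 'a
  have \<mu>m: "\<mu> \<in> borel_measurable borel" unfolding \<mu>_def by measurable
  have m\<mu>: "m x = \<mu> x" if "norm x < 2" "x \<noteq> 0" for x using m[of x] that by (simp add: \<mu>_def)
  \<comment> \<open>In the ball \<open>2 + |x| \<ge> 2 |x|\<close>. Thus \<open>m\<close> is bounded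
    below, and \<open>v\<close> inherits square integrability from \<open>m v\<close>.\<close>
  have \<mu>half: "\<mu> x \<ge> 1/2" if x: "norm x < 2" "x \<noteq> 0" for x
  proof -
    have "(2 * norm x) ^ (?d - 1) \<le> (2 + norm x) ^ (?d - 1)" using x by (intro power_mono) auto
    then have "2 ^ (?d - 1) * norm x ^ (?d - 1) \<le> (2 + norm x) ^ (?d - 1)" by (simp add: power_mult_distrib)
    moreover have "(2::real) ^ ?d = 2 * 2 ^ (?d - 1)" using d1 by (cases ?d) auto
    ultimately show ?thesis using x by (simp add: \<mu>_def field_simps)
  qed
  have vm: "v \<in> borel_measurable ?M"
  proof -
    \<comment> \<open>\<open>v\<close> is recovered by dividing by \<mu>. At the origin
      \<open>\<mu> 0 = 0\<close>, hence \<open>1 / \<mu> 0 = 0\<close> by the convention on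
      division, and the value \<open>v 0\<close> has to be added by hand.\<close>
    have "(\<lambda>x. mv x * of_real (1 / \<mu> x) + indicator {0} x *\<^sub>R v 0) \<in> borel_measurable ?M"
    proof (intro borel_measurable_add borel_measurable_times mvm)
      have "(\<lambda>x. complex_of_real (1 / \<mu> x)) \<in> borel_measurable borel" using \<mu>m by measurable
      then show "(\<lambda>x. complex_of_real (1 / \<mu> x)) \<in> borel_measurable ?M" by (rule borel_measurable_lebesgue_on)
      have "(\<lambda>x::'a. indicator {0} x *\<^sub>R v 0) \<in> borel_measurable borel"
        by (intro borel_measurable_scaleR borel_measurable_indicator borel_measurable_const) auto
      then show "(\<lambda>x. indicator {0} x *\<^sub>R v 0) \<in> borel_measurable ?M" by (rule borel_measurable_lebesgue_on)
    qed
    moreover have "mv x * of_real (1 / \<mu> x) + indicator {0} x *\<^sub>R v 0 = v x" if "x \<in> space ?M" for x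
    proof (cases "x = 0")
      case True
      have "\<mu> 0 = 0" using d1 by (simp add: \<mu>_def zero_power)
      then show ?thesis using True by simp
    next
      case False
      then have "norm x < 2" using that by (simp add: space_restrict_space)
      then have "\<mu> x \<noteq> 0" "m x = \<mu> x" using \<mu>half[of x] m\<mu>[of x] False by auto
      then show ?thesis using False by (simp add: mv_def)
    qed
    ultimately show ?thesis by (subst measurable_cong[symmetric]) auto
  qed
  have vle: "AE x in ?M. norm (v x) \<le> 2 * norm (mv x)"
    using AE_lebesgue_on_ball_nonzero AE_space
  proof eventually_elim
    case (elim x)
    then have x: "norm x < 2" "x \<noteq> 0" by (auto simp: space_restrict_space)
    have "1/2 * norm (v x) \<le> \<mu> x * norm (v x)" using \<mu>half[OF x] by (intro mult_right_mono) auto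
    moreover have "norm (mv x) = \<mu> x * norm (v x)" using m\<mu>[OF x] \<mu>half[OF x] by (simp add: mv_def norm_mult)
    ultimately show ?case by simp
  qed
  have vL: "v \<in> L2 ?M"
  proof -
    have i: "integrable ?M (\<lambda>x. 4 * (norm (mv x))^2)" using mvL by (simp add: L2_def)
    have "integrable ?M (\<lambda>x. (norm (v x))^2)"
    proof (rule Bochner_Integration.integrable_bound[OF i])
      show "AE x in ?M. norm ((norm (v x))^2) \<le> norm (4 * (norm (mv x))^2)"
        using vle
      proof eventually_elim
        case (elim x)
        from power_mono[OF this, of 2] show ?case by (simp add: power_mult_distrib)
      qed
    qed (use vm in measurable)
    then show ?thesis using vm by (simp add: L2_def)
  qed
  have vi: "integrable ?M v" and mvi: "integrable ?M mv" using L2i vL mvL by auto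
  have uL: "u \<in> L2 ?M" using sol by (auto simp: born_solution_def sobolev_def)
  have ui: "integrable ?M u" using L2i uL by auto
  have green: "(\<integral>x. u x * (laplacian \<phi> x + \<kappa> * \<phi> x) \<partial>?M) = - \<kappa> * (\<integral>x. mv x * \<phi> x \<partial>?M)" if \<phi>: "smooth \<phi>" for \<phi>
  proof -
    have fe: "(\<lambda>x. - k\<^sup>2 * of_real (m x) * v x) = (\<lambda>x. - \<kappa> * mv x)" by (auto simp: mv_def \<kappa>_def)
    have "integrable ?M (\<lambda>x. (norm \<kappa>)^2 * (norm (mv x))^2)" using mvL by (simp add: L2_def)
    then have fL: "(\<lambda>x. - \<kappa> * mv x) \<in> L2 ?M" using mvm by (simp add: L2_def norm_mult power_mult_distrib)
    have s: "u \<in> sobolev 2 (ball 0 2)" "has_trace 2 u (\<lambda>x. 0)" "has_normal_trace 2 u (\<lambda>x. 0)"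
      "helmholtz_distributional (ball 0 2) k u (\<lambda>x. - \<kappa> * mv x)"
      using sol unfolding born_solution_def fe by auto
    have "(\<integral>x. u x * (laplacian \<phi> x + k^2 * \<phi> x) \<partial>?M) = (\<integral>x. (- \<kappa> * mv x) * \<phi> x \<partial>?M)"
      by (rule green_zero_traces[OF _ s(1-3) fL s(4) \<phi>]) simp
    also have "(\<lambda>x. (- \<kappa> * mv x) * \<phi> x) = (\<lambda>x. - \<kappa> * (mv x * \<phi> x))" by auto
    finally show ?thesis by (simp only: \<kappa>_def integral_mult_right_zero)
  qed
  \<comment> \<open>The core: a relation \<open>s \<Lambda> + t bes_moment = 0\<close> is applied to
    truncations of \<open>m\<close> times the Bessel solution. Its first term tends to 0 and its
    second to \<open>t\<close> times a multiple of \<open>charfun\<close>, so \<open>t = 0\<close>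
    and \<Lambda> vanishes.\<close>
  have harm: "(\<integral>x. v x * (Y x * poly q (of_real (x \<bullet> x))) \<partial>?M) = 0"
    if Y: "hpoly l Y" "\<And>x. laplacian Y x = 0" for l Y q
  proof -
    define N where "N = 2 * l + ?d"
    have N: "N \<ge> 1" using d1 by (simp add: N_def)
    have cY: "continuous_on S Y" for S by (rule smooth_continuous_on[OF hpoly_smooth[OF Y(1)]])
    obtain C where C: "C \<ge> 0" "\<And>x. norm x \<le> 2 \<Longrightarrow> norm (Y x) \<le> C"
      using bounded_continuous_on_ball[OF cY, of 2] by auto
    have x4: "x \<bullet> x \<in> {0..4}" if "norm x < 2" for x :: 'a
      using power_mono[of "norm x" 2 2] that by (simp add: power2_norm_eq_inner[symmetric])
    define \<Lambda> where "\<Lambda> g = (\<integral>x. v x * (Y x * g (x \<bullet> x)) \<partial>?M)" for g :: "real \<Rightarrow> complex"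
    have ci: "continuous_on UNIV (\<lambda>x. Y x * g (x \<bullet> x))" if "continuous_on UNIV g" for g :: "real \<Rightarrow> complex"
      by (intro continuous_intros cY continuous_on_compose2[OF that]) auto
    have gi: "integrable ?M (\<lambda>x. w x * (Y x * g (x \<bullet> x)))" if "integrable ?M w" "continuous_on UNIV g" for w and g :: "real \<Rightarrow> complex"
      by (rule integrable_mult_continuous_ball[OF that(1) ci[OF that(2)]])
    have \<Lambda>add: "\<Lambda> (\<lambda>s. f s + g s) = \<Lambda> f + \<Lambda> g" if "continuous_on UNIV f" "continuous_on UNIV g" for f g
      using gi[OF vi that(1)] gi[OF vi that(2)] by (simp add: \<Lambda>_def distrib_left)
    define K where "K = C * (\<integral>x. norm (v x) \<partial>?M)"
    have K: "K \<ge> 0" using C by (simp add: K_def)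
    have int_le: "norm (\<integral>x. w x * (Y x * g (x \<bullet> x)) \<partial>?M) \<le> (C * (\<integral>x. norm (w x) \<partial>?M)) * e"
      if w: "integrable ?M w" and g: "continuous_on UNIV g" and e: "\<And>s. s \<in> {0..4} \<Longrightarrow> norm (g s) \<le> e" for w g e
    proof -
      have "norm (\<integral>x. w x * (Y x * g (x \<bullet> x)) \<partial>?M) \<le> (\<integral>x. norm (w x * (Y x * g (x \<bullet> x))) \<partial>?M)" by (rule integral_norm_bound)
      also have "\<dots> \<le> (\<integral>x. (C * e) * norm (w x) \<partial>?M)"
      proof (rule integral_mono)
        show "integrable ?M (\<lambda>x. norm (w x * (Y x * g (x \<bullet> x))))" using gi[OF w g] by (rule integrable_norm)
        show "integrable ?M (\<lambda>x. (C * e) * norm (w x))" using w by simp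
        fix x assume "x \<in> space ?M"
        then have x: "norm x < 2" by (simp add: space_restrict_space)
        have "norm (Y x) * norm (g (x \<bullet> x)) \<le> C * e" using C(2)[of x] e[OF x4[OF x]] x C(1) by (intro mult_mono) auto
        then have "norm (w x) * (norm (Y x) * norm (g (x \<bullet> x))) \<le> norm (w x) * (C * e)" by (rule mult_left_mono) simp
        then show "norm (w x * (Y x * g (x \<bullet> x))) \<le> (C * e) * norm (w x)" by (simp add: norm_mult mult.commute)
      qed
      finally show ?thesis by (simp add: mult_ac)
    qed
    have cp: "continuous_on UNIV (\<lambda>s. poly q (complex_of_real s))" for q by (intro continuous_intros)
    have sYp: "smooth (\<lambda>x. Y x * poly q (of_real (x \<bullet> x)))" for q
      by (rule smooth_mult[OF hpoly_smooth[OF Y(1)] smooth_poly_inner_self])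
    define \<Lambda>p where "\<Lambda>p q = \<Lambda> (\<lambda>s. poly q (of_real s))" for q
    have "\<exists>s t. (s \<noteq> 0 \<or> t \<noteq> 0) \<and> (\<forall>q. s * \<Lambda>p q + t * bes_moment N \<kappa> (\<lambda>x. poly q (of_real x)) = 0)"
    proof (rule functional_proportional_to_moment[OF N \<kappa>, where K = K])
      show "\<Lambda>p (p + q) = \<Lambda>p p + \<Lambda>p q" for p q using \<Lambda>add[OF cp[of p] cp[of q]] by (simp add: \<Lambda>p_def)
      show "\<Lambda>p (smult c p) = c * \<Lambda>p p" for c p
      proof -
        have "(\<lambda>x. v x * (Y x * poly (smult c p) (of_real (x \<bullet> x)))) = (\<lambda>x. c * (v x * (Y x * poly p (of_real (x \<bullet> x)))))" by auto
        then show ?thesis unfolding \<Lambda>p_def \<Lambda>_def by (simp only: integral_mult_right_zero)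
      qed
      show "norm (\<Lambda>p p) \<le> K * e" if "\<And>s. s \<in> {0..4} \<Longrightarrow> norm (poly p (of_real s)) \<le> e" for p e
        unfolding \<Lambda>p_def \<Lambda>_def K_def by (rule int_le[OF vi cp that])
      show "\<Lambda>p (helm_op N \<kappa> ([:-4, 1:]^2 * p)) = 0" for p
      proof -
        have hd: "helmholtz_distributional (ball 0 2) k v (\<lambda>x. 0)" using sol by (simp add: born_solution_def)
        \<comment> \<open>In the variable \<open>s = |x|^2\<close> the boundary factor
          \<open>(4 - |x|^2)^2\<close> is the polynomial \<open>(s - 4)^2\<close>, the form assumed
          in \<open>functional_proportional_to_moment\<close>.\<close>
        have e: "(Y x * poly p (of_real (x \<bullet> x))) * of_real ((2^2 + (-1) * (x \<bullet> x))^2) = Y x * poly ([:-4, 1:]^2 * p) (of_real (x \<bullet> x))" for x :: 'a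
          by (simp add: power2_eq_square algebra_simps)
        have "(\<integral>x. v x * (laplacian (\<lambda>x. Y x * poly ([:-4, 1:]^2 * p) (of_real (x \<bullet> x))) x
           + k^2 * (Y x * poly ([:-4, 1:]^2 * p) (of_real (x \<bullet> x)))) \<partial>?M) = 0"
          using helmholtz_test_quadratic[OF _ vi hd sYp[of p]] unfolding e by simp
        then show ?thesis
          unfolding \<Lambda>p_def \<Lambda>_def laplacian_harmonic_mult_poly[OF Y] N_def \<kappa>_def .
      qed
    qed
    then obtain s t where st: "s \<noteq> 0 \<or> t \<noteq> 0" "\<And>q. s * \<Lambda>p q + t * bes_moment N \<kappa> (\<lambda>x. poly q (of_real x)) = 0" by blast
    have ext: "s * \<Lambda> g + t * bes_moment N \<kappa> g = 0" if g: "continuous_on UNIV g" for g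
    proof (rule functional_moment_extend[OF N \<Lambda>add _ K _ g])
      show "norm (\<Lambda> f) \<le> K * e" if "continuous_on UNIV f" "\<And>s. s \<in> {0..4} \<Longrightarrow> norm (f s) \<le> e" for f e
        unfolding \<Lambda>_def K_def by (rule int_le[OF vi that])
    qed (use st(2) in \<open>auto simp: \<Lambda>p_def\<close>)
    define \<Phi> where "\<Phi> s = bes N (\<kappa> * of_real s)" for s :: real
    have c\<Phi>: "continuous_on S \<Phi>" for S unfolding \<Phi>_def by (intro continuous_intros N)
    \<comment> \<open>Green's formula for \<open>u\<close> with the truncated Bessel series: one
      side tends to the integral in question, the other to 0 since \<open>helm_op\<close> leaves
      only the top term.\<close>
    have mv0: "(\<integral>x. mv x * (Y x * \<Phi> (x \<bullet> x)) \<partial>?M) = 0"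
    proof -
      let ?p = "\<lambda>n. bes_poly N \<kappa> n"
      obtain B where B: "B \<ge> 0" "\<And>n z. norm z \<le> 4 \<Longrightarrow> norm (poly (?p n) z) \<le> B" using bes_poly_norm_le[OF N] by blast
      have "(\<lambda>n. \<integral>x. mv x * (Y x * poly (?p n) (of_real (x \<bullet> x))) \<partial>?M) \<longlonglongrightarrow> (\<integral>x. mv x * (Y x * \<Phi> (x \<bullet> x)) \<partial>?M)"
      proof (rule integral_dominated_convergence[where w = "\<lambda>x. norm (mv x) * (C * B)"])
        show "integrable ?M (\<lambda>x. norm (mv x) * (C * B))" using mvi by simp
        show "(\<lambda>x. mv x * (Y x * \<Phi> (x \<bullet> x))) \<in> borel_measurable ?M" using gi[OF mvi c\<Phi>] by (rule borel_measurable_integrable)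
        show "(\<lambda>x. mv x * (Y x * poly (?p n) (of_real (x \<bullet> x)))) \<in> borel_measurable ?M" for n using gi[OF mvi cp] by (rule borel_measurable_integrable)
        show "AE x in ?M. (\<lambda>n. mv x * (Y x * poly (?p n) (of_real (x \<bullet> x)))) \<longlonglongrightarrow> mv x * (Y x * \<Phi> (x \<bullet> x))"
          unfolding \<Phi>_def by (intro AE_I2 tendsto_mult tendsto_const bes_poly_LIMSEQ N)
        show "AE x in ?M. norm (mv x * (Y x * poly (?p n) (of_real (x \<bullet> x)))) \<le> norm (mv x) * (C * B)" for n
        proof (rule AE_I2)
          fix x assume "x \<in> space ?M"
          then have x: "norm x < 2" by (simp add: space_restrict_space)
          have "norm (Y x) * norm (poly (?p n) (of_real (x \<bullet> x))) \<le> C * B"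
            using C(2)[of x] B(2)[of "of_real (x \<bullet> x)" n] x4[OF x] x C(1) by (intro mult_mono) auto
          then show "norm (mv x * (Y x * poly (?p n) (of_real (x \<bullet> x)))) \<le> norm (mv x) * (C * B)"
            by (simp add: norm_mult mult_left_mono)
        qed
      qed
      from tendsto_mult[OF tendsto_const[of "- \<kappa>"] this]
      have l1: "(\<lambda>n. \<integral>x. u x * (Y x * poly (helm_op N \<kappa> (?p n)) (of_real (x \<bullet> x))) \<partial>?M) \<longlonglongrightarrow> - \<kappa> * (\<integral>x. mv x * (Y x * \<Phi> (x \<bullet> x)) \<partial>?M)"
        unfolding green[OF sYp, symmetric] laplacian_harmonic_mult_poly[OF Y] N_def .
      have l0: "(\<lambda>n. \<integral>x. u x * (Y x * poly (helm_op N \<kappa> (?p n)) (of_real (x \<bullet> x))) \<partial>?M) \<longlonglongrightarrow> 0"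
      proof (rule Lim_null_comparison)
        let ?z = "\<lambda>n. norm \<kappa> * norm (of_real (bes_coeff N n) * (\<kappa> * 4) ^ n)"
        show "eventually (\<lambda>n. norm (\<integral>x. u x * (Y x * poly (helm_op N \<kappa> (?p n)) (of_real (x \<bullet> x))) \<partial>?M) \<le> (C * (\<integral>x. norm (u x) \<partial>?M)) * ?z n) sequentially"
        proof (intro always_eventually allI int_le[OF ui cp])
          fix n and s :: real assume s: "s \<in> {0..4}"
          have "norm (poly (helm_op N \<kappa> (?p n)) (of_real s)) = norm \<kappa> * (\<bar>bes_coeff N n\<bar> * norm \<kappa> ^ n * s ^ n)"
            unfolding helm_op_bes_poly[OF N] poly_monom using s by (simp add: norm_mult norm_power)
          also have "\<dots> \<le> norm \<kappa> * (\<bar>bes_coeff N n\<bar> * norm \<kappa> ^ n * 4 ^ n)"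
            using s by (intro mult_left_mono power_mono) auto
          also have "\<dots> = ?z n" by (simp add: norm_mult norm_power power_mult_distrib)
          finally show "norm (poly (helm_op N \<kappa> (?p n)) (of_real s)) \<le> ?z n" .
        qed
        have "(\<lambda>n. norm (of_real (bes_coeff N n) * (\<kappa> * 4) ^ n)) \<longlonglongrightarrow> 0"
          by (rule summable_LIMSEQ_zero[OF bes_norm_summable[OF N]])
        from tendsto_mult[OF tendsto_const[of "C * (\<integral>x. norm (u x) \<partial>?M)"] tendsto_mult[OF tendsto_const[of "norm \<kappa>"] this]]
        show "(\<lambda>n. (C * (\<integral>x. norm (u x) \<partial>?M)) * ?z n) \<longlonglongrightarrow> 0" by simp
      qed
      from LIMSEQ_unique[OF l1 l0] \<kappa> show ?thesis by simp
    qed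
    \<comment> \<open>The profile of \<open>m\<close> with its pole cut off below
      \<open>1/(n+1)\<close>. It is continuous, so the extended relation applies, and it never
      exceeds \<open>m\<close>, so \<open>m v\<close> provides the dominating function.\<close>
    define \<rho> where "\<rho> n r = (2 + r) ^ (?d - 1) / (2 ^ ?d * (max r (1 / real (Suc n))) ^ (?d - 1))" for n and r :: real
    have c\<rho>: "continuous_on S (\<rho> n)" for S n
      unfolding \<rho>_def by (intro continuous_intros) (auto simp: max_def)
    define g where "g n s = of_real (\<rho> n (sqrt s)) * \<Phi> s" for n s
    have cg: "continuous_on UNIV (g n)" for n
      unfolding g_def by (intro continuous_intros c\<Phi> continuous_on_compose2[OF c\<rho>[of UNIV]]) auto
    have max_lim: "eventually (\<lambda>n. max r (1 / real (Suc n)) = r) sequentially" if "r > 0" for r :: real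
    proof -
      have "eventually (\<lambda>n. inverse (real (Suc n)) < r) sequentially"
        using order_tendstoD(2)[OF LIMSEQ_inverse_real_of_nat that] .
      then show ?thesis by eventually_elim (simp add: max_def inverse_eq_divide)
    qed
    have L1: "(\<lambda>n. \<Lambda> (g n)) \<longlonglongrightarrow> (\<integral>x. mv x * (Y x * \<Phi> (x \<bullet> x)) \<partial>?M)"
      unfolding \<Lambda>_def
    proof (rule integral_dominated_convergence[where w = "\<lambda>x. norm (mv x * (Y x * \<Phi> (x \<bullet> x)))"])
      show "integrable ?M (\<lambda>x. norm (mv x * (Y x * \<Phi> (x \<bullet> x))))" using gi[OF mvi c\<Phi>] by (rule integrable_norm)
      show "(\<lambda>x. mv x * (Y x * \<Phi> (x \<bullet> x))) \<in> borel_measurable ?M" using gi[OF mvi c\<Phi>] by (rule borel_measurable_integrable)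
      show "(\<lambda>x. v x * (Y x * g n (x \<bullet> x))) \<in> borel_measurable ?M" for n using gi[OF vi cg] by (rule borel_measurable_integrable)
      show "AE x in ?M. (\<lambda>n. v x * (Y x * g n (x \<bullet> x))) \<longlonglongrightarrow> mv x * (Y x * \<Phi> (x \<bullet> x))"
        using AE_lebesgue_on_ball_nonzero AE_space
      proof eventually_elim
        case (elim x)
        then have x: "norm x < 2" "x \<noteq> 0" by (auto simp: space_restrict_space)
        have "eventually (\<lambda>n. v x * (Y x * g n (x \<bullet> x)) = mv x * (Y x * \<Phi> (x \<bullet> x))) sequentially"
          using max_lim[of "norm x"] x(2)
          by (auto elim!: eventually_mono simp: g_def \<rho>_def norm_eq_sqrt_inner[symmetric] mv_def m\<mu>[OF x] \<mu>_def)
        then show ?case by (rule tendsto_eventually)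
      qed
      show "AE x in ?M. norm (v x * (Y x * g n (x \<bullet> x))) \<le> norm (mv x * (Y x * \<Phi> (x \<bullet> x)))" for n
        using AE_lebesgue_on_ball_nonzero AE_space
      proof eventually_elim
        case (elim x)
        then have x: "norm x < 2" "x \<noteq> 0" by (auto simp: space_restrict_space)
        have "norm x ^ (?d - 1) \<le> (max (norm x) (1 / real (Suc n))) ^ (?d - 1)" by (intro power_mono) auto
        then have "\<rho> n (norm x) \<le> \<mu> x" unfolding \<rho>_def \<mu>_def using x
          by (intro divide_left_mono mult_left_mono mult_pos_pos) (auto simp: max_def)
        moreover have "\<rho> n (norm x) \<ge> 0" by (auto simp: \<rho>_def max_def)
        ultimately have "\<bar>\<rho> n (norm x)\<bar> * norm (v x * (Y x * \<Phi> (x \<bullet> x))) \<le> \<mu> x * norm (v x * (Y x * \<Phi> (x \<bullet> x)))"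
          by (intro mult_right_mono) auto
        then show ?case using \<mu>half[OF x]
          by (simp add: g_def norm_eq_sqrt_inner[symmetric] mv_def m\<mu>[OF x] norm_mult mult_ac)
      qed
    qed
    have L2: "(\<lambda>n. bes_moment N \<kappa> (g n)) \<longlonglongrightarrow> charfun ?d l \<kappa> / 2 ^ ?d"
    proof -
      define F where "F n r = of_real (r ^ (N - 1)) * g n (r^2) * bes N (\<kappa> * of_real (r^2))" for n and r :: real
      define G where "G r = of_real ((2 + r) ^ (?d - 1) * r ^ (2 * l)) * (bes N (\<kappa> * of_real (r^2)))^2 / 2 ^ ?d" for r :: real
      have cG: "continuous_on {0..2} G" unfolding G_def by (intro continuous_intros N) simp
      \<comment> \<open>\<open>N - 1 = 2l + (d-1)\<close>: the polar weight absorbs the pole of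
        \<open>m\<close> exactly and leaves the weight of \<open>charfun\<close>.\<close>
      have Np: "r ^ (N - 1) = r ^ (2 * l) * r ^ (?d - 1)" for r :: real
        unfolding N_def power_add[symmetric] using d1 by (intro arg_cong[where f = "\<lambda>n. r ^ n"]) auto
      have FG: "F n r = of_real ((r / max r (1 / real (Suc n))) ^ (?d - 1)) * G r" if "r \<in> {0..2}" for n r
      proof -
        have "sqrt (r^2) = r" using that by simp
        then show ?thesis
          unfolding F_def G_def g_def \<rho>_def \<Phi>_def Np by (simp add: power_divide power2_eq_square mult_ac)
      qed
      have "(\<lambda>n. integral {0..2} (F n)) \<longlonglongrightarrow> integral {0..2} (\<lambda>r. if r = 0 then 0 else G r)"
      proof (rule dominated_convergence(2)[where h = "\<lambda>r. norm (G r)"])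
        show "F n integrable_on {0..2}" for n
        proof -
          have "continuous_on {0..2} (\<lambda>r::real. g n (r^2))"
            by (rule continuous_on_compose2[OF cg]) (auto intro!: continuous_intros)
          then show ?thesis unfolding F_def by (intro integrable_continuous_real continuous_intros N)
        qed
        show "(\<lambda>r. norm (G r)) integrable_on {0..2}" by (intro integrable_continuous_real continuous_intros cG)
        show "norm (F n r) \<le> norm (G r)" if r: "r \<in> {0..2}" for n r
        proof -
          define y where "y = r / max r (1 / real (Suc n))"
          have y: "0 \<le> y" "y \<le> 1" using r by (auto simp: y_def max_def divide_simps)
          then have "y ^ (?d - 1) * norm (G r) \<le> 1 * norm (G r)" by (intro mult_right_mono power_le_one) auto
          then show ?thesis using y unfolding FG[OF r] y_def[symmetric] by (simp add: norm_mult norm_power)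
        qed
        show "(\<lambda>n. F n r) \<longlonglongrightarrow> (if r = 0 then 0 else G r)" if r: "r \<in> {0..2}" for r
        proof (cases "r = 0")
          case True
          then have "F n r = 0" for n using d1 unfolding FG[OF r] by (simp add: zero_power)
          then show ?thesis using True by simp
        next
          case False
          then have "r > 0" using r by simp
          have "eventually (\<lambda>n. F n r = G r) sequentially"
          proof (rule eventually_mono[OF max_lim[OF \<open>r > 0\<close>]])
            fix n assume m: "max r (1 / real (Suc n)) = r"
            show "F n r = G r" unfolding FG[OF r] m using \<open>r > 0\<close> by simp
          qed
          then show ?thesis using False by (simp add: tendsto_eventually)
        qed
      qed
      moreover have "integral {0..2} (\<lambda>r. if r = 0 then 0 else G r) = integral {0..2} G"
        by (rule integral_spike[of "{0}"]) auto
      moreover have "integral {0..2} G = charfun ?d l \<kappa> / 2 ^ ?d"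
        unfolding G_def charfun_def N_def by (rule integral_divide)
      ultimately show ?thesis unfolding bes_moment_def F_def by simp
    qed
    have "(\<lambda>n. s * \<Lambda> (g n) + t * bes_moment N \<kappa> (g n)) \<longlonglongrightarrow> s * (\<integral>x. mv x * (Y x * \<Phi> (x \<bullet> x)) \<partial>?M) + t * (charfun ?d l \<kappa> / 2 ^ ?d)"
      by (intro tendsto_intros L1 L2)
    then have "(\<lambda>n::nat. 0) \<longlonglongrightarrow> t * (charfun ?d l \<kappa> / 2 ^ ?d)" unfolding ext[OF cg] mv0 by simp
    from LIMSEQ_unique[OF this tendsto_const] have "t = 0" using nz[of l] by (simp add: \<kappa>_def)
    then have "s \<noteq> 0" "s * \<Lambda>p q = 0" using st(1) st(2)[of q] by auto
    then show ?thesis by (simp add: \<Lambda>p_def \<Lambda>_def)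
  qed
  \<comment> \<open>The exponent \<open>j\<close> collects the powers of \<open>|x|^2\<close>
    produced by successive decompositions, so that the induction on the degree closes.\<close>
  have hz: "(\<integral>x. v x * (p x * of_real (x \<bullet> x) ^ j) \<partial>?M) = 0" if "hpoly n p" for n p j
    using that
  proof (induction n arbitrary: p j rule: less_induct)
    case (less n)
    show ?case
    proof (cases "n < 2")
      case True
      have "laplacian p x = 0" for x using hpoly_laplacian_zero[OF less.prems True] by simp
      from harm[OF less.prems this, of "monom 1 j"] show ?thesis by (simp add: poly_monom)
    next
      case False
      then obtain h q where h: "hpoly n h" "\<And>x. laplacian h x = 0" and q: "hpoly (n - 2) q" and p: "\<And>x. p x = h x + of_real (x \<bullet> x) * q x"
        using hpoly_decompose[OF less.prems] by auto
      have i: "integrable ?M (\<lambda>x. v x * (h x * of_real (x \<bullet> x) ^ j))" "integrable ?M (\<lambda>x. v x * (q x * of_real (x \<bullet> x) ^ Suc j))"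
        by (rule integrable_mult_continuous_ball[OF vi], intro continuous_intros smooth_continuous_on[OF hpoly_smooth[OF h(1)]] smooth_continuous_on[OF hpoly_smooth[OF q]])+
      have "(\<integral>x. v x * (p x * of_real (x \<bullet> x) ^ j) \<partial>?M) = (\<integral>x. v x * (h x * of_real (x \<bullet> x) ^ j) + v x * (q x * of_real (x \<bullet> x) ^ Suc j) \<partial>?M)"
        by (simp add: p algebra_simps)
      also have "\<dots> = (\<integral>x. v x * (h x * of_real (x \<bullet> x) ^ j) \<partial>?M) + (\<integral>x. v x * (q x * of_real (x \<bullet> x) ^ Suc j) \<partial>?M)"
        by (rule Bochner_Integration.integral_add[OF i])
      also have "(\<integral>x. v x * (q x * of_real (x \<bullet> x) ^ Suc j) \<partial>?M) = 0"
        by (rule less.IH[OF _ q]) (use False in simp)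
      also have "(\<integral>x. v x * (h x * of_real (x \<bullet> x) ^ j) \<partial>?M) = 0"
        using harm[OF h, of "monom 1 j"] by (simp add: poly_monom)
      finally show ?thesis by simp
    qed
  qed
  have v0: "AE x in ?M. v x = 0"
  proof (rule integral_poly_zero_imp_AE_zero[OF vi])
    fix p :: "'a \<Rightarrow> complex" assume "poly_fun p"
    then obtain n q where q: "\<And>i. hpoly i (q i)" "p = (\<lambda>x. \<Sum>i\<le>n. q i x)" unfolding poly_fun_def by blast
    have i: "integrable ?M (\<lambda>x. v x * q i x)" for i
      by (rule integrable_mult_continuous_ball[OF vi smooth_continuous_on[OF hpoly_smooth[OF q(1)]]])
    have "(\<integral>x. v x * p x \<partial>?M) = (\<Sum>i\<le>n. \<integral>x. v x * q i x \<partial>?M)"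
      unfolding q(2) sum_distrib_left by (rule Bochner_Integration.integral_sum[OF i])
    also have "\<dots> = 0" using hz[OF q(1), of _ 0] by (intro sum.neutral) simp
    finally show "(\<integral>x. v x * p x \<partial>?M) = 0" .
  qed
  have u0: "AE x in ?M. u x = 0"
  proof (rule integral_poly_zero_imp_AE_zero[OF ui])
    fix p :: "'a \<Rightarrow> complex" assume "poly_fun p"
    then obtain n q where q: "\<And>i. hpoly i (q i)" "p = (\<lambda>x. \<Sum>i\<le>n. q i x)" unfolding poly_fun_def by blast
    have i: "integrable ?M (\<lambda>x. u x * q i x)" for i
      by (rule integrable_mult_continuous_ball[OF ui smooth_continuous_on[OF hpoly_smooth[OF q(1)]]])
    have z: "(\<integral>x. u x * q i x \<partial>?M) = 0" for i
    proof -
      obtain \<phi> where \<phi>: "smooth \<phi>" "\<And>x. laplacian \<phi> x + \<kappa> * \<phi> x = q i x"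
        using hpoly_helmholtz_surj[OF \<kappa> q(1)] by blast
      have "(\<integral>x. mv x * \<phi> x \<partial>?M) = 0"
        by (rule integral_eq_zero_AE) (use v0 in \<open>eventually_elim, simp add: mv_def\<close>)
      then show ?thesis using green[OF \<phi>(1)] unfolding \<phi>(2) by simp
    qed
    have "(\<integral>x. u x * p x \<partial>?M) = (\<Sum>i\<le>n. \<integral>x. u x * q i x \<partial>?M)"
      unfolding q(2) sum_distrib_left by (rule Bochner_Integration.integral_sum[OF i])
    also have "\<dots> = 0" using z by (intro sum.neutral) simp
    finally show "(\<integral>x. u x * p x \<partial>?M) = 0" .
  qed
  show ?thesis using u0 v0 by eventually_elim simp
qed

section \<open>Construction of eigenfunctions\<close>

lemma L2_tendsto_bounded_pointwise:
  assumes fin: "finite_measure M" and m: "\<And>n. F n \<in> borel_measurable M"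
    and B: "\<And>n x. x \<in> space M \<Longrightarrow> norm (F n x) \<le> B" and lim: "\<And>x. x \<in> space M \<Longrightarrow> (\<lambda>n. F n x) \<longlonglongrightarrow> f x"
  shows "L2_tendsto M F f"
proof -
  interpret finite_measure M by fact
  have mf: "f \<in> borel_measurable M" by (rule borel_measurable_LIMSEQ_metric[OF m lim])
  have Bf: "norm (f x) \<le> B" if "x \<in> space M" for x
    using tendsto_upperbound[OF tendsto_norm[OF lim[OF that]]] B[OF that] by (simp add: always_eventually)
  have "(\<lambda>n. \<integral>x. (norm (F n x - f x))\<^sup>2 \<partial>M) \<longlonglongrightarrow> (\<integral>x. 0 \<partial>M)"
  proof (rule integral_dominated_convergence[where w = "\<lambda>x. (2 * B)\<^sup>2"])
    show "AE x in M. (\<lambda>n. (norm (F n x - f x))\<^sup>2) \<longlonglongrightarrow> 0"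
    proof (rule AE_I2)
      fix x assume "x \<in> space M"
      then have "(\<lambda>n. F n x - f x) \<longlonglongrightarrow> 0" using lim by (simp add: LIM_zero)
      from tendsto_power[OF tendsto_norm[OF this], of 2] show "(\<lambda>n. (norm (F n x - f x))\<^sup>2) \<longlonglongrightarrow> 0" by simp
    qed
    show "AE x in M. norm ((norm (F n x - f x))\<^sup>2) \<le> (2 * B)\<^sup>2" for n
    proof (rule AE_I2)
      fix x assume x: "x \<in> space M"
      have "norm (F n x - f x) \<le> 2 * B" using norm_triangle_ineq4[of "F n x" "f x"] B[OF x, of n] Bf[OF x] by simp
      from power_mono[OF this norm_ge_zero, of 2] show "norm ((norm (F n x - f x))\<^sup>2) \<le> (2 * B)\<^sup>2" by simp
    qed
    show "(\<lambda>x. (norm (F n x - f x))\<^sup>2) \<in> borel_measurable M" for n using m mf by measurable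
  qed auto
  then show ?thesis
    unfolding L2_tendsto_def using L2_bounded[OF fin m B] L2_bounded[OF fin mf Bf] by simp
qed

lemma test_function_partial:
  assumes "\<phi> \<in> test_functions (ball 0 r)" "b \<in> Basis"
  shows "partials [b] \<phi> \<in> test_functions (ball 0 r)"
proof -
  have s: "smooth \<phi>" and c: "compact (closure {x. \<phi> x \<noteq> 0})" "closure {x. \<phi> x \<noteq> 0} \<subseteq> ball 0 r"
    using assms(1) by (auto simp: test_functions_def)
  have sub: "{x. partials [b] \<phi> x \<noteq> 0} \<subseteq> closure {x. \<phi> x \<noteq> 0}"
  proof (rule ccontr)
    assume "\<not> {x. partials [b] \<phi> x \<noteq> 0} \<subseteq> closure {x. \<phi> x \<noteq> 0}"
    then obtain x where x: "partials [b] \<phi> x \<noteq> 0" "x \<in> - closure {x. \<phi> x \<noteq> 0}" by auto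
    have "(\<phi> has_derivative (\<lambda>h. 0)) (at x)"
      by (rule has_derivative_transform_within_open[OF has_derivative_const[of 0], of "- closure {x. \<phi> x \<noteq> 0}"])
         (use x closure_subset[of "{x. \<phi> x \<noteq> 0}"] in auto)
    from partials_single_at[OF this] x(1) show False by simp
  qed
  have cl: "closure {x. partials [b] \<phi> x \<noteq> 0} \<subseteq> closure {x. \<phi> x \<noteq> 0}"
    using closure_mono[OF sub] by simp
  have "compact (closure {x. partials [b] \<phi> x \<noteq> 0})"
    using cl c(1) by (metis closed_closure compact_Int_closed inf.absorb2)
  then show ?thesis using cl c smooth_partials[OF s, of "[b]"] assms(2) by (auto simp: test_functions_def)
qed

lemma integral_by_parts_test:
  fixes F \<phi> :: "'a::euclidean_space \<Rightarrow> complex"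
  assumes r: "r > 0" and F: "smooth F" and \<phi>: "\<phi> \<in> test_functions (ball 0 r)" and b: "b \<in> Basis"
  shows "(\<integral>x. F x * partials [b] \<phi> x \<partial>lebesgue_on (ball 0 r)) = - (\<integral>x. partials [b] F x * \<phi> x \<partial>lebesgue_on (ball 0 r))"
proof -
  let ?M = "lebesgue_on (ball (0::'a) r)"
  have s\<phi>: "smooth \<phi>" and sup: "closure {x. \<phi> x \<noteq> 0} \<subseteq> ball 0 r" using \<phi> by (auto simp: test_functions_def)
  have pF: "smooth (partials [b] F)" and p\<phi>: "smooth (partials [b] \<phi>)" using F s\<phi> b by (auto intro!: smooth_partials)
  have iF: "integrable ?M F" "integrable ?M (partials [b] F)"
    by (intro L2_integrable[OF finite_measure_lebesgue_on_ball] L2_continuous_ball smooth_continuous_on F pF)+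
  have i: "integrable ?M (\<lambda>x. partials [b] F x * \<phi> x)" "integrable ?M (\<lambda>x. F x * partials [b] \<phi> x)"
    by (rule integrable_mult_continuous_ball[OF iF(2) smooth_continuous_on[OF s\<phi>]],
        rule integrable_mult_continuous_ball[OF iF(1) smooth_continuous_on[OF p\<phi>]])
  have "(\<integral>x. partials [b] F x * \<phi> x \<partial>?M) + (\<integral>x. F x * partials [b] \<phi> x \<partial>?M)
     = (\<integral>x. partials [b] F x * \<phi> x + F x * partials [b] \<phi> x \<partial>?M)"
    using i by simp
  also have "\<dots> = (\<integral>x. partials [b] (\<lambda>x. F x * \<phi> x) x \<partial>?M)"
    by (simp add: partials_mult smooth_differentiable F s\<phi>)
  also have "\<dots> = (\<integral>x. indicator (ball 0 r) x *\<^sub>R partials [b] (\<lambda>x. F x * \<phi> x) x \<partial>lborel)"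
    using b by (intro integral_lebesgue_on_ball_eq_lborel borel_measurable_continuous_onI smooth_partials_continuous_on smooth_mult F s\<phi>) auto
  also have "\<dots> = (\<integral>x. (F x * \<phi> x) * of_real (sgn x \<bullet> b) \<partial>sphere_measure r)"
    using smooth_mult[OF F s\<phi>] by (intro divergence_ball r b) (simp add: smooth_iff_Ck)
  also have "\<dots> = 0"
  proof (rule integral_eq_zero_AE, rule AE_I2)
    fix x :: 'a assume "x \<in> space (sphere_measure r)"
    then have "x \<notin> ball 0 r" by (simp add: space_sphere_measure)
    then have "\<phi> x = 0" using sup closure_subset[of "{x. \<phi> x \<noteq> 0}"] by blast
    then show "F x * \<phi> x * of_real (sgn x \<bullet> b) = 0" by simp
  qed
  finally show ?thesis by (simp add: eq_neg_iff_add_eq_0 add.commute)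
qed

lemma L2_loc_integrable:
  assumes "f \<in> L2 (lebesgue_on (ball (0::'a::euclidean_space) r))"
  shows "loc_integrable (ball 0 r) f"
  unfolding loc_integrable_def
proof (intro allI impI)
  fix K :: "'a set" assume K: "compact K \<and> K \<subseteq> ball 0 r"
  have i: "integrable (lebesgue_on (ball 0 r)) f" by (rule L2_integrable[OF finite_measure_lebesgue_on_ball assms])
  have "K \<in> sets lebesgue" using K lmeasurable_compact by blast
  then have "integrable lebesgue (\<lambda>x. indicator K x *\<^sub>R (indicator (ball 0 r) x *\<^sub>R f x))"
    by (rule integrable_mult_indicator) (use i in \<open>auto simp: integrable_restrict_space\<close>)
  moreover have "(\<lambda>x. indicator K x *\<^sub>R (indicator (ball 0 r) x *\<^sub>R f x)) = (\<lambda>x. indicator K x *\<^sub>R f x)"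
    using K by (auto simp: indicator_def fun_eq_iff)
  ultimately show "integrable (lebesgue_on K) f"
    using \<open>K \<in> sets lebesgue\<close> by (subst integrable_restrict_space) auto
qed

lemma weak_deriv_limit:
  fixes F :: "nat \<Rightarrow> 'a::euclidean_space \<Rightarrow> complex"
  assumes r: "r > 0" and F: "\<And>n. smooth (F n)" and b: "b \<in> Basis"
    and f: "L2_tendsto (lebesgue_on (ball 0 r)) F f" and g: "L2_tendsto (lebesgue_on (ball 0 r)) (\<lambda>n. partials [b] (F n)) g"
  shows "weak_deriv (ball 0 r) [b] f g"
proof -
  let ?M = "lebesgue_on (ball (0::'a) r)"
  have "(\<integral>x. f x * partials [b] \<phi> x \<partial>?M) = - (\<integral>x. g x * \<phi> x \<partial>?M)" if \<phi>: "\<phi> \<in> test_functions (ball 0 r)" for \<phi>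
  proof -
    have s: "smooth \<phi>" "smooth (partials [b] \<phi>)" using \<phi> b by (auto simp: test_functions_def intro!: smooth_partials)
    have "(\<lambda>n. \<integral>x. F n x * partials [b] \<phi> x \<partial>?M) \<longlonglongrightarrow> (\<integral>x. f x * partials [b] \<phi> x \<partial>?M)"
      by (intro L2_tendsto_integral_mult[OF f] L2_continuous_ball smooth_continuous_on s)
    moreover have "(\<lambda>n. - (\<integral>x. partials [b] (F n) x * \<phi> x \<partial>?M)) \<longlonglongrightarrow> - (\<integral>x. g x * \<phi> x \<partial>?M)"
      by (intro tendsto_minus L2_tendsto_integral_mult[OF g] L2_continuous_ball smooth_continuous_on s)
    ultimately show ?thesis
      unfolding integral_by_parts_test[OF r F \<phi> b] by (rule LIMSEQ_unique)
  qed
  moreover have "f \<in> L2 ?M" "g \<in> L2 ?M" using f g by (auto simp: L2_tendsto_def)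
  ultimately show ?thesis by (simp add: weak_deriv_def L2_loc_integrable)
qed

lemma weak_deriv_Nil: "f \<in> L2 (lebesgue_on (ball (0::'a::euclidean_space) r)) \<Longrightarrow> weak_deriv (ball 0 r) [] f f"
  by (simp add: weak_deriv_def L2_loc_integrable)

lemma weak_deriv_Cons:
  assumes "weak_deriv (ball 0 r) [b] f g" "weak_deriv (ball 0 r) [c] g h" "c \<in> Basis"
  shows "weak_deriv (ball 0 r) [b, c] f h"
proof -
  have "(\<integral>x. f x * partials [b, c] \<phi> x \<partial>lebesgue_on (ball 0 r)) = (\<integral>x. h x * \<phi> x \<partial>lebesgue_on (ball 0 r))"
    if \<phi>: "\<phi> \<in> test_functions (ball 0 r)" for \<phi>
  proof -
    have "partials [c] \<phi> \<in> test_functions (ball 0 r)" by (rule test_function_partial[OF \<phi> assms(3)])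
    then have "(\<integral>x. f x * partials [b] (partials [c] \<phi>) x \<partial>lebesgue_on (ball 0 r)) = - (\<integral>x. g x * partials [c] \<phi> x \<partial>lebesgue_on (ball 0 r))"
      using assms(1) by (simp add: weak_deriv_def)
    also have "\<dots> = (\<integral>x. h x * \<phi> x \<partial>lebesgue_on (ball 0 r))" using assms(2) \<phi> by (simp add: weak_deriv_def)
    finally show ?thesis by (simp add: partials_Cons[of b "[c]"])
  qed
  then show ?thesis using assms by (simp add: weak_deriv_def)
qed

lemma multi_indices_1: "bs \<in> multi_indices 1 \<longleftrightarrow> bs = [] \<or> (\<exists>b\<in>Basis. bs = [b])"
  by (cases bs) (auto simp: multi_indices_def)

lemma multi_indices_2: "bs \<in> multi_indices 2 \<longleftrightarrow> bs = [] \<or> (\<exists>b\<in>Basis. bs = [b]) \<or> (\<exists>b\<in>Basis. \<exists>c\<in>Basis. bs = [b, c])"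
proof (cases bs)
  case (Cons b cs)
  then show ?thesis by (cases cs) (auto simp: multi_indices_def)
qed (auto simp: multi_indices_def)

text \<open>A single approximating sequence serves membership in \<open>H^2\<close> and both traces.
  All first partial derivatives tend to 0 on the sphere, so the normal trace is witnessed by the
  zero function in every direction.\<close>

lemma born_conditions_of_smooth_limit:
  fixes F :: "nat \<Rightarrow> 'a::euclidean_space \<Rightarrow> complex" and g :: "'a list \<Rightarrow> 'a \<Rightarrow> complex"
  assumes r: "r > 0" and F: "\<And>n. smooth (F n)"
    and g: "\<And>bs. bs \<in> multi_indices 2 \<Longrightarrow> L2_tendsto (lebesgue_on (ball 0 r)) (\<lambda>n. partials bs (F n)) (g bs)"
    and tr: "\<And>bs. bs \<in> multi_indices 1 \<Longrightarrow> L2_tendsto (sphere_measure r) (\<lambda>n. partials bs (F n)) (\<lambda>x. 0)"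
  shows "g [] \<in> sobolev 2 (ball 0 r)" "has_trace r (g []) (\<lambda>x. 0)" "has_normal_trace r (g []) (\<lambda>x. 0)"
    "\<And>\<phi>. \<phi> \<in> test_functions (ball 0 r) \<Longrightarrow>
       (\<integral>x. g [] x * laplacian \<phi> x \<partial>lebesgue_on (ball 0 r)) = (\<integral>x. (\<Sum>b\<in>Basis. g [b, b] x) * \<phi> x \<partial>lebesgue_on (ball 0 r))"
proof -
  let ?M = "lebesgue_on (ball (0::'a) r)"
  have gL: "g bs \<in> L2 ?M" if "bs \<in> multi_indices 2" for bs using g[OF that] by (simp add: L2_tendsto_def)
  have mi: "[] \<in> multi_indices 2" "b \<in> Basis \<Longrightarrow> [b] \<in> multi_indices 2" "b \<in> Basis \<Longrightarrow> c \<in> Basis \<Longrightarrow> [b, c] \<in> multi_indices 2"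
    "[] \<in> multi_indices 1" "b \<in> Basis \<Longrightarrow> [b] \<in> multi_indices 1" for b c :: 'a
    by (auto simp: multi_indices_def)
  have w1: "weak_deriv (ball 0 r) [b] (g []) (g [b])" if b: "b \<in> Basis" for b
    by (rule weak_deriv_limit[OF r F b _ g[OF mi(2)[OF b]]]) (use g[OF mi(1)] in simp)
  have w2: "weak_deriv (ball 0 r) [c] (g [b]) (g [c, b])" if b: "b \<in> Basis" "c \<in> Basis" for b c
  proof (rule weak_deriv_limit[OF r _ b(2) g[OF mi(2)[OF b(1)]]])
    show "smooth (partials [b] (F n))" for n using F b by (intro smooth_partials) auto
    show "L2_tendsto ?M (\<lambda>n. partials [c] (partials [b] (F n))) (g [c, b])"
      using g[OF mi(3)[OF b(2,1)]] by (simp add: partials_Cons[of c "[b]"])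
  qed
  \<comment> \<open>The indices are reversed: \<open>g [c, b]\<close> is the limit obtained by
    differentiating along \<open>b\<close> first, whereas in \<open>weak_deriv\<close> the
    derivatives fall on the test function. Stated this way, partial derivatives are never
    interchanged.\<close>
  have w3: "weak_deriv (ball 0 r) [b, c] (g []) (g [c, b])" if "b \<in> Basis" "c \<in> Basis" for b c
    by (rule weak_deriv_Cons[OF w1[OF that(1)] w2[OF that] that(2)])
  show s2: "g [] \<in> sobolev 2 (ball 0 r)"
    unfolding sobolev_def mem_Collect_eq
  proof (intro conjI ballI gL mi)
    fix bs :: "'a list" assume "bs \<in> multi_indices 2"
    then consider "bs = []" | b where "b \<in> Basis" "bs = [b]" | b c where "b \<in> Basis" "c \<in> Basis" "bs = [b, c]"
      unfolding multi_indices_2 by blast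
    then show "\<exists>h\<in>L2 ?M. weak_deriv (ball 0 r) bs (g []) h"
    proof cases
      case 1 then show ?thesis using weak_deriv_Nil[OF gL[OF mi(1)]] gL[OF mi(1)] by blast
    next
      case 2 then show ?thesis using w1 gL[OF mi(2)] by blast
    next
      case 3 then show ?thesis using w3 gL[OF mi(3)] by blast
    qed
  qed
  have sob1: "f \<in> sobolev 1 (ball 0 r)" if "f \<in> L2 ?M" "\<And>b. b \<in> Basis \<Longrightarrow> weak_deriv (ball 0 r) [b] f (h b)" "\<And>b. b \<in> Basis \<Longrightarrow> h b \<in> L2 ?M" for f h
    unfolding sobolev_def mem_Collect_eq
  proof (intro conjI ballI that(1))
    fix bs :: "'a list" assume "bs \<in> multi_indices 1"
    then consider "bs = []" | b where "b \<in> Basis" "bs = [b]" unfolding multi_indices_1 by blast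
    then show "\<exists>h\<in>L2 ?M. weak_deriv (ball 0 r) bs f h"
    proof cases
      case 1 then show ?thesis using weak_deriv_Nil[OF that(1)] that(1) by blast
    next
      case 2 then show ?thesis using that(2,3) by blast
    qed
  qed
  show "has_trace r (g []) (\<lambda>x. 0)"
    unfolding has_trace_def
  proof (intro conjI exI[of _ F])
    show "g [] \<in> sobolev 1 (ball 0 r)" by (rule sob1[OF gL[OF mi(1)] w1 gL[OF mi(2)]])
    show "smooth_tendsto_sobolev 1 (ball 0 r) F (g [])"
      unfolding smooth_tendsto_sobolev_def
    proof (intro conjI allI ballI F)
      fix bs :: "'a list" assume "bs \<in> multi_indices 1"
      then consider "bs = []" | b where "b \<in> Basis" "bs = [b]" unfolding multi_indices_1 by blast
      then show "\<exists>h. weak_deriv (ball 0 r) bs (g []) h \<and> L2_tendsto ?M (\<lambda>n. partials bs (F n)) h"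
      proof cases
        case 1 then show ?thesis using weak_deriv_Nil[OF gL[OF mi(1)]] g[OF mi(1)] by blast
      next
        case 2 then show ?thesis using w1 g[OF mi(2)] by blast
      qed
    qed
    show "L2_tendsto (sphere_measure r) F (\<lambda>x. 0)" using tr[OF mi(4)] by simp
  qed
  show "has_normal_trace r (g []) (\<lambda>x. 0)"
    unfolding has_normal_trace_def
  proof (rule exI[of _ "\<lambda>b. g [b]"], rule exI[of _ "\<lambda>b x. 0"], intro conjI ballI)
    fix b :: 'a assume b: "b \<in> Basis"
    show "weak_deriv (ball 0 r) [b] (g []) (g [b])" by (rule w1[OF b])
    show "has_trace r (g [b]) (\<lambda>x. 0)"
      unfolding has_trace_def
    proof (intro conjI exI[of _ "\<lambda>n. partials [b] (F n)"])
      show "g [b] \<in> sobolev 1 (ball 0 r)"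
        by (rule sob1[OF gL[OF mi(2)[OF b]] w2[OF b] gL[OF mi(3)]]) (use b in auto)
      show "smooth_tendsto_sobolev 1 (ball 0 r) (\<lambda>n. partials [b] (F n)) (g [b])"
        unfolding smooth_tendsto_sobolev_def
      proof (intro conjI allI ballI)
        show "smooth (partials [b] (F n))" for n using F b by (intro smooth_partials) auto
        fix bs :: "'a list" assume "bs \<in> multi_indices 1"
        then consider "bs = []" | c where "c \<in> Basis" "bs = [c]" unfolding multi_indices_1 by blast
        then show "\<exists>h. weak_deriv (ball 0 r) bs (g [b]) h \<and> L2_tendsto ?M (\<lambda>n. partials bs (partials [b] (F n))) h"
        proof cases
          case 1 then show ?thesis using weak_deriv_Nil[OF gL[OF mi(2)[OF b]]] g[OF mi(2)[OF b]] by auto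
        next
          case 2
          then have "L2_tendsto ?M (\<lambda>n. partials bs (partials [b] (F n))) (g [c, b])"
            using g[OF mi(3)[OF 2(1) b]] by (simp add: partials_Cons[of c "[b]"])
          then show ?thesis using w2[OF b 2(1)] 2(2) by blast
        qed
      qed
      show "L2_tendsto (sphere_measure r) (\<lambda>n. partials [b] (F n)) (\<lambda>x. 0)" by (rule tr[OF mi(5)[OF b]])
    qed
  qed simp
  fix \<phi> assume \<phi>: "\<phi> \<in> test_functions (ball (0::'a) r)"
  then have s: "smooth \<phi>" by (simp add: test_functions_def)
  have i1: "integrable ?M (\<lambda>x. g [] x * partials [b, b] \<phi> x)" if "b \<in> Basis" for b
    by (intro L2_mult_integrable gL mi L2_continuous_ball smooth_partials_continuous_on s) (use that in auto)
  have i2: "integrable ?M (\<lambda>x. g [b, b] x * \<phi> x)" if "b \<in> Basis" for b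
    by (intro L2_mult_integrable gL mi L2_continuous_ball smooth_continuous_on s that)
  have "(\<integral>x. g [] x * laplacian \<phi> x \<partial>?M) = (\<Sum>b\<in>Basis. \<integral>x. g [] x * partials [b, b] \<phi> x \<partial>?M)"
    unfolding laplacian_def sum_distrib_left by (rule Bochner_Integration.integral_sum[OF i1])
  also have "\<dots> = (\<Sum>b\<in>Basis. \<integral>x. g [b, b] x * \<phi> x \<partial>?M)"
    using w3 \<phi> by (intro sum.cong refl) (simp add: weak_deriv_def)
  also have "\<dots> = (\<integral>x. (\<Sum>b\<in>Basis. g [b, b] x) * \<phi> x \<partial>?M)"
    unfolding sum_distrib_right by (rule Bochner_Integration.integral_sum[symmetric, OF i2])
  finally show "(\<integral>x. g [] x * laplacian \<phi> x \<partial>?M) = (\<integral>x. (\<Sum>b\<in>Basis. g [b, b] x) * \<phi> x \<partial>?M)" .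
qed

text \<open>If the derivatives of the generators lie in the algebra, the algebra is closed under
  differentiation. This supplies the family demanded by \<open>smooth_radial_family\<close> for a
  profile whose higher derivatives have no handy formula.\<close>

inductive_set function_algebra :: "(real \<Rightarrow> complex) set \<Rightarrow> (real \<Rightarrow> complex) set" for A where
  function_algebra_const: "(\<lambda>s. c) \<in> function_algebra A"
| function_algebra_gen: "f \<in> A \<Longrightarrow> f \<in> function_algebra A"
| function_algebra_add: "f \<in> function_algebra A \<Longrightarrow> g \<in> function_algebra A \<Longrightarrow> (\<lambda>s. f s + g s) \<in> function_algebra A"
| function_algebra_mult: "f \<in> function_algebra A \<Longrightarrow> g \<in> function_algebra A \<Longrightarrow> (\<lambda>s. f s * g s) \<in> function_algebra A"

lemma function_algebra_power: "f \<in> function_algebra A \<Longrightarrow> (\<lambda>s. f s ^ n) \<in> function_algebra A"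
  by (induction n) (auto intro: function_algebra_const function_algebra_mult)

lemma function_algebra_deriv:
  assumes gen: "\<And>f. f \<in> A \<Longrightarrow> \<exists>f'\<in>function_algebra A. \<forall>s\<in>T. (f has_vector_derivative f' s) (at s)"
    and "f \<in> function_algebra A"
  shows "\<exists>f'\<in>function_algebra A. \<forall>s\<in>T. (f has_vector_derivative f' s) (at s)"
  using assms(2)
proof induction
  case (function_algebra_const c)
  show ?case by (rule bexI[of _ "\<lambda>s. 0"]) (auto intro: function_algebra.intros)
next
  case (function_algebra_gen f)
  then show ?case by (rule gen)
next
  case (function_algebra_add f g)
  then obtain f' g' where fg: "f' \<in> function_algebra A" "g' \<in> function_algebra A"
    and f': "\<forall>s\<in>T. (f has_vector_derivative f' s) (at s)" and g': "\<forall>s\<in>T. (g has_vector_derivative g' s) (at s)" by blast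
  show ?case
  proof (rule bexI[of _ "\<lambda>s. f' s + g' s"])
    show "\<forall>s\<in>T. ((\<lambda>s. f s + g s) has_vector_derivative f' s + g' s) (at s)"
      using f' g' has_vector_derivative_add by blast
  qed (intro function_algebra.function_algebra_add fg)
next
  case (function_algebra_mult f g)
  then obtain f' g' where fg: "f' \<in> function_algebra A" "g' \<in> function_algebra A"
    and f': "\<forall>s\<in>T. (f has_vector_derivative f' s) (at s)" and g': "\<forall>s\<in>T. (g has_vector_derivative g' s) (at s)" by blast
  show ?case
  proof (rule bexI[of _ "\<lambda>s. f s * g' s + f' s * g s"])
    show "\<forall>s\<in>T. ((\<lambda>s. f s * g s) has_vector_derivative f s * g' s + f' s * g s) (at s)"
      using f' g' has_vector_derivative_mult by blast
  qed (intro function_algebra.function_algebra_add function_algebra.function_algebra_mult fg function_algebra_mult.hyps)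
qed

section \<open>The radial profile of an eigenfunction\<close>

lemma bes_of_real_deriv:
  assumes "M \<ge> 1"
  shows "((\<lambda>s. bes M (\<kappa> * of_real s)) has_vector_derivative - \<kappa> / (2 * of_nat M) * bes (M + 2) (\<kappa> * of_real s)) (at s)"
proof -
  have "((\<lambda>z. bes M (\<kappa> * z)) has_field_derivative (- bes (M + 2) (\<kappa> * of_real s) / (2 * of_nat M) * \<kappa>)) (at (of_real s))"
    by (rule bes_DERIV[OF assms DERIV_cmult_Id])
  from has_vector_derivative_real_field[OF this, of UNIV] show ?thesis by (simp add: mult.commute)
qed

lemma bes_of_real_deriv2:
  assumes "M \<ge> 1"
  shows "((\<lambda>s. - \<kappa> / (2 * of_nat M) * bes (M + 2) (\<kappa> * of_real s)) has_vector_derivative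
    \<kappa>\<^sup>2 / (4 * of_nat M * of_nat (M + 2)) * bes (M + 4) (\<kappa> * of_real s)) (at s)"
proof -
  have "((\<lambda>s. - \<kappa> / (2 * of_nat M) * bes (M + 2) (\<kappa> * of_real s)) has_vector_derivative
      - \<kappa> / (2 * of_nat M) * (- \<kappa> / (2 * of_nat (M + 2)) * bes (M + 2 + 2) (\<kappa> * of_real s))) (at s)"
    by (intro has_vector_derivative_mult_right bes_of_real_deriv) simp
  then show ?thesis by (simp add: power2_eq_square eval_nat_numeral mult_ac)
qed

lemma bes_radial_ode:
  assumes "M \<ge> 1"
  shows "4 * z * (\<kappa>\<^sup>2 / (4 * of_nat M * of_nat (M + 2)) * bes (M + 4) (\<kappa> * z)) + 2 * of_nat M * (- \<kappa> / (2 * of_nat M) * bes (M + 2) (\<kappa> * z))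
    + \<kappa> * bes M (\<kappa> * z) = 0"
proof -
  have M: "of_nat M \<noteq> (0::complex)" "of_nat (M + 2) \<noteq> (0::complex)"
    using assms by (simp_all only: of_nat_eq_0_iff)
  have e: "4 * z * (\<kappa>\<^sup>2 / (4 * m * m2) * b4) + 2 * m * (- \<kappa> / (2 * m) * b2) + \<kappa> * b = \<kappa> * (b - b2 + (\<kappa> * z) * b4 / (m * m2))"
    if "m \<noteq> 0" "m2 \<noteq> 0" for m m2 b b2 b4 :: complex
    using that by (simp add: divide_simps power2_eq_square) (simp add: algebra_simps)
  have M2: "complex_of_nat (M + 2) = of_nat M + 2" by simp
  show ?thesis unfolding e[OF M] unfolding M2 bes_recurrence[OF assms, of "\<kappa> * z"] by simp
qed

lemma bes_of_real_nonzero: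
  assumes "M \<ge> 1" "\<kappa> \<notin> \<real>" shows "bes M (\<kappa> * of_real s) \<noteq> 0"
proof (cases "s = 0")
  case False
  have "\<kappa> * of_real s \<notin> \<real>"
  proof
    assume "\<kappa> * of_real s \<in> \<real>"
    then have "\<kappa> * of_real s / of_real s \<in> \<real>" by (rule Reals_divide) simp
    then show False using False assms(2) by simp
  qed
  then show ?thesis by (rule bes_nonreal_nonzero[OF assms(1)])
qed simp

lemma continuous_on_Icc_bounded:
  fixes f :: "real \<Rightarrow> complex"
  assumes "continuous_on {a..b} f" shows "\<exists>B\<ge>0. \<forall>x\<in>{a..b}. norm (f x) \<le> B"
proof -
  have "bounded (f ` {a..b})" by (intro compact_imp_bounded compact_continuous_image assms compact_Icc)
  then obtain B where "\<forall>y\<in>f ` {a..b}. norm y \<le> B" unfolding bounded_iff by blast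
  then show ?thesis by (intro exI[of _ "max 0 B"]) (auto simp: le_max_iff_disj)
qed

text \<open>The interval ends at 5 because the profile will be evaluated at
  \<open>1/(n+1) + |x|^2 \<le> 1 + 4\<close>. The factor 3 bounds \<open>sqrt 5\<close> and lets
  \<open>d = 2\<close> share the bound of \<open>d = 3\<close>.\<close>

lemma inverse_sqrt_power_le:
  assumes d: "d = 2 \<or> d = 3" and s: "s \<in> {0<..5}"
  shows "(1 / sqrt s) ^ (d - 1) \<le> 3 / s"
proof -
  have s0: "s > 0" using s by simp
  have "sqrt s \<le> 3" by (rule real_le_lsqrt) (use s in auto)
  then have "sqrt s / s \<le> 3 / s" using s0 by (simp add: divide_right_mono)
  moreover have "1 / sqrt s * (1 / sqrt s) = 1 / s" using s0 by simp
  moreover have "1 / sqrt s = sqrt s / s" using s0 by (simp add: real_div_sqrt field_simps)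
  ultimately show ?thesis using d s0 by (auto simp: power2_eq_square divide_right_mono)
qed

text \<open>For the ansatz \<open>u = Y \<Phi> V\<close> with \<open>\<Phi>\<close> the radial Helmholtz solution, the equation for \<open>u\<close> is of first order in
  \<open>H = V'\<close>; the solution that is moderate at the origin vanishes at the boundary exactly when \<open>charfun\<close> does.\<close>

lemma born_ratio_exists:
  assumes d: "d = 2 \<or> d = 3" and \<kappa>: "\<kappa> \<notin> \<real>" and z: "charfun d l \<kappa> = 0"
  shows "\<exists>H C. C \<ge> 0 \<and> H 4 = 0 \<and> (\<forall>s\<in>{0<..5}. norm (H s) \<le> C / s) \<and>
    (\<forall>s>0. (H has_vector_derivative
      - \<kappa> / 2 ^ (d + 2) * of_real ((2 + sqrt s) ^ (d - 1) * (1 / sqrt s) ^ (d + 1))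
      - of_nat (2 * l + d) / 2 * of_real ((1 / sqrt s)^2) * H s
      - 2 * (- \<kappa> / (2 * of_nat (2 * l + d)) * bes (2 * l + d + 2) (\<kappa> * of_real s)) * H s / bes (2 * l + d) (\<kappa> * of_real s)) (at s))"
proof -
  define N where "N = 2 * l + d"
  have N: "N \<ge> 1" using d by (auto simp: N_def)
  \<comment> \<open>The integrating factor \<open>s^(N/2) \<Phi>^2\<close> gives
    \<open>(s^(N/2) \<Phi>^2 H)' = -(\<kappa>/4) m s^(N/2-1) \<Phi>^2\<close>. Substituting
    \<open>s = r^2\<close> doubles the factor, and the \<open>2^d\<close> in \<open>m\<close> yields
    \<open>-\<kappa> / 2^(d+1)\<close>.\<close>
  define c where "c = - \<kappa> / 2 ^ (d + 1)"
  define w where "w z = (2 + z) ^ (d - 1) * z ^ (2 * l) * (bes N (\<kappa> * z^2))^2" for z :: complex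
  have w: "w holomorphic_on UNIV" unfolding w_def by (intro holomorphic_intros N)
  \<comment> \<open>A complex primitive of the integrand makes \<open>Q\<close> differentiable at
    every real point, the end points included.\<close>
  obtain F where F: "\<And>x. (F has_field_derivative w x) (at x)"
    using holomorphic_convex_primitive[of UNIV "{}" w] w holomorphic_on_imp_continuous_on[OF w]
    by (auto simp: holomorphic_on_def)
  define Q where "Q r = F (of_real r) - F 0" for r :: real
  have dQ: "(Q has_vector_derivative w (of_real r)) (at r within S)" for r S
    unfolding Q_def using has_vector_derivative_diff[OF has_vector_derivative_real_field[OF F] has_vector_derivative_const] by simp
  have Q0: "Q 0 = 0" by (simp add: Q_def)
  have intQ: "((\<lambda>r. w (of_real r)) has_integral Q r) {0..r}" if "r \<ge> 0" for r
    using fundamental_theorem_of_calculus[OF that dQ] Q0 by simp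
  \<comment> \<open>The zero of \<open>charfun\<close> enters here: it makes \<open>H\<close>, and
    with it the gradient of \<open>u\<close>, vanish on the sphere.\<close>
  have Q2: "Q 2 = 0"
  proof -
    have "charfun d l \<kappa> = integral {0..2} (\<lambda>r. w (of_real r))"
      unfolding charfun_def w_def N_def by simp
    then show ?thesis using integral_unique[OF intQ[of 2]] z by simp
  qed
  obtain B where B: "B \<ge> 0" "\<And>r. r \<in> {0..3} \<Longrightarrow> norm ((2 + complex_of_real r) ^ (d - 1) * (bes N (\<kappa> * (of_real r)^2))^2) \<le> B"
  proof -
    have "continuous_on {0..3} (\<lambda>r. (2 + complex_of_real r) ^ (d - 1) * (bes N (\<kappa> * (of_real r)^2))^2)"
      by (intro continuous_intros N)
    from continuous_on_Icc_bounded[OF this] show ?thesis using that by blast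
  qed
  \<comment> \<open>\<open>Q\<close> vanishes to order \<open>2l+1\<close> at 0. This cancels all
    but \<open>N - (2l+1) = d - 1\<close> of the factors \<open>1 / sqrt s\<close> in
    \<open>H\<close>.\<close>
  have QB: "norm (Q r) \<le> B * r ^ (2 * l + 1)" if r: "r \<in> {0..3}" for r
  proof -
    have "norm (w (of_real t)) \<le> B * r ^ (2 * l)" if t: "t \<in> cbox 0 r" for t
    proof -
      have t': "0 \<le> t" "t \<le> r" "t \<in> {0..3}" using t r by auto
      have "norm (w (of_real t)) = norm ((2 + complex_of_real t) ^ (d - 1) * (bes N (\<kappa> * (of_real t)^2))^2) * t ^ (2 * l)"
        using t' by (simp add: w_def norm_mult norm_power)
      also have "\<dots> \<le> B * r ^ (2 * l)"
        using t' r by (intro mult_mono B power_mono zero_le_power) auto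
      finally show ?thesis .
    qed
    moreover have "((\<lambda>r. w (of_real r)) has_integral Q r) (cbox 0 r)" using intQ[of r] r by simp
    moreover have "0 \<le> B * r ^ (2 * l)" using B r by simp
    ultimately have "norm (Q r) \<le> B * r ^ (2 * l) * measure lborel (cbox 0 r)" by (intro has_integral_bound)
    then show ?thesis using r by (simp add: mult_ac)
  qed
  define \<Phi> where "\<Phi> s = bes N (\<kappa> * of_real s)" for s :: real
  define \<Phi>1 where "\<Phi>1 s = - \<kappa> / (2 * of_nat N) * bes (N + 2) (\<kappa> * of_real s)" for s :: real
  have d\<Phi>: "(\<Phi> has_vector_derivative \<Phi>1 s) (at s)" for s
    unfolding \<Phi>_def \<Phi>1_def by (rule bes_of_real_deriv[OF N])
  have nz: "\<Phi> s \<noteq> 0" for s unfolding \<Phi>_def by (rule bes_of_real_nonzero[OF N \<kappa>])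
  have dI: "((\<lambda>s. inverse ((\<Phi> s)^2)) has_vector_derivative - 2 * \<Phi>1 s / (\<Phi> s) ^ 3) (at s)" for s
  proof -
    have b: "((\<lambda>z. bes N (\<kappa> * z)) has_field_derivative (- bes (N + 2) (\<kappa> * of_real s) / (2 * of_nat N) * \<kappa>)) (at (of_real s))"
      by (rule bes_DERIV[OF N DERIV_cmult_Id])
    have b': "- bes (N + 2) (\<kappa> * of_real s) / (2 * of_nat N) * \<kappa> = \<Phi>1 s" by (simp add: \<Phi>1_def)
    have "((\<lambda>z. inverse ((bes N (\<kappa> * z))^2)) has_field_derivative
        - (inverse ((\<Phi> s)^2) * (of_nat 2 * (\<Phi>1 s * \<Phi> s ^ (2 - Suc 0))) * inverse ((\<Phi> s)^2))) (at (of_real s))"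
      unfolding \<Phi>_def by (rule DERIV_inverse'[OF DERIV_power[OF b[unfolded b']]]) (use nz[of s] in \<open>simp add: \<Phi>_def\<close>)
    from has_vector_derivative_real_field[OF this, of UNIV]
    show ?thesis using nz[of s] unfolding \<Phi>_def[symmetric]
      by (simp add: power2_eq_square power3_eq_cube field_simps)
  qed
  define i where "i s = 1 / sqrt s" for s
  have di: "((\<lambda>s. complex_of_real (i s ^ N)) has_vector_derivative of_real (- (real N / 2) * i s ^ (N + 2))) (at s)" if s: "s > 0" for s
  proof (rule has_vector_derivative_of_real)
    have "i s ^ (N - Suc 0) * i s ^ 3 = i s ^ (N + 2)"
      unfolding power_add[symmetric] using N by (intro arg_cong[where f = "\<lambda>n. i s ^ n"]) auto
    moreover have "(i has_real_derivative - (i s ^ 3 / 2)) (at s)"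
      unfolding i_def using s by (auto intro!: derivative_eq_intros simp: field_simps power3_eq_cube)
    from DERIV_power[OF this, of N] have "((\<lambda>s. i s ^ N) has_real_derivative real N * (i s ^ (N - Suc 0) * - (i s ^ 3 / 2))) (at s)"
      by (simp add: mult_ac)
    ultimately show "((\<lambda>s. i s ^ N) has_real_derivative - (real N / 2) * i s ^ (N + 2)) (at s)" by (simp add: mult_ac)
  qed
  have dq: "((\<lambda>s. Q (sqrt s)) has_vector_derivative of_real (i s / 2) * w (of_real (sqrt s))) (at s)" if s: "s > 0" for s
  proof -
    have "(sqrt has_vector_derivative i s / 2) (at s)"
      unfolding has_real_derivative_iff_has_vector_derivative[symmetric] i_def using DERIV_real_sqrt[OF s] by (simp add: field_simps)
    from vector_diff_chain_at[OF this dQ] show ?thesis by (simp add: o_def scaleR_conv_of_real)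
  qed
  define H where "H s = c * ((Q (sqrt s) * of_real (i s ^ N)) * inverse ((\<Phi> s)^2))" for s
  have dH: "(H has_vector_derivative - \<kappa> / 2 ^ (d + 2) * of_real ((2 + sqrt s) ^ (d - 1) * i s ^ (d + 1))
      - of_nat N / 2 * of_real ((i s)^2) * H s - 2 * \<Phi>1 s * H s / \<Phi> s) (at s)" if s: "s > 0" for s
  proof -
    define q where "q = Q (sqrt s)"
    define a where "a = complex_of_real (i s)"
    define r where "r = complex_of_real (sqrt s)"
    define f where "f = \<Phi> s"
    have f: "f \<noteq> 0" using nz by (simp add: f_def)
    have ra: "r * a = 1" using s by (simp add: r_def a_def i_def flip: of_real_mult)
    have ww: "w r = (2 + r) ^ (d - 1) * r ^ (2 * l) * f^2"
    proof -
      have "r^2 = of_real s" using s by (simp add: r_def flip: of_real_power)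
      then show ?thesis unfolding w_def f_def \<Phi>_def by simp
    qed
    have rl: "r ^ (2 * l) * a ^ (N + 1) = a ^ (d + 1)"
    proof -
      have "a ^ (N + 1) = a ^ (2 * l) * a ^ (d + 1)" unfolding power_add[symmetric] N_def by (simp add: add.assoc)
      then have "r ^ (2 * l) * a ^ (N + 1) = (r * a) ^ (2 * l) * a ^ (d + 1)" by (simp only: power_mult_distrib mult.assoc)
      then show ?thesis unfolding ra by simp
    qed
    have D: "(H has_vector_derivative c * ((q * a ^ N) * (- 2 * \<Phi>1 s / f ^ 3)
        + (q * of_real (- (real N / 2) * i s ^ (N + 2)) + (a / 2 * w r) * a ^ N) * inverse (f^2))) (at s)"
      using has_vector_derivative_mult_right[OF has_vector_derivative_mult[OF has_vector_derivative_mult[OF dq[OF s] di[OF s]] dI], of c]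
      unfolding H_def q_def a_def r_def f_def by simp
    have Hs: "H s = c * ((q * a ^ N) * inverse (f^2))" by (simp add: H_def q_def a_def f_def)
    have "c * ((q * a ^ N) * (- 2 * \<Phi>1 s / f ^ 3) + (q * of_real (- (real N / 2) * i s ^ (N + 2)) + (a / 2 * w r) * a ^ N) * inverse (f^2))
      = c * (q * a ^ N) * (- 2 * \<Phi>1 s / f ^ 3) + c * q * (- (of_nat N / 2) * (a ^ N * a^2)) * inverse (f^2) + c * (a / 2 * w r * a ^ N) * inverse (f^2)"
      unfolding a_def by (simp add: algebra_simps power_add power2_eq_square)
    also have "c * (a / 2 * w r * a ^ N) * inverse (f^2) = c / 2 * ((2 + r) ^ (d - 1) * (r ^ (2 * l) * a ^ (N + 1))) * (f^2 * inverse (f^2))"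
      unfolding ww by (simp add: mult_ac)
    also have "\<dots> = - \<kappa> / 2 ^ (d + 2) * of_real ((2 + sqrt s) ^ (d - 1) * i s ^ (d + 1))"
      unfolding rl using f by (simp add: c_def r_def a_def)
    also have "c * q * (- (of_nat N / 2) * (a ^ N * a^2)) * inverse (f^2) = - (of_nat N / 2 * of_real ((i s)^2) * H s)"
      unfolding Hs a_def by (simp add: mult_ac)
    also have "c * (q * a ^ N) * (- 2 * \<Phi>1 s / f ^ 3) = - (2 * \<Phi>1 s * H s / f)"
      unfolding Hs using f by (simp add: field_simps power2_eq_square power3_eq_cube)
    finally have E: "c * ((q * a ^ N) * (- 2 * \<Phi>1 s / f ^ 3) + (q * of_real (- (real N / 2) * i s ^ (N + 2)) + (a / 2 * w r) * a ^ N) * inverse (f^2))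
      = - \<kappa> / 2 ^ (d + 2) * of_real ((2 + sqrt s) ^ (d - 1) * i s ^ (d + 1)) - of_nat N / 2 * of_real ((i s)^2) * H s - 2 * \<Phi>1 s * H s / f"
      by (simp only: diff_conv_add_uminus add_ac)
    show ?thesis using D unfolding E unfolding f_def .
  qed
  obtain C where C: "C \<ge> 0" "\<And>s. s \<in> {0..5} \<Longrightarrow> norm (inverse ((\<Phi> s)^2)) \<le> C"
  proof -
    have "continuous_on {0..5} (\<lambda>s. inverse ((\<Phi> s)^2))"
      unfolding \<Phi>_def by (intro continuous_intros N) (use nz in \<open>auto simp: \<Phi>_def\<close>)
    from continuous_on_Icc_bounded[OF this] show ?thesis using that by blast
  qed
  have HB: "norm (H s) \<le> norm c * B * C * 3 / s" if s: "s \<in> {0<..5}" for s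
  proof -
    have s0: "s > 0" using s by simp
    have r3: "sqrt s \<le> 3" by (rule real_le_lsqrt) (use s in auto)
    have i0: "i s > 0" using s0 by (simp add: i_def)
    have r0: "sqrt s * i s = 1" using s0 by (simp add: i_def)
    have i2: "i s ^ (d - 1) \<le> 3 / s" unfolding i_def by (rule inverse_sqrt_power_le[OF d s])
    have "norm (H s) = norm c * (norm (Q (sqrt s)) * i s ^ N * norm (inverse ((\<Phi> s)^2)))"
      using i0 by (simp add: H_def norm_mult norm_power)
    also have "\<dots> \<le> norm c * ((B * sqrt s ^ (2 * l + 1)) * i s ^ N * C)"
      using r3 s i0 B C by (intro mult_left_mono mult_mono QB C) auto
    also have "sqrt s ^ (2 * l + 1) * i s ^ N = i s ^ (d - 1)"
    proof -
      have "N = (2 * l + 1) + (d - 1)" using d by (auto simp: N_def)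
      then have "i s ^ N = i s ^ (2 * l + 1) * i s ^ (d - 1)" by (simp only: power_add)
      then have "sqrt s ^ (2 * l + 1) * i s ^ N = (sqrt s * i s) ^ (2 * l + 1) * i s ^ (d - 1)" by (simp only: power_mult_distrib mult.assoc)
      then show ?thesis unfolding r0 by simp
    qed
    then have "norm c * ((B * sqrt s ^ (2 * l + 1)) * i s ^ N * C) = norm c * B * C * i s ^ (d - 1)"
      by (simp add: mult_ac)
    also have "\<dots> \<le> norm c * B * C * (3 / s)" using i2 B C by (intro mult_left_mono) auto
    finally show ?thesis by simp
  qed
  have "H 4 = 0" using Q2 by (simp add: H_def)
  moreover have "norm c * B * C * 3 \<ge> 0" using B C by simp
  ultimately show ?thesis using HB dH unfolding i_def \<Phi>_def \<Phi>1_def N_def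
    by (intro exI[of _ H] exI[of _ "norm c * B * C * 3"] conjI allI ballI impI) auto
qed

text \<open>The family \<open>G\<close> is part of the result because smoothness of the shifted
  profile needs derivatives of every order. The bounds \<open>K/s\<close> and \<open>K/s^2\<close>
  are of the kind that polynomial factors of degree 2 and 4 compensate.\<close>

lemma born_profile_exists:
  assumes d: "d = 2 \<or> d = 3" and \<kappa>: "\<kappa> \<notin> \<real>" and z: "charfun d l \<kappa> = 0"
  shows "\<exists>G U U1 U2 K. U \<in> G \<and> U1 \<in> G \<and> U2 \<in> G \<and>
    (\<forall>g\<in>G. \<exists>g'\<in>G. \<forall>s\<in>{0<..}. (g has_vector_derivative g' s) (at s)) \<and>
    (\<forall>s\<in>{0<..}. (U has_vector_derivative U1 s) (at s)) \<and> (\<forall>s\<in>{0<..}. (U1 has_vector_derivative U2 s) (at s)) \<and>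
    (\<forall>s\<in>{0<..}. 4 * of_real s * U2 s + 2 * of_nat (2 * l + d) * U1 s + \<kappa> * U s
      = - \<kappa> * of_real ((2 + sqrt s) ^ (d - 1) / (2 ^ d * sqrt s ^ (d - 1))) * bes (2 * l + d) (\<kappa> * of_real s)) \<and>
    U 4 = 0 \<and> U1 4 = 0 \<and> K \<ge> 0 \<and>
    (\<forall>s\<in>{0<..5}. norm (U s) \<le> K / s \<and> norm (U1 s) \<le> K / s \<and> norm (U2 s) \<le> K / s^2)"
proof -
  define N where "N = 2 * l + d"
  have N: "N \<ge> 1" using d by (auto simp: N_def)
  define \<Phi> where "\<Phi> s = bes N (\<kappa> * of_real s)" for s :: real
  define \<Phi>1 where "\<Phi>1 s = - \<kappa> / (2 * of_nat N) * bes (N + 2) (\<kappa> * of_real s)" for s :: real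
  define \<Phi>2 where "\<Phi>2 s = \<kappa>\<^sup>2 / (4 * of_nat N * of_nat (N + 2)) * bes (N + 4) (\<kappa> * of_real s)" for s :: real
  have d\<Phi>: "(\<Phi> has_vector_derivative \<Phi>1 s) (at s)" for s
    unfolding \<Phi>_def \<Phi>1_def by (rule bes_of_real_deriv[OF N])
  have d\<Phi>1: "(\<Phi>1 has_vector_derivative \<Phi>2 s) (at s)" for s
    unfolding \<Phi>1_def \<Phi>2_def by (rule bes_of_real_deriv2[OF N])
  have ode\<Phi>: "4 * of_real s * \<Phi>2 s + 2 * of_nat N * \<Phi>1 s + \<kappa> * \<Phi> s = 0" for s
    unfolding \<Phi>_def \<Phi>1_def \<Phi>2_def by (rule bes_radial_ode[OF N])
  have nz: "\<Phi> s \<noteq> 0" for s unfolding \<Phi>_def by (rule bes_of_real_nonzero[OF N \<kappa>])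
  define i where "i s = 1 / sqrt s" for s
  define \<rho> where "\<rho> s = (2 + sqrt s) ^ (d - 1) * i s ^ (d - 1) / 2 ^ d" for s
  obtain H C where C: "C \<ge> 0" and H4: "H 4 = 0" and HB: "\<And>s. s \<in> {0<..5} \<Longrightarrow> norm (H s) \<le> C / s"
    and dH: "\<And>s. s > 0 \<Longrightarrow> (H has_vector_derivative - \<kappa> / 2 ^ (d + 2) * of_real ((2 + sqrt s) ^ (d - 1) * i s ^ (d + 1))
      - of_nat N / 2 * of_real ((i s)^2) * H s - 2 * \<Phi>1 s * H s / \<Phi> s) (at s)"
    using born_ratio_exists[OF d \<kappa> z] unfolding i_def \<Phi>_def \<Phi>1_def N_def by blast
  obtain V0 where V0: "\<And>s. s > 0 \<Longrightarrow> (V0 has_vector_derivative H s) (at s)"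
    using einterval_antiderivative[of 0 \<infinity> H] has_vector_derivative_continuous[OF dH] by auto
  \<comment> \<open>Normalising the primitive at 4 gives \<open>U 4 = 0\<close>; together with
    \<open>H 4 = 0\<close> it also gives \<open>U1 4 = 0\<close>.\<close>
  define V where "V s = V0 s - V0 4" for s
  have dV: "(V has_vector_derivative H s) (at s)" if "s > 0" for s
    unfolding V_def using has_vector_derivative_diff[OF V0[OF that] has_vector_derivative_const] by simp
  \<comment> \<open>Mean value estimate on the segment from \<open>s\<close> to 4. Its left end is
    at least \<open>4 s / 5\<close> since \<open>s \<le> 5\<close>, and its length is at most 4,
    hence the factor 5.\<close>
  have VB: "norm (V s) \<le> 5 * C / s" if s: "s \<in> {0<..5}" for s
  proof -
    define a where "a = min s 4"
    have a: "a > 0" "4 / 5 * s \<le> a" using s by (auto simp: a_def)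
    have sub: "t > 0 \<and> t \<le> 5 \<and> a \<le> t" if "t \<in> closed_segment s 4" for t
      using that s by (auto simp: closed_segment_eq_real_ivl a_def split: if_splits)
    have "norm (V s - V 4) \<le> C / a * norm (s - 4)"
    proof (rule differentiable_bound[of "closed_segment s 4" V "\<lambda>t h. h *\<^sub>R H t"])
      fix t assume t: "t \<in> closed_segment s 4"
      show "(V has_derivative (\<lambda>h. h *\<^sub>R H t)) (at t within closed_segment s 4)"
        using dV[of t] sub[OF t] unfolding has_vector_derivative_def by (blast intro: has_derivative_at_withinI)
      have Ht: "norm (H t) \<le> C / a"
      proof (rule order_trans[OF HB])
        show "t \<in> {0<..5}" using sub[OF t] by simp
        show "C / t \<le> C / a" using sub[OF t] a C by (intro divide_left_mono) auto
      qed
      show "onorm (\<lambda>h. h *\<^sub>R H t) \<le> C / a"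
      proof (rule onorm_bound)
        show "0 \<le> C / a" using a C by simp
        show "norm (x *\<^sub>R H t) \<le> C / a * norm x" for x
          using mult_right_mono[OF Ht norm_ge_zero, of x] by (simp add: mult.commute)
      qed
    qed auto
    also have "\<dots> \<le> C / (4 / 5 * s) * 4"
      using a s C by (intro mult_mono divide_left_mono) auto
    also have "\<dots> = 5 * C / s" by simp
    finally show ?thesis by (simp add: V_def)
  qed
  define U where "U s = \<Phi> s * V s" for s
  define U1 where "U1 s = \<Phi>1 s * V s + \<Phi> s * H s" for s
  \<comment> \<open>The second derivative is defined by solving the differential equation for it,
    which exhibits it as a polynomial in the generators of the algebra; that it is the derivative of
    \<open>U1\<close> is verified afterwards.\<close>
  define U2 where "U2 s = (- \<kappa> * of_real (\<rho> s) * \<Phi> s - 2 * of_nat N * U1 s - \<kappa> * U s) * ((of_real (i s))^2 / 4)" for s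
  have i2: "complex_of_real s * (of_real (i s))^2 = 1" if "s > 0" for s
    using that by (simp add: i_def power_divide flip: of_real_power)
  have dU: "(U has_vector_derivative U1 s) (at s)" if "s > 0" for s
    using has_vector_derivative_mult[OF d\<Phi> dV[OF that]] unfolding U_def U1_def by (simp add: add.commute)
  have odeU: "4 * of_real s * U2 s + 2 * of_nat N * U1 s + \<kappa> * U s = - \<kappa> * of_real (\<rho> s) * \<Phi> s" if s: "s > 0" for s
  proof -
    have "4 * of_real s * U2 s = (- \<kappa> * of_real (\<rho> s) * \<Phi> s - 2 * of_nat N * U1 s - \<kappa> * U s) * (of_real s * (of_real (i s))^2)"
      by (simp add: U2_def)
    then show ?thesis unfolding i2[OF s] by simp
  qed
  have dU1: "(U1 has_vector_derivative U2 s) (at s)" if s: "s > 0" for s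
  proof -
    define H' where "H' = - \<kappa> / 2 ^ (d + 2) * of_real ((2 + sqrt s) ^ (d - 1) * i s ^ (d + 1))
      - of_nat N / 2 * of_real ((i s)^2) * H s - 2 * \<Phi>1 s * H s / \<Phi> s"
    have D: "(U1 has_vector_derivative (\<Phi>1 s * H s + \<Phi>2 s * V s) + (\<Phi> s * H' + \<Phi>1 s * H s)) (at s)"
      unfolding U1_def using has_vector_derivative_add[OF has_vector_derivative_mult[OF d\<Phi>1 dV[OF s]] has_vector_derivative_mult[OF d\<Phi> dH[OF s]]]
      unfolding H'_def .
    have s0: "complex_of_real s \<noteq> 0" using s by simp
    have iN: "of_real ((i s)^2) = 1 / complex_of_real s" using i2[OF s] s0 by (simp add: field_simps)
    have Hp: "4 * of_real s * (\<Phi> s * H') = - \<kappa> * of_real (\<rho> s) * \<Phi> s - 2 * of_nat N * \<Phi> s * H s - 8 * of_real s * \<Phi>1 s * H s"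
    proof -
      have e1: "- \<kappa> / 2 ^ (d + 2) * of_real ((2 + sqrt s) ^ (d - 1) * i s ^ (d + 1)) = - \<kappa> / 4 * of_real (\<rho> s) * (1 / of_real s)"
      proof -
        have "i s ^ (d + 1) = i s ^ ((d - 1) + 2)" using d by (intro arg_cong[where f = "\<lambda>n. i s ^ n"]) auto
        then have "i s ^ (d + 1) = i s ^ (d - 1) * (i s)^2" by (simp only: power_add)
        then have "(2 + sqrt s) ^ (d - 1) * i s ^ (d + 1) = \<rho> s * 2 ^ d * (i s)^2" by (simp add: \<rho>_def)
        then show ?thesis unfolding iN[symmetric] by (simp add: power_add)
      qed
      have "4 * S * (P * (- \<kappa> / 4 * R * (1 / S) - n / 2 * (1 / S) * h - 2 * p * h / P)) = - \<kappa> * R * P - 2 * n * P * h - 8 * S * p * h"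
        if "S \<noteq> 0" "P \<noteq> 0" for S P R n h p :: complex
        using that by (simp add: divide_simps) (simp add: algebra_simps)
      from this[OF s0 nz[of s]] show ?thesis unfolding H'_def e1 iN by simp
    qed
    have "4 * of_real s * ((\<Phi>1 s * H s + \<Phi>2 s * V s) + (\<Phi> s * H' + \<Phi>1 s * H s)) = 4 * of_real s * U2 s"
    proof -
      have a: "4 * of_real s * \<Phi>2 s = - 2 * of_nat N * \<Phi>1 s - \<kappa> * \<Phi> s"
        using ode\<Phi>[of s] by (simp add: algebra_simps eq_neg_iff_add_eq_0)
      have b: "4 * of_real s * U2 s = - \<kappa> * of_real (\<rho> s) * \<Phi> s - 2 * of_nat N * U1 s - \<kappa> * U s"
        using odeU[OF s] by (simp add: algebra_simps)
      have "4 * of_real s * ((\<Phi>1 s * H s + \<Phi>2 s * V s) + (\<Phi> s * H' + \<Phi>1 s * H s))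
         = 8 * of_real s * \<Phi>1 s * H s + (4 * of_real s * \<Phi>2 s) * V s + 4 * of_real s * (\<Phi> s * H')"
        by (simp add: algebra_simps)
      also have "\<dots> = - \<kappa> * of_real (\<rho> s) * \<Phi> s - 2 * of_nat N * U1 s - \<kappa> * U s"
        unfolding a Hp U_def U1_def by (simp add: algebra_simps)
      finally show ?thesis unfolding b .
    qed
    then have "(\<Phi>1 s * H s + \<Phi>2 s * V s) + (\<Phi> s * H' + \<Phi>1 s * H s) = U2 s" using s0 by simp
    then show ?thesis using D by simp
  qed
  \<comment> \<open>The generators include \<open>1 / sqrt s\<close>, so that dividing the two
    second order equations by \<open>s\<close> stays inside the algebra.\<close>
  define A where "A = {\<lambda>s. of_real (sqrt s), \<lambda>s. of_real (i s), \<Phi>, \<Phi>1, U, U1}"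
  let ?G = "function_algebra A"
  note fa = function_algebra.intros(1,3,4) function_algebra_power
  have gen: "(\<lambda>s. of_real (sqrt s)) \<in> ?G" "(\<lambda>s. of_real (i s)) \<in> ?G" "\<Phi> \<in> ?G" "\<Phi>1 \<in> ?G" "U \<in> ?G" "U1 \<in> ?G"
    by (auto simp: A_def intro: function_algebra_gen)
  have U2': "U2 = (\<lambda>s. ((- \<kappa> / 2 ^ d) * ((2 + of_real (sqrt s)) ^ (d - 1) * of_real (i s) ^ (d - 1)) * \<Phi> s + (- 2 * of_nat N) * U1 s + (- \<kappa>) * U s) * ((of_real (i s))^2 * (1 / 4)))"
    unfolding U2_def \<rho>_def by (simp add: fun_eq_iff)
  have U2G: "U2 \<in> ?G" unfolding U2' by (intro fa gen)
  have \<Phi>2': "\<Phi>2 s = ((- 2 * of_nat N) * \<Phi>1 s + (- \<kappa>) * \<Phi> s) * ((of_real (i s))^2 * (1 / 4))" if "s > 0" for s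
  proof -
    have "(- 2 * of_nat N) * \<Phi>1 s + (- \<kappa>) * \<Phi> s = 4 * of_real s * \<Phi>2 s"
      using ode\<Phi>[of s] by (simp add: algebra_simps minus_unique)
    then have "((- 2 * of_nat N) * \<Phi>1 s + (- \<kappa>) * \<Phi> s) * ((of_real (i s))^2 * (1 / 4)) = (of_real s * (of_real (i s))^2) * \<Phi>2 s" by simp
    then show ?thesis unfolding i2[OF that] by simp
  qed
  have closed: "\<exists>g'\<in>?G. \<forall>s\<in>{0<..}. (g has_vector_derivative g' s) (at s)" if "g \<in> ?G" for g
  proof (rule function_algebra_deriv[OF _ that])
    fix f assume "f \<in> A"
    then consider "f = (\<lambda>s. of_real (sqrt s))" | "f = (\<lambda>s. of_real (i s))" | "f = \<Phi>" | "f = \<Phi>1" | "f = U" | "f = U1"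
      unfolding A_def by blast
    then show "\<exists>f'\<in>?G. \<forall>s\<in>{0<..}. (f has_vector_derivative f' s) (at s)"
    proof cases
      case 1
      have "(\<lambda>s. (1 / 2) * of_real (i s)) \<in> ?G" by (intro fa gen)
      moreover have "\<forall>s\<in>{0<..}. (f has_vector_derivative (1 / 2) * of_real (i s)) (at s)"
      proof
        fix s :: real assume "s \<in> {0<..}"
        then have that: "s > 0" by simp
        have "((\<lambda>s. complex_of_real (sqrt s)) has_vector_derivative of_real (inverse (sqrt s) / 2)) (at s)"
          by (rule has_vector_derivative_of_real[OF DERIV_real_sqrt[OF that]])
        then show "(f has_vector_derivative (1 / 2) * of_real (i s)) (at s)" unfolding 1 by (simp add: i_def inverse_eq_divide mult.commute)
      qed
      ultimately show ?thesis by (rule rev_bexI[where P = "\<lambda>f'. \<forall>s\<in>{0<..}. (f has_vector_derivative f' s) (at s)"])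
    next
      case 2
      have "(\<lambda>s. (- 1 / 2) * of_real (i s) ^ 3) \<in> ?G" by (intro fa gen)
      moreover have "\<forall>s\<in>{0<..}. (f has_vector_derivative (- 1 / 2) * of_real (i s) ^ 3) (at s)"
      proof
        fix s :: real assume "s \<in> {0<..}"
        then have that: "s > 0" by simp
        have "(i has_real_derivative - (i s ^ 3 / 2)) (at s)"
          unfolding i_def using that by (auto intro!: derivative_eq_intros simp: field_simps power3_eq_cube)
        from has_vector_derivative_of_real[OF this, where 'a = complex] show "(f has_vector_derivative (- 1 / 2) * of_real (i s) ^ 3) (at s)" unfolding 2 by simp
      qed
      ultimately show ?thesis by (rule rev_bexI[where P = "\<lambda>f'. \<forall>s\<in>{0<..}. (f has_vector_derivative f' s) (at s)"])
    next
      case 3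
      then show ?thesis using d\<Phi> gen by blast
    next
      case 4
      have "(\<lambda>s. ((- 2 * of_nat N) * \<Phi>1 s + (- \<kappa>) * \<Phi> s) * ((of_real (i s))^2 * (1 / 4))) \<in> ?G" by (intro fa gen)
      moreover have "\<forall>s\<in>{0<..}. (f has_vector_derivative ((- 2 * of_nat N) * \<Phi>1 s + (- \<kappa>) * \<Phi> s) * ((of_real (i s))^2 * (1 / 4))) (at s)"
        unfolding 4 using d\<Phi>1 by (metis \<Phi>2' greaterThan_iff)
      ultimately show ?thesis by (rule rev_bexI[where P = "\<lambda>f'. \<forall>s\<in>{0<..}. (f has_vector_derivative f' s) (at s)"])
    next
      case 5
      then show ?thesis using dU gen by (intro bexI[of _ U1]) auto
    next
      case 6
      then show ?thesis using dU1 U2G by (intro bexI[of _ U2]) auto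
    qed
  qed
  obtain B0 where B0: "B0 \<ge> 0" "\<And>s. s \<in> {0..5} \<Longrightarrow> norm (\<Phi> s) \<le> B0"
  proof -
    have "continuous_on {0..5} \<Phi>" unfolding \<Phi>_def by (intro continuous_intros N)
    from continuous_on_Icc_bounded[OF this] show ?thesis using that by blast
  qed
  obtain B1 where B1: "B1 \<ge> 0" "\<And>s. s \<in> {0..5} \<Longrightarrow> norm (\<Phi>1 s) \<le> B1"
  proof -
    have "continuous_on {0..5} \<Phi>1" unfolding \<Phi>1_def by (intro continuous_intros) simp
    from continuous_on_Icc_bounded[OF this] show ?thesis using that by blast
  qed
  define K0 where "K0 = B0 * (5 * C)"
  define K1 where "K1 = B1 * (5 * C) + B0 * C"
  define K2 where "K2 = norm \<kappa> * 75 * B0 + 2 * real N * K1 + norm \<kappa> * K0"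
  have K: "K0 \<ge> 0" "K1 \<ge> 0" "K2 \<ge> 0" using B0 B1 C by (simp_all add: K0_def K1_def K2_def)
  have UB: "norm (U s) \<le> K0 / s" if s: "s \<in> {0<..5}" for s
  proof -
    have "norm (U s) \<le> B0 * (5 * C / s)" unfolding U_def norm_mult
      using s B0 by (intro mult_mono VB B0) auto
    then show ?thesis by (simp add: K0_def)
  qed
  have U1B: "norm (U1 s) \<le> K1 / s" if s: "s \<in> {0<..5}" for s
  proof -
    have a: "norm (\<Phi>1 s * V s) \<le> B1 * (5 * C / s)" unfolding norm_mult
      using s B1 by (intro mult_mono VB B1) auto
    have b: "norm (\<Phi> s * H s) \<le> B0 * (C / s)" unfolding norm_mult
      using s B0 by (intro mult_mono HB B0) auto
    have "norm (U1 s) \<le> B1 * (5 * C / s) + B0 * (C / s)" unfolding U1_def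
      by (rule order_trans[OF norm_triangle_ineq add_mono[OF a b]])
    then show ?thesis by (simp add: K1_def add_divide_distrib)
  qed
  have \<rho>B: "0 \<le> \<rho> s \<and> \<rho> s \<le> 75 / s" if s: "s \<in> {0<..5}" for s
  proof -
    have s0: "s > 0" using s by simp
    have r3: "sqrt s \<le> 3" by (rule real_le_lsqrt) (use s in auto)
    have i0: "i s > 0" using s0 by (simp add: i_def)
    have i2: "i s ^ (d - 1) \<le> 3 / s" unfolding i_def by (rule inverse_sqrt_power_le[OF d s])
    have "(2 + sqrt s) ^ (d - 1) \<le> 5 ^ (d - 1)" using r3 s0 by (intro power_mono) auto
    also have "\<dots> \<le> (25::real)" using d by auto
    finally have p: "(2 + sqrt s) ^ (d - 1) \<le> 25" .
    have nn: "0 \<le> (2 + sqrt s) ^ (d - 1) * i s ^ (d - 1)" using s0 i0 by simp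
    have "\<rho> s \<le> (2 + sqrt s) ^ (d - 1) * i s ^ (d - 1)"
      using nn unfolding \<rho>_def by (intro divide_le_eq[THEN iffD2] impI) (auto simp: mult_le_cancel_left1 intro: one_le_power)
    also have "\<dots> \<le> 25 * (3 / s)" using p i2 i0 by (intro mult_mono) auto
    finally show ?thesis using nn by (simp add: \<rho>_def)
  qed
  have U2B: "norm (U2 s) \<le> K2 / s^2" if s: "s \<in> {0<..5}" for s
  proof -
    have s0: "s > 0" using s by simp
    have "norm (- \<kappa> * of_real (\<rho> s) * \<Phi> s - 2 * of_nat N * U1 s - \<kappa> * U s)
      \<le> norm (- \<kappa> * of_real (\<rho> s) * \<Phi> s) + norm (2 * of_nat N * U1 s) + norm (\<kappa> * U s)"
      by (intro order_trans[OF norm_triangle_ineq4] add_mono order_refl norm_triangle_ineq4)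
    also have "\<dots> \<le> norm \<kappa> * (75 / s) * B0 + 2 * real N * (K1 / s) + norm \<kappa> * (K0 / s)"
    proof (intro add_mono)
      have "norm (- \<kappa> * of_real (\<rho> s) * \<Phi> s) = norm \<kappa> * \<rho> s * norm (\<Phi> s)"
        using \<rho>B[OF s] by (simp add: norm_mult)
      also have "\<dots> \<le> norm \<kappa> * (75 / s) * B0"
        using \<rho>B[OF s] s B0 by (intro mult_mono mult_left_mono B0) auto
      finally show "norm (- \<kappa> * of_real (\<rho> s) * \<Phi> s) \<le> norm \<kappa> * (75 / s) * B0" .
      show "norm (2 * of_nat N * U1 s) \<le> 2 * real N * (K1 / s)"
        using mult_left_mono[OF U1B[OF s], of "2 * real N"] by (simp add: norm_mult)
      show "norm (\<kappa> * U s) \<le> norm \<kappa> * (K0 / s)"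
        using mult_left_mono[OF UB[OF s] norm_ge_zero[of \<kappa>]] by (simp add: norm_mult)
    qed
    also have "\<dots> = K2 / s" by (simp add: K2_def add_divide_distrib)
    finally have b: "norm (- \<kappa> * of_real (\<rho> s) * \<Phi> s - 2 * of_nat N * U1 s - \<kappa> * U s) \<le> K2 / s" .
    have i4: "norm ((of_real (i s))^2 / (4::complex)) = 1 / (4 * s)"
      using s0 by (simp add: i_def norm_divide norm_power power_divide)
    have "norm (U2 s) \<le> K2 / s * (1 / (4 * s))"
      unfolding U2_def norm_mult i4 using b s0 by (intro mult_right_mono) auto
    also have "\<dots> \<le> K2 / s^2" using s0 K by (simp add: divide_simps power2_eq_square)
    finally show ?thesis .
  qed
  define K where "K = K0 + K1 + K2"
  have bounds: "norm (U s) \<le> K / s \<and> norm (U1 s) \<le> K / s \<and> norm (U2 s) \<le> K / s^2" if s: "s \<in> {0<..5}" for s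
  proof (intro conjI)
    have s0: "s > 0" using s by simp
    show "norm (U s) \<le> K / s" using UB[OF s] s0 K by (intro order_trans[OF UB[OF s]] divide_right_mono) (auto simp: K_def)
    show "norm (U1 s) \<le> K / s" using s0 K by (intro order_trans[OF U1B[OF s]] divide_right_mono) (auto simp: K_def)
    show "norm (U2 s) \<le> K / s^2" using s0 K by (intro order_trans[OF U2B[OF s]] divide_right_mono) (auto simp: K_def)
  qed
  have \<rho>': "\<rho> s = (2 + sqrt s) ^ (d - 1) / (2 ^ d * sqrt s ^ (d - 1))" for s
    by (simp add: \<rho>_def i_def power_divide mult.commute)
  have K': "K \<ge> 0" using K by (simp add: K_def)
  have U4: "U 4 = 0" "U1 4 = 0" by (simp_all add: U_def U1_def V_def H4)
  show ?thesis
    using gen(5,6) U2G closed dU dU1 odeU U4 K' bounds unfolding \<rho>' \<Phi>_def N_def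
    by (intro exI[of _ ?G] exI[of _ U] exI[of _ U1] exI[of _ U2] exI[of _ K] conjI ballI) (simp_all add: greaterThan_iff)
qed

section \<open>Assembling the eigenfunction\<close>

lemma integral_laplacian_test:
  fixes v \<phi> :: "'a::euclidean_space \<Rightarrow> complex"
  assumes r: "r > 0" and v: "smooth v" and \<phi>: "\<phi> \<in> test_functions (ball 0 r)"
  shows "(\<integral>x. v x * laplacian \<phi> x \<partial>lebesgue_on (ball 0 r)) = (\<integral>x. laplacian v x * \<phi> x \<partial>lebesgue_on (ball 0 r))"
proof -
  let ?M = "lebesgue_on (ball (0::'a) r)"
  have s\<phi>: "smooth \<phi>" using \<phi> by (simp add: test_functions_def)
  have i: "integrable ?M (\<lambda>x. f x * g x)" if "smooth f" "smooth g" for f g :: "'a \<Rightarrow> complex"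
    by (intro integrable_mult_continuous_ball L2_integrable[OF finite_measure_lebesgue_on_ball] L2_continuous_ball smooth_continuous_on that)
  have eq: "(\<integral>x. v x * partials [b, b] \<phi> x \<partial>?M) = (\<integral>x. partials [b, b] v x * \<phi> x \<partial>?M)" if b: "b \<in> Basis" for b
  proof -
    have sv: "smooth (partials [b] v)" using v b by (intro smooth_partials) auto
    show ?thesis
      unfolding partials_Cons[of b "[b]"] integral_by_parts_test[OF r v test_function_partial[OF \<phi> b] b]
        integral_by_parts_test[OF r sv \<phi> b] by simp
  qed
  have "(\<integral>x. v x * laplacian \<phi> x \<partial>?M) = (\<Sum>b\<in>Basis. \<integral>x. v x * partials [b, b] \<phi> x \<partial>?M)"
    unfolding laplacian_def sum_distrib_left by (rule Bochner_Integration.integral_sum) (auto intro!: i v smooth_partials s\<phi>)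
  also have "\<dots> = (\<Sum>b\<in>Basis. \<integral>x. partials [b, b] v x * \<phi> x \<partial>?M)"
    by (rule sum.cong[OF refl eq])
  also have "\<dots> = (\<integral>x. laplacian v x * \<phi> x \<partial>?M)"
    unfolding laplacian_def sum_distrib_right by (rule Bochner_Integration.integral_sum[symmetric]) (auto intro!: i v smooth_partials s\<phi>)
  finally show ?thesis .
qed

lemma hpoly_norm_le_inner:
  assumes "hpoly n p" "2 * j \<le> n"
  shows "\<exists>C\<ge>0. \<forall>x. norm x \<le> 2 \<longrightarrow> norm (p x) \<le> C * (x \<bullet> x) ^ j"
proof -
  obtain C where C: "C \<ge> 0" "\<And>x. norm (p x) \<le> C * norm x ^ n" using hpoly_norm_le[OF assms(1)] by blast
  have "norm (p x) \<le> (C * 2 ^ (n - 2 * j)) * (x \<bullet> x) ^ j" if "norm x \<le> 2" for x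
  proof -
    have "norm x ^ n = norm x ^ (n - 2 * j) * (x \<bullet> x) ^ j"
      unfolding power2_norm_eq_inner[symmetric] power_mult[symmetric] power_add[symmetric] using assms(2) by simp
    also have "\<dots> \<le> 2 ^ (n - 2 * j) * (x \<bullet> x) ^ j" using that by (intro mult_right_mono power_mono) auto
    finally have "C * norm x ^ n \<le> C * (2 ^ (n - 2 * j) * (x \<bullet> x) ^ j)" by (rule mult_left_mono[OF _ C(1)])
    with C(2)[of x] show ?thesis by (simp add: mult.assoc)
  qed
  then show ?thesis using C(1) by (intro exI[of _ "C * 2 ^ (n - 2 * j)"]) auto
qed

text \<open>The shift by \<open>1/(n+1)\<close> keeps the profile away from its singularity. Since
  \<open>|x|^2\<close> is at most the shifted argument, the polynomial factors compensate the bounds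
  \<open>K/s\<close> and \<open>K/s^2\<close> uniformly in \<open>n\<close>. The measure is left
  general to cover both the ball and the sphere.\<close>

lemma radial_combination_L2_tendsto:
  fixes p0 p1 p2 :: "'a::euclidean_space \<Rightarrow> complex"
  assumes fin: "finite_measure M" and sp: "space M \<subseteq> cball 0 2"
    and meas: "\<And>g::'a \<Rightarrow> complex. g \<in> borel_measurable borel \<Longrightarrow> g \<in> borel_measurable M"
    and p: "hpoly n0 p0" "2 \<le> n0" "hpoly n1 p1" "2 \<le> n1" "hpoly n2 p2" "4 \<le> n2"
    and U: "\<And>s. s > 0 \<Longrightarrow> isCont U s" "\<And>s. s > 0 \<Longrightarrow> isCont U1 s" "\<And>s. s > 0 \<Longrightarrow> isCont U2 s"
    and K: "K \<ge> 0" "\<And>s. s \<in> {0<..5} \<Longrightarrow> norm (U s) \<le> K / s \<and> norm (U1 s) \<le> K / s \<and> norm (U2 s) \<le> K / s\<^sup>2"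
    and f: "f 0 = 0" "\<And>x. x \<in> space M \<Longrightarrow> x \<noteq> 0 \<Longrightarrow> f x = p0 x * U (x \<bullet> x) + p1 x * U1 (x \<bullet> x) + p2 x * U2 (x \<bullet> x)"
  shows "L2_tendsto M (\<lambda>n x. p0 x * U (1 / real (Suc n) + x \<bullet> x) + p1 x * U1 (1 / real (Suc n) + x \<bullet> x) + p2 x * U2 (1 / real (Suc n) + x \<bullet> x)) f"
proof -
  obtain C0 where C0: "C0 \<ge> 0" "\<And>x. norm x \<le> 2 \<Longrightarrow> norm (p0 x) \<le> C0 * (x \<bullet> x)"
    using hpoly_norm_le_inner[OF p(1), of 1] p(2) by auto
  obtain C1 where C1: "C1 \<ge> 0" "\<And>x. norm x \<le> 2 \<Longrightarrow> norm (p1 x) \<le> C1 * (x \<bullet> x)"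
    using hpoly_norm_le_inner[OF p(3), of 1] p(4) by auto
  obtain C2 where C2: "C2 \<ge> 0" "\<And>x. norm x \<le> 2 \<Longrightarrow> norm (p2 x) \<le> C2 * (x \<bullet> x)\<^sup>2"
    using hpoly_norm_le_inner[OF p(5), of 2] p(6) by auto
  have p00: "p0 0 = 0" "p1 0 = 0" "p2 0 = 0" using C0(2)[of 0] C1(2)[of 0] C2(2)[of 0] by simp_all
  show ?thesis
  proof (rule L2_tendsto_bounded_pointwise[OF fin, where B = "(C0 + C1 + C2) * K"])
    fix n
    let ?s = "\<lambda>x::'a. 1 / real (Suc n) + x \<bullet> x"
    have c: "continuous_on UNIV (\<lambda>x. W (?s x))" if "\<And>s. s > 0 \<Longrightarrow> isCont W s" for W :: "real \<Rightarrow> complex"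
    proof (rule continuous_on_compose2[of "{0<..}" W])
      show "continuous_on {0<..} W" using that by (simp add: continuous_at_imp_continuous_on)
      show "continuous_on UNIV ?s" by (intro continuous_intros)
      show "?s ` UNIV \<subseteq> {0<..}" by (auto intro!: add_pos_nonneg)
    qed
    show "(\<lambda>x. p0 x * U (?s x) + p1 x * U1 (?s x) + p2 x * U2 (?s x)) \<in> borel_measurable M"
      by (intro meas borel_measurable_continuous_onI continuous_intros c U smooth_continuous_on hpoly_smooth[OF p(1)] hpoly_smooth[OF p(3)] hpoly_smooth[OF p(5)])
    fix x assume "x \<in> space M"
    then have x: "norm x \<le> 2" using sp by auto
    define s where "s = ?s x"
    have "x \<bullet> x \<le> 2\<^sup>2" unfolding power2_norm_eq_inner[symmetric] using x by (intro power_mono) auto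
    then have "x \<bullet> x \<le> 4" by simp
    moreover have "1 / real (Suc n) \<le> 1" "1 / real (Suc n) > 0" by simp_all
    moreover have "0 \<le> x \<bullet> x" by simp
    ultimately have "0 < s" "s \<le> 5" "x \<bullet> x \<le> s" unfolding s_def by linarith+
    then have s: "s \<in> {0<..5}" "x \<bullet> x \<le> s" "s > 0" by simp_all
    have q: "(x \<bullet> x) ^ j * (K / s ^ j) \<le> K" for j
    proof -
      have "(x \<bullet> x) ^ j \<le> s ^ j" using s by (intro power_mono) auto
      then have "(x \<bullet> x) ^ j * (K / s ^ j) \<le> s ^ j * (K / s ^ j)" using s K(1) by (intro mult_right_mono) auto
      then show ?thesis using s by simp
    qed
    have b: "norm (p0 x * U s) \<le> C0 * K" "norm (p1 x * U1 s) \<le> C1 * K" "norm (p2 x * U2 s) \<le> C2 * K"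
    proof -
      have "norm (p0 x * U s) \<le> (C0 * (x \<bullet> x)) * (K / s)"
        unfolding norm_mult using C0 K s x by (intro mult_mono) auto
      also have "\<dots> \<le> C0 * K" using mult_left_mono[OF q[of 1] C0(1)] by (simp add: mult.assoc)
      finally show "norm (p0 x * U s) \<le> C0 * K" .
      have "norm (p1 x * U1 s) \<le> (C1 * (x \<bullet> x)) * (K / s)"
        unfolding norm_mult using C1 K s x by (intro mult_mono) auto
      also have "\<dots> \<le> C1 * K" using mult_left_mono[OF q[of 1] C1(1)] by (simp add: mult.assoc)
      finally show "norm (p1 x * U1 s) \<le> C1 * K" .
      have "norm (p2 x * U2 s) \<le> (C2 * (x \<bullet> x)\<^sup>2) * (K / s\<^sup>2)"
        unfolding norm_mult using C2 K s x by (intro mult_mono) auto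
      also have "\<dots> \<le> C2 * K" using mult_left_mono[OF q[of 2] C2(1)] by (simp add: mult.assoc)
      finally show "norm (p2 x * U2 s) \<le> C2 * K" .
    qed
    have "norm (p0 x * U s + p1 x * U1 s + p2 x * U2 s) \<le> C0 * K + C1 * K + C2 * K"
      by (intro order_trans[OF norm_triangle_ineq] add_mono b)
    then show "norm (p0 x * U (?s x) + p1 x * U1 (?s x) + p2 x * U2 (?s x)) \<le> (C0 + C1 + C2) * K"
      unfolding s_def by (simp add: algebra_simps)
  next
    fix x assume x: "x \<in> space M"
    show "(\<lambda>n. p0 x * U (1 / real (Suc n) + x \<bullet> x) + p1 x * U1 (1 / real (Suc n) + x \<bullet> x) + p2 x * U2 (1 / real (Suc n) + x \<bullet> x)) \<longlonglongrightarrow> f x"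
    proof (cases "x = 0")
      case True
      then show ?thesis by (simp add: p00 f(1))
    next
      case False
      have l: "(\<lambda>n. 1 / real (Suc n) + x \<bullet> x) \<longlonglongrightarrow> x \<bullet> x"
        using tendsto_add[OF LIMSEQ_inverse_real_of_nat tendsto_const[of "x \<bullet> x"]] by (simp add: inverse_eq_divide)
      have "x \<bullet> x > 0" using False by simp
      then show ?thesis unfolding f(2)[OF x False]
        by (intro tendsto_intros isCont_tendsto_compose[OF _ l] U)
    qed
  qed
qed

lemma partials_radial_combination:
  fixes p0 p1 :: "'a::euclidean_space \<Rightarrow> complex"
  assumes dU: "\<And>s. s > 0 \<Longrightarrow> (U has_vector_derivative U1 s) (at s)" "\<And>s. s > 0 \<Longrightarrow> (U1 has_vector_derivative U2 s) (at s)"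
    and p: "smooth p0" "smooth p1" and e: "e > 0"
  shows "partials [b] (\<lambda>x. p0 x * U (e + x \<bullet> x) + p1 x * U1 (e + x \<bullet> x)) =
    (\<lambda>x. partials [b] p0 x * U (e + x \<bullet> x) + (partials [b] p1 x + 2 * of_real (x \<bullet> b) * p0 x) * U1 (e + x \<bullet> x)
      + 2 * of_real (x \<bullet> b) * p1 x * U2 (e + x \<bullet> x))"
proof -
  have pos: "e + x \<bullet> x > 0" for x :: 'a using e by (intro add_pos_nonneg) auto
  have r: "partials [b] (\<lambda>x::'a. W (e + x \<bullet> x)) = (\<lambda>x. of_real (x \<bullet> b) * (2 * W' (e + x \<bullet> x)))"
    "\<And>x. (\<lambda>x::'a. W (e + x \<bullet> x)) differentiable (at x)"
    if W: "\<And>s. s > 0 \<Longrightarrow> (W has_vector_derivative W' s) (at s)" for W W' :: "real \<Rightarrow> complex"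
  proof -
    have "partials [b] (\<lambda>x::'a. W (e + 1 * (x \<bullet> x))) = (\<lambda>x. of_real (x \<bullet> b) * (of_real (2 * 1) * W' (e + 1 * (x \<bullet> x))))"
      by (rule partials_radial_fun) (use pos W in simp)
    then show "partials [b] (\<lambda>x::'a. W (e + x \<bullet> x)) = (\<lambda>x. of_real (x \<bullet> b) * (2 * W' (e + x \<bullet> x)))" by simp
    fix x :: 'a
    have "(W has_vector_derivative W' (e + x \<bullet> x)) (at (e + 1 * (x \<bullet> x)))" using W[OF pos[of x]] by simp
    from radial_has_derivative[OF this] show "(\<lambda>x::'a. W (e + x \<bullet> x)) differentiable (at x)"
      unfolding differentiable_def mult_1 by blast
  qed
  note d = smooth_differentiable[OF p(1)] smooth_differentiable[OF p(2)] r(2)[OF dU(1)] r(2)[OF dU(2)]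
  show ?thesis
    by (simp add: partials_add partials_mult d differentiable_mult r(1)[OF dU(1)] r(1)[OF dU(2)] algebra_simps)
qed

text \<open>\<open>(x_1 + i x_2)^n\<close> is harmonic because the Laplacian produces the factor
  \<open>1 + i^2 = 0\<close>; it equals 1 at the first of the two basis vectors.\<close>

lemma exists_harmonic_hpoly:
  assumes "DIM('a::euclidean_space) \<ge> 2"
  shows "\<exists>Y (e::'a). hpoly n Y \<and> (\<forall>x. laplacian Y x = 0) \<and> norm e = 1 \<and> Y e = 1"
proof -
  have "\<not> card (Basis :: 'a set) \<le> Suc 0" using assms by simp
  then obtain b1 b2 :: 'a where b: "b1 \<in> Basis" "b2 \<in> Basis" "b1 \<noteq> b2"
    using card_le_Suc0_iff_eq[of "Basis :: 'a set"] by auto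
  define z where "z x = of_real (x \<bullet> b1) * 1 + of_real (x \<bullet> b2) * \<i>" for x :: 'a
  define c where "c b = complex_of_real (b \<bullet> b1) + of_real (b \<bullet> b2) * \<i>" for b :: 'a
  have z1: "hpoly 1 z" unfolding z_def
    using hpoly_add[OF hpoly_coord_mult[OF hpoly_const[of 1] b(1)] hpoly_coord_mult[OF hpoly_const[of "\<i>"] b(2)]] by simp
  have zn: "hpoly n (\<lambda>x. z x ^ n)" for n
  proof (induction n)
    case (Suc n)
    then show ?case using hpoly_mult[OF z1 Suc] by simp
  qed (simp add: hpoly_const)
  have dz: "partials [b] z = (\<lambda>x. c b)" for b
  proof -
    have "partials [b] z = (\<lambda>x. partials [b] (\<lambda>x::'a. of_real (x \<bullet> b1) * 1) x + partials [b] (\<lambda>x. of_real (x \<bullet> b2) * \<i>) x)"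
      unfolding z_def by (rule partials_add) (auto intro!: smooth_differentiable hpoly_smooth[OF hpoly_coord_mult[OF hpoly_const]] b)
    also have "\<dots> = (\<lambda>x. c b)"
      by (subst (1 2) partials_mult) (auto simp: partials_coord c_def intro!: Ck_differentiable[OF Ck_coord])
    finally show ?thesis .
  qed
  have dzn: "partials [b] (\<lambda>x. z x ^ n) = (\<lambda>x. of_nat n * c b * z x ^ (n - 1))" for n b
  proof (induction n)
    case (Suc n)
    have "partials [b] (\<lambda>x. z x * z x ^ n) = (\<lambda>x. partials [b] z x * z x ^ n + z x * partials [b] (\<lambda>x. z x ^ n) x)"
      by (intro partials_mult smooth_differentiable hpoly_smooth[OF z1] hpoly_smooth[OF zn])
    also have "\<dots> = (\<lambda>x. of_nat (Suc n) * c b * z x ^ n)"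
      unfolding Suc dz by (cases n) (auto simp: fun_eq_iff algebra_simps)
    finally show ?case by simp
  qed simp
  have "laplacian (\<lambda>x. z x ^ n) x = 0" for x
  proof -
    have "partials [b, b] (\<lambda>x. z x ^ n) x = of_nat n * of_nat (n - 1) * z x ^ (n - 1 - 1) * (c b)\<^sup>2" for b
    proof -
      have "partials [b, b] (\<lambda>x. z x ^ n) = partials [b] (\<lambda>x. of_nat n * c b * z x ^ (n - 1))"
        unfolding partials_Cons[of b "[b]"] dzn ..
      also have "\<dots> = (\<lambda>x. partials [b] (\<lambda>x. of_nat n * c b) x * z x ^ (n - 1) + of_nat n * c b * partials [b] (\<lambda>x. z x ^ (n - 1)) x)"
        by (rule partials_mult) (auto intro!: smooth_differentiable hpoly_smooth[OF zn])
      finally show ?thesis by (simp add: dzn power2_eq_square)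
    qed
    then have "laplacian (\<lambda>x. z x ^ n) x = of_nat n * of_nat (n - 1) * z x ^ (n - 1 - 1) * (\<Sum>b\<in>Basis. (c b)\<^sup>2)"
      by (simp add: laplacian_def sum_distrib_left)
    also have "(\<Sum>b\<in>Basis. (c b)\<^sup>2) = (\<Sum>b\<in>Basis. (if b = b1 then 1 else 0) - (if b = b2 then 1 else 0))"
      using b by (intro sum.cong refl) (auto simp: c_def inner_Basis power2_eq_square)
    also have "\<dots> = 0" using b by (simp add: sum_subtractf)
    finally show ?thesis by simp
  qed
  moreover have "z b1 ^ n = 1" using b by (simp add: z_def inner_Basis)
  ultimately show ?thesis using zn[of n] b(1) by (intro exI[of _ "\<lambda>x. z x ^ n"] exI[of _ b1]) simp
qed

lemma smooth_bes_inner_self: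
  assumes "M \<ge> 1" shows "smooth (\<lambda>x::'a::euclidean_space. bes M (\<kappa> * of_real (x \<bullet> x)))"
proof -
  define G where "G = {\<lambda>s. c * bes (M + j) (\<kappa> * complex_of_real s) | c j. True}"
  have "smooth (\<lambda>x::'a. (\<lambda>s. bes M (\<kappa> * complex_of_real s)) (0 + 1 * (x \<bullet> x)))"
  proof (rule smooth_radial_family[where G = G and T = UNIV])
    fix g assume "g \<in> G"
    then obtain c j where g: "g = (\<lambda>s. c * bes (M + j) (\<kappa> * complex_of_real s))" unfolding G_def by blast
    show "\<exists>g'\<in>G. \<forall>s\<in>UNIV. (g has_vector_derivative g' s) (at s)"
    proof (rule bexI[of _ "\<lambda>s. (c * (- \<kappa> / (2 * of_nat (M + j)))) * bes (M + (j + 2)) (\<kappa> * complex_of_real s)"])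
      have "(g has_vector_derivative c * (- \<kappa> / (2 * of_nat (M + j)) * bes (M + j + 2) (\<kappa> * of_real s))) (at s)" for s
        unfolding g using assms by (intro has_vector_derivative_mult_right bes_of_real_deriv) simp
      then show "\<forall>s\<in>UNIV. (g has_vector_derivative c * (- \<kappa> / (2 * of_nat (M + j))) * bes (M + (j + 2)) (\<kappa> * complex_of_real s)) (at s)"
        by (simp only: mult.assoc add.assoc) simp
      show "(\<lambda>s. (c * (- \<kappa> / (2 * of_nat (M + j)))) * bes (M + (j + 2)) (\<kappa> * complex_of_real s)) \<in> G"
        unfolding G_def by blast
    qed
  next
    show "(\<lambda>s. bes M (\<kappa> * complex_of_real s)) \<in> G"
      unfolding G_def by (rule CollectI, rule exI[of _ 1], rule exI[of _ 0]) simp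
  qed simp
  then show ?thesis by simp
qed

text \<open>In degree 4 the second derivatives of \<open>Y\<close> still have degree 2, enough
  against the bound \<open>K/s\<close> on \<open>U\<close>, and the coefficients of
  \<open>U2\<close> have degree at least 4.\<close>

lemma born_eigenvalue_of_charfun_zero:
  fixes m :: "'a::euclidean_space \<Rightarrow> real"
  assumes d: "DIM('a) = 2 \<or> DIM('a) = 3"
    and m: "\<And>x. x \<in> ball 0 2 - {0} \<Longrightarrow> m x = (2 + norm x) ^ (DIM('a) - 1) / (2 ^ DIM('a) * norm x ^ (DIM('a) - 1))"
    and k: "k \<noteq> 0" and zero: "charfun DIM('a) 4 (k^2) = 0"
  shows "k \<in> born_transmission_eigenvalues 2 m"
proof -
  let ?M = "lebesgue_on (ball (0::'a) 2)" and ?d = "DIM('a)"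
  define \<kappa> where "\<kappa> = k^2"
  have \<kappa>0: "\<kappa> \<noteq> 0" using k by (simp add: \<kappa>_def)
  have z: "charfun ?d 4 \<kappa> = 0" using zero by (simp add: \<kappa>_def)
  have \<kappa>: "\<kappa> \<notin> \<real>"
  proof
    assume "\<kappa> \<in> \<real>"
    with charfun_real_pos[of ?d \<kappa> 4] z d show False by auto
  qed
  define N where "N = 2 * 4 + ?d"
  have N: "N \<ge> 1" by (simp add: N_def)
  define \<Phi> where "\<Phi> s = bes N (\<kappa> * of_real s)" for s :: real
  define \<rho> where "\<rho> s = (2 + sqrt s) ^ (?d - 1) / (2 ^ ?d * sqrt s ^ (?d - 1))" for s
  obtain G U U1 U2 K where G: "U \<in> G" "U1 \<in> G" "U2 \<in> G"
    "\<And>g. g \<in> G \<Longrightarrow> \<exists>g'\<in>G. \<forall>s\<in>{0<..}. (g has_vector_derivative g' s) (at s)"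
    and dU: "\<And>s. s > 0 \<Longrightarrow> (U has_vector_derivative U1 s) (at s)" and dU1: "\<And>s. s > 0 \<Longrightarrow> (U1 has_vector_derivative U2 s) (at s)"
    and ode: "\<And>s. s > 0 \<Longrightarrow> 4 * of_real s * U2 s + 2 * of_nat N * U1 s + \<kappa> * U s = - \<kappa> * of_real (\<rho> s) * \<Phi> s"
    and U4: "U 4 = 0" "U1 4 = 0" and K: "K \<ge> 0"
    "\<And>s. s \<in> {0<..5} \<Longrightarrow> norm (U s) \<le> K / s \<and> norm (U1 s) \<le> K / s \<and> norm (U2 s) \<le> K / s^2"
  proof -
    from born_profile_exists[OF d \<kappa> z] obtain G U U1 U2 K where
      H: "U \<in> G \<and> U1 \<in> G \<and> U2 \<in> G \<and>
    (\<forall>g\<in>G. \<exists>g'\<in>G. \<forall>s\<in>{0<..}. (g has_vector_derivative g' s) (at s)) \<and>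
    (\<forall>s\<in>{0<..}. (U has_vector_derivative U1 s) (at s)) \<and> (\<forall>s\<in>{0<..}. (U1 has_vector_derivative U2 s) (at s)) \<and>
    (\<forall>s\<in>{0<..}. 4 * of_real s * U2 s + 2 * of_nat N * U1 s + \<kappa> * U s = - \<kappa> * of_real (\<rho> s) * \<Phi> s) \<and>
    U 4 = 0 \<and> U1 4 = 0 \<and> K \<ge> 0 \<and>
    (\<forall>s\<in>{0<..5}. norm (U s) \<le> K / s \<and> norm (U1 s) \<le> K / s \<and> norm (U2 s) \<le> K / s^2)"
      unfolding N_def \<rho>_def \<Phi>_def by (elim exE)
    show ?thesis by (rule that[of U G U1 U2 K]) (use H in auto)
  qed
  have Gc: "isCont g s" if g: "g \<in> G" and s: "s > 0" for g s
  proof -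
    obtain g' where "\<forall>s\<in>{0<..}. (g has_vector_derivative g' s) (at s)" using G(4)[OF g] by blast
    then show ?thesis using s by (intro has_vector_derivative_continuous) auto
  qed
  obtain Y :: "'a \<Rightarrow> complex" and e :: 'a where Y: "hpoly 4 Y" "\<And>x. laplacian Y x = 0" and e: "norm e = 1" "Y e = 1"
    using exists_harmonic_hpoly[where 'a = 'a, of 4] d by auto
  have sY: "smooth Y" by (rule hpoly_smooth[OF Y(1)])
  have Y0: "Y 0 = 0"
  proof -
    obtain C where "\<And>x. norm (Y x) \<le> C * norm x ^ 4" using hpoly_norm_le[OF Y(1)] by blast
    from this[of 0] show ?thesis by simp
  qed
  define v where "v x = Y x * \<Phi> (x \<bullet> x)" for x
  have sv: "smooth v" unfolding v_def \<Phi>_def by (intro smooth_mult sY smooth_bes_inner_self N)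
  have hv: "laplacian v x + \<kappa> * v x = 0" for x
  proof -
    define \<Phi>1 where "\<Phi>1 s = - \<kappa> / (2 * of_nat N) * bes (N + 2) (\<kappa> * of_real s)" for s :: real
    define \<Phi>2 where "\<Phi>2 s = \<kappa>\<^sup>2 / (4 * of_nat N * of_nat (N + 2)) * bes (N + 4) (\<kappa> * of_real s)" for s :: real
    have d1: "(\<Phi> has_vector_derivative \<Phi>1 s) (at s)" for s
      unfolding \<Phi>_def \<Phi>1_def by (rule bes_of_real_deriv[OF N])
    have d2: "(\<Phi>1 has_vector_derivative \<Phi>2 s) (at s)" for s
      unfolding \<Phi>1_def \<Phi>2_def by (rule bes_of_real_deriv2[OF N])
    have "laplacian (\<lambda>x. Y x * \<Phi> (0 + (x \<bullet> x))) x
      = Y x * (4 * of_real (x \<bullet> x) * \<Phi>2 (0 + (x \<bullet> x)) + 2 * of_nat (2 * 4 + ?d) * \<Phi>1 (0 + (x \<bullet> x)))"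
      by (rule laplacian_harmonic_mult_radial[where T = UNIV, OF Y d1 d2 UNIV_I])
    then have "laplacian v x = Y x * (4 * of_real (x \<bullet> x) * \<Phi>2 (x \<bullet> x) + 2 * of_nat N * \<Phi>1 (x \<bullet> x))"
      unfolding v_def N_def[symmetric] add_0 .
    then have "laplacian v x + \<kappa> * v x = Y x * (4 * of_real (x \<bullet> x) * \<Phi>2 (x \<bullet> x) + 2 * of_nat N * \<Phi>1 (x \<bullet> x) + \<kappa> * \<Phi> (x \<bullet> x))"
      by (simp add: v_def algebra_simps)
    then show ?thesis unfolding \<Phi>_def \<Phi>1_def \<Phi>2_def bes_radial_ode[OF N] by simp
  qed
  have mv: "of_real (m x) * v x = Y x * (of_real (\<rho> (x \<bullet> x)) * \<Phi> (x \<bullet> x))" if "x \<in> ball 0 2" for x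
  proof (cases "x = 0")
    case False
    then have "m x = \<rho> (x \<bullet> x)" using that m by (simp add: \<rho>_def norm_eq_sqrt_inner[symmetric])
    then show ?thesis by (simp add: v_def mult_ac)
  qed (simp add: v_def Y0)
  \<comment> \<open>Smooth approximations of the eigenfunction \<open>Y U(|x|^2)\<close>, obtained
    by shifting the argument of the profile off 0.\<close>
  define u where "u n x = Y x * U (1 / real (Suc n) + x \<bullet> x)" for n x
  have su: "smooth (u n)" for n
  proof -
    have "smooth (\<lambda>x::'a. U (1 / real (Suc n) + 1 * (x \<bullet> x)))"
      by (rule smooth_radial_family[OF G(4) _ G(1)]) (auto intro!: add_pos_nonneg)
    then show ?thesis unfolding u_def by (intro smooth_mult sY) simp
  qed
  define R where "R b x = 2 * of_real (x \<bullet> b) * Y x" for b x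
  have hR: "hpoly 5 (R b)" if "b \<in> Basis" for b
    using hpoly_cmult[OF hpoly_coord_mult[OF Y(1) that], of 2] unfolding R_def by (simp add: mult.assoc)
  have hY1: "hpoly 3 (partials [b] Y)" for b using hpoly_partial[OF Y(1), of b] by simp
  \<comment> \<open>\<open>P0\<close>, \<open>P1\<close>, \<open>P2\<close> are the coefficients of
    \<open>U\<close>, \<open>U1\<close>, \<open>U2\<close> in the partial derivatives of
    \<open>u n\<close> up to order 2, and \<open>R b\<close> is the coefficient of \<open>U1\<close>
    at order 1.\<close>
  define P0 where "P0 bs = partials bs Y" for bs
  define P1 where "P1 bs = (case bs of [] \<Rightarrow> (\<lambda>x. 0) | b # cs \<Rightarrow> (case cs of [] \<Rightarrow> R b
    | c # _ \<Rightarrow> (\<lambda>x. partials [b] (R c) x + 2 * of_real (x \<bullet> b) * partials [c] Y x)))" for bs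
  define P2 where "P2 bs = (case bs of [] \<Rightarrow> (\<lambda>x. 0) | b # cs \<Rightarrow> (case cs of [] \<Rightarrow> (\<lambda>x. 0)
    | c # _ \<Rightarrow> (\<lambda>x. 2 * of_real (x \<bullet> b) * R c x)))" for bs
  define E where "E bs n = (\<lambda>x. P0 bs x * U (1 / real (Suc n) + x \<bullet> x) + P1 bs x * U1 (1 / real (Suc n) + x \<bullet> x) + P2 bs x * U2 (1 / real (Suc n) + x \<bullet> x))" for bs n
  have PU: "(\<exists>n0 n1 n2. hpoly n0 (P0 bs) \<and> 2 \<le> n0 \<and> hpoly n1 (P1 bs) \<and> 2 \<le> n1 \<and> hpoly n2 (P2 bs) \<and> 4 \<le> n2) \<and> partials bs (u n) = E bs n"
    if "bs \<in> multi_indices 2" for bs n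
  proof -
    have pos: "1 / real (Suc n) > 0" by simp
    have one: "partials [c] (u n) = (\<lambda>x. partials [c] Y x * U (1 / real (Suc n) + x \<bullet> x) + R c x * U1 (1 / real (Suc n) + x \<bullet> x))" for c
    proof -
      have "u n = (\<lambda>x. Y x * U (1 / real (Suc n) + x \<bullet> x) + 0 * U1 (1 / real (Suc n) + x \<bullet> x))" by (simp add: u_def fun_eq_iff)
      then show ?thesis using partials_radial_combination[OF dU dU1 sY smooth_const[of 0] pos, of c] by (simp add: R_def)
    qed
    from that consider "bs = []" | b where "b \<in> Basis" "bs = [b]" | b c where "b \<in> Basis" "c \<in> Basis" "bs = [b, c]"
      unfolding multi_indices_2 by blast
    then show ?thesis
    proof cases
      case 1
      have "hpoly 4 (P0 bs)" "hpoly 2 (P1 bs)" "hpoly 4 (P2 bs)" unfolding 1 by (simp_all add: P0_def P1_def P2_def Y hpoly_zero)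
      moreover have "u n = E bs n"
        unfolding 1 E_def by (simp add: P0_def P1_def P2_def u_def fun_eq_iff)
      ultimately show ?thesis unfolding 1 by (intro conjI exI[of _ 4] exI[of _ 2]) simp_all
    next
      case 2
      have "hpoly 3 (P0 bs)" "hpoly 5 (P1 bs)" "hpoly 4 (P2 bs)" unfolding 2 by (simp_all add: P0_def P1_def P2_def hY1 hR 2 hpoly_zero)
      moreover have "partials bs (u n) = E bs n"
        unfolding 2 one E_def by (simp add: P0_def P1_def P2_def fun_eq_iff)
      ultimately show ?thesis by (intro conjI exI[of _ 3] exI[of _ 5] exI[of _ 4]) simp_all
    next
      case 3
      have "hpoly 2 (P0 bs)" unfolding 3 P0_def partials_Cons[of b "[c]"] using hpoly_partial[OF hY1, of b c] by simp
      moreover have "hpoly 4 (P1 bs)"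
      proof -
        have "hpoly 4 (\<lambda>x. 2 * (of_real (x \<bullet> b) * partials [c] Y x))"
          using hpoly_cmult[OF hpoly_coord_mult[OF hY1 3(1)]] by simp
        from hpoly_add[OF hpoly_partial[OF hR[OF 3(2)], of b, simplified] this]
        show ?thesis unfolding 3 P1_def by (simp add: mult.assoc)
      qed
      moreover have "hpoly 6 (P2 bs)"
        using hpoly_cmult[OF hpoly_coord_mult[OF hR[OF 3(2)] 3(1)], of 2] unfolding 3 P2_def by (simp add: mult.assoc)
      moreover have "partials bs (u n) = E bs n"
      proof -
        have "partials [b] (partials [c] (u n)) = (\<lambda>x. partials [b] (partials [c] Y) x * U (1 / real (Suc n) + x \<bullet> x)
            + (partials [b] (R c) x + 2 * of_real (x \<bullet> b) * partials [c] Y x) * U1 (1 / real (Suc n) + x \<bullet> x)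
            + 2 * of_real (x \<bullet> b) * R c x * U2 (1 / real (Suc n) + x \<bullet> x))"
          unfolding one by (rule partials_radial_combination[OF dU dU1 hpoly_smooth[OF hY1] hpoly_smooth[OF hR[OF 3(2)]] pos])
        then show ?thesis unfolding 3 E_def P0_def P1_def P2_def partials_Cons[of b "[c]"] by simp
      qed
      ultimately show ?thesis by (intro conjI exI[of _ 2] exI[of _ 4] exI[of _ 6]) simp_all
    qed
  qed
  note P = PU[THEN conjunct1] and pu = PU[THEN conjunct2]
  \<comment> \<open>The value 0 at the origin is the pointwise limit there, as all coefficient
    polynomials vanish at 0.\<close>
  define g where "g bs x = (if x = 0 then 0 else P0 bs x * U (x \<bullet> x) + P1 bs x * U1 (x \<bullet> x) + P2 bs x * U2 (x \<bullet> x))" for bs x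
  note rc = radial_combination_L2_tendsto[OF _ _ _ _ _ _ _ _ _ Gc[OF G(1)] Gc[OF G(2)] Gc[OF G(3)] K]
  have gl: "L2_tendsto ?M (\<lambda>n. partials bs (u n)) (g bs)" if bs: "bs \<in> multi_indices 2" for bs
  proof -
    obtain n0 n1 n2 where n: "hpoly n0 (P0 bs)" "2 \<le> n0" "hpoly n1 (P1 bs)" "2 \<le> n1" "hpoly n2 (P2 bs)" "4 \<le> n2"
      using P[OF bs] by blast
    show ?thesis unfolding pu[OF bs] E_def
      by (rule rc[OF finite_measure_lebesgue_on_ball _ borel_measurable_lebesgue_on n])
         (auto simp: g_def space_restrict_space)
  qed
  \<comment> \<open>On the sphere the argument of the profile tends to 4, where \<open>U\<close> and
    \<open>U1\<close> vanish; up to order 1 the function \<open>U2\<close> does not occur.\<close>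
  have gs: "L2_tendsto (sphere_measure 2) (\<lambda>n. partials bs (u n)) (\<lambda>x. 0)" if bs1: "bs \<in> multi_indices 1" for bs
  proof -
    have bs: "bs \<in> multi_indices 2" using bs1 by (auto simp: multi_indices_def)
    obtain n0 n1 n2 where n: "hpoly n0 (P0 bs)" "2 \<le> n0" "hpoly n1 (P1 bs)" "2 \<le> n1" "hpoly n2 (P2 bs)" "4 \<le> n2"
      using P[OF bs] by blast
    have "P2 bs x = 0" for x using bs1 unfolding multi_indices_1 P2_def by auto
    moreover have "x \<bullet> x = 4" if "x \<in> sphere 0 2" for x :: 'a
      using that by (simp add: power2_norm_eq_inner[symmetric])
    ultimately show ?thesis unfolding pu[OF bs] E_def
      by (intro rc[OF finite_measure_sphere_measure _ borel_measurable_sphere_measure n])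
         (auto simp: space_sphere_measure U4)
  qed
  note born = born_conditions_of_smooth_limit[where F = u and g = g and r = 2, OF _ su gl gs]
  have sumP1: "(\<Sum>b\<in>Basis. P1 [b, b] x) = 2 * of_nat N * Y x" for x
  proof -
    have "P1 [b, b] x = 2 * Y x + 4 * (of_real (x \<bullet> b) * partials [b] Y x)" if b: "b \<in> Basis" for b
    proof -
      have "partials [b] (R b) = (\<lambda>x. partials [b] (\<lambda>x. 2 * of_real (x \<bullet> b)) x * Y x + 2 * of_real (x \<bullet> b) * partials [b] Y x)"
        unfolding R_def by (intro partials_mult smooth_differentiable sY smooth_mult smooth_const) (simp add: smooth_iff_Ck)
      moreover have "partials [b] (\<lambda>x. 2 * of_real (x \<bullet> b)) = (\<lambda>x. 2 :: complex)"
        using b by (subst partials_mult) (auto simp: partials_coord intro!: Ck_differentiable[OF Ck_coord])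
      ultimately show ?thesis by (simp add: P1_def algebra_simps)
    qed
    then have "(\<Sum>b\<in>Basis. P1 [b, b] x) = of_nat ?d * (2 * Y x) + 4 * (\<Sum>b\<in>Basis. of_real (x \<bullet> b) * partials [b] Y x)"
      by (simp add: sum.distrib sum_distrib_left)
    then show ?thesis unfolding hpoly_euler[OF Y(1)] by (simp add: N_def algebra_simps)
  qed
  have sumP2: "(\<Sum>b\<in>Basis. P2 [b, b] x) = 4 * of_real (x \<bullet> x) * Y x" for x
  proof -
    have "(\<Sum>b\<in>Basis. P2 [b, b] x) = 4 * of_real (\<Sum>b\<in>Basis. (x \<bullet> b) * (x \<bullet> b)) * Y x"
      by (simp add: P2_def R_def sum_distrib_left sum_distrib_right mult_ac)
    then show ?thesis unfolding inner_self_eq_sum .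
  qed
  have sumg: "(\<Sum>b\<in>Basis. g [b, b] x) + \<kappa> * g [] x = - \<kappa> * (of_real (m x) * v x)" if x: "x \<in> ball 0 2" for x
  proof (cases "x = 0")
    case False
    then have pos: "x \<bullet> x > 0" by simp
    have "(\<Sum>b\<in>Basis. P0 [b, b] x) = 0" using Y(2)[of x] by (simp add: P0_def laplacian_def)
    then have "(\<Sum>b\<in>Basis. g [b, b] x) = (2 * of_nat N * Y x) * U1 (x \<bullet> x) + (4 * of_real (x \<bullet> x) * Y x) * U2 (x \<bullet> x)"
      using False unfolding sumP1[symmetric] sumP2[symmetric]
      by (simp add: g_def sum.distrib flip: sum_distrib_right)
    moreover have "g [] x = Y x * U (x \<bullet> x)" using False by (simp add: g_def P0_def P1_def P2_def)
    ultimately have "(\<Sum>b\<in>Basis. g [b, b] x) + \<kappa> * g [] x = Y x * (4 * of_real (x \<bullet> x) * U2 (x \<bullet> x) + 2 * of_nat N * U1 (x \<bullet> x) + \<kappa> * U (x \<bullet> x))"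
      by (simp add: algebra_simps)
    then show ?thesis unfolding ode[OF pos] mv[OF x] by (simp add: mult_ac)
  qed (simp add: g_def v_def Y0)
  \<comment> \<open>The profile equation writes \<open>\<kappa> m v\<close> as a combination of
    \<open>U\<close>, \<open>U1\<close>, \<open>U2\<close> with polynomial coefficients, so the same
    convergence lemma gives its square integrability.\<close>
  have mvL: "(\<lambda>x. c * (of_real (m x) * v x)) \<in> L2 ?M" for c
  proof -
    define q where "q = - c / \<kappa>"
    have "hpoly 4 (\<lambda>x. (q * \<kappa>) * Y x)" "hpoly 4 (\<lambda>x. (q * 2 * of_nat N) * Y x)" by (rule hpoly_cmult[OF Y(1)])+
    moreover have "hpoly 6 (\<lambda>x. (q * 4) * (of_real (x \<bullet> x) * Y x))" using hpoly_cmult[OF hpoly_mult[OF hpoly_inner_self Y(1)]] by simp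
    ultimately have "L2_tendsto ?M (\<lambda>n x. (q * \<kappa>) * Y x * U (1 / real (Suc n) + x \<bullet> x) + (q * 2 * of_nat N) * Y x * U1 (1 / real (Suc n) + x \<bullet> x)
        + (q * 4) * (of_real (x \<bullet> x) * Y x) * U2 (1 / real (Suc n) + x \<bullet> x)) (\<lambda>x. c * (of_real (m x) * v x))"
    proof (intro rc[OF finite_measure_lebesgue_on_ball _ borel_measurable_lebesgue_on _ order.refl[of 4, THEN le_trans[rotated]] _ order.refl[of 4, THEN le_trans[rotated]]])
      fix x assume "x \<in> space ?M" "x \<noteq> 0"
      then have x: "x \<in> ball 0 2" "x \<bullet> x > 0" by (simp_all add: space_restrict_space)
      have "(q * \<kappa>) * Y x * U (x \<bullet> x) + (q * 2 * of_nat N) * Y x * U1 (x \<bullet> x) + (q * 4) * (of_real (x \<bullet> x) * Y x) * U2 (x \<bullet> x)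
        = q * Y x * (4 * of_real (x \<bullet> x) * U2 (x \<bullet> x) + 2 * of_nat N * U1 (x \<bullet> x) + \<kappa> * U (x \<bullet> x))"
        by (simp add: algebra_simps)
      also have "\<dots> = (- q * \<kappa>) * (of_real (m x) * v x)" unfolding ode[OF x(2)] mv[OF x(1)] by (simp add: mult_ac)
      finally show "c * (of_real (m x) * v x) = (q * \<kappa>) * Y x * U (x \<bullet> x) + (q * 2 * of_nat N) * Y x * U1 (x \<bullet> x) + (q * 4) * (of_real (x \<bullet> x) * Y x) * U2 (x \<bullet> x)"
        using \<kappa>0 by (simp add: q_def)
    qed (auto simp: space_restrict_space v_def Y0)
    then show ?thesis by (simp add: L2_tendsto_def)
  qed
  have sob: "g [] \<in> sobolev 2 (ball 0 2)" and tr: "has_trace 2 (g []) (\<lambda>x. 0)" "has_normal_trace 2 (g []) (\<lambda>x. 0)"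
    by (rule born; simp)+
  have gL: "g bs \<in> L2 ?M" if "bs \<in> multi_indices 2" for bs using gl[OF that] by (simp add: L2_tendsto_def)
  have mi: "[] \<in> multi_indices 2" "\<And>b::'a. b \<in> Basis \<Longrightarrow> [b, b] \<in> multi_indices 2" by (auto simp: multi_indices_def)
  have hu: "helmholtz_distributional (ball 0 2) k (g []) (\<lambda>x. - k\<^sup>2 * of_real (m x) * v x)"
    unfolding helmholtz_distributional_def
  proof (intro conjI ballI)
    show "loc_integrable (ball 0 2) (g [])" by (rule L2_loc_integrable[OF gL[OF mi(1)]])
    show "loc_integrable (ball 0 2) (\<lambda>x. - k\<^sup>2 * of_real (m x) * v x)"
      using L2_loc_integrable[OF mvL[of "- k\<^sup>2"]] by (simp add: mult.assoc)
    fix \<phi> :: "'a \<Rightarrow> complex" assume \<phi>: "\<phi> \<in> test_functions (ball 0 2)"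
    then have s\<phi>: "smooth \<phi>" by (simp add: test_functions_def)
    have L\<phi>: "\<phi> \<in> L2 ?M" "laplacian \<phi> \<in> L2 ?M"
    proof -
      show "\<phi> \<in> L2 ?M" by (intro L2_continuous_ball smooth_continuous_on s\<phi>)
      have "smooth (laplacian \<phi>)" unfolding laplacian_def [abs_def] by (intro smooth_sum smooth_partials s\<phi>) simp
      then show "laplacian \<phi> \<in> L2 ?M" by (intro L2_continuous_ball smooth_continuous_on)
    qed
    have i: "integrable ?M (\<lambda>x. g [] x * laplacian \<phi> x)" "integrable ?M (\<lambda>x. \<kappa> * (g [] x * \<phi> x))"
      by (intro L2_mult_integrable gL mi L\<phi> integrable_mult_right)+
    have i3: "integrable ?M (\<lambda>x. (\<Sum>b\<in>Basis. g [b, b] x) * \<phi> x)"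
      unfolding sum_distrib_right by (intro Bochner_Integration.integrable_sum L2_mult_integrable gL mi L\<phi>)
    have "(\<integral>x. g [] x * (laplacian \<phi> x + k^2 * \<phi> x) \<partial>?M) = (\<integral>x. g [] x * laplacian \<phi> x + \<kappa> * (g [] x * \<phi> x) \<partial>?M)"
      by (simp add: \<kappa>_def algebra_simps)
    also have "\<dots> = (\<integral>x. g [] x * laplacian \<phi> x \<partial>?M) + (\<integral>x. \<kappa> * (g [] x * \<phi> x) \<partial>?M)"
      by (rule Bochner_Integration.integral_add[OF i])
    also have "(\<integral>x. g [] x * laplacian \<phi> x \<partial>?M) = (\<integral>x. (\<Sum>b\<in>Basis. g [b, b] x) * \<phi> x \<partial>?M)"
      by (rule born(4)[OF _ _ _ \<phi>]) simp_all
    also have "\<dots> + (\<integral>x. \<kappa> * (g [] x * \<phi> x) \<partial>?M) = (\<integral>x. (\<Sum>b\<in>Basis. g [b, b] x) * \<phi> x + \<kappa> * (g [] x * \<phi> x) \<partial>?M)"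
      by (rule Bochner_Integration.integral_add[OF i3 i(2), symmetric])
    also have "\<dots> = (\<integral>x. - k\<^sup>2 * of_real (m x) * v x * \<phi> x \<partial>?M)"
    proof (rule Bochner_Integration.integral_cong[OF refl])
      fix x assume "x \<in> space ?M"
      then have x: "x \<in> ball 0 2" by (simp add: space_restrict_space)
      have "(\<Sum>b\<in>Basis. g [b, b] x) * \<phi> x + \<kappa> * (g [] x * \<phi> x) = ((\<Sum>b\<in>Basis. g [b, b] x) + \<kappa> * g [] x) * \<phi> x"
        by (simp add: algebra_simps)
      then show "(\<Sum>b\<in>Basis. g [b, b] x) * \<phi> x + \<kappa> * (g [] x * \<phi> x) = - k\<^sup>2 * of_real (m x) * v x * \<phi> x"
        unfolding sumg[OF x] by (simp add: \<kappa>_def mult_ac)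
    qed
    finally show "(\<integral>x. g [] x * (laplacian \<phi> x + k^2 * \<phi> x) \<partial>?M) = (\<integral>x. - k\<^sup>2 * of_real (m x) * v x * \<phi> x \<partial>?M)" .
  qed
  have helv: "helmholtz_distributional (ball 0 2) k v (\<lambda>x. 0)"
    unfolding helmholtz_distributional_def
  proof (intro conjI ballI)
    show "loc_integrable (ball 0 2) v" by (intro L2_loc_integrable L2_continuous_ball smooth_continuous_on sv)
    show "loc_integrable (ball (0::'a) 2) (\<lambda>x. 0)" by (intro L2_loc_integrable L2_continuous_ball continuous_intros)
    fix \<phi> :: "'a \<Rightarrow> complex" assume \<phi>: "\<phi> \<in> test_functions (ball 0 2)"
    then have s\<phi>: "smooth \<phi>" by (simp add: test_functions_def)
    have sl: "smooth (laplacian f)" if "smooth f" for f :: "'a \<Rightarrow> complex"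
      unfolding laplacian_def [abs_def] by (intro smooth_sum smooth_partials that) simp
    have i: "integrable ?M (\<lambda>x. f x * h x)" if "smooth f" "smooth h" for f h :: "'a \<Rightarrow> complex"
      by (intro L2_mult_integrable L2_continuous_ball smooth_continuous_on that)
    have j: "integrable ?M (\<lambda>x. \<kappa> * (v x * \<phi> x))" by (intro integrable_mult_right i sv s\<phi>)
    have "(\<integral>x. v x * (laplacian \<phi> x + k^2 * \<phi> x) \<partial>?M) = (\<integral>x. v x * laplacian \<phi> x + \<kappa> * (v x * \<phi> x) \<partial>?M)"
      by (simp add: \<kappa>_def algebra_simps)
    also have "\<dots> = (\<integral>x. v x * laplacian \<phi> x \<partial>?M) + (\<integral>x. \<kappa> * (v x * \<phi> x) \<partial>?M)"
      by (rule Bochner_Integration.integral_add[OF i[OF sv sl[OF s\<phi>]] j])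
    also have "(\<integral>x. v x * laplacian \<phi> x \<partial>?M) = (\<integral>x. laplacian v x * \<phi> x \<partial>?M)"
      by (rule integral_laplacian_test[OF _ sv \<phi>]) simp
    also have "\<dots> + (\<integral>x. \<kappa> * (v x * \<phi> x) \<partial>?M) = (\<integral>x. laplacian v x * \<phi> x + \<kappa> * (v x * \<phi> x) \<partial>?M)"
      by (rule Bochner_Integration.integral_add[OF i[OF sl[OF sv] s\<phi>] j, symmetric])
    also have "\<dots> = (\<integral>x. (laplacian v x + \<kappa> * v x) * \<phi> x \<partial>?M)" by (simp add: algebra_simps)
    finally show "(\<integral>x. v x * (laplacian \<phi> x + k^2 * \<phi> x) \<partial>?M) = (\<integral>x. 0 * \<phi> x \<partial>?M)" unfolding hv .
  qed
  have "born_solution 2 m k (g []) v"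
    unfolding born_solution_def using sob tr hu helv mvL[of 1] by simp
  \<comment> \<open>\<open>v\<close> is continuous and nonzero at the unit vector \<open>e\<close>,
    since the Bessel factor has no zeros for nonreal \<kappa>; hence it is nonzero on a nonempty
    open set.\<close>
  moreover have "\<not> (AE x in ?M. g [] x = 0 \<and> v x = 0)"
  proof
    assume "AE x in ?M. g [] x = 0 \<and> v x = 0"
    then have ae: "AE x in lebesgue. x \<in> ball 0 2 \<longrightarrow> v x = 0"
      by (subst (asm) AE_restrict_space_iff) (auto elim!: eventually_mono)
    have o: "open {x \<in> ball 0 2. v x \<noteq> 0}"
    proof -
      have "open (ball 0 2 \<inter> v -` (- {0}))"
        by (rule continuous_open_preimage[OF smooth_continuous_on[OF sv]]) auto
      then show ?thesis by (simp add: Int_def vimage_def)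
    qed
    then have "{x \<in> ball 0 2. v x \<noteq> 0} \<in> sets lebesgue" by (intro sets_completionI_sets) simp
    then have "{x \<in> ball 0 2. v x \<noteq> 0} \<in> null_sets lebesgue"
      using ae by (subst AE_iff_null_sets) (auto elim: eventually_mono)
    then have "negligible {x \<in> ball 0 2. v x \<noteq> 0}" by (simp only: negligible_iff_null_sets)
    moreover have "e \<in> {x \<in> ball 0 2. v x \<noteq> 0}"
      using e bes_of_real_nonzero[OF N \<kappa>] by (simp add: v_def \<Phi>_def)
    ultimately show False using open_not_negligible[OF o] by blast
  qed
  ultimately show ?thesis unfolding born_transmission_eigenvalues_def using k by blast
qed

section \<open>From zeros of \<open>charfun\<close> to the four claims\<close>

lemma finite_zeros_in_cball:
  assumes "f holomorphic_on UNIV" "f 0 \<noteq> 0"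
  shows "finite {z \<in> cball 0 R. f z = (0::complex)}"
proof (cases "f constant_on UNIV")
  case True
  then have fz: "f z = f 0" for z unfolding constant_on_def by auto
  have "f z \<noteq> 0" for z unfolding fz[of z] by (rule assms(2))
  then have "{z \<in> cball 0 R. f z = 0} = {}" by blast
  then show ?thesis by (simp only: finite.emptyI)
next
  case False
  then show ?thesis
    by (intro holomorphic_compact_finite_zeros[OF assms(1) open_UNIV connected_UNIV compact_cball subset_UNIV])
qed

theorem theorem2p3:
  fixes m :: "real ^ 'd \<Rightarrow> real" and BTE :: "complex set"
  assumes "CARD('d) = 2 \<or> CARD('d) = 3"
    and "\<And>x. x \<in> ball 0 2 - {0} \<Longrightarrow>
           m x = (2 + norm x) ^ (CARD('d) - 1) / (2 ^ CARD('d) * norm x ^ (CARD('d) - 1))"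
  defines "BTE \<equiv> born_transmission_eigenvalues 2 m"
  shows "(\<forall>k\<in>BTE. k \<notin> \<real> \<and> Re k \<noteq> 0)
    \<and> infinite (BTE \<inter> {k. k \<notin> \<real> \<and> Re k \<noteq> 0})
    \<and> (countable BTE \<and> (\<forall>z. \<not> z islimpt BTE))
    \<and> (\<exists>c>0. \<forall>k\<in>BTE. \<not> \<bar>Im k\<bar> < c)"
proof -
  let ?d = "CARD('d)"
  have D: "DIM(real ^ 'd) = ?d" by simp
  have d: "DIM(real ^ 'd) = 2 \<or> DIM(real ^ 'd) = 3" using assms(1) by simp
  have d1: "?d \<ge> 1" using assms(1) by auto
  have m: "m x = (2 + norm x) ^ (DIM(real ^ 'd) - 1) / (2 ^ DIM(real ^ 'd) * norm x ^ (DIM(real ^ 'd) - 1))"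
    if "x \<in> ball 0 2 - {0}" for x unfolding D by (rule assms(2)[OF that])
  have sub: "\<exists>l. charfun ?d l (k\<^sup>2) = 0" if k: "k \<in> BTE" for k
  proof (rule ccontr)
    assume "\<nexists>l. charfun ?d l (k\<^sup>2) = 0"
    then have nz: "charfun DIM(real ^ 'd) l (k\<^sup>2) \<noteq> 0" for l unfolding D by blast
    obtain u v where uv: "born_solution 2 m k u v" "k \<noteq> 0" "\<not> (AE x in lebesgue_on (ball 0 2). u x = 0 \<and> v x = 0)"
      using k unfolding BTE_def born_transmission_eigenvalues_def by blast
    show False using born_solution_trivial[OF d m uv(1,2) nz] uv(3) by blast
  qed
  \<comment> \<open>Only zeros for \<open>l = 4\<close> are converted back into eigenvalues. This is
    enough for infinitude, while \<open>sub\<close> bounds the set of eigenvalues using all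
    degrees.\<close>
  have sup: "k \<in> BTE" if "k \<noteq> 0" "charfun ?d 4 (k\<^sup>2) = 0" for k
    unfolding BTE_def by (rule born_eigenvalue_of_charfun_zero[OF d m that(1)]) (use that(2) in \<open>simp_all only: D\<close>)
  have nonreal: "k \<notin> \<real> \<and> Re k \<noteq> 0" if k: "k \<in> BTE" for k
  proof -
    obtain l where "charfun ?d l (k\<^sup>2) = 0" using sub[OF k] by blast
    with charfun_real_pos[OF d1] have "k\<^sup>2 \<notin> \<real>" by blast
    then have "Re k * Im k \<noteq> 0" by (simp add: complex_is_Real_iff power2_eq_square)
    then show ?thesis by (simp add: complex_is_Real_iff)
  qed
  have inf: "infinite (BTE \<inter> {k. k \<notin> \<real> \<and> Re k \<noteq> 0})"
  proof
    assume "finite (BTE \<inter> {k. k \<notin> \<real> \<and> Re k \<noteq> 0})"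
    moreover have "{\<kappa>. charfun ?d 4 \<kappa> = 0} \<subseteq> (\<lambda>k. k\<^sup>2) ` (BTE \<inter> {k. k \<notin> \<real> \<and> Re k \<noteq> 0})"
    proof
      fix \<kappa> assume "\<kappa> \<in> {\<kappa>. charfun ?d 4 \<kappa> = 0}"
      then have z: "charfun ?d 4 \<kappa> = 0" by simp
      with charfun_real_pos[OF d1, of 0] have "\<kappa> \<noteq> 0" by auto
      then have "csqrt \<kappa> \<in> BTE" using z by (intro sup) simp_all
      with nonreal have "csqrt \<kappa> \<in> BTE \<inter> {k. k \<notin> \<real> \<and> Re k \<noteq> 0}" by blast
      then have "(csqrt \<kappa>)\<^sup>2 \<in> (\<lambda>k. k\<^sup>2) ` (BTE \<inter> {k. k \<notin> \<real> \<and> Re k \<noteq> 0})" by (rule imageI)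
      then show "\<kappa> \<in> (\<lambda>k. k\<^sup>2) ` (BTE \<inter> {k. k \<notin> \<real> \<and> Re k \<noteq> 0})" by (simp only: power2_csqrt)
    qed
    ultimately show False using charfun_infinite_zeros[OF d1] finite_surj by blast
  qed
  \<comment> \<open>In a disc of radius \<open>R\<close> only degrees \<open>l < 4 R^2\<close> can
    contribute, and each contributes finitely many zeros because \<open>charfun\<close> does not
    vanish at 0.\<close>
  have fin: "finite (BTE \<inter> cball 0 R)" if R: "R \<ge> 0" for R
  proof (rule finite_subset)
    define L where "L = nat \<lceil>4 * R\<^sup>2\<rceil>"
    show "BTE \<inter> cball 0 R \<subseteq> (\<Union>l<L. {k \<in> cball 0 R. charfun ?d l (k\<^sup>2) = 0})"
    proof
      fix k assume k: "k \<in> BTE \<inter> cball 0 R"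
      then obtain l where l: "charfun ?d l (k\<^sup>2) = 0" using sub by blast
      have "norm (k\<^sup>2) \<le> R\<^sup>2" using k by (simp add: norm_power power_mono)
      then have "\<not> real l \<ge> 4 * R\<^sup>2" using charfun_large_l[OF d1, of "k\<^sup>2" "R\<^sup>2" l] l by auto
      then have "l < L" unfolding L_def by linarith
      then show "k \<in> (\<Union>l<L. {k \<in> cball 0 R. charfun ?d l (k\<^sup>2) = 0})" using k l by blast
    qed
    have sq: "(\<lambda>k::complex. k\<^sup>2) holomorphic_on UNIV" by (intro holomorphic_intros)
    have "(\<lambda>k. charfun ?d l (k\<^sup>2)) holomorphic_on UNIV" for l
      using holomorphic_on_compose_gen[OF sq charfun_holomorphic[OF d1]] by (simp add: o_def)
    then show "finite (\<Union>l<L. {k \<in> cball 0 R. charfun ?d l (k\<^sup>2) = 0})"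
      by (intro finite_UN_I finite_lessThan finite_zeros_in_cball) (use charfun_real_pos[OF d1, of 0] in simp_all)
  qed
  have "BTE = (\<Union>n::nat. BTE \<inter> cball 0 (real n))"
    using real_arch_simple by auto
  moreover have "countable (\<Union>n::nat. BTE \<inter> cball 0 (real n))"
    by (rule countable_UN[OF countableI_type countable_finite[OF fin]]) simp
  ultimately have count: "countable BTE" by simp
  have limpt: "\<not> z islimpt BTE" for z
  proof
    assume "z islimpt BTE"
    then have i: "infinite (BTE \<inter> ball z 1)" unfolding islimpt_eq_infinite_ball by simp
    have s: "BTE \<inter> ball z 1 \<subseteq> BTE \<inter> cball 0 (norm z + 1)"
    proof -
      have "norm k \<le> norm z + 1" if "dist z k < 1" for k
        using that norm_triangle_ineq2[of k z] by (simp add: dist_norm norm_minus_commute)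
      then show ?thesis by auto
    qed
    have "finite (BTE \<inter> cball 0 (norm z + 1))" by (rule fin) simp
    from finite_subset[OF s this] i show False by simp
  qed
  obtain c where c: "c > 0" and strip: "\<And>l k. \<bar>Im k\<bar> < c \<Longrightarrow> charfun ?d l (k\<^sup>2) \<noteq> 0"
    using charfun_strip[OF assms(1)] by blast
  have "\<not> \<bar>Im k\<bar> < c" if "k \<in> BTE" for k
    using sub[OF that] strip[of k] by blast
  then have "\<exists>c>0. \<forall>k\<in>BTE. \<not> \<bar>Im k\<bar> < c" using c by blast
  moreover have "\<forall>k\<in>BTE. k \<notin> \<real> \<and> Re k \<noteq> 0" using nonreal by blast
  moreover have "\<forall>z. \<not> z islimpt BTE" using limpt by blast
  ultimately show ?thesis using inf count by (intro conjI)
qed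

end
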